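(* Let $\alpha\in\mathbb C$ and $\eta\in\mathbb Z/2\mathbb Z$. The operator $T^*_{\alpha,\eta}$ is the adjoint of $T_{\alpha,\eta}$, in the sense that $$\int_{\mathbb R}T_{\alpha,\eta}(f)(x)\,\sigma(x)\,dx=\int_{\mathbb R}f(x)\,T^*_{\alpha,\eta}(\sigma)(x)\,dx$$ if $\sigma\in\mathcal S'(\mathbb R)$ vanishes to infinite order at the origin and $f\in\mathcal S_{\rm sis}(\mathbb R)$.
   Context: Vanishing of distributions. Distributions on a one-dimensional smooth manifold $M$ ($\mathbb R$, or $\mathbb R\cup\{\infty\}$ with coordinate $1/x$ near $\infty$) are the dual of compactly supported smooth measures and transform like functions. A differential operator (linear, $C^\infty$ coefficients) near $p\in M$ is tangential to $\{p\}$ if for every $k$ it maps smooth functions vanishing to order $k$ at $p$ to such functions. A distribution $\sigma$ vanishes to order $k\ge0$ at $p$ if on some neighborhood $U_p$ of $p$, $\sigma=\sum_{j=1}^Nf_jD_jh_j$ with $h_j\in L^\infty_{\rm loc}(U_p)$, $D_j$ tangential to $\{p\}$, $f_j\in C^\infty(U_p)$ vanishing to order $k$ at $p$; to infinite order if this holds for every $k\ge0$. A distribution on $M-\{p\}$ has a canonical extension across $p$ if it is the restriction of a (necessarily unique) distribution on $M$ vanishing to infinite order at $p$. Definition of $\mathcal S_{\rm sis}(\mathbb R)$. A function $f\in C^\infty(\mathbb R-\{0\})$ has a singularity of type $(\alpha,\eta)\in\mathbb C\times\mathbb Z/2\mathbb Z$ at $0$ if there exist $C^\infty$ functions $f_0,\dots,f_n$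 near $0$ such that $f(x)=\sum_{0\le j\le n}(\operatorname{sgn}x)^\eta|x|^\alpha(\log|x|)^jf_j(x)$ for $0<|x|\ll1$; it has a simple singularity at $0$ if near $0$ it is a finite sum of functions each having a singularity of some type $(\alpha_j,\eta_j)$. $\mathcal S_{\rm sis}(\mathbb R)$ is the space of $f\in C^\infty(\mathbb R-\{0\})$ with a simple singularity at $0$ which decay rapidly, with all derivatives, as $|x|\to\infty$. Fourier transform: $\mathcal Ff(y)=\widehat f(y)=\int_{\mathbb R}f(x)e^{-2\pi ixy}\,dx$ and $\int\widehat\sigma f=\int\sigma\widehat f$ for tempered $\sigma$ and Schwartz $f$. Definition of $T_{\alpha,\eta}$. For $f\in\mathcal S_{\rm sis}(\mathbb R)$, $T_{\alpha,\eta}(f)=\mathcal F\bigl(x\mapsto f(1/x)(\operatorname{sgn}x)^\eta|x|^{-\alpha-1}\bigr)$ as a function on $\mathbb R-\{0\}$; the argument of $\mathcal F$ is a smooth function on $\mathbb R$ (equal to $0$ at $x=0$) of at most polynomial growth, its Fourier transform is taken in the sense of tempered distributions, and is $C^\infty$ on $\mathbb R-\{0\}$. It is known that $T_{\alpha,\eta}(f)\in\mathcal S_{\rm sis}(\mathbb R)$. Pairing. If $\sigma\in\mathcal S'(\mathbb R)$ vanishes to infinite order at $0$ and $f\in\mathcal S_{\rm sis}(\mathbb R)$, the product $f\sigma$ on $\mathbb R-\{0\}$ has a canonical extension across $0$. With $\phi\in C_c^\infty(\mathbb R)$ equal to $1$ near $0$, $\int_{\mathbb R}f\sigma\,dx$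 denotes the integral of the canonical extension of the compactly supported $\phi f\sigma$ plus the pairing of the Schwartz function $(1-\phi)f$ with $\sigma$; it does not depend on $\phi$. Definition of $T^*_{\alpha,\eta}$. If $\sigma\in\mathcal S'(\mathbb R)$ vanishes to infinite order at $0$, then $\widehat\sigma$ extends canonically across $\infty$, and $T^*_{\alpha,\eta}(\sigma)(x)=(\operatorname{sgn}x)^\eta|x|^{\alpha-1}\widehat\sigma(1/x)$, meaning the canonical extension across $x=0$ of this distribution on $\mathbb R-\{0\}$; it is again a tempered distribution vanishing to infinite order at $0$. *)

theory Defs
  imports "HOL-Analysis.Analysis" "HOL-Library.Z2"
begin

section \<open>Smooth functions of a real variable\<close>

definition nderiv :: "nat \<Rightarrow> (real \<Rightarrow> complex) \<Rightarrow> real \<Rightarrow> complex" where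
  "nderiv n = (\<lambda>g x. vector_derivative g (at x)) ^^ n"

text \<open>Only used for open \<open>U\<close>; values outside \<open>U\<close> are irrelevant.\<close>

definition smooth_on :: "real set \<Rightarrow> (real \<Rightarrow> complex) \<Rightarrow> bool" where
  "smooth_on U f \<longleftrightarrow> (\<forall>n. \<forall>x\<in>U. nderiv n f differentiable (at x))"

text \<open>Vanishing to order \<open>k\<close> means divisible by \<open>(x - p) ^ k\<close>; order \<open>0\<close> is no condition.\<close>

definition fun_vanishes :: "real \<Rightarrow> nat \<Rightarrow> (real \<Rightarrow> complex) \<Rightarrow> bool" where
  "fun_vanishes p k f \<longleftrightarrow> (\<forall>j<k. nderiv j f p = 0)"

definition schwartz :: "(real \<Rightarrow> complex) \<Rightarrow> bool" where
  "schwartz f \<longleftrightarrow> smooth_on UNIV f \<and>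
     (\<forall>j k. bounded (range (\<lambda>x. of_real (x ^ j) * nderiv k f x)))"

definition test_functions :: "real set \<Rightarrow> (real \<Rightarrow> complex) set" where
  "test_functions U = {\<phi>. smooth_on UNIV \<phi> \<and>
     compact (closure {x. \<phi> x \<noteq> 0}) \<and> closure {x. \<phi> x \<noteq> 0} \<subseteq> U}"

section \<open>Distributions\<close>

text \<open>Compactly supported smooth measures on an open subset of the line are identified with
  test functions \<open>\<phi>\<close> via \<open>\<phi> dx\<close>. A distribution is a functional of which only the values
  on test functions (on Schwartz functions in the tempered case) are meaningful.\<close>

type_synonym functional = "(real \<Rightarrow> complex) \<Rightarrow> complex"

definition linear_functional_on :: "(real \<Rightarrow> complex) set \<Rightarrow> functional \<Rightarrow> bool" where
  "linear_functional_on V S \<longleftrightarrow>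
     (\<forall>\<phi>\<in>V. \<forall>\<psi>\<in>V. S (\<lambda>x. \<phi> x + \<psi> x) = S \<phi> + S \<psi>) \<and>
     (\<forall>c. \<forall>\<phi>\<in>V. S (\<lambda>x. c * \<phi> x) = c * S \<phi>)"

definition distribution_on :: "real set \<Rightarrow> functional \<Rightarrow> bool" where
  "distribution_on U S \<longleftrightarrow> linear_functional_on (test_functions U) S \<and>
     (\<forall>K. compact K \<and> K \<subseteq> U \<longrightarrow>
       (\<exists>C N. \<forall>\<phi>\<in>test_functions U. {x. \<phi> x \<noteq> 0} \<subseteq> K \<longrightarrow>
          norm (S \<phi>) \<le> C * (\<Sum>j\<le>N. SUP x. norm (nderiv j \<phi> x))))"

definition tempered :: "functional \<Rightarrow> bool" where
  "tempered S \<longleftrightarrow> linear_functional_on {\<phi>. schwartz \<phi>} S \<and>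
     (\<exists>C N. \<forall>\<phi>. schwartz \<phi> \<longrightarrow>
        norm (S \<phi>) \<le> C * (\<Sum>j\<le>N. \<Sum>k\<le>N. SUP x. norm (of_real (x ^ j) * nderiv k \<phi> x)))"

definition fun_dist :: "real set \<Rightarrow> (real \<Rightarrow> complex) \<Rightarrow> functional" where
  "fun_dist U h = (\<lambda>\<phi>. integral\<^sup>L (lebesgue_on U) (\<lambda>x. h x * \<phi> x))"

definition dist_mult :: "(real \<Rightarrow> complex) \<Rightarrow> functional \<Rightarrow> functional" where
  "dist_mult f S = (\<lambda>\<phi>. S (\<lambda>x. f x * \<phi> x))"

definition dist_deriv :: "functional \<Rightarrow> functional" where
  "dist_deriv S = (\<lambda>\<phi>. - S (nderiv 1 \<phi>))"

text \<open>Pullback of a distribution on \<open>\<real> - {0}\<close> under \<open>x \<mapsto> 1/x\<close>, i.e. \<open>S(1/x)\<close>; distributions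
  transform like functions, so the substitution \<open>y = 1/x\<close> puts the Jacobian \<open>1/y\<^sup>2\<close>
  on the test function.\<close>

definition dist_inversion :: "functional \<Rightarrow> functional" where
  "dist_inversion S = (\<lambda>\<phi>. S (\<lambda>y. \<phi> (1 / y) / of_real (y\<^sup>2)))"

section \<open>Vanishing to infinite order and canonical extensions\<close>

text \<open>The pair \<open>m\<close>, \<open>a\<close> encodes the differential operator \<open>\<Sum>i\<le>m. a i * (d/dx)^i\<close>.\<close>

definition diff_op :: "nat \<Rightarrow> (nat \<Rightarrow> real \<Rightarrow> complex) \<Rightarrow> (real \<Rightarrow> complex) \<Rightarrow> real \<Rightarrow> complex" where
  "diff_op m a g = (\<lambda>x. \<Sum>i\<le>m. a i x * nderiv i g x)"

definition dist_diff_op :: "nat \<Rightarrow> (nat \<Rightarrow> real \<Rightarrow> complex) \<Rightarrow> functional \<Rightarrow> functional" where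
  "dist_diff_op m a S = (\<lambda>\<phi>. \<Sum>i\<le>m. dist_mult (a i) ((dist_deriv ^^ i) S) \<phi>)"

definition tangential_op :: "real set \<Rightarrow> real \<Rightarrow> nat \<Rightarrow> (nat \<Rightarrow> real \<Rightarrow> complex) \<Rightarrow> bool" where
  "tangential_op U p m a \<longleftrightarrow> (\<forall>i\<le>m. smooth_on U (a i)) \<and>
     (\<forall>k g. smooth_on U g \<and> fun_vanishes p k g \<longrightarrow> fun_vanishes p k (diff_op m a g))"

definition Linf_loc :: "real set \<Rightarrow> (real \<Rightarrow> complex) \<Rightarrow> bool" where
  "Linf_loc U h \<longleftrightarrow> h \<in> borel_measurable (lebesgue_on U) \<and>
     (\<forall>K. compact K \<and> K \<subseteq> U \<longrightarrow> (\<exists>C. AE x in lebesgue_on K. norm (h x) \<le> C))"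

definition dist_vanishes :: "real \<Rightarrow> nat \<Rightarrow> functional \<Rightarrow> bool" where
  "dist_vanishes p k S \<longleftrightarrow>
     (\<exists>U. open U \<and> p \<in> U \<and>
       (\<exists>N f m a h.
          (\<forall>j<N. Linf_loc U (h j) \<and> tangential_op U p (m j) (a j) \<and>
                 smooth_on U (f j) \<and> fun_vanishes p k (f j)) \<and>
          (\<forall>\<phi>\<in>test_functions U.
             S \<phi> = (\<Sum>j<(N::nat). dist_mult (f j) (dist_diff_op (m j) (a j) (fun_dist U (h j))) \<phi>))))"

definition dist_vanishes_inf :: "real \<Rightarrow> functional \<Rightarrow> bool" where
  "dist_vanishes_inf p S \<longleftrightarrow> (\<forall>k. dist_vanishes p k S)"

definition is_canonical_extension :: "real \<Rightarrow> functional \<Rightarrow> functional \<Rightarrow> bool" where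
  "is_canonical_extension p S E \<longleftrightarrow> distribution_on UNIV E \<and> dist_vanishes_inf p E \<and>
     (\<forall>\<phi>\<in>test_functions (- {p}). E \<phi> = S \<phi>)"

text \<open>The choice is unique on test functions, but not as a function on all of
  \<^typ>\<open>real \<Rightarrow> complex\<close>; the same applies to the other uses of \<open>SOME\<close> below.\<close>

definition canonical_extension :: "real \<Rightarrow> functional \<Rightarrow> functional" where
  "canonical_extension p S = (SOME E. is_canonical_extension p S E)"

text \<open>A distribution on the line that is tempered, regarded as a functional on Schwartz functions.\<close>

definition as_tempered :: "functional \<Rightarrow> functional" where
  "as_tempered E = (SOME S. tempered S \<and> (\<forall>\<phi>\<in>test_functions UNIV. S \<phi> = E \<phi>))"

text \<open>Integral of a compactly supported distribution: its value on any test function that is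
  \<open>1\<close> near a compact set carrying it.\<close>

definition dist_integral :: "functional \<Rightarrow> complex" where
  "dist_integral E = (THE c. \<exists>K. compact K \<and> (\<forall>\<phi>\<in>test_functions (- K). E \<phi> = 0) \<and>
     (\<forall>\<psi>\<in>test_functions UNIV. (\<exists>W. open W \<and> K \<subseteq> W \<and> (\<forall>x\<in>W. \<psi> x = 1)) \<longrightarrow> E \<psi> = c))"

section \<open>Functions with a simple singularity\<close>

definition sgn_abs_powr :: "complex \<Rightarrow> bit \<Rightarrow> real \<Rightarrow> complex" where
  "sgn_abs_powr \<alpha> \<eta> x = (if \<eta> = 0 then 1 else of_real (sgn x)) * of_real \<bar>x\<bar> powr \<alpha>"

definition singularity_of_type :: "complex \<Rightarrow> bit \<Rightarrow> (real \<Rightarrow> complex) \<Rightarrow> bool" where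
  "singularity_of_type \<alpha> \<eta> f \<longleftrightarrow> smooth_on (- {0}) f \<and>
     (\<exists>\<delta>>0. \<exists>n g. (\<forall>j\<le>n. smooth_on {-\<delta><..<\<delta>} (g j)) \<and>
        (\<forall>x. 0 < \<bar>x\<bar> \<and> \<bar>x\<bar> < \<delta> \<longrightarrow>
           f x = (\<Sum>j\<le>(n::nat). sgn_abs_powr \<alpha> \<eta> x * of_real (ln \<bar>x\<bar>) ^ j * g j x)))"

definition simple_singularity :: "(real \<Rightarrow> complex) \<Rightarrow> bool" where
  "simple_singularity f \<longleftrightarrow>
     (\<exists>\<delta>>0. \<exists>N \<alpha> \<eta> g. (\<forall>j<N. singularity_of_type (\<alpha> j) (\<eta> j) (g j)) \<and>
        (\<forall>x. 0 < \<bar>x\<bar> \<and> \<bar>x\<bar> < \<delta> \<longrightarrow> f x = (\<Sum>j<(N::nat). g j x)))"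

text \<open>Functions on \<open>\<real> - {0}\<close> are represented by total functions with irrelevant value at \<open>0\<close>.\<close>

definition S_sis :: "(real \<Rightarrow> complex) set" where
  "S_sis = {f. smooth_on (- {0}) f \<and> simple_singularity f \<and>
     (\<forall>n k. ((\<lambda>x. of_real (x ^ n) * nderiv k f x) \<longlongrightarrow> 0) at_infinity)}"

section \<open>Fourier transform, the operators and the pairing\<close>

definition fourier :: "(real \<Rightarrow> complex) \<Rightarrow> real \<Rightarrow> complex" where
  "fourier f y = integral\<^sup>L lebesgue (\<lambda>x. f x * exp (- 2 * of_real pi * \<i> * of_real x * of_real y))"

definition dist_fourier :: "functional \<Rightarrow> functional" where
  "dist_fourier S = (\<lambda>\<phi>. S (fourier \<phi>))"

definition T_op :: "complex \<Rightarrow> bit \<Rightarrow> (real \<Rightarrow> complex) \<Rightarrow> real \<Rightarrow> complex" where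
  "T_op \<alpha> \<eta> f = (SOME u. smooth_on (- {0}) u \<and>
     (\<forall>\<phi>\<in>test_functions (- {0}).
        fun_dist (- {0}) u \<phi> =
        dist_fourier (fun_dist UNIV
          (\<lambda>x. if x = 0 then 0 else f (1 / x) * sgn_abs_powr (- \<alpha> - 1) \<eta> x)) \<phi>))"

definition T_star :: "complex \<Rightarrow> bit \<Rightarrow> functional \<Rightarrow> functional" where
  "T_star \<alpha> \<eta> \<sigma> = as_tempered (canonical_extension 0
     (dist_mult (sgn_abs_powr (\<alpha> - 1) \<eta>) (dist_inversion (dist_fourier \<sigma>))))"

definition cutoff :: "(real \<Rightarrow> complex) \<Rightarrow> bool" where
  "cutoff \<phi> \<longleftrightarrow> \<phi> \<in> test_functions UNIV \<and> (\<exists>\<delta>>0. \<forall>x. \<bar>x\<bar> < \<delta> \<longrightarrow> \<phi> x = 1)"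

text \<open>The pairing \<open>\<integral> f \<sigma> dx\<close>. The description requires the value to be the same for all cutoffs.\<close>

definition sis_pairing :: "(real \<Rightarrow> complex) \<Rightarrow> functional \<Rightarrow> complex" where
  "sis_pairing f \<sigma> = (THE c. \<forall>\<phi>. cutoff \<phi> \<longrightarrow>
     c = dist_integral (canonical_extension 0 (dist_mult (\<lambda>x. \<phi> x * f x) \<sigma>))
         + \<sigma> (\<lambda>x. (1 - \<phi> x) * f x))"

end

theory Submission
  imports Defs
begin

text \<open>
  Write \<open>\<theta> = x d/dx\<close>. The proof takes place in the larger space \<open>sing_space\<close> of functions on
  \<open>\<real> - {0}\<close> which, together with all their \<open>\<theta>\<close>-derivatives, decay rapidly at infinity and are
  bounded by a fixed power of \<open>1/|x|\<close> near \<open>0\<close>; it contains every function with a simple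
  singularity. The pairing with a tempered distribution \<open>\<sigma>\<close> vanishing to infinite order at \<open>0\<close> is a
  continuous functional \<open>L\<close> on this space: a tangential operator is a combination of powers of
  \<open>\<theta>\<close> near \<open>0\<close>, so the order \<open>k\<close> vanishing makes \<open>\<sigma>\<close> continuous for the norms of
  \<open>|x|\<^sup>k \<theta>\<^sup>l f\<close>, and cutting off at \<open>0\<close> approximates \<open>f\<close>. Conversely, any such functional vanishes to
  infinite order: in the coordinate \<open>- ln x\<close> a test function is a superposition of dilates of the
  fundamental solution of a power of \<open>\<theta>\<close>, and applying \<open>L\<close> to these dilates gives a bounded
  density.

  The operator \<open>T = T\<^sub>\<alpha>\<^sub>,\<^sub>\<eta>\<close> maps the space continuously to itself, because the function whose
  Fourier transform is taken is a symbol and \<open>\<theta> T = T (\<theta> + \<alpha>)\<close>. Hence \<open>L \<circ> T\<close> is again such a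
  functional. For test functions on \<open>\<real> - {0}\<close> it agrees with the distribution defining
  \<open>T\<^sup>*\<sigma>\<close>, so it is the canonical extension of the latter, and both sides of the claim equal
  \<open>L (T f)\<close>.
\<close>

section \<open>Smoothness as repeated differentiability, and its closure properties\<close>

section \<open>Calculus of smooth functions\<close>

text \<open>The pairing, the canonical extension, \<open>T_op\<close> and \<open>T_star\<close> are
  given by \<open>SOME\<close> or \<open>THE\<close>, so each must be pinned down by existence and
  uniqueness before it can be computed. Existence is the obstacle: an extension has to come with
  explicit bounded densities and tangential operators, and nothing in the definition of
  \<open>T_star\<close> supplies them. This is why the converse direction, from continuity to
  vanishing, has to be proved at all. The space is chosen so that no asymptotic expansion is ever
  followed: powers and logarithms are forgotten in favour of one order a. Its norms use \<theta>
  because \<theta> commutes with dilations, is carried to - (\<theta> + \<alpha> + 1) by the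
  inversion, and preserves orders of vanishing. The bookkeeping under T is an exchange: decay of f
  at infinity becomes flatness at 0 after x \<mapsto> 1/x, and the singularity of order a becomes
  growth of order a + q, where q \<ge> |Re \<alpha> + 1|. Such growth costs a + q + 2 derivatives
  before the Fourier integral converges, so T f has order a + q + 2 at 0; every further derivative
  yields decay at infinity.\<close>

lemma nderiv_0 [simp]: "nderiv 0 f = f"
  by (simp add: nderiv_def)

lemma nderiv_Suc: "nderiv (Suc n) f = (\<lambda>x. vector_derivative (nderiv n f) (at x))"
  by (simp add: nderiv_def)

lemma nderiv_1: "nderiv 1 f = (\<lambda>x. vector_derivative f (at x))"
  by (simp add: nderiv_def)

lemma nderiv_add: "nderiv (m + n) f = nderiv m (nderiv n f)"
  by (simp add: nderiv_def funpow_add)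

lemma nderiv_Suc_right: "nderiv (Suc n) f = nderiv n (nderiv 1 f)"
  using nderiv_add[of n 1 f] by simp

text \<open>Smoothness itself offers no induction: the derivative of a product or of 1/f involves f
  again. With n-fold differentiability (\<open>k < n\<close>, so \<open>C_on 0\<close> is no
  condition) such formulas give one more order at each step.\<close>

definition C_on :: "nat \<Rightarrow> real set \<Rightarrow> (real \<Rightarrow> complex) \<Rightarrow> bool" where
  "C_on n U f \<longleftrightarrow> (\<forall>k<n. \<forall>x\<in>U. nderiv k f differentiable (at x))"

lemma smooth_on_iff_C_on: "smooth_on U f \<longleftrightarrow> (\<forall>n. C_on n U f)"
  unfolding smooth_on_def C_on_def by blast

lemma C_on_0 [simp]: "C_on 0 U f"
  by (simp add: C_on_def)

lemma C_on_Suc: "C_on (Suc n) U f \<longleftrightarrow> (\<forall>x\<in>U. f differentiable (at x)) \<and> C_on n U (nderiv 1 f)"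
  unfolding C_on_def by (simp add: All_less_Suc2 nderiv_Suc_right del: One_nat_def)

lemma C_on_mono: "C_on n U f \<Longrightarrow> m \<le> n \<Longrightarrow> C_on m U f"
  unfolding C_on_def by auto

lemma smooth_on_subset: "smooth_on U f \<Longrightarrow> V \<subseteq> U \<Longrightarrow> smooth_on V f"
  unfolding smooth_on_def by auto

lemma smooth_on_nderiv: "smooth_on U f \<Longrightarrow> smooth_on U (nderiv n f)"
  unfolding smooth_on_def by (simp add: nderiv_add[symmetric])

lemma smooth_on_has_nderiv:
  "smooth_on U f \<Longrightarrow> x \<in> U \<Longrightarrow> (nderiv n f has_vector_derivative nderiv (Suc n) f x) (at x)"
  unfolding smooth_on_def nderiv_Suc by (simp add: vector_derivative_works)

lemma smooth_on_has_deriv: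
  "smooth_on U f \<Longrightarrow> x \<in> U \<Longrightarrow> (f has_vector_derivative nderiv 1 f x) (at x)"
  using smooth_on_has_nderiv[of U f x 0] by simp

lemma nderiv_1_eq: "(f has_vector_derivative D) (at x) \<Longrightarrow> nderiv 1 f x = D"
  unfolding nderiv_1 by (rule vector_derivative_at)

lemma nderiv_Suc_eq: "(nderiv n f has_vector_derivative D) (at x) \<Longrightarrow> nderiv (Suc n) f x = D"
  unfolding nderiv_Suc by (rule vector_derivative_at)

lemma smooth_on_isCont: "smooth_on U f \<Longrightarrow> x \<in> U \<Longrightarrow> isCont (nderiv n f) x"
  using smooth_on_has_nderiv has_vector_derivative_continuous by blast

lemma smooth_on_continuous_on: "smooth_on U f \<Longrightarrow> continuous_on U (nderiv n f)"
  by (meson continuous_at_imp_continuous_on smooth_on_isCont)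

lemma has_vector_derivative_open_cong:
  assumes "open U" "x \<in> U" "\<And>y. y \<in> U \<Longrightarrow> f y = g y"
  shows "(f has_vector_derivative D) (at x) \<longleftrightarrow> (g has_vector_derivative D) (at x)"
  using assms by (metis has_vector_derivative_transform_within_open)

lemma has_vector_derivative_open_congI:
  assumes "open U" "x \<in> U" "\<And>y. y \<in> U \<Longrightarrow> f y = g y" "(g has_vector_derivative D) (at x)"
  shows "(f has_vector_derivative D) (at x)"
  using has_vector_derivative_open_cong[of U x f g D] assms by blast

lemma nderiv_cong:
  assumes "open U" "\<And>y. y \<in> U \<Longrightarrow> f y = g y" "x \<in> U"
  shows "nderiv n f x = nderiv n g x"
  using assms(3)
proof (induction n arbitrary: x)
  case 0
  then show ?case using assms by simp
next
  case (Suc n)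
  show ?case unfolding nderiv_Suc vector_derivative_def
    using has_vector_derivative_open_cong[OF assms(1) Suc.prems, of "nderiv n f" "nderiv n g"] Suc.IH
    by simp
qed

lemma C_on_cong:
  assumes "open U" "\<And>y. y \<in> U \<Longrightarrow> f y = g y"
  shows "C_on n U f \<longleftrightarrow> C_on n U g"
proof -
  have "nderiv k f differentiable (at x) \<longleftrightarrow> nderiv k g differentiable (at x)" if "x \<in> U" for k x
  proof -
    have "\<And>y. y \<in> U \<Longrightarrow> nderiv k f y = nderiv k g y"
      by (rule nderiv_cong[OF assms])
    then show ?thesis
      using has_vector_derivative_open_cong[OF assms(1) that, of "nderiv k f" "nderiv k g"]
      by (metis differentiableI_vector vector_derivative_works)
  qed
  then show ?thesis unfolding C_on_def by blast
qed

lemma smooth_on_cong: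
  assumes "open U" "\<And>y. y \<in> U \<Longrightarrow> f y = g y"
  shows "smooth_on U f \<longleftrightarrow> smooth_on U g"
  unfolding smooth_on_iff_C_on using C_on_cong[OF assms] by simp

text \<open>Any formula valid for the derivative on an open set may replace
  \<open>nderiv 1 f\<close>, since \<open>nderiv\<close> depends on local values only. The
  regularity inductions below use this as their step.\<close>

lemma C_on_SucI:
  assumes "open U" "\<And>x. x \<in> U \<Longrightarrow> (f has_vector_derivative g x) (at x)" "C_on n U g"
  shows "C_on (Suc n) U f"
proof -
  have "nderiv 1 f x = g x" if "x \<in> U" for x
    using assms(2)[OF that] by (rule nderiv_1_eq)
  then have "C_on n U (nderiv 1 f)" using C_on_cong[OF assms(1)] assms(3) by blast
  then show ?thesis unfolding C_on_Suc using assms(2) differentiableI_vector by blast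
qed

lemma smooth_onI_deriv:
  assumes "open U" "\<And>x. x \<in> U \<Longrightarrow> (f has_vector_derivative g x) (at x)" "smooth_on U g"
  shows "smooth_on U f"
  unfolding smooth_on_iff_C_on
proof
  fix n show "C_on n U f"
    using C_on_SucI[OF assms(1,2)] assms(3) unfolding smooth_on_iff_C_on
    by (cases n) auto
qed

lemma smooth_on_Un: "smooth_on U f \<Longrightarrow> smooth_on V f \<Longrightarrow> smooth_on (U \<union> V) f"
  unfolding smooth_on_def by blast

lemma C_on_const: "open U \<Longrightarrow> C_on n U (\<lambda>x. c)"
proof (induction n arbitrary: c)
  case (Suc n)
  show ?case by (rule C_on_SucI[where g = "\<lambda>x. 0"]) (use Suc in auto)
qed simp

lemma smooth_on_const [intro]: "open U \<Longrightarrow> smooth_on U (\<lambda>x. c)"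
  by (simp add: smooth_on_iff_C_on C_on_const)

lemma has_vector_derivative_complex_of_real: "(complex_of_real has_vector_derivative 1) (at x)"
  by (auto intro!: derivative_eq_intros simp: has_vector_derivative_def scaleR_conv_of_real)

lemma smooth_on_of_real [intro]: "open U \<Longrightarrow> smooth_on U of_real"
  by (rule smooth_onI_deriv[where g = "\<lambda>x. 1"])
     (auto intro!: smooth_on_const has_vector_derivative_complex_of_real)

lemma C_on_add:
  assumes "open U"
  shows "C_on n U f \<Longrightarrow> C_on n U g \<Longrightarrow> C_on n U (\<lambda>x. f x + g x)"
proof (induction n arbitrary: f g)
  case (Suc n)
  then show ?case unfolding C_on_Suc[of n U f] C_on_Suc[of n U g]
    by (intro C_on_SucI[OF assms, where g = "\<lambda>x. nderiv 1 f x + nderiv 1 g x"])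
       (auto simp: nderiv_1 vector_derivative_works intro!: has_vector_derivative_add simp del: One_nat_def)
qed simp

lemma C_on_mult:
  assumes "open U"
  shows "C_on n U f \<Longrightarrow> C_on n U g \<Longrightarrow> C_on n U (\<lambda>x. f x * g x)"
proof (induction n arbitrary: f g)
  case (Suc n)
  have "C_on n U f" "C_on n U g" using Suc.prems C_on_mono by (meson le_SucI order_refl)+
  with Suc show ?case unfolding C_on_Suc[of n U f] C_on_Suc[of n U g]
    by (intro C_on_SucI[OF assms, where g = "\<lambda>x. f x * nderiv 1 g x + nderiv 1 f x * g x"])
       (auto simp: nderiv_1 vector_derivative_works intro!: has_vector_derivative_mult C_on_add[OF assms] simp del: One_nat_def)
qed simp

lemma smooth_on_add [intro]:
  "open U \<Longrightarrow> smooth_on U f \<Longrightarrow> smooth_on U g \<Longrightarrow> smooth_on U (\<lambda>x. f x + g x)"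
  by (simp add: smooth_on_iff_C_on C_on_add)

lemma smooth_on_mult [intro]:
  "open U \<Longrightarrow> smooth_on U f \<Longrightarrow> smooth_on U g \<Longrightarrow> smooth_on U (\<lambda>x. f x * g x)"
  by (simp add: smooth_on_iff_C_on C_on_mult)

lemma smooth_on_cmult [intro]: "open U \<Longrightarrow> smooth_on U f \<Longrightarrow> smooth_on U (\<lambda>x. c * f x)"
  by (intro smooth_on_mult smooth_on_const)

lemma smooth_on_minus [intro]: "open U \<Longrightarrow> smooth_on U f \<Longrightarrow> smooth_on U (\<lambda>x. - f x)"
  using smooth_on_cmult[of U f "-1"] by simp

lemma smooth_on_diff [intro]:
  "open U \<Longrightarrow> smooth_on U f \<Longrightarrow> smooth_on U g \<Longrightarrow> smooth_on U (\<lambda>x. f x - g x)"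
  using smooth_on_add[of U f "\<lambda>x. - g x"] smooth_on_minus[of U g] by simp

lemma smooth_on_power [intro]: "open U \<Longrightarrow> smooth_on U f \<Longrightarrow> smooth_on U (\<lambda>x. f x ^ n)"
  by (induction n) (auto intro!: smooth_on_mult smooth_on_const)

lemma smooth_on_sum [intro]:
  "open U \<Longrightarrow> (\<And>i. i \<in> I \<Longrightarrow> smooth_on U (f i)) \<Longrightarrow> smooth_on U (\<lambda>x. \<Sum>i\<in>I. f i x)"
  by (induction I rule: infinite_finite_induct) (auto intro!: smooth_on_add smooth_on_const)

text \<open>Bootstrapping: once f is n times differentiable, so is g f, which is f'. This gives the
  smoothness of \<open>sgn_abs_powr\<close> without computing its higher derivatives.\<close>

lemma smooth_on_linear_ode:
  assumes "open U" "smooth_on U g" "\<And>x. x \<in> U \<Longrightarrow> (f has_vector_derivative g x * f x) (at x)"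
  shows "smooth_on U f"
  unfolding smooth_on_iff_C_on
proof
  fix n show "C_on n U f"
  proof (induction n)
    case (Suc n)
    show ?case
      by (rule C_on_SucI[OF assms(1,3)], assumption, rule C_on_mult[OF assms(1)])
         (use Suc assms(2) smooth_on_iff_C_on in auto)
  qed simp
qed

text \<open>The derivative is a polynomial in f' and 1/f, so each order of differentiability of 1/f
  yields the next.\<close>

lemma smooth_on_inverse:
  assumes "open U" "smooth_on U f" "\<And>x. x \<in> U \<Longrightarrow> f x \<noteq> 0"
  shows "smooth_on U (\<lambda>x. inverse (f x))"
  unfolding smooth_on_iff_C_on
proof
  fix n show "C_on n U (\<lambda>x. inverse (f x))"
  proof (induction n)
    case (Suc n)
    have "((\<lambda>x. inverse (f x)) has_vector_derivative
        (- nderiv 1 f x) * (inverse (f x) * inverse (f x))) (at x)" if "x \<in> U" for x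
    proof -
      have "(inverse has_field_derivative - (inverse (f x) ^ Suc (Suc 0))) (at (f x))"
        by (rule DERIV_inverse) (use assms that in auto)
      from field_vector_diff_chain_at[OF smooth_on_has_deriv[OF assms(2) that] this]
      show ?thesis by (simp add: o_def mult.commute power2_eq_square)
    qed
    moreover have "C_on n U (\<lambda>x. (- nderiv 1 f x) * (inverse (f x) * inverse (f x)))"
      using Suc smooth_on_minus[OF assms(1) smooth_on_nderiv[OF assms(2)]]
      by (intro C_on_mult[OF assms(1)]) (simp_all add: smooth_on_iff_C_on)
    ultimately show ?case by (rule C_on_SucI[OF assms(1)])
  qed simp
qed

lemma smooth_on_divide:
  assumes "open U" "smooth_on U f" "smooth_on U g" "\<And>x. x \<in> U \<Longrightarrow> g x \<noteq> 0"
  shows "smooth_on U (\<lambda>x. f x / g x)"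
  unfolding divide_inverse
  by (intro smooth_on_mult smooth_on_inverse assms)

text \<open>The inner function is real, so its smoothness is requested through \<open>g'\<close>
  regarded as a complex function. The chain rule reproduces the same shape with
  \<open>nderiv 1 f\<close> in place of f, hence the induction over all f.\<close>

lemma smooth_on_compose:
  assumes "open U" "open V" "smooth_on V f" "\<And>x. x \<in> U \<Longrightarrow> g x \<in> V"
    and g: "\<And>x. x \<in> U \<Longrightarrow> (g has_real_derivative g' x) (at x)"
    and g': "smooth_on U (\<lambda>x. of_real (g' x))"
  shows "smooth_on U (\<lambda>x. f (g x))"
  unfolding smooth_on_iff_C_on
proof
  fix n show "C_on n U (\<lambda>x. f (g x))"
    using assms(3)
  proof (induction n arbitrary: f)
    case (Suc n)
    have "((\<lambda>x. f (g x)) has_vector_derivative of_real (g' x) * nderiv 1 f (g x)) (at x)"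
      if "x \<in> U" for x
      using vector_diff_chain_at[OF g[OF that, unfolded has_real_derivative_iff_has_vector_derivative]
          smooth_on_has_deriv[OF Suc.prems assms(4)[OF that]]]
      by (simp add: o_def scaleR_conv_of_real)
    moreover have "C_on n U (\<lambda>x. of_real (g' x) * nderiv 1 f (g x))"
      using g' Suc.IH[OF smooth_on_nderiv[OF Suc.prems]]
      by (intro C_on_mult[OF assms(1)]) (simp_all add: smooth_on_iff_C_on)
    ultimately show ?case by (rule C_on_SucI[OF assms(1)])
  qed simp
qed

lemma nderiv_plus:
  assumes "open U" "smooth_on U f" "smooth_on U g" "x \<in> U"
  shows "nderiv n (\<lambda>x. f x + g x) x = nderiv n f x + nderiv n g x"
  using assms(4)
proof (induction n arbitrary: x)
  case (Suc n)
  have "(nderiv n (\<lambda>x. f x + g x) has_vector_derivative nderiv (Suc n) f x + nderiv (Suc n) g x) (at x)"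
    by (rule has_vector_derivative_open_congI[OF assms(1) Suc.prems Suc.IH], assumption)
      (intro has_vector_derivative_add smooth_on_has_nderiv[OF _ Suc.prems] assms)
  then show ?case by (rule nderiv_Suc_eq)
qed simp

lemma nderiv_cmult:
  assumes "open U" "smooth_on U f" "x \<in> U"
  shows "nderiv n (\<lambda>x. c * f x) x = c * nderiv n f x"
  using assms(3)
proof (induction n arbitrary: x)
  case (Suc n)
  have "(nderiv n (\<lambda>x. c * f x) has_vector_derivative c * nderiv (Suc n) f x) (at x)"
    by (rule has_vector_derivative_open_congI[OF assms(1) Suc.prems Suc.IH], assumption)
      (intro has_vector_derivative_mult_right smooth_on_has_nderiv[OF _ Suc.prems] assms)
  then show ?case by (rule nderiv_Suc_eq)
qed simp

lemma nderiv_const_Suc: "nderiv (Suc n) (\<lambda>x. c) = (\<lambda>x. 0)"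
proof (induction n)
  case 0
  show ?case by (simp add: nderiv_Suc)
next
  case (Suc n)
  show ?case unfolding nderiv_Suc[of "Suc n"] Suc by simp
qed

lemma nderiv_zero [simp]: "nderiv n (\<lambda>x. 0) = (\<lambda>x. 0)"
  by (cases n) (simp_all add: nderiv_const_Suc)

lemma nderiv_eq_0_outside:
  assumes "open U" "\<And>y. y \<in> U \<Longrightarrow> f y = 0" "x \<in> U"
  shows "nderiv n f x = 0"
  using nderiv_cong[OF assms(1), of f "\<lambda>x. 0" x n] assms by simp

section \<open>The dilation-invariant derivative x d/dx and its comparison with d/dx\<close>

section \<open>The Euler operator\<close>

definition euler :: "(real \<Rightarrow> complex) \<Rightarrow> real \<Rightarrow> complex" where
  "euler f = (\<lambda>x. of_real x * nderiv 1 f x)"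

lemma smooth_on_euler: "open U \<Longrightarrow> smooth_on U f \<Longrightarrow> smooth_on U (euler f)"
  unfolding euler_def by (intro smooth_on_mult smooth_on_of_real smooth_on_nderiv)

lemma smooth_on_euler_pow: "open U \<Longrightarrow> smooth_on U f \<Longrightarrow> smooth_on U ((euler ^^ n) f)"
  by (induction n) (auto intro: smooth_on_euler)

lemma euler_pow_Suc_right: "(euler ^^ Suc n) f = (euler ^^ n) (euler f)"
  by (simp add: funpow_swap1)

lemma euler_cong:
  assumes "open U" "\<And>y. y \<in> U \<Longrightarrow> f y = g y" "x \<in> U"
  shows "euler f x = euler g x"
  unfolding euler_def using nderiv_cong[OF assms] by simp

lemma euler_pow_cong:
  assumes "open U" "\<And>y. y \<in> U \<Longrightarrow> f y = g y" "x \<in> U"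
  shows "(euler ^^ n) f x = (euler ^^ n) g x"
  using assms(3)
proof (induction n arbitrary: x)
  case (Suc n)
  then show ?case using euler_cong[OF assms(1), of "(euler ^^ n) f" "(euler ^^ n) g"] by simp
qed (use assms in simp)

lemma euler_eqI: "(f has_vector_derivative D) (at x) \<Longrightarrow> euler f x = of_real x * D"
  unfolding euler_def by (metis nderiv_1_eq)

lemma euler_has_deriv:
  "smooth_on U f \<Longrightarrow> x \<in> U \<Longrightarrow> x \<noteq> 0 \<Longrightarrow> (f has_vector_derivative euler f x / of_real x) (at x)"
  unfolding euler_def using smooth_on_has_deriv by fastforce

lemma euler_zero [simp]: "euler (\<lambda>x. 0) = (\<lambda>x. 0)"
  by (simp add: euler_def)

lemma euler_pow_zero [simp]: "(euler ^^ n) (\<lambda>x. 0) = (\<lambda>x. 0)"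
  by (induction n) simp_all

lemma euler_pow_eq_0_outside:
  assumes "open U" "\<And>y. y \<in> U \<Longrightarrow> f y = 0" "x \<in> U"
  shows "(euler ^^ n) f x = 0"
  using euler_pow_cong[OF assms(1), of f "\<lambda>x. 0" x n] assms by simp

lemma euler_add:
  assumes "open U" "smooth_on U f" "smooth_on U g" "x \<in> U"
  shows "euler (\<lambda>x. f x + g x) x = euler f x + euler g x"
  unfolding euler_def using nderiv_plus[OF assms] by (simp add: algebra_simps del: One_nat_def)

lemma euler_cmult:
  assumes "open U" "smooth_on U f" "x \<in> U"
  shows "euler (\<lambda>x. c * f x) x = c * euler f x"
  unfolding euler_def using nderiv_cmult[OF assms] by (simp add: algebra_simps del: One_nat_def)

lemma euler_mult:
  assumes "smooth_on U f" "smooth_on U g" "x \<in> U"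
  shows "euler (\<lambda>x. f x * g x) x = euler f x * g x + f x * euler g x"
proof -
  have "((\<lambda>x. f x * g x) has_vector_derivative f x * nderiv 1 g x + nderiv 1 f x * g x) (at x)"
    by (intro has_vector_derivative_mult smooth_on_has_deriv[OF _ assms(3)] assms)
  from euler_eqI[OF this] show ?thesis unfolding euler_def by (simp add: algebra_simps)
qed

lemma euler_pow_add:
  assumes "open U" "smooth_on U f" "smooth_on U g" "x \<in> U"
  shows "(euler ^^ n) (\<lambda>x. f x + g x) x = (euler ^^ n) f x + (euler ^^ n) g x"
  using assms(4)
proof (induction n arbitrary: x)
  case (Suc n)
  then show ?case
    using euler_cong[OF assms(1) Suc.IH Suc.prems]
      euler_add[OF assms(1) smooth_on_euler_pow[OF assms(1,2)] smooth_on_euler_pow[OF assms(1,3)] Suc.prems, of n n]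
    by simp
qed simp

lemma euler_pow_cmult:
  assumes "open U" "smooth_on U f" "x \<in> U"
  shows "(euler ^^ n) (\<lambda>x. c * f x) x = c * (euler ^^ n) f x"
  using assms(3)
proof (induction n arbitrary: x)
  case (Suc n)
  then show ?case
    using euler_cong[OF assms(1) Suc.IH Suc.prems]
      euler_cmult[OF assms(1) smooth_on_euler_pow[OF assms(1,2)] Suc.prems, of c n]
    by simp
qed simp

text \<open>Leibniz rule for the derivation \<theta>: each step splits a product into two, whence
  \<open>2 ^ n\<close> terms, each at most A B.\<close>

lemma norm_euler_pow_mult_le:
  assumes "open U" "x \<in> U"
  shows "smooth_on U f \<Longrightarrow> smooth_on U g \<Longrightarrow> (\<And>i. i \<le> n \<Longrightarrow> norm ((euler ^^ i) f x) \<le> A) \<Longrightarrow>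
    (\<And>i. i \<le> n \<Longrightarrow> norm ((euler ^^ i) g x) \<le> B) \<Longrightarrow>
    norm ((euler ^^ n) (\<lambda>x. f x * g x) x) \<le> 2 ^ n * (A * B)"
proof (induction n arbitrary: f g)
  case 0
  have "norm (f x) \<le> A" "norm (g x) \<le> B" using 0(3)[of 0] 0(4)[of 0] by auto
  then show ?case by (simp add: norm_mult mult_mono')
next
  case (Suc n)
  note sm = Suc.prems(1,2) smooth_on_euler[OF assms(1) Suc.prems(1)] smooth_on_euler[OF assms(1) Suc.prems(2)]
  have s: "i \<le> Suc n" "Suc i \<le> Suc n" if "i \<le> n" for i using that by auto
  have 1: "norm ((euler ^^ n) (\<lambda>x. euler f x * g x) x) \<le> 2 ^ n * (A * B)"
    by (rule Suc.IH[OF sm(3,2)])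
       (use Suc.prems(3)[OF s(2)] Suc.prems(4)[OF s(1)] in \<open>simp_all only: euler_pow_Suc_right\<close>)
  have 2: "norm ((euler ^^ n) (\<lambda>x. f x * euler g x) x) \<le> 2 ^ n * (A * B)"
    by (rule Suc.IH[OF sm(1,4)])
       (use Suc.prems(3)[OF s(1)] Suc.prems(4)[OF s(2)] in \<open>simp_all only: euler_pow_Suc_right\<close>)
  have "(euler ^^ Suc n) (\<lambda>x. f x * g x) x = (euler ^^ n) (\<lambda>x. euler f x * g x + f x * euler g x) x"
    unfolding euler_pow_Suc_right
    by (rule euler_pow_cong[OF assms(1) _ assms(2)]) (use euler_mult sm in blast)
  also have "\<dots> = (euler ^^ n) (\<lambda>x. euler f x * g x) x + (euler ^^ n) (\<lambda>x. f x * euler g x) x"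
    by (intro euler_pow_add[OF assms(1) _ _ assms(2)] smooth_on_mult assms sm)
  finally show ?case using norm_triangle_le[OF add_mono[OF 1 2]] by (simp only: power_Suc)
qed

text \<open>Moving n derivatives past the factor x leaves the commutator term
  \<open>of_nat n * nderiv n f x\<close>.\<close>

lemma nderiv_euler:
  assumes "open U" "smooth_on U f" "x \<in> U"
  shows "nderiv n (euler f) x = of_real x * nderiv (Suc n) f x + of_nat n * nderiv n f x"
  using assms(3)
proof (induction n arbitrary: x)
  case 0
  then show ?case by (simp add: euler_def)
next
  case (Suc n)
  have "((\<lambda>x. of_real x * nderiv (Suc n) f x + of_nat n * nderiv n f x) has_vector_derivative
     of_real x * nderiv (Suc (Suc n)) f x + of_nat (Suc n) * nderiv (Suc n) f x) (at x)"
    using has_vector_derivative_add[OF has_vector_derivative_mult[OF has_vector_derivative_complex_of_real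
          smooth_on_has_nderiv[OF assms(2) Suc.prems, of "Suc n"]]
        has_vector_derivative_mult_right[OF smooth_on_has_nderiv[OF assms(2) Suc.prems, of n], of "of_nat n"]]
    by (simp add: algebra_simps)
  then have "(nderiv n (euler f) has_vector_derivative
     of_real x * nderiv (Suc (Suc n)) f x + of_nat (Suc n) * nderiv (Suc n) f x) (at x)"
    using has_vector_derivative_open_cong[OF assms(1) Suc.prems, of "nderiv n (euler f)", OF Suc.IH] by blast
  then show ?case by (rule nderiv_Suc_eq)
qed

text \<open>x^n d^n equals \<theta> (\<theta> - 1) ... (\<theta> - n + 1). The factor \<theta> - n
  multiplies bounds by at most n + 1, and these factors accumulate to \<open>fact\<close>.\<close>

lemma norm_nderiv_le_euler:
  assumes "open U" "x \<in> U"
  shows "smooth_on U f \<Longrightarrow> (\<And>i. i \<le> n \<Longrightarrow> norm ((euler ^^ i) f x) \<le> A) \<Longrightarrow>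
    \<bar>x\<bar> ^ n * norm (nderiv n f x) \<le> fact n * A"
proof (induction n arbitrary: f A)
  case 0
  then show ?case using 0(2)[of 0] by simp
next
  case (Suc n)
  \<comment> \<open>Subtracting n f cancels the commutator term, so that \<open>nderiv n g\<close>
    is x times \<open>nderiv (Suc n) f\<close>.\<close>
  define g where "g = (\<lambda>x. euler f x + (- of_nat n) * f x)"
  have sm: "smooth_on U (euler f)" "smooth_on U (\<lambda>x. (- of_nat n) * f x)"
    by (rule smooth_on_euler[OF assms(1) Suc.prems(1)], rule smooth_on_cmult[OF assms(1) Suc.prems(1)])
  have g: "smooth_on U g" unfolding g_def by (intro smooth_on_add assms sm)
  have "norm ((euler ^^ i) g x) \<le> real (Suc n) * A" if "i \<le> n" for i
  proof -
    have "(euler ^^ i) g x = (euler ^^ Suc i) f x - of_nat n * (euler ^^ i) f x"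
      unfolding g_def euler_pow_add[OF assms(1) sm assms(2)] euler_pow_cmult[OF assms(1) Suc.prems(1) assms(2)]
      by (simp add: funpow_swap1)
    also have "norm \<dots> \<le> A + n * A"
      using Suc.prems(2)[of "Suc i"] Suc.prems(2)[of i] that
      by (intro norm_triangle_le_diff add_mono) (auto simp: norm_mult mult_left_mono simp del: funpow.simps)
    finally show ?thesis by (simp add: algebra_simps)
  qed
  from Suc.IH[OF g this] have *: "\<bar>x\<bar> ^ n * norm (nderiv n g x) \<le> fact (Suc n) * A" by (simp add: algebra_simps)
  have "nderiv n g x = of_real x * nderiv (Suc n) f x"
    unfolding g_def nderiv_plus[OF assms(1) sm assms(2)] nderiv_cmult[OF assms(1) Suc.prems(1) assms(2)]
      nderiv_euler[OF assms(1) Suc.prems(1) assms(2)] by simp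
  with * show ?case by (simp add: norm_mult algebra_simps)
qed

text \<open>Conversely \<theta>^n is a combination of the x^i d^i; one application of \<theta> turns
  the bound A into (n + 1) A, whence again \<open>fact\<close>.\<close>

lemma norm_euler_le_nderiv:
  assumes "open U" "x \<in> U"
  shows "smooth_on U f \<Longrightarrow> (\<And>i. i \<le> n \<Longrightarrow> \<bar>x\<bar> ^ i * norm (nderiv i f x) \<le> A) \<Longrightarrow>
    norm ((euler ^^ n) f x) \<le> fact n * A"
proof (induction n arbitrary: f A)
  case 0
  then show ?case using 0(2)[of 0] by simp
next
  case (Suc n)
  have "\<bar>x\<bar> ^ i * norm (nderiv i (euler f) x) \<le> real (Suc n) * A" if "i \<le> n" for i
  proof -
    have A: "A \<ge> 0" using Suc.prems(2)[of 0] order_trans[OF norm_ge_zero, of "f x" A] by simp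
    have "\<bar>x\<bar> ^ i * norm (nderiv i (euler f) x) \<le>
      \<bar>x\<bar> ^ i * (\<bar>x\<bar> * norm (nderiv (Suc i) f x) + i * norm (nderiv i f x))"
      unfolding nderiv_euler[OF assms(1) Suc.prems(1) assms(2)]
      by (intro mult_left_mono norm_triangle_le) (auto simp: norm_mult)
    also have "\<dots> = \<bar>x\<bar> ^ Suc i * norm (nderiv (Suc i) f x) + i * (\<bar>x\<bar> ^ i * norm (nderiv i f x))"
      by (simp add: algebra_simps)
    also have "\<dots> \<le> A + n * A"
      using Suc.prems(2)[of "Suc i"] Suc.prems(2)[of i] that A
      by (intro add_mono mult_mono) auto
    finally show ?thesis by (simp add: algebra_simps)
  qed
  from Suc.IH[OF smooth_on_euler[OF assms(1) Suc.prems(1)] this]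
  show ?case by (simp add: funpow_swap1 algebra_simps)
qed

section \<open>Taylor bounds at zeros, and the coefficients of tangential operators\<close>

section \<open>Vanishing orders\<close>

lemma compact_bounded_norm:
  fixes f :: "real \<Rightarrow> complex"
  assumes "compact K" "continuous_on K f"
  obtains C where "C \<ge> 0" "\<And>x. x \<in> K \<Longrightarrow> norm (f x) \<le> C"
proof -
  have "bounded (f ` K)" using assms compact_continuous_image compact_imp_bounded by blast
  then obtain C where "C > 0" "\<forall>y\<in>f ` K. norm y \<le> C" unfolding bounded_pos by blast
  then show ?thesis using that[of C] by auto
qed

lemma norm_diff_le_deriv:
  fixes f :: "real \<Rightarrow> complex"
  assumes "\<And>t. t \<in> closed_segment a x \<Longrightarrow> (f has_vector_derivative f' t) (at t)"
    and "\<And>t. t \<in> closed_segment a x \<Longrightarrow> norm (f' t) \<le> B"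
  shows "norm (f x - f a) \<le> B * \<bar>x - a\<bar>"
proof -
  have "norm (f x - f a) \<le> B * norm (x - a)"
  proof (rule differentiable_bound[where S = "closed_segment a x" and f' = "\<lambda>t h. h *\<^sub>R f' t"])
    fix t assume t: "t \<in> closed_segment a x"
    show "(f has_derivative (\<lambda>h. h *\<^sub>R f' t)) (at t within closed_segment a x)"
      using assms(1)[OF t] unfolding has_vector_derivative_def by (rule has_derivative_at_withinI)
    show "onorm (\<lambda>h. h *\<^sub>R f' t) \<le> B"
      using onorm_scaleR_left[OF bounded_linear_ident, of "f' t"] assms(2)[OF t] by (simp add: onorm_id)
  qed auto
  then show ?thesis by simp
qed

lemma abs_le_in_closed_segment_0: "t \<in> closed_segment 0 (x::real) \<Longrightarrow> \<bar>t\<bar> \<le> \<bar>x\<bar>"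
  by (auto simp: closed_segment_eq_real_ivl split: if_splits)

lemma fun_vanishes_nderiv: "fun_vanishes p (Suc k) f \<Longrightarrow> fun_vanishes p k (nderiv 1 f)"
  unfolding fun_vanishes_def nderiv_Suc_right[symmetric] by simp

text \<open>The mean value inequality, applied to the bound for w', gains one factor |x| per order
  and takes the place of Taylor's formula.\<close>

lemma fun_vanishes_bound:
  assumes "\<And>x. \<bar>x\<bar> \<le> r \<Longrightarrow> x \<in> U"
  shows "smooth_on U w \<Longrightarrow> fun_vanishes 0 p w \<Longrightarrow> \<exists>C\<ge>0. \<forall>x. \<bar>x\<bar> \<le> r \<longrightarrow> norm (w x) \<le> C * \<bar>x\<bar> ^ p"
proof (induction p arbitrary: w)
  case 0
  have "compact {-r..r}" "continuous_on {-r..r} w"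
    using smooth_on_continuous_on[OF 0(1), of 0] assms by (auto elim!: continuous_on_subset simp: abs_le_iff)
  then obtain C where "C \<ge> 0" "\<And>x. x \<in> {-r..r} \<Longrightarrow> norm (w x) \<le> C"
    using compact_bounded_norm by blast
  then show ?case by (intro exI[of _ C]) (auto simp: abs_le_iff)
next
  case (Suc p)
  obtain C where C: "C \<ge> 0" "\<And>x. \<bar>x\<bar> \<le> r \<Longrightarrow> norm (nderiv 1 w x) \<le> C * \<bar>x\<bar> ^ p"
    using Suc.IH[OF smooth_on_nderiv fun_vanishes_nderiv, OF Suc.prems] by blast
  have "norm (w x) \<le> C * \<bar>x\<bar> ^ Suc p" if "\<bar>x\<bar> \<le> r" for x
  proof -
    have w0: "w 0 = 0" using Suc.prems(2) unfolding fun_vanishes_def by (auto dest: spec[of _ 0])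
    have "norm (w x - w 0) \<le> (C * \<bar>x\<bar> ^ p) * \<bar>x - 0\<bar>"
    proof (rule norm_diff_le_deriv[where f' = "nderiv 1 w"])
      fix t assume "t \<in> closed_segment 0 x"
      then have t: "\<bar>t\<bar> \<le> \<bar>x\<bar>" by (rule abs_le_in_closed_segment_0)
      with that have "t \<in> U" using assms by auto
      then show "(w has_vector_derivative nderiv 1 w t) (at t)"
        by (rule smooth_on_has_deriv[OF Suc.prems(1)])
      have "norm (nderiv 1 w t) \<le> C * \<bar>t\<bar> ^ p" using C(2) t that by auto
      also have "\<dots> \<le> C * \<bar>x\<bar> ^ p" using C(1) t by (intro mult_left_mono power_mono) auto
      finally show "norm (nderiv 1 w t) \<le> C * \<bar>x\<bar> ^ p" .
    qed
    then show ?thesis using w0 by (simp add: mult.assoc mult.left_commute mult.commute)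
  qed
  then show ?case using C(1) by blast
qed

lemma nderiv_mult_Suc:
  assumes "open U" "smooth_on U f" "smooth_on U g" "x \<in> U"
  shows "nderiv (Suc n) (\<lambda>x. f x * g x) x =
    nderiv n (\<lambda>x. nderiv 1 f x * g x) x + nderiv n (\<lambda>x. f x * nderiv 1 g x) x"
proof -
  have "nderiv 1 (\<lambda>x. f x * g x) y = nderiv 1 f y * g y + f y * nderiv 1 g y" if "y \<in> U" for y
    using nderiv_1_eq[OF has_vector_derivative_mult[OF smooth_on_has_deriv[OF assms(2) that]
        smooth_on_has_deriv[OF assms(3) that]]] by (simp add: add.commute)
  then have "nderiv (Suc n) (\<lambda>x. f x * g x) x = nderiv n (\<lambda>x. nderiv 1 f x * g x + f x * nderiv 1 g x) x"
    unfolding nderiv_Suc_right by (intro nderiv_cong[OF assms(1) _ assms(4)])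
  then show ?thesis
    by (subst nderiv_plus[OF assms(1), symmetric]) (use assms in \<open>auto intro!: smooth_on_mult smooth_on_nderiv\<close>)
qed

text \<open>A derivative falls on one factor and lowers its order by one; the truncated difference
  \<open>l - 1\<close> covers order 0.\<close>

lemma fun_vanishes_mult:
  assumes "open U" "p \<in> U" "smooth_on U f" "smooth_on U g" "fun_vanishes p i f" "fun_vanishes p j g"
  shows "fun_vanishes p (i + j) (\<lambda>x. f x * g x)"
proof -
  have "nderiv n (\<lambda>x. f x * g x) p = 0" if "n < i + j" for n
    using that assms(3-6)
  proof (induction n arbitrary: f g i j)
    case 0
    then show ?case unfolding fun_vanishes_def by (cases "i = 0") auto
  next
    case (Suc n)
    have d: "fun_vanishes p (l - 1) (nderiv 1 h)" if "fun_vanishes p l h" for l h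
      using that fun_vanishes_nderiv[of p "l - 1" h] by (cases l) (auto simp: fun_vanishes_def)
    have "nderiv n (\<lambda>x. nderiv 1 f x * g x) p = 0"
      by (rule Suc.IH[of "i - 1" j]) (use Suc.prems d smooth_on_nderiv in auto)
    moreover have "nderiv n (\<lambda>x. f x * nderiv 1 g x) p = 0"
      by (rule Suc.IH[of i "j - 1"]) (use Suc.prems d smooth_on_nderiv in auto)
    ultimately show ?case using nderiv_mult_Suc[OF assms(1) Suc.prems(2,3) assms(2)] by simp
  qed
  then show ?thesis unfolding fun_vanishes_def by blast
qed

lemma fun_vanishes_plus:
  assumes "open U" "p \<in> U" "smooth_on U f" "smooth_on U g" "fun_vanishes p i f" "fun_vanishes p i g"
  shows "fun_vanishes p i (\<lambda>x. f x + g x)"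
  using assms unfolding fun_vanishes_def by (simp add: nderiv_plus[OF assms(1,3,4,2)])

lemma fun_vanishes_cmult:
  assumes "open U" "p \<in> U" "smooth_on U f" "fun_vanishes p i f"
  shows "fun_vanishes p i (\<lambda>x. c * f x)"
  using assms unfolding fun_vanishes_def by (simp add: nderiv_cmult[OF assms(1,3,2)])

lemma fun_vanishes_euler:
  assumes "open U" "0 \<in> U" "smooth_on U f" "fun_vanishes 0 k f"
  shows "fun_vanishes 0 k (euler f)"
  using assms unfolding fun_vanishes_def by (simp add: nderiv_euler[OF assms(1,3,2)])

lemma fun_vanishes_euler_pow:
  assumes "open U" "0 \<in> U" "smooth_on U f" "fun_vanishes 0 k f"
  shows "fun_vanishes 0 k ((euler ^^ n) f)"
  by (induction n) (auto intro: assms fun_vanishes_euler[OF assms(1,2)] smooth_on_euler_pow)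

lemma nderiv_power:
  "nderiv i (\<lambda>x. of_real x ^ n) x = (\<Prod>j<i. of_nat (n - j)) * of_real x ^ (n - i)"
proof (induction i arbitrary: x)
  case (Suc i)
  have "((\<lambda>z::complex. z ^ (n - i)) has_field_derivative of_nat (n - i) * of_real x ^ (n - i - 1)) (at (of_real x))"
    by (auto intro!: derivative_eq_intros)
  from field_vector_diff_chain_at[OF has_vector_derivative_complex_of_real this]
  have "((\<lambda>x. of_real x ^ (n - i) :: complex) has_vector_derivative of_nat (n - i) * of_real x ^ (n - i - 1)) (at x)"
    by (simp add: o_def)
  from has_vector_derivative_mult_right[OF this, of "\<Prod>j<i. of_nat (n - j)"]
  have "nderiv (Suc i) (\<lambda>x. of_real x ^ n) x = (\<Prod>j<i. of_nat (n - j)) * (of_nat (n - i) * of_real x ^ (n - i - 1))"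
    unfolding nderiv_Suc Suc by (rule vector_derivative_at)
  then show ?case by (simp add: mult.assoc)
qed simp

lemma smooth_on_of_real_power: "open U \<Longrightarrow> smooth_on U (\<lambda>x. of_real x ^ n)"
  by (intro smooth_on_power smooth_on_of_real)

lemma fun_vanishes_power: "fun_vanishes 0 n (\<lambda>x. of_real x ^ n)"
  unfolding fun_vanishes_def by (simp add: nderiv_power)

text \<open>A tangential operator is tested against the monomials, one degree after the other.\<close>

lemma tangential_coeff_vanishes:
  assumes U: "open U" "0 \<in> U" and t: "tangential_op U 0 m a"
  shows "i \<le> m \<Longrightarrow> fun_vanishes 0 i (a i)"
proof (induction i rule: less_induct)
  case (less i)
  have sm: "smooth_on U (a l)" if "l \<le> m" for l using t that unfolding tangential_op_def by blast
  define D where "D = diff_op m a (\<lambda>x. of_real x ^ i)"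
  define e where "e l = (\<Prod>j<l. of_nat (i - j) :: complex)" for l
  have e0: "e l = 0" if "l > i" for l
    unfolding e_def by (rule prod_zero) (use that in auto)
  have ei: "e i \<noteq> 0" unfolding e_def by auto
  \<comment> \<open>On x^i the operator produces i! a_i and terms x^(i - l) a_l with l < i. The
    terms l > i drop out because the falling factorial \<open>e l\<close> then contains the factor
    \<open>i - i\<close>.\<close>
  have D: "D x = (\<Sum>l<i. e l * (of_real x ^ (i - l) * a l x)) + e i * a i x" for x
  proof -
    have "D x = (\<Sum>l\<le>m. if l \<le> i then e l * (of_real x ^ (i - l) * a l x) else 0)"
      unfolding D_def diff_op_def nderiv_power using e0 by (intro sum.cong) (auto simp: e_def)
    also have "\<dots> = (\<Sum>l\<le>i. e l * (of_real x ^ (i - l) * a l x))"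
      by (rule sum.mono_neutral_cong_right) (use less.prems in auto)
    also have "\<dots> = (\<Sum>l<i. e l * (of_real x ^ (i - l) * a l x)) + e i * a i x"
      by (simp add: lessThan_Suc_atMost[symmetric])
    finally show ?thesis .
  qed
  have terms: "fun_vanishes 0 i (\<lambda>x. e l * (of_real x ^ (i - l) * a l x))" if "l < i" for l
  proof -
    have "fun_vanishes 0 (i - l + l) (\<lambda>x. of_real x ^ (i - l) * a l x)"
      by (rule fun_vanishes_mult[OF U]) (use less that sm fun_vanishes_power smooth_on_of_real_power U in auto)
    then show ?thesis using that
      by (intro fun_vanishes_cmult[OF U]) (use less.prems sm smooth_on_of_real_power U in \<open>auto intro!: smooth_on_mult\<close>)
  qed
  have S: "smooth_on U (\<lambda>x. \<Sum>l\<in>L. e l * (of_real x ^ (i - l) * a l x)) \<and>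
    fun_vanishes 0 i (\<lambda>x. \<Sum>l\<in>L. e l * (of_real x ^ (i - l) * a l x))" if "finite L" "L \<subseteq> {..<i}" for L
    using that
  proof (induction L rule: finite_induct)
    case empty
    then show ?case using U by (auto simp: fun_vanishes_def)
  next
    case (insert l L)
    have "smooth_on U (\<lambda>x. e l * (of_real x ^ (i - l) * a l x))"
      using insert.prems less.prems sm U smooth_on_of_real_power by (intro smooth_on_cmult smooth_on_mult) auto
    with insert show ?case
      using terms[of l] fun_vanishes_plus[OF U] U by (auto intro!: smooth_on_add)
  qed
  have smD: "smooth_on U D" unfolding D
    using S[of "{..<i}"] sm[OF less.prems] U by (auto intro!: smooth_on_add smooth_on_cmult)
  have "fun_vanishes 0 i D" using t smooth_on_of_real_power[OF U(1)] fun_vanishes_power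
    unfolding tangential_op_def D_def by blast
  then have "fun_vanishes 0 i (\<lambda>x. D x + (-1) * (\<Sum>l<i. e l * (of_real x ^ (i - l) * a l x)))"
    using S[of "{..<i}"] smD U by (intro fun_vanishes_plus[OF U] fun_vanishes_cmult[OF U] smooth_on_cmult) auto
  then have "fun_vanishes 0 i (\<lambda>x. e i * a i x)" by (simp add: D)
  from fun_vanishes_cmult[OF U _ this, of "1 / e i"] sm[OF less.prems] U ei show ?case by auto
qed

section \<open>Flat functions and smooth cutoffs\<close>

section \<open>Cutoff functions\<close>

text \<open>The bound at x = 0 forces f 0 = 0, and the difference quotient is then O(|x|). Quadratic
  bounds are the form in which remainders are estimated below.\<close>

lemma has_vector_derivative_0_quadratic:
  fixes f :: "real \<Rightarrow> complex"
  assumes "\<delta> > 0" "\<And>x. \<bar>x\<bar> < \<delta> \<Longrightarrow> norm (f x) \<le> C * x\<^sup>2"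
  shows "(f has_vector_derivative 0) (at 0)"
proof -
  have f0: "f 0 = 0" using assms(2)[of 0] assms(1) by simp
  have "((\<lambda>x. norm ((f x - f 0 - (x - 0) *\<^sub>R 0) /\<^sub>R norm (x - 0))) \<longlongrightarrow> 0) (at 0)"
  proof (rule tendsto_sandwich[of "\<lambda>x. 0" _ _ "\<lambda>x. \<bar>C\<bar> * \<bar>x\<bar>"])
    have "norm ((f x - f 0 - (x - 0) *\<^sub>R 0) /\<^sub>R norm (x - 0)) \<le> \<bar>C\<bar> * \<bar>x\<bar>" if "x \<noteq> 0" "\<bar>x\<bar> < \<delta>" for x
    proof -
      have "norm (f x) \<le> C * x\<^sup>2" using assms(2) that by simp
      also have "\<dots> \<le> \<bar>C\<bar> * x\<^sup>2" by (intro mult_right_mono) auto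
      also have "\<dots> = (\<bar>C\<bar> * \<bar>x\<bar>) * \<bar>x\<bar>" by (simp add: power2_eq_square mult.assoc)
      finally show ?thesis using that f0 by (simp add: field_simps)
    qed
    then show "\<forall>\<^sub>F x in at 0. norm ((f x - f 0 - (x - 0) *\<^sub>R 0) /\<^sub>R norm (x - 0)) \<le> \<bar>C\<bar> * \<bar>x\<bar>"
      unfolding eventually_at using assms(1) by (intro exI[of _ \<delta>]) auto
    have "((\<lambda>x::real. \<bar>C\<bar> * \<bar>x\<bar>) \<longlongrightarrow> \<bar>C\<bar> * \<bar>0\<bar>) (at 0)" by (intro tendsto_intros)
    then show "((\<lambda>x::real. \<bar>C\<bar> * \<bar>x\<bar>) \<longlongrightarrow> 0) (at 0)" by simp
  qed auto
  then show ?thesis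
    unfolding has_vector_derivative_def has_derivative_at_within
    using tendsto_norm_zero_iff by fastforce
qed

text \<open>The bounds speak of x \<noteq> 0 only. Inductively, a derivative that is 0 at the origin
  and O(x^2) around it has derivative 0 there, which provides the value at 0 of the next
  one.\<close>

lemma smooth_on_flat_extension:
  assumes "smooth_on (- {0}) f" "f 0 = 0"
    and flat: "\<And>i. \<exists>C. \<exists>\<delta>>0. \<forall>x. x \<noteq> 0 \<longrightarrow> \<bar>x\<bar> < \<delta> \<longrightarrow> norm (nderiv i f x) \<le> C * x\<^sup>2"
  shows "smooth_on UNIV f"
proof -
  have "nderiv i f 0 = 0 \<and> (nderiv i f has_vector_derivative 0) (at 0)" for i
  proof (induction i)
    case 0
    obtain C \<delta> where "\<delta> > 0" and *: "\<And>x. x \<noteq> 0 \<Longrightarrow> \<bar>x\<bar> < \<delta> \<Longrightarrow> norm (f x) \<le> C * x\<^sup>2"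
      using flat[of 0] by auto
    show ?case
      by (simp add: assms(2), rule has_vector_derivative_0_quadratic[OF \<open>\<delta> > 0\<close>, of _ C])
         (metis * assms(2) norm_zero mult_zero_right order_refl power_zero_numeral)
  next
    case (Suc i)
    then have n0: "nderiv (Suc i) f 0 = 0" using nderiv_Suc_eq by blast
    obtain C \<delta> where "\<delta> > 0" and *: "\<And>x. x \<noteq> 0 \<Longrightarrow> \<bar>x\<bar> < \<delta> \<Longrightarrow> norm (nderiv (Suc i) f x) \<le> C * x\<^sup>2"
      using flat[of "Suc i"] by auto
    have "(nderiv (Suc i) f has_vector_derivative 0) (at 0)"
      by (rule has_vector_derivative_0_quadratic[OF \<open>\<delta> > 0\<close>, of _ C])
         (metis * n0 norm_zero mult_zero_right order_refl power_zero_numeral)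
    with n0 show ?case by blast
  qed
  then have "smooth_on {0} f" unfolding smooth_on_def using differentiableI_vector by blast
  from smooth_on_Un[OF this assms(1)] show ?thesis by (simp add: Compl_partition)
qed

text \<open>The functions exp(-1/x) / x^k form a family whose linear span is closed under
  differentiation, so smoothness follows by an induction over all k at once.\<close>

definition exp_bump :: "nat \<Rightarrow> real \<Rightarrow> complex" where
  "exp_bump k x = (if x \<le> 0 then 0 else of_real (exp (- (1 / x)) / x ^ k))"

lemma power_div_fact_le_exp: "x ^ n / fact n \<le> exp x" if "x \<ge> 0" for x :: real
proof -
  have "(\<Sum>k\<in>{n}. x ^ k /\<^sub>R fact k) \<le> (\<Sum>k. x ^ k /\<^sub>R fact k)"
    by (rule sum_le_suminf) (use that summable_exp_generic[of x] in auto)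
  then show ?thesis using exp_converges[of x] sums_unique by (fastforce simp: field_simps)
qed

lemma norm_exp_bump_le: "norm (exp_bump k x) \<le> fact (k + 2) * x\<^sup>2"
proof (cases "x > 0")
  case True
  \<comment> \<open>A single term of the exponential series of 1/x. The case m = k + 2 absorbs the
    denominator x^k and leaves x^2.\<close>
  have "exp (- (1 / x)) \<le> fact m * x ^ m" for m
  proof -
    have "(1 / x) ^ m / fact m \<le> exp (1 / x)"
      using True by (intro power_div_fact_le_exp) auto
    then show ?thesis using True by (simp add: exp_minus field_simps)
  qed
  from this[of "k + 2"] have "exp (- (1 / x)) / x ^ k \<le> fact (k + 2) * x\<^sup>2"
    using True by (simp add: pos_divide_le_eq power_add mult.assoc mult.commute mult.left_commute del: fact_Suc add_2_eq_Suc')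
  then show ?thesis using True
    by (simp add: exp_bump_def norm_divide norm_power del: fact_Suc add_2_eq_Suc')
qed (simp add: exp_bump_def)

lemma exp_div_power_has_deriv:
  fixes x :: real
  assumes "x > 0"
  shows "((\<lambda>x. exp (- (1 / x)) / x ^ k) has_real_derivative
      - real k * (exp (- (1 / x)) / x ^ (k + 1)) + exp (- (1 / x)) / x ^ (k + 2)) (at x)"
proof -
  have "((\<lambda>x. - (1 / x)) has_real_derivative 1 / x\<^sup>2) (at x)"
    using assms by (auto intro!: derivative_eq_intros simp: power2_eq_square)
  from DERIV_chain2[OF DERIV_exp this]
  have 1: "((\<lambda>x. exp (- (1 / x))) has_real_derivative exp (- (1 / x)) * (1 / x\<^sup>2)) (at x)" .
  have 2: "((\<lambda>x. x ^ k) has_real_derivative real k * x ^ (k - 1)) (at x)"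
    using DERIV_pow[of k x] by simp
  have "x ^ k \<noteq> 0" using assms by simp
  note D = DERIV_divide[OF 1 2 this]
  have 3: "(E * (1 / x\<^sup>2) * x ^ k - E * (real k * x ^ (k - 1))) / (x ^ k * x ^ k) =
      - real k * (E / x ^ (k + 1)) + E / x ^ (k + 2)" for E
  proof -
    have "(E * (1 / x\<^sup>2) * x ^ k) / (x ^ k * x ^ k) = E / x ^ (k + 2)"
      using assms by (simp add: power_add power2_eq_square)
    moreover have "(E * (real k * x ^ (k - 1))) / (x ^ k * x ^ k) = real k * (E / x ^ (k + 1))"
      using assms by (cases k) auto
    ultimately show ?thesis by (simp add: diff_divide_distrib)
  qed
  show ?thesis using D unfolding 3 .
qed

lemma exp_bump_has_deriv:
  "(exp_bump k has_vector_derivative - of_nat k * exp_bump (k + 1) x + exp_bump (k + 2) x) (at x)"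
proof (cases x "0 :: real" rule: linorder_cases)
  case less
  have "((\<lambda>x. 0) has_vector_derivative 0) (at x)" by simp
  then have "(exp_bump k has_vector_derivative 0) (at x)"
    by (rule has_vector_derivative_open_congI[of "{..<0}", rotated 3]) (use less in \<open>auto simp: exp_bump_def\<close>)
  then show ?thesis using less by (simp add: exp_bump_def)
next
  case equal
  have "(exp_bump k has_vector_derivative 0) (at 0)"
    by (rule has_vector_derivative_0_quadratic[of 1 "exp_bump k" "fact (k + 2)"], simp, rule norm_exp_bump_le)
  then show ?thesis using equal by (simp add: exp_bump_def)
next
  case greater
  have "((\<lambda>x. complex_of_real (exp (- (1 / x)) / x ^ k)) has_vector_derivative
      of_real (- real k * (exp (- (1 / x)) / x ^ (k + 1)) + exp (- (1 / x)) / x ^ (k + 2))) (at x)"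
    by (rule has_vector_derivative_of_real)
       (use exp_div_power_has_deriv[OF greater] has_real_derivative_iff_has_vector_derivative in blast)
  then have *: "(exp_bump k has_vector_derivative
      of_real (- real k * (exp (- (1 / x)) / x ^ (k + 1)) + exp (- (1 / x)) / x ^ (k + 2))) (at x)"
    by (rule has_vector_derivative_open_congI[of "{0<..}", rotated 3])
       (use greater in \<open>simp_all add: exp_bump_def del: of_real_exp of_real_divide\<close>)
  have "of_real (- real k * (exp (- (1 / x)) / x ^ (k + 1)) + exp (- (1 / x)) / x ^ (k + 2)) =
      - of_nat k * exp_bump (k + 1) x + exp_bump (k + 2) x"
    using greater unfolding exp_bump_def of_real_add of_real_mult by simp
  with * show ?thesis by simp
qed

lemma smooth_on_exp_bump: "smooth_on UNIV (exp_bump k)"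
  unfolding smooth_on_iff_C_on
proof
  fix n show "C_on n UNIV (exp_bump k)"
  proof (induction n arbitrary: k)
    case (Suc n)
    have "C_on n UNIV (\<lambda>x. - of_nat k * exp_bump (k + 1) x + exp_bump (k + 2) x)"
      by (intro C_on_add C_on_mult C_on_const Suc open_UNIV)
    then show ?case by (rule C_on_SucI[OF open_UNIV exp_bump_has_deriv])
  qed simp
qed

text \<open>A smooth step, 1 for |x| \<le> 1 and 0 for |x| \<ge> 2. The arguments 4 - x^2 and x^2 -
  1 are never both nonpositive, so the denominator has no zero.\<close>

definition chi :: "real \<Rightarrow> complex" where
  "chi x = exp_bump 0 (4 - x\<^sup>2) / (exp_bump 0 (4 - x\<^sup>2) + exp_bump 0 (x\<^sup>2 - 1))"

lemma chi_eq_1: "\<bar>x\<bar> \<le> 1 \<Longrightarrow> chi x = 1"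
proof -
  assume "\<bar>x\<bar> \<le> 1"
  then have "x\<^sup>2 \<le> 1" by (simp add: abs_square_le_1)
  then show ?thesis by (simp add: chi_def exp_bump_def)
qed

lemma chi_eq_0: "\<bar>x\<bar> \<ge> 2 \<Longrightarrow> chi x = 0"
proof -
  assume "\<bar>x\<bar> \<ge> 2"
  then have "x\<^sup>2 \<ge> 2\<^sup>2" by (metis abs_ge_zero abs_numeral power2_abs power_mono zero_le_numeral)
  then show ?thesis by (simp add: chi_def exp_bump_def)
qed

lemma smooth_on_chi: "smooth_on UNIV chi"
proof -
  have s: "smooth_on UNIV (\<lambda>x. 2 * complex_of_real x)"
    by (intro smooth_on_cmult smooth_on_of_real open_UNIV)
  have 1: "smooth_on UNIV (\<lambda>x. exp_bump 0 (4 - x\<^sup>2))"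
    by (rule smooth_on_compose[OF open_UNIV open_UNIV smooth_on_exp_bump, where g' = "\<lambda>x. -2 * x"])
       (auto intro!: derivative_eq_intros s)
  have 2: "smooth_on UNIV (\<lambda>x. exp_bump 0 (x\<^sup>2 - 1))"
    by (rule smooth_on_compose[OF open_UNIV open_UNIV smooth_on_exp_bump, where g' = "\<lambda>x. 2 * x"])
       (auto intro!: derivative_eq_intros s)
  have "exp_bump 0 (4 - x\<^sup>2) + exp_bump 0 (x\<^sup>2 - 1) \<noteq> 0" for x :: real
  proof -
    have "exp (- (1 / (4 - x\<^sup>2))) + exp (- (1 / (x\<^sup>2 - 1))) > 0" by (intro add_pos_pos) auto
    then show ?thesis by (auto simp: exp_bump_def simp del: of_real_exp simp flip: of_real_add)
  qed
  then show ?thesis unfolding chi_def[abs_def] by (intro smooth_on_divide smooth_on_add 1 2 open_UNIV)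
qed

lemma smooth_on_scale:
  assumes "smooth_on UNIV f"
  shows "smooth_on UNIV (\<lambda>x. f (c * x))"
  by (rule smooth_on_compose[OF open_UNIV open_UNIV assms, where g' = "\<lambda>x. c"])
     (auto intro!: derivative_eq_intros smooth_on_const)

lemma smooth_on_chi_scale: "smooth_on UNIV (\<lambda>x. chi (c * x))"
  by (rule smooth_on_scale[OF smooth_on_chi])

text \<open>\<theta> commutes with dilations. This is why the bounds for the cutoffs
  \<open>chi (c * x)\<close> hold uniformly in c.\<close>

lemma euler_pow_scale:
  assumes "open U" "open V" "smooth_on V f" "\<And>x. x \<in> U \<Longrightarrow> c * x \<in> V" "x \<in> U"
  shows "(euler ^^ n) (\<lambda>x. f (c * x)) x = (euler ^^ n) f (c * x)"
  using assms(5)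
proof (induction n arbitrary: x)
  case (Suc n)
  have "((\<lambda>x. (euler ^^ n) f (c * x)) has_vector_derivative c *\<^sub>R nderiv 1 ((euler ^^ n) f) (c * x)) (at x)"
    using vector_diff_chain_at[of "\<lambda>x. c * x" c x "(euler ^^ n) f"]
      smooth_on_has_deriv[OF smooth_on_euler_pow[OF assms(2,3)] assms(4)[OF Suc.prems]]
    by (auto simp: o_def intro!: derivative_eq_intros simp flip: has_real_derivative_iff_has_vector_derivative)
  from euler_eqI[OF this] have "euler (\<lambda>x. (euler ^^ n) f (c * x)) x = euler ((euler ^^ n) f) (c * x)"
    by (simp add: euler_def scaleR_conv_of_real mult_ac)
  then show ?case using euler_cong[OF assms(1) Suc.IH Suc.prems] by simp
qed simp

section \<open>Stability of test functions, and their inclusion in the Schwartz space\<close>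

section \<open>Test functions\<close>

lemma test_functionsI:
  assumes "smooth_on UNIV \<phi>" "compact K" "K \<subseteq> U" "\<And>x. x \<notin> K \<Longrightarrow> \<phi> x = 0"
  shows "\<phi> \<in> test_functions U"
proof -
  have "{x. \<phi> x \<noteq> 0} \<subseteq> K" using assms(4) by blast
  then have "closure {x. \<phi> x \<noteq> 0} \<subseteq> K" by (simp add: assms(2) closure_minimal compact_imp_closed)
  moreover from this have "compact (closure {x. \<phi> x \<noteq> 0})"
    by (meson assms(2) bounded_subset closed_closure compact_eq_bounded_closed)
  ultimately show ?thesis using assms(1,3) by (auto simp: test_functions_def)
qed

lemma test_functionsE:
  assumes "\<phi> \<in> test_functions U"
  obtains K where "smooth_on UNIV \<phi>" "compact K" "K \<subseteq> U" "\<And>x. x \<notin> K \<Longrightarrow> \<phi> x = 0"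
proof -
  have "\<phi> x = 0" if "x \<notin> closure {x. \<phi> x \<noteq> 0}" for x
    using that closure_subset[of "{x. \<phi> x \<noteq> 0}"] by auto
  then show ?thesis using assms that unfolding test_functions_def by blast
qed

lemma test_functions_smooth: "\<phi> \<in> test_functions U \<Longrightarrow> smooth_on UNIV \<phi>"
  by (simp add: test_functions_def)

lemma test_functions_mono: "\<phi> \<in> test_functions U \<Longrightarrow> U \<subseteq> V \<Longrightarrow> \<phi> \<in> test_functions V"
  by (auto simp: test_functions_def)

lemma test_functions_eq_0: "\<phi> \<in> test_functions U \<Longrightarrow> x \<notin> U \<Longrightarrow> \<phi> x = 0"
  by (elim test_functionsE) blast

text \<open>g is smooth on U only. The product is smooth on U and identically 0 off the compact set
  K, and these two open sets cover the line.\<close>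

lemma test_functions_mult:
  assumes "\<phi> \<in> test_functions U" "open U" "smooth_on U g"
  shows "(\<lambda>x. g x * \<phi> x) \<in> test_functions U"
proof -
  obtain K where K: "smooth_on UNIV \<phi>" "compact K" "K \<subseteq> U" "\<And>x. x \<notin> K \<Longrightarrow> \<phi> x = 0"
    using test_functionsE[OF assms(1)] by blast
  have 1: "smooth_on U (\<lambda>x. g x * \<phi> x)"
    using assms K(1) by (intro smooth_on_mult) (auto intro: smooth_on_subset)
  have o: "open (- K)" using K(2) by (simp add: compact_imp_closed open_Compl)
  have 2: "smooth_on (- K) (\<lambda>x. g x * \<phi> x)"
    by (rule iffD1[OF smooth_on_cong[OF o, of "\<lambda>x. 0"]]) (use K(4) o in auto)
  have "U \<union> - K = UNIV" using K(3) by blast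
  with smooth_on_Un[OF 1 2] have "smooth_on UNIV (\<lambda>x. g x * \<phi> x)" by simp
  then show ?thesis by (rule test_functionsI[OF _ K(2,3)]) (use K(4) in auto)
qed

lemma test_functions_cmult:
  assumes "\<phi> \<in> test_functions U"
  shows "(\<lambda>x. c * \<phi> x) \<in> test_functions U"
  using assms by (elim test_functionsE) (rule test_functionsI, auto intro!: smooth_on_cmult)

lemma compact_support_nderiv_bound:
  assumes "smooth_on UNIV \<phi>" "compact K" "\<And>x. x \<notin> K \<Longrightarrow> \<phi> x = 0"
  shows "\<exists>B\<ge>0. \<forall>x. norm (nderiv i \<phi> x) \<le> B"
proof -
  obtain B where B: "B \<ge> 0" "\<And>x. x \<in> K \<Longrightarrow> norm (nderiv i \<phi> x) \<le> B"
    using compact_bounded_norm[OF assms(2), of "nderiv i \<phi>"] smooth_on_continuous_on[OF assms(1)]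
    by (metis continuous_on_subset subset_UNIV)
  have "norm (nderiv i \<phi> x) \<le> B" for x
  proof (cases "x \<in> K")
    case False
    have "open (- K)" using assms(2) by (simp add: compact_imp_closed open_Compl)
    then show ?thesis using nderiv_eq_0_outside[of "- K" \<phi> x i] False assms(3) B(1) by simp
  qed (use B in blast)
  then show ?thesis using B(1) by blast
qed

lemma test_functions_nderiv_bound:
  assumes "\<phi> \<in> test_functions U"
  shows "\<exists>B\<ge>0. \<forall>x. norm (nderiv i \<phi> x) \<le> B"
  using assms by (elim test_functionsE) (rule compact_support_nderiv_bound)

lemma test_functions_schwartz:
  assumes "\<phi> \<in> test_functions U"
  shows "schwartz \<phi>"
  unfolding schwartz_def
proof (intro conjI allI)
  show "smooth_on UNIV \<phi>" using assms by (rule test_functions_smooth)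
  fix j k
  obtain K where K: "smooth_on UNIV \<phi>" "compact K" "K \<subseteq> U" "\<And>x. x \<notin> K \<Longrightarrow> \<phi> x = 0"
    using test_functionsE[OF assms(1)] by blast
  have "continuous_on K (\<lambda>x. of_real (x ^ j) * nderiv k \<phi> x)"
    using smooth_on_continuous_on[OF K(1), of k] by (intro continuous_intros) (auto intro: continuous_on_subset)
  then obtain B where B: "B \<ge> 0" "\<And>x. x \<in> K \<Longrightarrow> norm (of_real (x ^ j) * nderiv k \<phi> x) \<le> B"
    using compact_bounded_norm[OF K(2)] by blast
  have o: "open (- K)" using K(2) by (simp add: compact_imp_closed open_Compl)
  have "norm (of_real (x ^ j) * nderiv k \<phi> x) \<le> B" for x
    using nderiv_eq_0_outside[of "- K" \<phi> x k] K(4) B o by (cases "x \<in> K") auto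
  then show "bounded (range (\<lambda>x. of_real (x ^ j) * nderiv k \<phi> x))"
    unfolding bounded_iff by blast
qed

section \<open>The space of moderately singular functions and its continuous functionals\<close>

section \<open>Functions with moderate singularities\<close>

text \<open>The index j buys decay at infinity. Near 0 the strongest condition is j = 0, a
  singularity of order at most a. One N limits derivatives and decay together, so each
  \<open>sing_class a\<close> carries an increasing sequence of norms.\<close>

definition sing_bound :: "nat \<Rightarrow> nat \<Rightarrow> real \<Rightarrow> (real \<Rightarrow> complex) \<Rightarrow> bool" where
  "sing_bound a N B f \<longleftrightarrow>
     (\<forall>x i j. x \<noteq> 0 \<longrightarrow> i \<le> N \<longrightarrow> j \<le> N \<longrightarrow> \<bar>x\<bar> ^ (a + j) * norm ((euler ^^ i) f x) \<le> B)"

definition sing_class :: "nat \<Rightarrow> (real \<Rightarrow> complex) set" where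
  "sing_class a = {f. smooth_on (- {0}) f \<and> (\<forall>N. \<exists>B. sing_bound a N B f)}"

definition sing_space :: "(real \<Rightarrow> complex) set" where
  "sing_space = (\<Union>a. sing_class a)"

text \<open>Continuity on an inductive limit: on each class one norm suffices, with N and C
  depending on a. The topology itself never has to be introduced.\<close>

definition sing_functional :: "functional \<Rightarrow> bool" where
  "sing_functional L \<longleftrightarrow> linear_functional_on sing_space L \<and>
     (\<forall>a. \<exists>N C. \<forall>f\<in>sing_class a. \<forall>B. sing_bound a N B f \<longrightarrow> norm (L f) \<le> C * B)"

lemma open_punctured [simp]: "open (- {0::real})"
  by (simp add: open_Compl)

lemma sing_boundD:
  "sing_bound a N B f \<Longrightarrow> x \<noteq> 0 \<Longrightarrow> i \<le> N \<Longrightarrow> j \<le> N \<Longrightarrow> \<bar>x\<bar> ^ (a + j) * norm ((euler ^^ i) f x) \<le> B"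
  unfolding sing_bound_def by blast

lemma sing_bound_nonneg: "sing_bound a N B f \<Longrightarrow> B \<ge> 0"
  using sing_boundD[of a N B f 1 0 0] order_trans[OF norm_ge_zero, of "f 1" B] by simp

lemma sing_bound_mono: "sing_bound a N B f \<Longrightarrow> M \<le> N \<Longrightarrow> B \<le> C \<Longrightarrow> sing_bound a M C f"
  unfolding sing_bound_def by (meson order_trans)

text \<open>A larger singular order uses up d of the decay weights, since a + d + j = a + (j +
  d).\<close>

lemma sing_bound_shift: "sing_bound a (N + d) B f \<Longrightarrow> sing_bound (a + d) N B f"
  unfolding sing_bound_def
proof (intro allI impI)
  fix x :: real and i j
  assume *: "\<forall>x i j. x \<noteq> 0 \<longrightarrow> i \<le> N + d \<longrightarrow> j \<le> N + d \<longrightarrow> \<bar>x\<bar> ^ (a + j) * norm ((euler ^^ i) f x) \<le> B"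
    and "x \<noteq> 0" "i \<le> N" "j \<le> N"
  then show "\<bar>x\<bar> ^ (a + d + j) * norm ((euler ^^ i) f x) \<le> B"
    using *[rule_format, of x i "j + d"] by (simp add: ac_simps)
qed

lemma sing_bound_cong:
  assumes "\<And>x. x \<noteq> 0 \<Longrightarrow> f x = g x"
  shows "sing_bound a N B f \<longleftrightarrow> sing_bound a N B g"
proof -
  have "(euler ^^ i) f x = (euler ^^ i) g x" if "x \<noteq> 0" for i x
    by (rule euler_pow_cong[OF open_punctured]) (use assms that in auto)
  then show ?thesis unfolding sing_bound_def by simp
qed

lemma sing_bound_add:
  assumes "smooth_on (- {0}) f" "smooth_on (- {0}) g" "sing_bound a N A f" "sing_bound a N B g"
  shows "sing_bound a N (A + B) (\<lambda>x. f x + g x)"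
  unfolding sing_bound_def
proof (intro allI impI)
  fix x :: real and i j
  assume *: "x \<noteq> 0" "i \<le> N" "j \<le> N"
  have "\<bar>x\<bar> ^ (a + j) * norm ((euler ^^ i) f x + (euler ^^ i) g x) \<le>
    \<bar>x\<bar> ^ (a + j) * norm ((euler ^^ i) f x) + \<bar>x\<bar> ^ (a + j) * norm ((euler ^^ i) g x)"
    unfolding distrib_left[symmetric] by (intro mult_left_mono norm_triangle_ineq) auto
  also have "\<dots> \<le> A + B" using sing_boundD[OF assms(3) *] sing_boundD[OF assms(4) *] by simp
  finally show "\<bar>x\<bar> ^ (a + j) * norm ((euler ^^ i) (\<lambda>x. f x + g x) x) \<le> A + B"
    using euler_pow_add[OF open_punctured assms(1,2)] * by simp
qed

lemma sing_bound_cmult: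
  assumes "smooth_on (- {0}) f" "sing_bound a N B f"
  shows "sing_bound a N (norm c * B) (\<lambda>x. c * f x)"
  unfolding sing_bound_def
proof (intro allI impI)
  fix x :: real and i j
  assume *: "x \<noteq> 0" "i \<le> N" "j \<le> N"
  have "norm c * (\<bar>x\<bar> ^ (a + j) * norm ((euler ^^ i) f x)) \<le> norm c * B"
    by (intro mult_left_mono sing_boundD[OF assms(2) *]) auto
  then show "\<bar>x\<bar> ^ (a + j) * norm ((euler ^^ i) (\<lambda>x. c * f x) x) \<le> norm c * B"
    using euler_pow_cmult[OF open_punctured assms(1)] * by (simp add: norm_mult mult_ac)
qed

lemma sing_bound_euler: "sing_bound a (Suc N) B f \<Longrightarrow> sing_bound a N B (euler f)"
  unfolding sing_bound_def by (metis Suc_le_mono euler_pow_Suc_right le_SucI)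

text \<open>g is controlled by the single weight |x|^b, so that f alone supplies the decay. Cutoffs
  are the case b = 0.\<close>

lemma sing_bound_mult:
  assumes "smooth_on (- {0}) f" "smooth_on (- {0}) g" "sing_bound a N B f"
    and A: "\<And>x i. x \<noteq> 0 \<Longrightarrow> i \<le> N \<Longrightarrow> \<bar>x\<bar> ^ b * norm ((euler ^^ i) g x) \<le> A"
  shows "sing_bound (a + b) N (2 ^ N * (A * B)) (\<lambda>x. g x * f x)"
  unfolding sing_bound_def
proof (intro allI impI)
  fix x :: real and i j
  assume *: "x \<noteq> 0" "i \<le> N" "j \<le> N"
  have A0: "A \<ge> 0" using A[of 1 0] order_trans[OF norm_ge_zero, of "g 1" A] by simp
  have B0: "B \<ge> 0" using assms(3) by (rule sing_bound_nonneg)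
  have "norm ((euler ^^ i) (\<lambda>x. g x * f x) x) \<le> 2 ^ i * (A / \<bar>x\<bar> ^ b * (B / \<bar>x\<bar> ^ (a + j)))"
  proof (rule norm_euler_pow_mult_le[OF open_punctured _ assms(2,1)])
    fix l assume "l \<le> i"
    then show "norm ((euler ^^ l) g x) \<le> A / \<bar>x\<bar> ^ b" "norm ((euler ^^ l) f x) \<le> B / \<bar>x\<bar> ^ (a + j)"
      using A[of x l] sing_boundD[OF assms(3), of x l j] * by (simp_all add: field_simps)
  qed (use * in auto)
  also have "\<dots> \<le> 2 ^ N * (A / \<bar>x\<bar> ^ b * (B / \<bar>x\<bar> ^ (a + j)))"
    using * A0 B0 by (intro mult_right_mono power_increasing mult_nonneg_nonneg) auto
  finally show "\<bar>x\<bar> ^ (a + b + j) * norm ((euler ^^ i) (\<lambda>x. g x * f x) x) \<le> 2 ^ N * (A * B)"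
    using * by (simp add: field_simps power_add)
qed

lemma sing_classD: "f \<in> sing_class a \<Longrightarrow> smooth_on (- {0}) f"
  by (simp add: sing_class_def)

lemma sing_classE:
  assumes "f \<in> sing_class a"
  obtains B where "sing_bound a N B f" "B \<ge> 0"
  using assms sing_bound_nonneg unfolding sing_class_def by blast

lemma sing_class_mono: "f \<in> sing_class a \<Longrightarrow> a \<le> b \<Longrightarrow> f \<in> sing_class b"
  unfolding sing_class_def using sing_bound_shift[of a _ "b - a"] by fastforce

lemma sing_class_cong:
  "(\<And>x. x \<noteq> 0 \<Longrightarrow> f x = g x) \<Longrightarrow> f \<in> sing_class a \<longleftrightarrow> g \<in> sing_class a"
  unfolding sing_class_def using sing_bound_cong[of f g] smooth_on_cong[OF open_punctured, of f g] by simp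

lemma sing_class_add:
  "f \<in> sing_class a \<Longrightarrow> g \<in> sing_class a \<Longrightarrow> (\<lambda>x. f x + g x) \<in> sing_class a"
  unfolding sing_class_def using sing_bound_add by (fastforce intro!: smooth_on_add)

lemma sing_class_cmult: "f \<in> sing_class a \<Longrightarrow> (\<lambda>x. c * f x) \<in> sing_class a"
  unfolding sing_class_def using sing_bound_cmult by (fastforce intro!: smooth_on_cmult)

lemma sing_class_diff:
  "f \<in> sing_class a \<Longrightarrow> g \<in> sing_class a \<Longrightarrow> (\<lambda>x. f x - g x) \<in> sing_class a"
  using sing_class_add[of f a "\<lambda>x. (-1) * g x"] sing_class_cmult[of g a "-1"] by simp

lemma sing_bound_diff:
  assumes "smooth_on (- {0}) f" "smooth_on (- {0}) g" "sing_bound a N A f" "sing_bound a N B g"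
  shows "sing_bound a N (A + B) (\<lambda>x. f x - g x)"
  using sing_bound_add[OF assms(1) _ assms(3), of "\<lambda>x. (-1) * g x" B]
    sing_bound_cmult[OF assms(2,4), of "-1"] smooth_on_minus[OF open_punctured assms(2)] by simp

lemma sing_class_euler: "f \<in> sing_class a \<Longrightarrow> euler f \<in> sing_class a"
  unfolding sing_class_def using sing_bound_euler by (blast intro: smooth_on_euler[OF open_punctured])

lemma ex_uniform_bound:
  fixes F :: "nat \<Rightarrow> 'a \<Rightarrow> real"
  assumes "\<And>i. i \<le> N \<Longrightarrow> \<exists>B\<ge>0. \<forall>x. P x \<longrightarrow> F i x \<le> B"
  shows "\<exists>B\<ge>0. \<forall>i\<le>N. \<forall>x. P x \<longrightarrow> F i x \<le> B"
proof -
  obtain B where B: "\<And>i. i \<le> N \<Longrightarrow> B i \<ge> 0" "\<And>i x. i \<le> N \<Longrightarrow> P x \<Longrightarrow> F i x \<le> B i"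
    using assms by metis
  have "F i x \<le> sum B {..N}" if "i \<le> N" "P x" for i x
    using B(2)[OF that] member_le_sum[of i "{..N}" B] B(1) that by force
  moreover have "sum B {..N} \<ge> 0" using B(1) by (intro sum_nonneg) auto
  ultimately show ?thesis by blast
qed

lemma sing_class_mult_gen:
  assumes "f \<in> sing_class a" "smooth_on (- {0}) g"
    and A: "\<And>i. \<exists>A\<ge>0. \<forall>x. x \<noteq> 0 \<longrightarrow> \<bar>x\<bar> ^ b * norm ((euler ^^ i) g x) \<le> A"
  shows "(\<lambda>x. g x * f x) \<in> sing_class (a + b)"
  unfolding sing_class_def mem_Collect_eq
proof (intro conjI allI)
  show "smooth_on (- {0}) (\<lambda>x. g x * f x)" by (intro smooth_on_mult assms(2) sing_classD[OF assms(1)] open_punctured)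
  fix N
  obtain M where "\<forall>i\<le>N. \<forall>x. x \<noteq> 0 \<longrightarrow> \<bar>x\<bar> ^ b * norm ((euler ^^ i) g x) \<le> M"
    using ex_uniform_bound[of N "\<lambda>x. x \<noteq> 0" "\<lambda>i x. \<bar>x\<bar> ^ b * norm ((euler ^^ i) g x)"] A by blast
  moreover obtain B where "sing_bound a N B f" using assms(1) by (rule sing_classE)
  ultimately show "\<exists>B. sing_bound (a + b) N B (\<lambda>x. g x * f x)"
    using sing_bound_mult[OF sing_classD[OF assms(1)] assms(2)] by blast
qed

lemma sing_class_mult:
  assumes "f \<in> sing_class a" "g \<in> sing_class b"
  shows "(\<lambda>x. g x * f x) \<in> sing_class (a + b)"
proof (rule sing_class_mult_gen[OF assms(1) sing_classD[OF assms(2)]])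
  fix i
  obtain B where "sing_bound b i B g" "B \<ge> 0" using assms(2) by (rule sing_classE)
  then show "\<exists>A\<ge>0. \<forall>x. x \<noteq> 0 \<longrightarrow> \<bar>x\<bar> ^ b * norm ((euler ^^ i) g x) \<le> A"
    using sing_boundD[of b i B g _ i 0] by auto
qed

lemma sing_space_add: "f \<in> sing_space \<Longrightarrow> g \<in> sing_space \<Longrightarrow> (\<lambda>x. f x + g x) \<in> sing_space"
proof -
  assume "f \<in> sing_space" "g \<in> sing_space"
  then obtain a b where "f \<in> sing_class a" "g \<in> sing_class b" unfolding sing_space_def by blast
  then have "f \<in> sing_class (max a b)" "g \<in> sing_class (max a b)" using sing_class_mono by auto
  then show ?thesis unfolding sing_space_def using sing_class_add by blast
qed

lemma sing_space_cmult: "f \<in> sing_space \<Longrightarrow> (\<lambda>x. c * f x) \<in> sing_space"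
  unfolding sing_space_def using sing_class_cmult by blast

lemma sing_space_mult: "f \<in> sing_space \<Longrightarrow> g \<in> sing_space \<Longrightarrow> (\<lambda>x. f x * g x) \<in> sing_space"
  unfolding sing_space_def using sing_class_mult by blast

lemma sing_functional_add:
  "sing_functional L \<Longrightarrow> f \<in> sing_space \<Longrightarrow> g \<in> sing_space \<Longrightarrow> L (\<lambda>x. f x + g x) = L f + L g"
  unfolding sing_functional_def linear_functional_on_def by blast

lemma sing_functional_cmult:
  "sing_functional L \<Longrightarrow> f \<in> sing_space \<Longrightarrow> L (\<lambda>x. c * f x) = c * L f"
  unfolding sing_functional_def linear_functional_on_def by blast

lemma sing_functional_diff:
  assumes "sing_functional L" "f \<in> sing_space" "g \<in> sing_space"
  shows "L (\<lambda>x. f x - g x) = L f - L g"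
  using sing_functional_add[OF assms(1,2) sing_space_cmult[OF assms(3)], of "-1"]
    sing_functional_cmult[OF assms(1,3), of "-1"] by simp

lemma sing_functionalE:
  assumes "sing_functional L"
  obtains N C where "C \<ge> 0" "\<And>f B. f \<in> sing_class a \<Longrightarrow> sing_bound a N B f \<Longrightarrow> norm (L f) \<le> C * B"
proof -
  obtain N C where *: "\<And>f B. f \<in> sing_class a \<Longrightarrow> sing_bound a N B f \<Longrightarrow> norm (L f) \<le> C * B"
    using assms unfolding sing_functional_def by meson
  have "norm (L f) \<le> \<bar>C\<bar> * B" if "f \<in> sing_class a" "sing_bound a N B f" for f B
    using *[OF that] sing_bound_nonneg[OF that(2)] by (meson abs_ge_self mult_right_mono order_trans)
  then show ?thesis using that[of "\<bar>C\<bar>" N] by simp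
qed

text \<open>A difference supported at 0 satisfies \<open>sing_bound\<close> with constant 0, so
  continuity annihilates it. The arbitrary value of a total function at the singular point is
  thereby harmless.\<close>

lemma sing_functional_cong:
  assumes "sing_functional L" "f \<in> sing_space" "\<And>x. x \<noteq> 0 \<Longrightarrow> f x = g x"
  shows "L f = L g"
proof -
  obtain a where f: "f \<in> sing_class a" using assms(2) unfolding sing_space_def by blast
  have g: "g \<in> sing_class a" using sing_class_cong[of f g a] f assms(3) by blast
  obtain N C where *: "\<And>f B. f \<in> sing_class a \<Longrightarrow> sing_bound a N B f \<Longrightarrow> norm (L f) \<le> C * B"
    using sing_functionalE[OF assms(1)] by metis
  have "sing_bound a N 0 (\<lambda>x. f x - g x)"
    using sing_bound_cong[of "\<lambda>x. f x - g x" "\<lambda>x. 0" a N 0] assms(3) by (simp add: sing_bound_def)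
  from *[OF sing_class_diff[OF f g] this] have "L (\<lambda>x. f x - g x) = 0" by simp
  moreover have "L (\<lambda>x. f x - g x) = L f - L g"
    using f g by (intro sing_functional_diff[OF assms(1)]) (auto simp: sing_space_def)
  ultimately show ?thesis by simp
qed

text \<open>In the pairing g is the singular function times a cutoff; continuity of the product
  functional makes it a canonical extension.\<close>

lemma sing_functional_mult:
  assumes L: "sing_functional L" and g: "g \<in> sing_space"
  shows "sing_functional (\<lambda>f. L (\<lambda>x. g x * f x))"
  unfolding sing_functional_def linear_functional_on_def
proof (intro conjI ballI allI)
  fix f h assume fh: "f \<in> sing_space" "h \<in> sing_space"
  show "L (\<lambda>x. g x * (f x + h x)) = L (\<lambda>x. g x * f x) + L (\<lambda>x. g x * h x)"
    using sing_functional_add[OF L sing_space_mult[OF g fh(1)] sing_space_mult[OF g fh(2)]]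
    by (simp add: distrib_left)
next
  fix f c assume f: "f \<in> sing_space"
  show "L (\<lambda>x. g x * (c * f x)) = c * L (\<lambda>x. g x * f x)"
    using sing_functional_cmult[OF L sing_space_mult[OF g f], of c] by (simp add: mult.left_commute)
next
  fix a
  obtain b where b: "g \<in> sing_class b" using g unfolding sing_space_def by blast
  obtain N C where C: "C \<ge> 0" "\<And>f B. f \<in> sing_class (a + b) \<Longrightarrow> sing_bound (a + b) N B f \<Longrightarrow> norm (L f) \<le> C * B"
    using sing_functionalE[OF L] by metis
  obtain G where G: "sing_bound b N G g" using b by (rule sing_classE)
  have "norm (L (\<lambda>x. g x * f x)) \<le> (C * (2 ^ N * G)) * B" if f: "f \<in> sing_class a" "sing_bound a N B f" for f B
  proof -
    have "sing_bound (a + b) N (2 ^ N * (G * B)) (\<lambda>x. g x * f x)"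
      by (rule sing_bound_mult[OF sing_classD[OF f(1)] sing_classD[OF b] f(2)])
         (use sing_boundD[OF G, of _ _ 0] in auto)
    from C(2)[OF sing_class_mult[OF f(1) b] this] show ?thesis by (simp add: mult_ac)
  qed
  then show "\<exists>N C. \<forall>f\<in>sing_class a. \<forall>B. sing_bound a N B f \<longrightarrow> norm (L (\<lambda>x. g x * f x)) \<le> C * B"
    by blast
qed

section \<open>Smallness of the parts near 0 and near infinity\<close>

section \<open>Cutting off\<close>

text \<open>Independence of c is dilation invariance: values for \<open>chi (c * x)\<close> are
  values for \<open>chi\<close> itself, whose support is compact.\<close>

lemma chi_euler_bound: "\<exists>M\<ge>0. \<forall>c x. norm ((euler ^^ i) (\<lambda>x. chi (c * x)) x) \<le> M"
proof -
  have sm: "smooth_on UNIV ((euler ^^ i) chi)" using smooth_on_euler_pow[OF open_UNIV smooth_on_chi] .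
  have "\<exists>B\<ge>0. \<forall>x. norm (nderiv 0 ((euler ^^ i) chi) x) \<le> B"
  proof (rule compact_support_nderiv_bound[OF sm, of "{-2..2}"])
    fix x :: real assume "x \<notin> {-2..2}"
    moreover have "open (- {-2..2::real})" by (simp add: open_Compl)
    ultimately show "(euler ^^ i) chi x = 0"
      using euler_pow_eq_0_outside[of "- {-2..2}" chi x i] chi_eq_0 by force
  qed simp
  then obtain M where "M \<ge> 0" "\<And>x. norm ((euler ^^ i) chi x) \<le> M" by auto
  then show ?thesis using euler_pow_scale[OF open_UNIV open_UNIV smooth_on_chi] by (intro exI[of _ M]) simp
qed

lemma chi_euler_uniform_bound:
  "\<exists>M\<ge>0. \<forall>i\<le>N. \<forall>c x. norm ((euler ^^ i) (\<lambda>x. chi (c * x)) x) \<le> M"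
  using ex_uniform_bound[of N "\<lambda>p. True" "\<lambda>i p. norm ((euler ^^ i) (\<lambda>x. chi (fst p * x)) (snd p))"]
    chi_euler_bound by auto

lemma smooth_on_chi_scale' [simp]: "smooth_on (- {0}) (\<lambda>x. chi (c * x))"
  using smooth_on_chi_scale smooth_on_subset by blast

lemma sing_bound_chi:
  "\<exists>K\<ge>0. \<forall>a f B c. smooth_on (- {0}) f \<longrightarrow> sing_bound a N B f \<longrightarrow>
     sing_bound a N (K * B) (\<lambda>x. chi (c * x) * f x) \<and>
     sing_bound a N (K * B) (\<lambda>x. (1 - chi (c * x)) * f x)"
proof -
  obtain M where M: "M \<ge> 0" "\<And>i c x. i \<le> N \<Longrightarrow> norm ((euler ^^ i) (\<lambda>x. chi (c * x)) x) \<le> M"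
    using chi_euler_uniform_bound by meson
  have 1: "sing_bound a N (2 ^ N * (M * B)) (\<lambda>x. chi (c * x) * f x)"
    if "smooth_on (- {0}) f" "sing_bound a N B f" for a f B c
    using sing_bound_mult[OF that(1) smooth_on_chi_scale' that(2), of 0 c M] M by simp
  have 2: "sing_bound a N (B + 2 ^ N * (M * B)) (\<lambda>x. (1 - chi (c * x)) * f x)"
    if "smooth_on (- {0}) f" "sing_bound a N B f" for a f B c
    using sing_bound_diff[OF that(1) smooth_on_mult[OF open_punctured smooth_on_chi_scale' that(1)] that(2) 1[OF that], of c]
    by (simp add: left_diff_distrib)
  show ?thesis
  proof (intro exI[of _ "1 + 2 ^ N * M"] conjI allI impI)
    fix a f B c assume *: "smooth_on (- {0}) f" "sing_bound a N B f"
    then have "B \<ge> 0" using sing_bound_nonneg by blast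
    then have "2 ^ N * (M * B) \<le> (1 + 2 ^ N * M) * B" by (simp add: distrib_right)
    then show "sing_bound a N ((1 + 2 ^ N * M) * B) (\<lambda>x. chi (c * x) * f x)"
      by (rule sing_bound_mono[OF 1[OF *] order_refl])
    show "sing_bound a N ((1 + 2 ^ N * M) * B) (\<lambda>x. (1 - chi (c * x)) * f x)"
      using 2[OF *, of c] by (simp add: algebra_simps)
  qed (use M in simp)
qed

text \<open>On the support |x| \<le> 2 / c, and the extra weight |x| of class a + 1 contributes this
  factor. The part near 0 thus tends to 0 as c grows, at the price of one order of
  singularity.\<close>

lemma sing_bound_chi_small:
  "\<exists>K\<ge>0. \<forall>a f B c. smooth_on (- {0}) f \<longrightarrow> sing_bound a N B f \<longrightarrow> c > 0 \<longrightarrow>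
     sing_bound (Suc a) N (K * B / c) (\<lambda>x. chi (c * x) * f x)"
proof -
  obtain K where K: "K \<ge> 0" "\<And>a f B c. smooth_on (- {0}) f \<Longrightarrow> sing_bound a N B f \<Longrightarrow>
     sing_bound a N (K * B) (\<lambda>x. chi (c * x) * f x)"
    using sing_bound_chi by meson
  have "sing_bound (Suc a) N (2 * K * B / c) (\<lambda>x. chi (c * x) * f x)"
    if f: "smooth_on (- {0}) f" "sing_bound a N B f" and c: "c > 0" for a f B c
    unfolding sing_bound_def
  proof (intro allI impI)
    fix x :: real and i j
    assume *: "x \<noteq> 0" "i \<le> N" "j \<le> N"
    have B: "B \<ge> 0" using f(2) by (rule sing_bound_nonneg)
    show "\<bar>x\<bar> ^ (Suc a + j) * norm ((euler ^^ i) (\<lambda>x. chi (c * x) * f x) x) \<le> 2 * K * B / c"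
    proof (cases "\<bar>x\<bar> \<le> 2 / c")
      case True
      have "\<bar>x\<bar> * (\<bar>x\<bar> ^ (a + j) * norm ((euler ^^ i) (\<lambda>x. chi (c * x) * f x) x)) \<le> 2 / c * (K * B)"
        by (intro mult_mono sing_boundD[OF K(2)[OF f] *] True) (use c in auto)
      then show ?thesis by (simp add: mult_ac)
    next
      case False
      have "open {x. \<bar>x\<bar> > 2 / c}" by (intro open_Collect_less continuous_intros)
      moreover have "chi (c * y) * f y = 0" if "\<bar>y\<bar> > 2 / c" for y
        using that c by (subst chi_eq_0) (auto simp: field_simps abs_mult)
      ultimately have "(euler ^^ i) (\<lambda>x. chi (c * x) * f x) x = 0"
        using euler_pow_eq_0_outside[of "{x. \<bar>x\<bar> > 2 / c}" "\<lambda>x. chi (c * x) * f x" x i] False by simp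
      then show ?thesis using K(1) B c by simp
    qed
  qed
  then show ?thesis using K(1) by (intro exI[of _ "2 * K"]) auto
qed

text \<open>Counterpart for c tending to 0: where the function is nonzero, |x| \<ge> 1 / c, and one
  spare decay weight gives the factor c. Here the price is \<open>Suc N\<close> in place of
  N.\<close>

lemma sing_bound_chi_large:
  "\<exists>K\<ge>0. \<forall>a f B c. smooth_on (- {0}) f \<longrightarrow> sing_bound a (Suc N) B f \<longrightarrow> c > 0 \<longrightarrow>
     sing_bound a N (K * B * c) (\<lambda>x. (1 - chi (c * x)) * f x)"
proof -
  obtain K where K: "K \<ge> 0" "\<And>a f B c. smooth_on (- {0}) f \<Longrightarrow> sing_bound a (Suc N) B f \<Longrightarrow>
     sing_bound a (Suc N) (K * B) (\<lambda>x. (1 - chi (c * x)) * f x)"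
    using sing_bound_chi by meson
  have "sing_bound a N (K * B * c) (\<lambda>x. (1 - chi (c * x)) * f x)"
    if f: "smooth_on (- {0}) f" "sing_bound a (Suc N) B f" and c: "c > 0" for a f B c
    unfolding sing_bound_def
  proof (intro allI impI)
    fix x :: real and i j
    assume *: "x \<noteq> 0" "i \<le> N" "j \<le> N"
    have B: "B \<ge> 0" using f(2) by (rule sing_bound_nonneg)
    show "\<bar>x\<bar> ^ (a + j) * norm ((euler ^^ i) (\<lambda>x. (1 - chi (c * x)) * f x) x) \<le> K * B * c"
    proof (cases "\<bar>x\<bar> \<ge> 1 / c")
      case True
      have "\<bar>x\<bar> * (\<bar>x\<bar> ^ (a + j) * norm ((euler ^^ i) (\<lambda>x. (1 - chi (c * x)) * f x) x)) \<le> K * B"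
        using sing_boundD[OF K(2)[OF f, of c], of x i "Suc j"] * by (simp add: mult_ac)
      moreover have "1 / c * (\<bar>x\<bar> ^ (a + j) * norm ((euler ^^ i) (\<lambda>x. (1 - chi (c * x)) * f x) x)) \<le>
        \<bar>x\<bar> * (\<bar>x\<bar> ^ (a + j) * norm ((euler ^^ i) (\<lambda>x. (1 - chi (c * x)) * f x) x))"
        by (intro mult_right_mono True) auto
      ultimately have "(\<bar>x\<bar> ^ (a + j) * norm ((euler ^^ i) (\<lambda>x. (1 - chi (c * x)) * f x) x)) / c \<le> K * B"
        by simp
      then show ?thesis using c by (simp only: pos_divide_le_eq)
    next
      case False
      have "open {x. \<bar>x\<bar> < 1 / c}" by (intro open_Collect_less continuous_intros)
      moreover have "(1 - chi (c * y)) * f y = 0" if "\<bar>y\<bar> < 1 / c" for y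
        using that c by (subst chi_eq_1) (auto simp: field_simps abs_mult)
      ultimately have "(euler ^^ i) (\<lambda>x. (1 - chi (c * x)) * f x) x = 0"
        using euler_pow_eq_0_outside[of "{x. \<bar>x\<bar> < 1 / c}" "\<lambda>x. (1 - chi (c * x)) * f x" x i] False by simp
      then show ?thesis using K(1) B c by simp
    qed
  qed
  then show ?thesis using K(1) by (intro exI[of _ K]) auto
qed

lemma sing_class_chi:
  assumes "f \<in> sing_class a"
  shows "(\<lambda>x. chi (c * x) * f x) \<in> sing_class a" "(\<lambda>x. (1 - chi (c * x)) * f x) \<in> sing_class a"
proof -
  note f = sing_classD[OF assms]
  have "\<exists>B. sing_bound a N B (\<lambda>x. chi (c * x) * f x)" "\<exists>B. sing_bound a N B (\<lambda>x. (1 - chi (c * x)) * f x)" for N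
    using sing_bound_chi[of N] f assms unfolding sing_class_def by blast+
  then show "(\<lambda>x. chi (c * x) * f x) \<in> sing_class a" "(\<lambda>x. (1 - chi (c * x)) * f x) \<in> sing_class a"
    unfolding sing_class_def using f by (auto intro!: smooth_on_mult smooth_on_diff)
qed

section \<open>Comparison of the Schwartz norms with the Euler norms\<close>

section \<open>Schwartz functions and tempered functionals\<close>

definition schwartz_bound :: "nat \<Rightarrow> real \<Rightarrow> (real \<Rightarrow> complex) \<Rightarrow> bool" where
  "schwartz_bound N B f \<longleftrightarrow> (\<forall>x i j. i \<le> N \<longrightarrow> j \<le> N \<longrightarrow> \<bar>x\<bar> ^ j * norm (nderiv i f x) \<le> B)"

lemma schwartz_iff: "schwartz f \<longleftrightarrow> smooth_on UNIV f \<and> (\<forall>N. \<exists>B. schwartz_bound N B f)"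
proof -
  have b: "(\<exists>B. \<forall>x. \<bar>x\<bar> ^ j * norm (nderiv k f x) \<le> B) \<longleftrightarrow> bounded (range (\<lambda>x. of_real (x ^ j) * nderiv k f x))" for j k
    unfolding bounded_iff by (auto simp: norm_mult norm_power power_abs)
  have "(\<forall>N. \<exists>B. schwartz_bound N B f) \<longleftrightarrow> (\<forall>j k. \<exists>B. \<forall>x. \<bar>x\<bar> ^ j * norm (nderiv k f x) \<le> B)"
  proof safe
    fix j k assume "\<forall>N. \<exists>B. schwartz_bound N B f"
    then obtain B where "schwartz_bound (max j k) B f" by blast
    then show "\<exists>B. \<forall>x. \<bar>x\<bar> ^ j * norm (nderiv k f x) \<le> B"
      unfolding schwartz_bound_def by (meson max.cobounded1 max.cobounded2)
  next
    fix N assume "\<forall>j k. \<exists>B. \<forall>x. \<bar>x\<bar> ^ j * norm (nderiv k f x) \<le> B"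
    then obtain B where B: "\<And>j k x. \<bar>x\<bar> ^ j * norm (nderiv k f x) \<le> B j k" by metis
    have "B j k \<ge> 0" for j k using B[of 1 j k] order_trans[OF norm_ge_zero, of "nderiv k f 1" "B j k"] by simp
    then have "B j k \<le> (\<Sum>j\<le>N. \<Sum>k\<le>N. B j k)" if "j \<le> N" "k \<le> N" for j k
      using that member_le_sum[of j "{..N}" "\<lambda>j. \<Sum>k\<le>N. B j k"] member_le_sum[of k "{..N}" "B j"]
      by (force intro: sum_nonneg)
    then have "schwartz_bound N (\<Sum>j\<le>N. \<Sum>k\<le>N. B j k) f"
      unfolding schwartz_bound_def using B order_trans by blast
    then show "\<exists>B. schwartz_bound N B f" ..
  qed
  then show ?thesis unfolding schwartz_def b by simp
qed

lemma schwartz_smooth: "schwartz f \<Longrightarrow> smooth_on UNIV f"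
  by (simp add: schwartz_def)

text \<open>\<theta>^i consists of x^l d^l with l \<le> i, and each comes with a further weight
  |x|^j, so weights up to 2 N occur.\<close>

lemma schwartz_bound_imp_sing_bound:
  assumes "smooth_on UNIV f" "schwartz_bound (2 * N) B f"
  shows "sing_bound 0 N (fact N * B) f"
  unfolding sing_bound_def
proof (intro allI impI)
  fix x :: real and i j
  assume *: "x \<noteq> 0" "i \<le> N" "j \<le> N"
  have B0: "B \<ge> 0"
    using assms(2)[unfolded schwartz_bound_def, rule_format, of 0 0 0] order_trans[OF norm_ge_zero, of "f 0" B] by simp
  have "norm ((euler ^^ i) f x) \<le> fact i * (B / \<bar>x\<bar> ^ j)"
  proof (rule norm_euler_le_nderiv[OF open_UNIV _ assms(1)])
    fix l assume "l \<le> i"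
    then have "\<bar>x\<bar> ^ (l + j) * norm (nderiv l f x) \<le> B"
      using assms(2) * unfolding schwartz_bound_def by auto
    then show "\<bar>x\<bar> ^ l * norm (nderiv l f x) \<le> B / \<bar>x\<bar> ^ j"
      using * by (simp add: field_simps power_add)
  qed simp
  also have "\<dots> \<le> fact N * (B / \<bar>x\<bar> ^ j)"
    using * B0 by (intro mult_right_mono fact_mono) auto
  finally show "\<bar>x\<bar> ^ (0 + j) * norm ((euler ^^ i) f x) \<le> fact N * B"
    using * by (simp add: field_simps)
qed

lemma schwartz_sing_class: "schwartz f \<Longrightarrow> f \<in> sing_class 0"
  unfolding schwartz_iff sing_class_def
  using schwartz_bound_imp_sing_bound by (blast intro: smooth_on_subset)

lemma schwartz_sing_space: "schwartz f \<Longrightarrow> f \<in> sing_space"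
  using schwartz_sing_class unfolding sing_space_def by blast

text \<open>Away from 0 the denominators |x|^(a + i), incurred in passing from Euler to ordinary
  derivatives, are harmless; \<delta> \<le> 1 makes \<delta>^(a + N) a lower bound for all of
  them.\<close>

lemma sing_bound_imp_schwartz_bound:
  assumes "\<delta> > 0" "\<delta> \<le> 1" "smooth_on (- {0}) f" "\<And>x. \<bar>x\<bar> < \<delta> \<Longrightarrow> f x = 0" "sing_bound a N B f"
  shows "schwartz_bound N (fact N / \<delta> ^ (a + N) * B) f"
  unfolding schwartz_bound_def
proof (intro allI impI)
  fix x :: real and i j
  assume *: "i \<le> N" "j \<le> N"
  have B0: "B \<ge> 0" using assms(5) by (rule sing_bound_nonneg)
  show "\<bar>x\<bar> ^ j * norm (nderiv i f x) \<le> fact N / \<delta> ^ (a + N) * B"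
  proof (cases "\<bar>x\<bar> < \<delta>")
    case True
    have "open {x. \<bar>x\<bar> < \<delta>}" by (intro open_Collect_less continuous_intros)
    then have "nderiv i f x = 0" using nderiv_eq_0_outside[of "{x. \<bar>x\<bar> < \<delta>}" f x i] assms(4) True by simp
    then show ?thesis using B0 assms(1) by simp
  next
    case False
    then have x: "x \<noteq> 0" "\<bar>x\<bar> \<ge> \<delta>" using assms(1) by auto
    have "\<bar>x\<bar> ^ i * norm (nderiv i f x) \<le> fact i * (B / \<bar>x\<bar> ^ (a + j))"
    proof (rule norm_nderiv_le_euler[OF open_punctured _ assms(3)])
      fix l assume "l \<le> i"
      then show "norm ((euler ^^ l) f x) \<le> B / \<bar>x\<bar> ^ (a + j)"
        using sing_boundD[OF assms(5) x(1), of l j] * x by (simp add: field_simps)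
    qed (use x in auto)
    then have "\<bar>x\<bar> ^ j * norm (nderiv i f x) \<le> fact i * B / \<bar>x\<bar> ^ (a + i)"
      using x by (simp add: field_simps power_add)
    also have "\<dots> \<le> fact N * B / \<delta> ^ (a + N)"
    proof (intro frac_le mult_right_mono fact_mono)
      have "\<delta> ^ (a + N) \<le> \<delta> ^ (a + i)" using assms(1,2) * by (intro power_decreasing) auto
      also have "\<dots> \<le> \<bar>x\<bar> ^ (a + i)" using assms(1) x by (intro power_mono) auto
      finally show "\<delta> ^ (a + N) \<le> \<bar>x\<bar> ^ (a + i)" .
    qed (use B0 assms(1) * in auto)
    finally show ?thesis by simp
  qed
qed

lemma flat_schwartz:
  assumes "\<delta> > 0" "f \<in> sing_class a" "\<And>x. \<bar>x\<bar> < \<delta> \<Longrightarrow> f x = 0"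
  shows "schwartz f"
  unfolding schwartz_iff
proof (intro conjI allI)
  have o: "open {x::real. \<bar>x\<bar> < \<delta>}" by (intro open_Collect_less continuous_intros)
  have "smooth_on {x. \<bar>x\<bar> < \<delta>} f"
    using smooth_on_cong[OF o, of f "\<lambda>x. 0"] assms(3) smooth_on_const[OF o] by simp
  from smooth_on_Un[OF this sing_classD[OF assms(2)]]
  show "smooth_on UNIV f" by (rule smooth_on_subset) (use assms(1) in auto)
  fix N
  obtain B where "sing_bound a N B f" using assms(2) by (rule sing_classE)
  then show "\<exists>B. schwartz_bound N B f"
    using sing_bound_imp_schwartz_bound[of "min \<delta> 1" f a N B] sing_classD[OF assms(2)] assms(1,3) by auto
qed

lemma schwartz_one_minus_chi:
  assumes "f \<in> sing_class a" "c > 0"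
  shows "schwartz (\<lambda>x. (1 - chi (c * x)) * f x)"
proof (rule flat_schwartz[of "1 / c"])
  fix x :: real assume "\<bar>x\<bar> < 1 / c"
  then show "(1 - chi (c * x)) * f x = 0"
    using assms(2) by (subst chi_eq_1) (auto simp: field_simps abs_mult)
qed (use assms sing_class_chi in auto)

text \<open>The suprema are exchanged for an arbitrary common bound B; the double sum has (N + 1)^2
  terms.\<close>

lemma temperedE:
  assumes "tempered S"
  obtains N C where "C \<ge> 0" "\<And>\<phi> B. schwartz \<phi> \<Longrightarrow> schwartz_bound N B \<phi> \<Longrightarrow> norm (S \<phi>) \<le> C * B"
proof -
  obtain C N where C: "\<And>\<phi>. schwartz \<phi> \<Longrightarrow>
      norm (S \<phi>) \<le> C * (\<Sum>j\<le>N. \<Sum>k\<le>N. SUP x. norm (of_real (x ^ j) * nderiv k \<phi> x))"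
    using assms unfolding tempered_def by blast
  have "norm (S \<phi>) \<le> \<bar>C\<bar> * (real (Suc N))\<^sup>2 * B" if \<phi>: "schwartz \<phi>" "schwartz_bound N B \<phi>" for \<phi> B
  proof -
    have 0: "(SUP x. norm (of_real (x ^ j) * nderiv k \<phi> x)) \<ge> 0" for j k
    proof -
      have "bdd_above (range (\<lambda>x. norm (of_real (x ^ j) * nderiv k \<phi> x)))"
        using \<phi>(1) unfolding schwartz_def bounded_iff bdd_above_def by fastforce
      from cSUP_upper[OF UNIV_I this, of 0] show ?thesis using norm_ge_zero order_trans by blast
    qed
    have "(SUP x. norm (of_real (x ^ j) * nderiv k \<phi> x)) \<le> B" if "j \<le> N" "k \<le> N" for j k
      by (rule cSUP_least) (use \<phi>(2) that in \<open>auto simp: schwartz_bound_def norm_mult norm_power power_abs\<close>)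
    then have s: "(\<Sum>j\<le>N. \<Sum>k\<le>N. SUP x. norm (of_real (x ^ j) * nderiv k \<phi> x)) \<le> (\<Sum>j\<le>N. \<Sum>k\<le>N. B)"
      by (intro sum_mono) auto
    have "norm (S \<phi>) \<le> \<bar>C\<bar> * (\<Sum>j\<le>N. \<Sum>k\<le>N. SUP x. norm (of_real (x ^ j) * nderiv k \<phi> x))"
      using C[OF \<phi>(1)] 0 by (meson abs_ge_self mult_right_mono order_trans sum_nonneg)
    also have "\<dots> \<le> \<bar>C\<bar> * (\<Sum>j\<le>N. \<Sum>k\<le>N. B)" by (intro mult_left_mono s) auto
    finally show ?thesis by (simp add: power2_eq_square mult_ac)
  qed
  then show ?thesis using that[of "\<bar>C\<bar> * (real (Suc N))\<^sup>2" N] by simp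
qed

lemma temperedI:
  assumes "linear_functional_on {\<phi>. schwartz \<phi>} S" "C \<ge> 0"
    and C: "\<And>\<phi> B. schwartz \<phi> \<Longrightarrow> schwartz_bound N B \<phi> \<Longrightarrow> norm (S \<phi>) \<le> C * B"
  shows "tempered S"
  unfolding tempered_def
proof (intro conjI assms exI[of _ C] exI[of _ N] allI impI C)
  fix \<phi> assume \<phi>: "schwartz \<phi>"
  show "schwartz_bound N (\<Sum>j\<le>N. \<Sum>k\<le>N. SUP x. norm (of_real (x ^ j) * nderiv k \<phi> x)) \<phi>"
    unfolding schwartz_bound_def
  proof (intro allI impI)
    fix x :: real and i j assume ij: "i \<le> N" "j \<le> N"
    define s where "s j k = (SUP x. norm (of_real (x ^ j) * nderiv k \<phi> x))" for j k
    have le: "norm (of_real (x ^ j) * nderiv k \<phi> x) \<le> s j k" for j k x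
      unfolding s_def
    proof (rule cSUP_upper[OF UNIV_I])
      show "bdd_above (range (\<lambda>x. norm (of_real (x ^ j) * nderiv k \<phi> x)))"
        using \<phi> unfolding schwartz_def bounded_iff bdd_above_def by fastforce
    qed
    have 0: "s j k \<ge> 0" for j k using le[of 0 j k] norm_ge_zero order_trans by blast
    have "\<bar>x\<bar> ^ j * norm (nderiv i \<phi> x) \<le> s j i" using le[of x j i] by (simp add: norm_mult norm_power power_abs)
    also have "\<dots> \<le> (\<Sum>k\<le>N. s j k)" using ij 0 by (intro member_le_sum) auto
    also have "\<dots> \<le> (\<Sum>j\<le>N. \<Sum>k\<le>N. s j k)"
      using ij 0 by (intro member_le_sum[of j _ "\<lambda>j. \<Sum>k\<le>N. s j k"] sum_nonneg) auto
    finally show "\<bar>x\<bar> ^ j * norm (nderiv i \<phi> x) \<le> (\<Sum>j\<le>N. \<Sum>k\<le>N. SUP x. norm (of_real (x ^ j) * nderiv k \<phi> x))"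
      unfolding s_def .
  qed
qed

lemma tempered_add:
  "tempered S \<Longrightarrow> schwartz f \<Longrightarrow> schwartz g \<Longrightarrow> S (\<lambda>x. f x + g x) = S f + S g"
  unfolding tempered_def linear_functional_on_def by blast

lemma tempered_cmult: "tempered S \<Longrightarrow> schwartz f \<Longrightarrow> S (\<lambda>x. c * f x) = c * S f"
  unfolding tempered_def linear_functional_on_def by blast

lemma schwartz_add:
  assumes "schwartz f" "schwartz g"
  shows "schwartz (\<lambda>x. f x + g x)"
  unfolding schwartz_iff
proof (intro conjI allI)
  have fg: "smooth_on UNIV f" "smooth_on UNIV g" using assms schwartz_smooth by auto
  then show "smooth_on UNIV (\<lambda>x. f x + g x)" by (intro smooth_on_add open_UNIV)
  fix N
  obtain A B where AB: "schwartz_bound N A f" "schwartz_bound N B g" using assms schwartz_iff by blast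
  have "schwartz_bound N (A + B) (\<lambda>x. f x + g x)"
    unfolding schwartz_bound_def
  proof (intro allI impI)
    fix x :: real and i j assume ij: "i \<le> N" "j \<le> N"
    have "\<bar>x\<bar> ^ j * norm (nderiv i (\<lambda>x. f x + g x) x) \<le> \<bar>x\<bar> ^ j * (norm (nderiv i f x) + norm (nderiv i g x))"
      unfolding nderiv_plus[OF open_UNIV fg UNIV_I] by (intro mult_left_mono norm_triangle_ineq) auto
    also have "\<dots> \<le> A + B"
      using AB ij unfolding schwartz_bound_def distrib_left by (meson add_mono)
    finally show "\<bar>x\<bar> ^ j * norm (nderiv i (\<lambda>x. f x + g x) x) \<le> A + B" .
  qed
  then show "\<exists>B. schwartz_bound N B (\<lambda>x. f x + g x)" ..
qed

lemma schwartz_cmult: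
  assumes "schwartz f"
  shows "schwartz (\<lambda>x. c * f x)"
  unfolding schwartz_iff
proof (intro conjI allI)
  have f: "smooth_on UNIV f" using assms schwartz_smooth by auto
  then show "smooth_on UNIV (\<lambda>x. c * f x)" by (intro smooth_on_cmult open_UNIV)
  fix N
  obtain B where B: "schwartz_bound N B f" using assms schwartz_iff by blast
  have "schwartz_bound N (norm c * B) (\<lambda>x. c * f x)"
    unfolding schwartz_bound_def
  proof (intro allI impI)
    fix x :: real and i j assume ij: "i \<le> N" "j \<le> N"
    have "norm c * (\<bar>x\<bar> ^ j * norm (nderiv i f x)) \<le> norm c * B"
      using B ij unfolding schwartz_bound_def by (intro mult_left_mono) auto
    then show "\<bar>x\<bar> ^ j * norm (nderiv i (\<lambda>x. c * f x) x) \<le> norm c * B"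
      unfolding nderiv_cmult[OF open_UNIV f UNIV_I] by (simp add: norm_mult mult_ac)
  qed
  then show "\<exists>B. schwartz_bound N B (\<lambda>x. c * f x)" ..
qed

lemma tempered_diff:
  assumes "tempered S" "schwartz f" "schwartz g"
  shows "S (\<lambda>x. f x - g x) = S f - S g"
  using tempered_add[OF assms(1,2) schwartz_cmult[OF assms(3)], of "-1"]
    tempered_cmult[OF assms(1,3), of "-1"] by simp

lemma sing_functional_tempered:
  assumes "sing_functional L"
  shows "tempered L"
proof -
  obtain N C where C: "C \<ge> 0" "\<And>f B. f \<in> sing_class 0 \<Longrightarrow> sing_bound 0 N B f \<Longrightarrow> norm (L f) \<le> C * B"
    using sing_functionalE[OF assms] by metis
  show ?thesis
  proof (rule temperedI[where C = "C * fact N" and N = "2 * N"])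
    show "linear_functional_on {\<phi>. schwartz \<phi>} L"
      using assms schwartz_sing_space unfolding sing_functional_def linear_functional_on_def by blast
    fix \<phi> B assume \<phi>: "schwartz \<phi>" "schwartz_bound (2 * N) B \<phi>"
    from C(2)[OF schwartz_sing_class[OF \<phi>(1)] schwartz_bound_imp_sing_bound[OF schwartz_smooth[OF \<phi>(1)] \<phi>(2)]]
    show "norm (L \<phi>) \<le> C * fact N * B" by (simp add: mult_ac)
  qed (use C in auto)
qed

section \<open>From vanishing to infinite order to continuity on singular functions\<close>

section \<open>Distributions vanishing to infinite order\<close>

text \<open>If f is not integrable, its Bochner integral is 0 by convention and the bound still
  holds, so integrability of the integrand never has to be verified.\<close>

lemma norm_integral_le_AE:
  fixes f :: "'a \<Rightarrow> complex"
  assumes "integrable M g" "AE x in M. norm (f x) \<le> g x"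
  shows "norm (integral\<^sup>L M f) \<le> integral\<^sup>L M g"
proof (cases "integrable M f")
  case True
  have "norm (integral\<^sup>L M f) \<le> (\<integral>x. norm (f x) \<partial>M)" by simp
  also have "\<dots> \<le> integral\<^sup>L M g" using True assms by (intro integral_mono_AE) auto
  finally show ?thesis .
next
  case False
  have "AE x in M. 0 \<le> g x" using assms(2) by eventually_elim (meson norm_ge_zero order_trans)
  then show ?thesis using False by (simp add: not_integrable_integral_eq integral_nonneg_AE)
qed

lemma dist_deriv_pow: "(dist_deriv ^^ i) S \<phi> = (-1) ^ i * S (nderiv i \<phi>)"
proof (induction i arbitrary: \<phi>)
  case (Suc i)
  have "(dist_deriv ^^ Suc i) S \<phi> = - ((dist_deriv ^^ i) S (nderiv 1 \<phi>))"
    by (simp only: funpow.simps o_apply dist_deriv_def)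
  also have "\<dots> = - ((-1) ^ i * S (nderiv (Suc i) \<phi>))" by (simp only: Suc.IH nderiv_Suc_right)
  finally show ?case by simp
qed simp

text \<open>A balance of powers: i derivatives cost |x|^i, the weight of \<phi> costs |x|^k, and w
  supplies |x|^(i + k).\<close>

lemma fun_dist_vanishing_bound:
  assumes r: "r > 0" "{-r..r} \<subseteq> U" and U: "open U"
    and h: "Linf_loc U h" and w: "smooth_on U w" "fun_vanishes 0 (i + k) w"
  shows "\<exists>C\<ge>0. \<forall>\<phi>\<in>test_functions {-r<..<r}. \<forall>B.
    (\<forall>x l. x \<noteq> 0 \<longrightarrow> l \<le> i \<longrightarrow> \<bar>x\<bar> ^ k * norm ((euler ^^ l) \<phi> x) \<le> B) \<longrightarrow>
    norm (fun_dist U h (nderiv i (\<lambda>x. w x * \<phi> x))) \<le> C * B"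
proof -
  have U0: "0 \<in> U" using r by auto
  have "\<exists>W\<ge>0. \<forall>x. \<bar>x\<bar> \<le> r \<longrightarrow> norm ((euler ^^ l) w x) / \<bar>x\<bar> ^ (i + k) \<le> W" for l
  proof -
    obtain W where W: "W \<ge> 0" "\<forall>x. \<bar>x\<bar> \<le> r \<longrightarrow> norm ((euler ^^ l) w x) \<le> W * \<bar>x\<bar> ^ (i + k)"
      using fun_vanishes_bound[of r U "(euler ^^ l) w" "i + k"] r
        smooth_on_euler_pow[OF U w(1)] fun_vanishes_euler_pow[OF U U0 w] by (auto simp: abs_le_iff subset_iff)
    \<comment> \<open>Division by zero gives 0, so the bound for the quotient includes x =
      0.\<close>
    have "norm ((euler ^^ l) w x) / \<bar>x\<bar> ^ (i + k) \<le> W" if "\<bar>x\<bar> \<le> r" for x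
    proof (cases "\<bar>x\<bar> ^ (i + k) = 0")
      case False
      moreover have "\<bar>x\<bar> ^ (i + k) \<ge> 0" by simp
      ultimately have "\<bar>x\<bar> ^ (i + k) > 0" by linarith
      then show ?thesis using W that by (simp add: pos_divide_le_eq)
    next
      case True
      then show ?thesis using W(1) by (simp only: div_by_0)
    qed
    then show ?thesis using W(1) by blast
  qed
  then obtain W where W: "W \<ge> 0" "\<And>l x. l \<le> i \<Longrightarrow> \<bar>x\<bar> \<le> r \<Longrightarrow> norm ((euler ^^ l) w x) / \<bar>x\<bar> ^ (i + k) \<le> W"
    using ex_uniform_bound[of i "\<lambda>x. \<bar>x\<bar> \<le> r" "\<lambda>l x. norm ((euler ^^ l) w x) / \<bar>x\<bar> ^ (i + k)"] by blast
  obtain H0 where H0: "AE x in lebesgue_on {-r..r}. norm (h x) \<le> H0"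
    using h r unfolding Linf_loc_def by (meson compact_Icc)
  define H where "H = max H0 0"
  have "AE x in lebesgue. x \<in> {-r..r} \<longrightarrow> norm (h x) \<le> H"
    using H0 unfolding H_def by (subst (asm) AE_restrict_space_iff) (auto elim!: eventually_mono)
  then have H: "AE x in lebesgue_on U. x \<in> {-r..r} \<longrightarrow> norm (h x) \<le> H"
    using U by (subst AE_restrict_space_iff) (auto elim: eventually_mono)
  have H0': "H \<ge> 0" unfolding H_def by simp
  \<comment> \<open>The Euler bounds on \<phi> say nothing at 0, which is a null set.\<close>
  have "AE x in lebesgue. x \<noteq> (0::real)"
    using AE_completion[OF AE_lborel_singleton[of "0::real"]] by simp
  then have N0: "AE x in lebesgue_on U. x \<noteq> 0"
    using U by (subst AE_restrict_space_iff) (auto elim: eventually_mono)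
  have bnd: "norm (fun_dist U h (nderiv i (\<lambda>x. w x * \<phi> x))) \<le> (2 * r * H * (fact i * (2 ^ i * W))) * B"
    if \<phi>: "\<phi> \<in> test_functions {-r<..<r}"
      and B: "\<And>x l. x \<noteq> 0 \<Longrightarrow> l \<le> i \<Longrightarrow> \<bar>x\<bar> ^ k * norm ((euler ^^ l) \<phi> x) \<le> B" for \<phi> B
  proof -
    have B0: "B \<ge> 0" using B[of 1 0] order_trans[OF norm_ge_zero, of "\<phi> 1" B] by simp
    have sm: "smooth_on U \<phi>" using \<phi> test_functions_smooth smooth_on_subset by blast
    define M where "M = fact i * (2 ^ i * W) * B"
    have M0: "M \<ge> 0" unfolding M_def using W(1) B0 by simp
    have inside: "norm (nderiv i (\<lambda>x. w x * \<phi> x) x) \<le> M" if x: "x \<noteq> 0" "\<bar>x\<bar> \<le> r" for x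
    proof -
      have xU: "x \<in> U" using x r by (auto simp: abs_le_iff)
      have "\<bar>x\<bar> ^ i * norm (nderiv i (\<lambda>x. w x * \<phi> x) x) \<le> fact i * (2 ^ i * W * B * \<bar>x\<bar> ^ i)"
      proof (rule norm_nderiv_le_euler[OF U xU smooth_on_mult[OF U w(1) sm]])
        fix l assume l: "l \<le> i"
        have "norm ((euler ^^ l) (\<lambda>x. w x * \<phi> x) x) \<le> 2 ^ l * ((W * \<bar>x\<bar> ^ (i + k)) * (B / \<bar>x\<bar> ^ k))"
        proof (rule norm_euler_pow_mult_le[OF U xU w(1) sm])
          fix p assume "p \<le> l"
          with l have "p \<le> i" by simp
          then show "norm ((euler ^^ p) w x) \<le> W * \<bar>x\<bar> ^ (i + k)" "norm ((euler ^^ p) \<phi> x) \<le> B / \<bar>x\<bar> ^ k"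
            using W(2)[of p x] B[of x p] x by (auto simp: field_simps)
        qed
        also have "\<dots> = 2 ^ l * (W * B * \<bar>x\<bar> ^ i)" using x by (simp add: power_add)
        also have "\<dots> \<le> 2 ^ i * (W * B * \<bar>x\<bar> ^ i)"
          using l W(1) B0 by (intro mult_right_mono power_increasing) auto
        finally show "norm ((euler ^^ l) (\<lambda>x. w x * \<phi> x) x) \<le> 2 ^ i * W * B * \<bar>x\<bar> ^ i" by (simp add: mult_ac)
      qed
      then have "\<bar>x\<bar> ^ i * norm (nderiv i (\<lambda>x. w x * \<phi> x) x) \<le> \<bar>x\<bar> ^ i * M" unfolding M_def by (simp add: mult_ac)
      then show ?thesis using x by simp
    qed
    have outside: "nderiv i (\<lambda>x. w x * \<phi> x) x = 0" if "x \<notin> {-r..r}" for x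
    proof (rule nderiv_eq_0_outside[of "- {-r..r}"])
      show "open (- {-r..r})" by (simp add: open_Compl)
      fix y assume "y \<in> - {-r..r}"
      then show "w y * \<phi> y = 0" using test_functions_eq_0[OF \<phi>, of y] by auto
    qed (use that in auto)
    have "AE x in lebesgue_on U. norm (h x * nderiv i (\<lambda>x. w x * \<phi> x) x) \<le> H * M * indicator {-r..r} x"
      using H N0
    proof eventually_elim
      case (elim x)
      show ?case
      proof (cases "x \<in> {-r..r}")
        case True
        then have "norm (h x) \<le> H" "norm (nderiv i (\<lambda>x. w x * \<phi> x) x) \<le> M"
          using elim inside by (auto simp: abs_le_iff)
        then show ?thesis using True H0' by (simp add: norm_mult mult_mono)
      qed (use outside in simp)
    qed
    moreover have "integrable (lebesgue_on U) (\<lambda>x. H * M * indicator {-r..r} x)"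
      using U r by (intro integrable_mult_right integrable_real_indicator)
         (auto simp: emeasure_restrict_space sets_restrict_space_iff)
    ultimately have "norm (integral\<^sup>L (lebesgue_on U) (\<lambda>x. h x * nderiv i (\<lambda>x. w x * \<phi> x) x)) \<le>
        integral\<^sup>L (lebesgue_on U) (\<lambda>x. H * M * indicator {-r..r} x)"
      by (intro norm_integral_le_AE)
    also have "\<dots> = H * M * (2 * r)"
      using U r by (simp add: measure_restrict_space sets_restrict_space_iff Int_absorb2)
    finally show ?thesis unfolding fun_dist_def M_def by (simp add: mult_ac)
  qed
  show ?thesis
    by (intro exI[of _ "2 * r * H * (fact i * (2 ^ i * W))"] conjI ballI allI impI bnd)
       (use r H0' W(1) in auto)
qed

text \<open>Transposition moves a_i f_j under the i derivatives. This product vanishes to order i +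
  k, because the coefficient a_i of a tangential operator vanishes to order i.\<close>

lemma dist_vanishes_bound:
  assumes "dist_vanishes 0 k S"
  shows "\<exists>r>0. \<exists>M. \<exists>C\<ge>0. \<forall>\<phi>\<in>test_functions {-r<..<r}. \<forall>B.
    (\<forall>x l. x \<noteq> 0 \<longrightarrow> l \<le> M \<longrightarrow> \<bar>x\<bar> ^ k * norm ((euler ^^ l) \<phi> x) \<le> B) \<longrightarrow> norm (S \<phi>) \<le> C * B"
proof -
  obtain U N f m a h where U: "open U" "0 \<in> U"
    and fh': "\<forall>j<N. Linf_loc U (h j) \<and> tangential_op U 0 (m j) (a j) \<and> smooth_on U (f j) \<and> fun_vanishes 0 k (f j)"
    and S': "\<forall>\<phi>\<in>test_functions U. S \<phi> = (\<Sum>j<(N::nat). dist_mult (f j) (dist_diff_op (m j) (a j) (fun_dist U (h j))) \<phi>)"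
    using assms unfolding dist_vanishes_def by (elim exE conjE) (rule that)
  have fh: "Linf_loc U (h j)" "tangential_op U 0 (m j) (a j)" "smooth_on U (f j)" "fun_vanishes 0 k (f j)"
    if "j < N" for j using fh' that by blast+
  have S: "S \<phi> = (\<Sum>j<N. dist_mult (f j) (dist_diff_op (m j) (a j) (fun_dist U (h j))) \<phi>)"
    if "\<phi> \<in> test_functions U" for \<phi> using S' that by blast
  obtain r where r: "r > 0" "cball 0 r \<subseteq> U" using U by (auto simp: open_contains_cball)
  then have rU: "{-r..r} \<subseteq> U" by (auto simp: cball_eq_atLeastAtMost)
  define w where "w j i x = a j i x * f j x" for j i x
  have sm: "smooth_on U (a j i)" if "j < N" "i \<le> m j" for i j
    using fh(2)[OF that(1)] that(2) unfolding tangential_op_def by blast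
  have w: "smooth_on U (w j i)" "fun_vanishes 0 (i + k) (w j i)" if "j < N" "i \<le> m j" for j i
    unfolding w_def using that fh sm tangential_coeff_vanishes[OF U fh(2)]
    by (auto intro!: smooth_on_mult fun_vanishes_mult[OF U] U)
  define M where "M = (\<Sum>j<N. m j)"
  have mM: "m j \<le> M" if "j < N" for j unfolding M_def using that by (intro member_le_sum) auto
  define P where "P j i C \<longleftrightarrow> C \<ge> 0 \<and> (\<forall>\<phi>\<in>test_functions {-r<..<r}. \<forall>B.
    (\<forall>x l. x \<noteq> 0 \<longrightarrow> l \<le> i \<longrightarrow> \<bar>x\<bar> ^ k * norm ((euler ^^ l) \<phi> x) \<le> B) \<longrightarrow>
    norm (fun_dist U (h j) (nderiv i (\<lambda>x. w j i x * \<phi> x))) \<le> C * B)" for j i C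
  have "\<exists>C. P j i C" if "j < N" "i \<le> m j" for j i
    unfolding P_def using fun_dist_vanishing_bound[OF r(1) rU U(1) fh(1)[OF that(1)] w[OF that]] by blast
  then obtain C where "\<And>j i. j < N \<Longrightarrow> i \<le> m j \<Longrightarrow> P j i (C j i)" by metis
  then have C: "\<And>j i. j < N \<Longrightarrow> i \<le> m j \<Longrightarrow> C j i \<ge> 0"
    "\<And>j i \<phi> B. j < N \<Longrightarrow> i \<le> m j \<Longrightarrow> \<phi> \<in> test_functions {-r<..<r} \<Longrightarrow>
      (\<And>x l. x \<noteq> 0 \<Longrightarrow> l \<le> i \<Longrightarrow> \<bar>x\<bar> ^ k * norm ((euler ^^ l) \<phi> x) \<le> B) \<Longrightarrow>
      norm (fun_dist U (h j) (nderiv i (\<lambda>x. w j i x * \<phi> x))) \<le> C j i * B" unfolding P_def by blast+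
  have bnd: "norm (S \<phi>) \<le> (\<Sum>j<N. \<Sum>i\<le>m j. C j i) * B"
    if \<phi>: "\<phi> \<in> test_functions {-r<..<r}"
      and B: "\<And>x l. x \<noteq> 0 \<Longrightarrow> l \<le> M \<Longrightarrow> \<bar>x\<bar> ^ k * norm ((euler ^^ l) \<phi> x) \<le> B" for \<phi> B
  proof -
    have "\<phi> \<in> test_functions U" using test_functions_mono[OF \<phi>, of U] rU by force
    from S[OF this] have "S \<phi> = (\<Sum>j<N. \<Sum>i\<le>m j. (-1) ^ i * fun_dist U (h j) (nderiv i (\<lambda>x. w j i x * \<phi> x)))"
      unfolding dist_mult_def dist_diff_op_def dist_deriv_pow w_def by (simp add: mult.assoc)
    also have "norm \<dots> \<le> (\<Sum>j<N. \<Sum>i\<le>m j. C j i * B)"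
    proof (intro sum_norm_le)
      fix j i assume ji: "j \<in> {..<N}" "i \<in> {..m j}"
      have "norm (fun_dist U (h j) (nderiv i (\<lambda>x. w j i x * \<phi> x))) \<le> C j i * B"
        by (rule C(2)[OF _ _ \<phi> B]) (use ji mM[of j] in auto)
      then show "norm ((-1) ^ i * fun_dist U (h j) (nderiv i (\<lambda>x. w j i x * \<phi> x))) \<le> C j i * B"
        by (simp add: norm_mult norm_power)
    qed
    finally show ?thesis by (simp add: sum_distrib_right)
  qed
  show ?thesis
    by (intro exI[of _ r] conjI r exI[of _ M] exI[of _ "\<Sum>j<N. \<Sum>i\<le>m j. C j i"] ballI allI impI bnd)
       (use C(1) in \<open>auto intro!: sum_nonneg\<close>)
qed

lemma test_functions_chi:
  assumes "smooth_on UNIV f" "c > 0" "2 / c < r"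
  shows "(\<lambda>x. chi (c * x) * f x) \<in> test_functions {-r<..<r}"
proof (rule test_functionsI[of _ "{-2/c..2/c}"])
  show "smooth_on UNIV (\<lambda>x. chi (c * x) * f x)" by (intro smooth_on_mult open_UNIV smooth_on_chi_scale assms)
  fix x :: real assume "x \<notin> {-2/c..2/c}"
  then show "chi (c * x) * f x = 0"
    using assms(2) by (subst chi_eq_0) (auto simp: field_simps abs_if)
qed (use assms in auto)

text \<open>Near 0 the vanishing applies; far from 0 temperedness does, because there
  \<open>sing_bound\<close> dominates the Schwartz norms. A cutoff at a fixed scale separates the
  two regions.\<close>

lemma tempered_sing_bound:
  assumes S: "tempered S" "dist_vanishes 0 a S"
  shows "\<exists>N. \<exists>C\<ge>0. \<forall>\<phi> B. schwartz \<phi> \<longrightarrow> sing_bound a N B \<phi> \<longrightarrow> norm (S \<phi>) \<le> C * B"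
proof -
  obtain r M C1 where r: "r > 0" and C1: "C1 \<ge> 0" "\<And>\<phi> B. \<phi> \<in> test_functions {-r<..<r} \<Longrightarrow>
      (\<And>x l. x \<noteq> 0 \<Longrightarrow> l \<le> M \<Longrightarrow> \<bar>x\<bar> ^ a * norm ((euler ^^ l) \<phi> x) \<le> B) \<Longrightarrow> norm (S \<phi>) \<le> C1 * B"
    using dist_vanishes_bound[OF S(2)] by metis
  obtain N2 C2 where C2: "C2 \<ge> 0" "\<And>\<phi> B. schwartz \<phi> \<Longrightarrow> schwartz_bound N2 B \<phi> \<Longrightarrow> norm (S \<phi>) \<le> C2 * B"
    using temperedE[OF S(1)] by metis
  define N where "N = max M N2"
  obtain K where K: "K \<ge> 0" "\<And>f B c. smooth_on (- {0}) f \<Longrightarrow> sing_bound a N B f \<Longrightarrow>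
     sing_bound a N (K * B) (\<lambda>x. chi (c * x) * f x)" "\<And>f B c. smooth_on (- {0}) f \<Longrightarrow> sing_bound a N B f \<Longrightarrow>
     sing_bound a N (K * B) (\<lambda>x. (1 - chi (c * x)) * f x)"
    using sing_bound_chi by meson
  \<comment> \<open>4 / r makes the support radius 2 / c less than r; the maximum with 1 ensures 1 /
    c \<le> 1, as \<open>sing_bound_imp_schwartz_bound\<close> requires.\<close>
  define c where "c = max 1 (4 / r)"
  have c: "c > 0" "c \<ge> 1" "2 / c < r" using r unfolding c_def by (auto simp: field_simps max_def)
  define D where "D = fact N2 / (1 / c) ^ (a + N2)"
  have bnd: "norm (S \<phi>) \<le> (C1 * K + C2 * D * K) * B" if \<phi>: "schwartz \<phi>" "sing_bound a N B \<phi>" for \<phi> B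
  proof -
    have sm: "smooth_on UNIV \<phi>" "smooth_on (- {0}) \<phi>" using schwartz_smooth[OF \<phi>(1)] smooth_on_subset by auto
    define f g where "f = (\<lambda>x. chi (c * x) * \<phi> x)" and "g = (\<lambda>x. (1 - chi (c * x)) * \<phi> x)"
    have f: "f \<in> test_functions {-r<..<r}" unfolding f_def by (rule test_functions_chi[OF sm(1) c(1,3)])
    have sbf: "sing_bound a N (K * B) f" unfolding f_def by (rule K(2)[OF sm(2) \<phi>(2)])
    have 1: "norm (S f) \<le> C1 * (K * B)"
      by (rule C1(2)[OF f]) (use sing_boundD[OF sbf, of _ _ 0] in \<open>simp add: N_def\<close>)
    have g: "schwartz g" unfolding g_def by (rule schwartz_one_minus_chi[OF schwartz_sing_class[OF \<phi>(1)] c(1)])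
    have "sing_bound a N2 (K * B) g" unfolding g_def using K(3)[OF sm(2) \<phi>(2), of c]
      by (rule sing_bound_mono) (auto simp: N_def)
    from sing_bound_imp_schwartz_bound[OF _ _ _ _ this, of "1 / c"]
    have "schwartz_bound N2 (D * (K * B)) g"
      using c schwartz_smooth[OF g] smooth_on_subset[of UNIV g]
      by (auto simp: g_def D_def chi_eq_1 field_simps abs_mult)
    from C2(2)[OF g this] have 2: "norm (S g) \<le> C2 * (D * (K * B))" .
    have "S \<phi> = S f + S g" using tempered_add[OF S(1) test_functions_schwartz[OF f] g]
      by (simp add: f_def g_def algebra_simps)
    then show ?thesis using norm_triangle_le[OF add_mono[OF 1 2]] by (simp add: algebra_simps)
  qed
  have "C1 * K + C2 * D * K \<ge> 0" using C1(1) C2(1) K(1) c unfolding D_def by simp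
  then show ?thesis using bnd by blast
qed

lemma convergent_inverse_Suc:
  fixes X :: "nat \<Rightarrow> complex"
  assumes "\<And>m n. norm (X m - X n) \<le> D * (1 / real (Suc m) + 1 / real (Suc n))"
  shows "convergent X"
proof -
  have "Cauchy X"
    unfolding Cauchy_def
  proof (intro allI impI)
    fix e :: real assume e: "e > 0"
    define E where "E = \<bar>D\<bar> + 1"
    have E: "E > 0" by (simp add: E_def)
    obtain M where M: "1 / real (Suc M) < e / (2 * E)"
      using e reals_Archimedean[of "e / (2 * E)"] by (auto simp: E_def inverse_eq_divide)
    have "dist (X m) (X n) < e" if "m \<ge> M" "n \<ge> M" for m n
    proof -
      have "norm (X m - X n) \<le> D * (1 / real (Suc m) + 1 / real (Suc n))" by (rule assms)
      also have "\<dots> \<le> E * (1 / real (Suc m) + 1 / real (Suc n))"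
        by (intro mult_right_mono) (auto simp: E_def)
      also have "\<dots> \<le> E * (1 / real (Suc M) + 1 / real (Suc M))"
        using that by (intro mult_left_mono add_mono frac_le) (auto simp: E_def)
      also have "\<dots> < e"
      proof -
        have "E * (1 / real (Suc M)) < E * (e / (2 * E))" using M using E by (intro mult_strict_left_mono)
        also have "\<dots> = e / 2" using E by simp
        finally show ?thesis unfolding distrib_left by linarith
      qed
      finally show ?thesis by (simp add: dist_norm)
    qed
    then show "\<exists>M. \<forall>m\<ge>M. \<forall>n\<ge>M. dist (X m) (X n) < e" by blast
  qed
  then show ?thesis by (simp add: Cauchy_convergent_iff)
qed

lemma tendsto_inverse_Suc_bound:
  fixes X :: "nat \<Rightarrow> complex"
  assumes "\<And>n. norm (X n - l) \<le> D / real (Suc n)"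
  shows "X \<longlonglongrightarrow> l"
proof (rule LIM_zero_cancel)
  have "(\<lambda>n. D * (1 / real (Suc n))) \<longlonglongrightarrow> 0"
    using tendsto_mult_left[OF LIMSEQ_Suc[OF lim_1_over_n], of D] by simp
  then show "(\<lambda>n. X n - l) \<longlonglongrightarrow> 0"
    by (rule Lim_null_comparison[rotated]) (use assms in simp)
qed

text \<open>For f in \<open>sing_space\<close> each approximant is 0 near the origin and a Schwartz
  function, so only meaningful values of S enter.\<close>

definition sing_extension :: "functional \<Rightarrow> functional" where
  "sing_extension S f = lim (\<lambda>n. S (\<lambda>x. (1 - chi (real (Suc n) * x)) * f x))"

text \<open>Two approximants differ by functions supported near 0, which are small in class a + 1.
  Vanishing of S to order a + 1, one more than the singularity of f, makes the sequence
  Cauchy.\<close>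

lemma sing_extension_tendsto:
  assumes S: "tempered S" "dist_vanishes_inf 0 S" and f: "f \<in> sing_space"
  shows "(\<lambda>n. S (\<lambda>x. (1 - chi (real (Suc n) * x)) * f x)) \<longlonglongrightarrow> sing_extension S f"
proof -
  obtain a where a: "f \<in> sing_class a" using f unfolding sing_space_def by blast
  have sm: "smooth_on (- {0}) f" using a by (rule sing_classD)
  obtain N C where C: "C \<ge> 0" "\<And>\<phi> B. schwartz \<phi> \<Longrightarrow> sing_bound (Suc a) N B \<phi> \<Longrightarrow> norm (S \<phi>) \<le> C * B"
    using tempered_sing_bound[of S "Suc a"] S unfolding dist_vanishes_inf_def by metis
  obtain K where K: "K \<ge> 0" "\<And>f B c. smooth_on (- {0}) f \<Longrightarrow> sing_bound a N B f \<Longrightarrow> c > 0 \<Longrightarrow>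
     sing_bound (Suc a) N (K * B / c) (\<lambda>x. chi (c * x) * f x)"
    using sing_bound_chi_small by meson
  obtain B where B: "sing_bound a N B f" using a by (rule sing_classE)
  define F where "F n = (\<lambda>x. (1 - chi (real (Suc n) * x)) * f x)" for n
  have F: "schwartz (F n)" for n unfolding F_def by (rule schwartz_one_minus_chi[OF a]) simp
  have "norm (S (F m) - S (F n)) \<le> C * K * B * (1 / real (Suc m) + 1 / real (Suc n))" for m n
  proof -
    have *: "(\<lambda>x. chi (real (Suc n) * x) * f x - chi (real (Suc m) * x) * f x) = (\<lambda>x. F m x - F n x)"
      unfolding F_def by (simp add: algebra_simps)
    have "sing_bound (Suc a) N (K * B / real (Suc n) + K * B / real (Suc m)) (\<lambda>x. F m x - F n x)"
      unfolding *[symmetric]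
      by (intro sing_bound_diff K(2) sm B smooth_on_mult smooth_on_chi_scale' open_punctured) auto
    moreover have "schwartz (\<lambda>x. F m x - F n x)"
      using schwartz_add[OF F schwartz_cmult[OF F], of m "-1" n] by simp
    ultimately have "norm (S (\<lambda>x. F m x - F n x)) \<le> C * (K * B / real (Suc n) + K * B / real (Suc m))"
      using C(2) by blast
    then show ?thesis unfolding tempered_diff[OF S(1) F F] by (simp add: algebra_simps)
  qed
  then have "convergent (\<lambda>n. S (F n))" by (rule convergent_inverse_Suc)
  then show ?thesis unfolding sing_extension_def F_def by (simp add: convergent_LIMSEQ_iff)
qed

lemma sing_extension_sing_functional:
  assumes S: "tempered S" "dist_vanishes_inf 0 S"
  shows "sing_functional (sing_extension S)"
  unfolding sing_functional_def linear_functional_on_def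
proof (intro conjI ballI allI)
  note lim = sing_extension_tendsto[OF S]
  have sch: "schwartz (\<lambda>x. (1 - chi (real (Suc n) * x)) * f x)" if "f \<in> sing_space" for f n
    using that schwartz_one_minus_chi[of f _ "real (Suc n)"] unfolding sing_space_def by auto
  fix f g assume fg: "f \<in> sing_space" "g \<in> sing_space"
  have "(\<lambda>n. S (\<lambda>x. (1 - chi (real (Suc n) * x)) * (f x + g x))) \<longlonglongrightarrow> sing_extension S f + sing_extension S g"
    using tendsto_add[OF lim[OF fg(1)] lim[OF fg(2)]]
    unfolding tempered_add[OF S(1) sch[OF fg(1)] sch[OF fg(2)], symmetric] by (simp add: distrib_left)
  then show "sing_extension S (\<lambda>x. f x + g x) = sing_extension S f + sing_extension S g"
    using lim[OF sing_space_add[OF fg]] LIMSEQ_unique by blast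
next
  note lim = sing_extension_tendsto[OF S]
  have sch: "schwartz (\<lambda>x. (1 - chi (real (Suc n) * x)) * f x)" if "f \<in> sing_space" for f n
    using that schwartz_one_minus_chi[of f _ "real (Suc n)"] unfolding sing_space_def by auto
  fix c f assume f: "f \<in> sing_space"
  have "(\<lambda>n. S (\<lambda>x. (1 - chi (real (Suc n) * x)) * (c * f x))) \<longlonglongrightarrow> c * sing_extension S f"
    using tendsto_mult_left[OF lim[OF f], of c]
    unfolding tempered_cmult[OF S(1) sch[OF f], symmetric] by (simp add: mult.left_commute)
  then show "sing_extension S (\<lambda>x. c * f x) = c * sing_extension S f"
    using lim[OF sing_space_cmult[OF f]] LIMSEQ_unique by blast
next
  fix a
  \<comment> \<open>For boundedness order a is enough: the approximants are uniformly bounded in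
    class a, and no smallness is used.\<close>
  obtain N C where C: "C \<ge> 0" "\<And>\<phi> B. schwartz \<phi> \<Longrightarrow> sing_bound a N B \<phi> \<Longrightarrow> norm (S \<phi>) \<le> C * B"
    using tempered_sing_bound[of S a] S unfolding dist_vanishes_inf_def by metis
  obtain K where K: "K \<ge> 0" "\<And>f B c. smooth_on (- {0}) f \<Longrightarrow> sing_bound a N B f \<Longrightarrow>
     sing_bound a N (K * B) (\<lambda>x. (1 - chi (c * x)) * f x)"
    using sing_bound_chi by meson
  have "norm (sing_extension S f) \<le> (C * K) * B" if f: "f \<in> sing_class a" "sing_bound a N B f" for f B
  proof (rule LIMSEQ_le_const2[OF tendsto_norm[OF sing_extension_tendsto[OF S]]])
    show "f \<in> sing_space" using f unfolding sing_space_def by blast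
    have "norm (S (\<lambda>x. (1 - chi (real (Suc n) * x)) * f x)) \<le> C * K * B" for n
      using C(2)[OF schwartz_one_minus_chi[OF f(1)] K(2)[OF sing_classD[OF f(1)] f(2)], of "real (Suc n)"]
      by (simp add: mult.assoc)
    then show "\<exists>N. \<forall>n\<ge>N. norm (S (\<lambda>x. (1 - chi (real (Suc n) * x)) * f x)) \<le> C * K * B" by blast
  qed
  then show "\<exists>N C. \<forall>f\<in>sing_class a. \<forall>B. sing_bound a N B f \<longrightarrow> norm (sing_extension S f) \<le> C * B" by blast
qed

lemma schwartz_chi_tendsto_0:
  fixes S :: functional
  assumes L: "\<And>\<phi> B. schwartz \<phi> \<Longrightarrow> sing_bound 1 N B \<phi> \<Longrightarrow> norm (S \<phi>) \<le> C * B" and f: "schwartz f"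
  shows "(\<lambda>n. S (\<lambda>x. chi (real (Suc n) * x) * f x)) \<longlonglongrightarrow> 0"
proof -
  obtain K where K: "K \<ge> 0" "\<And>f B c. smooth_on (- {0}) f \<Longrightarrow> sing_bound 0 N B f \<Longrightarrow> c > 0 \<Longrightarrow>
     sing_bound (Suc 0) N (K * B / c) (\<lambda>x. chi (c * x) * f x)"
    using sing_bound_chi_small by meson
  obtain B where B: "sing_bound 0 N B f" using schwartz_sing_class[OF f] by (rule sing_classE)
  have "schwartz (\<lambda>x. chi (real (Suc n) * x) * f x)" for n
    by (rule test_functions_schwartz[OF test_functions_chi[of _ _ 3]])
       (auto simp: schwartz_smooth[OF f] field_simps)
  then have "norm (S (\<lambda>x. chi (real (Suc n) * x) * f x)) \<le> C * (K * B / real (Suc n))" for n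
    by (rule L) (use K(2)[OF sing_classD[OF schwartz_sing_class[OF f]] B, of "real (Suc n)"] in simp)
  then have "norm (S (\<lambda>x. chi (real (Suc n) * x) * f x) - 0) \<le> C * (K * B) / real (Suc n)" for n by simp
  then show ?thesis by (rule tendsto_inverse_Suc_bound)
qed

text \<open>A Schwartz function has singular order 0, so vanishing to order one already makes its
  part near 0 negligible in the limit.\<close>

lemma sing_extension_schwartz:
  assumes S: "tempered S" "dist_vanishes_inf 0 S" and f: "schwartz f"
  shows "sing_extension S f = S f"
proof -
  obtain N C where C: "C \<ge> 0" "\<And>\<phi> B. schwartz \<phi> \<Longrightarrow> sing_bound 1 N B \<phi> \<Longrightarrow> norm (S \<phi>) \<le> C * B"
    using tempered_sing_bound[of S 1] S unfolding dist_vanishes_inf_def by metis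
  have 0: "(\<lambda>n. S (\<lambda>x. chi (real (Suc n) * x) * f x)) \<longlonglongrightarrow> 0"
    by (rule schwartz_chi_tendsto_0[OF C(2) f])
  have 1: "schwartz (\<lambda>x. chi (real (Suc n) * x) * f x)" for n
    by (rule test_functions_schwartz[OF test_functions_chi[of _ _ 3]])
       (auto simp: schwartz_smooth[OF f] field_simps)
  have "S (\<lambda>x. (1 - chi (real (Suc n) * x)) * f x) = S f - S (\<lambda>x. chi (real (Suc n) * x) * f x)" for n
    using tempered_diff[OF S(1) f 1[of n]] by (simp add: left_diff_distrib)
  with tendsto_diff[OF tendsto_const[of "S f"] 0]
  have "(\<lambda>n. S (\<lambda>x. (1 - chi (real (Suc n) * x)) * f x)) \<longlonglongrightarrow> S f" by simp
  then show ?thesis using sing_extension_tendsto[OF S schwartz_sing_space[OF f]] LIMSEQ_unique by blast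
qed

section \<open>Fourier integrals under the bound C / (1 + x^2)\<close>

section \<open>Fourier transforms of decaying functions\<close>

lemma interval_integral_whole_line:
  "(LBINT x=-\<infinity>..\<infinity>. f x) = integral\<^sup>L lborel f" for f :: "real \<Rightarrow> 'a::{banach, second_countable_topology}"
  by (simp add: interval_lebesgue_integral_def set_lebesgue_integral_def einterval_eq_UNIV)

lemma integrable_inverse_1_plus_square: "integrable lborel (\<lambda>x::real. 1 / (1 + x\<^sup>2))"
proof -
  have "set_integrable lborel (einterval (-\<infinity>) \<infinity>) (\<lambda>x::real. 1 / (1 + x\<^sup>2))"
  proof (rule interval_integral_FTC_nonneg[where F = arctan])
    show "((arctan \<circ> real_of_ereal) \<longlongrightarrow> - (pi / 2)) (at_right (-\<infinity>))"
      unfolding ereal_tendsto_simps using tendsto_arctan_at_bot by (simp add: o_def)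
    show "((arctan \<circ> real_of_ereal) \<longlongrightarrow> pi / 2) (at_left \<infinity>)"
      unfolding ereal_tendsto_simps using tendsto_arctan_at_top by (simp add: o_def)
    fix x :: real
    show "(arctan has_real_derivative 1 / (1 + x\<^sup>2)) (at x)"
      using DERIV_arctan[of x] by (simp add: inverse_eq_divide)
    have "1 + x\<^sup>2 > 0" by (simp add: add_pos_nonneg)
    then show "isCont (\<lambda>x. 1 / (1 + x\<^sup>2)) x" by (intro continuous_intros) auto
  qed auto
  then show ?thesis by (simp add: set_integrable_def einterval_eq_UNIV)
qed

text \<open>A quantitative form of integrability; continuity supplies measurability, for
  \<open>lborel\<close> and \<open>lebesgue\<close> alike.\<close>

definition decays :: "real \<Rightarrow> (real \<Rightarrow> complex) \<Rightarrow> bool" where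
  "decays C f \<longleftrightarrow> continuous_on UNIV f \<and> (\<forall>x. norm (f x) \<le> C / (1 + x\<^sup>2))"

lemma decays_integrable:
  assumes "decays C f"
  shows "integrable lborel f" "integrable lebesgue f" "integral\<^sup>L lebesgue f = integral\<^sup>L lborel f"
    "norm (integral\<^sup>L lborel f) \<le> C * (\<integral>x. 1 / (1 + x\<^sup>2) \<partial>lborel)"
proof -
  have m: "f \<in> borel_measurable lborel"
    using assms unfolding decays_def by (simp add: borel_measurable_continuous_onI)
  have i: "integrable lborel (\<lambda>x. C * (1 / (1 + x\<^sup>2)))"
    by (intro integrable_mult_right integrable_inverse_1_plus_square)
  have le: "norm (f x) \<le> C * (1 / (1 + x\<^sup>2))" for x using assms unfolding decays_def by simp
  show 1: "integrable lborel f"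
    by (rule Bochner_Integration.integrable_bound[OF i m]) (rule AE_I2, simp only: real_norm_def, rule order_trans[OF le abs_ge_self])
  then show "integrable lebesgue f" using integrable_completion[OF m] by simp
  show "integral\<^sup>L lebesgue f = integral\<^sup>L lborel f" using integral_completion[OF m] by simp
  have "norm (integral\<^sup>L lborel f) \<le> (\<integral>x. C * (1 / (1 + x\<^sup>2)) \<partial>lborel)"
    by (rule Bochner_Integration.integral_norm_bound_integral[OF 1 i le])
  then show "norm (integral\<^sup>L lborel f) \<le> C * (\<integral>x. 1 / (1 + x\<^sup>2) \<partial>lborel)"
    by (simp only: integral_mult_right_zero)
qed

lemma decays_nonneg: "decays C f \<Longrightarrow> C \<ge> 0"
  unfolding decays_def using order_trans[OF norm_ge_zero, of "f 0" C] by (auto dest!: spec[of _ 0])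

lemma decays_mult:
  assumes "decays C f" "continuous_on UNIV g" "\<And>x. norm (g x) \<le> D"
  shows "decays (C * D) (\<lambda>x. f x * g x)"
  unfolding decays_def
proof (intro conjI allI)
  show "continuous_on UNIV (\<lambda>x. f x * g x)" using assms by (intro continuous_intros) (auto simp: decays_def)
  fix x
  have "norm (f x) * norm (g x) \<le> (C / (1 + x\<^sup>2)) * D"
    using assms decays_nonneg[OF assms(1)] by (intro mult_mono) (auto simp: decays_def)
  then show "norm (f x * g x) \<le> C * D / (1 + x\<^sup>2)" by (simp add: norm_mult)
qed

lemma decays_cmult: "decays C f \<Longrightarrow> decays (norm c * C) (\<lambda>x. c * f x)"
  using decays_mult[of C f "\<lambda>x. c" "norm c"] by (simp add: mult.commute)

lemma decays_add:
  assumes "decays C f" "decays D g"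
  shows "decays (C + D) (\<lambda>x. f x + g x)"
  unfolding decays_def
proof (intro conjI allI)
  show "continuous_on UNIV (\<lambda>x. f x + g x)" using assms by (intro continuous_intros) (auto simp: decays_def)
  fix x
  have "norm (f x + g x) \<le> C / (1 + x\<^sup>2) + D / (1 + x\<^sup>2)"
    using assms by (intro norm_triangle_le add_mono) (auto simp: decays_def)
  then show "norm (f x + g x) \<le> (C + D) / (1 + x\<^sup>2)" by (simp add: add_divide_distrib)
qed

lemma decays_tendsto_0:
  assumes "decays C f"
  shows "(f \<longlongrightarrow> 0) at_top" "(f \<longlongrightarrow> 0) at_bot"
proof -
  have sq: "filterlim (\<lambda>x::real. 1 + x\<^sup>2) at_top at_top" "filterlim (\<lambda>x::real. 1 + x\<^sup>2) at_top at_bot"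
    by (intro filterlim_tendsto_add_at_top[OF tendsto_const] filterlim_pow_at_top filterlim_ident, simp)
       (intro filterlim_tendsto_add_at_top[OF tendsto_const] filterlim_pow_at_bot_even filterlim_ident, simp_all)
  have le: "norm (f x) \<le> C / (1 + x\<^sup>2)" for x using assms unfolding decays_def by simp
  have "((\<lambda>x. C / (1 + x\<^sup>2)) \<longlongrightarrow> 0) at_top" "((\<lambda>x. C / (1 + x\<^sup>2)) \<longlongrightarrow> 0) at_bot"
    by (rule real_tendsto_divide_at_top[OF tendsto_const sq(1)], rule real_tendsto_divide_at_top[OF tendsto_const sq(2)])
  then show "(f \<longlongrightarrow> 0) at_top" "(f \<longlongrightarrow> 0) at_bot"
    using le by (auto intro!: Lim_null_comparison[of f "\<lambda>x. C / (1 + x\<^sup>2)"] always_eventually)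
qed

text \<open>The fundamental theorem on the whole line: decay of F removes the boundary terms, decay
  of f gives integrability. All integrations by parts below reduce to this.\<close>

lemma integral_deriv_eq_0:
  fixes F :: "real \<Rightarrow> complex"
  assumes "\<And>x. (F has_vector_derivative f x) (at x)" "decays C f" "decays D F"
  shows "integral\<^sup>L lborel f = 0"
proof -
  have "(LBINT x=-\<infinity>..\<infinity>. f x) = 0 - 0"
  proof (rule interval_integral_FTC_integrable[where F = F])
    show "isCont f x" for x
      using assms(2) unfolding decays_def by (simp add: continuous_on_eq_continuous_at)
    show "set_integrable lborel (einterval (-\<infinity>) \<infinity>) f"
      using decays_integrable(1)[OF assms(2)] by (simp add: set_integrable_def einterval_eq_UNIV)
    show "((F \<circ> real_of_ereal) \<longlongrightarrow> 0) (at_right (-\<infinity>))"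
      unfolding ereal_tendsto_simps using decays_tendsto_0[OF assms(3)] by (simp add: o_def)
    show "((F \<circ> real_of_ereal) \<longlongrightarrow> 0) (at_left \<infinity>)"
      unfolding ereal_tendsto_simps using decays_tendsto_0[OF assms(3)] by (simp add: o_def)
  qed (use assms in auto)
  then show ?thesis by (simp add: interval_integral_whole_line)
qed

definition wave :: "real \<Rightarrow> complex" where
  "wave t = exp (- 2 * of_real pi * \<i> * of_real t)"

lemma norm_wave [simp]: "norm (wave t) = 1"
  by (simp add: wave_def)

lemma wave_has_deriv:
  "((\<lambda>x. wave (x * y)) has_vector_derivative (- 2 * of_real pi * \<i> * of_real y) * wave (x * y)) (at x)"
  "((\<lambda>y. wave (x * y)) has_vector_derivative (- 2 * of_real pi * \<i> * of_real x) * wave (x * y)) (at y)"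
proof -
  have *: "((\<lambda>x. exp (c * complex_of_real x)) has_vector_derivative c * exp (c * of_real x)) (at x)" for c x
  proof -
    have "((\<lambda>z. exp (c * z)) has_field_derivative c * exp (c * of_real x)) (at (of_real x))"
      by (auto intro!: derivative_eq_intros)
    from field_vector_diff_chain_at[OF has_vector_derivative_complex_of_real this]
    show ?thesis by (simp add: o_def)
  qed
  show "((\<lambda>x. wave (x * y)) has_vector_derivative (- 2 * of_real pi * \<i> * of_real y) * wave (x * y)) (at x)"
    using *[of "- 2 * of_real pi * \<i> * of_real y" x] by (simp add: wave_def mult_ac)
  show "((\<lambda>y. wave (x * y)) has_vector_derivative (- 2 * of_real pi * \<i> * of_real x) * wave (x * y)) (at y)"
    using *[of "- 2 * of_real pi * \<i> * of_real x" y] by (simp add: wave_def mult_ac)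
qed

lemma continuous_on_wave: "continuous_on UNIV (\<lambda>x. wave (x * y))"
  unfolding wave_def by (intro continuous_intros)

lemma fourier_wave: "fourier f y = integral\<^sup>L lebesgue (\<lambda>x. f x * wave (x * y))"
  unfolding fourier_def wave_def by (simp add: mult.assoc)

lemma decays_wave: "decays C f \<Longrightarrow> decays C (\<lambda>x. f x * wave (x * y))"
  using decays_mult[OF _ continuous_on_wave, of C f y 1] by simp

lemma fourier_lborel: "decays C f \<Longrightarrow> fourier f y = integral\<^sup>L lborel (\<lambda>x. f x * wave (x * y))"
  unfolding fourier_wave by (rule decays_integrable(3)[OF decays_wave])

lemma norm_fourier_le: "decays C f \<Longrightarrow> norm (fourier f y) \<le> C * (\<integral>x. 1 / (1 + x\<^sup>2) \<partial>lborel)"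
  using fourier_lborel decays_integrable(4)[OF decays_wave] by simp

lemma fourier_add:
  assumes "decays C f" "decays D g"
  shows "fourier (\<lambda>x. f x + g x) y = fourier f y + fourier g y"
  using assms decays_integrable(1)[OF decays_wave[OF assms(1)]] decays_integrable(1)[OF decays_wave[OF assms(2)]]
  by (simp add: fourier_lborel[OF assms(1)] fourier_lborel[OF assms(2)] fourier_lborel[OF decays_add[OF assms]] distrib_right)

lemma fourier_cmult: "fourier (\<lambda>x. c * f x) y = c * fourier f y"
  unfolding fourier_wave by (simp add: mult.assoc)

lemma fourier_deriv:
  assumes "\<And>x. (f has_vector_derivative f' x) (at x)" "decays C f'" "decays D f"
  shows "fourier f' y = 2 * of_real pi * \<i> * of_real y * fourier f y"
proof -
  define c where "c = - 2 * of_real pi * \<i> * complex_of_real y"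
  define F where "F = (\<lambda>x. f x * wave (x * y))"
  have 1: "(F has_vector_derivative f x * (c * wave (x * y)) + f' x * wave (x * y)) (at x)" for x
    unfolding F_def c_def by (rule has_vector_derivative_mult[OF assms(1) wave_has_deriv(1)])
  have d: "decays (norm c * D) (\<lambda>x. f x * (c * wave (x * y)))"
    using decays_cmult[OF decays_wave[OF assms(3)], of c y] by (simp add: mult_ac)
  from integral_deriv_eq_0[OF 1 decays_add[OF d decays_wave[OF assms(2)]]] decays_wave[OF assms(3)]
  have "integral\<^sup>L lborel (\<lambda>x. f x * (c * wave (x * y)) + f' x * wave (x * y)) = 0"
    unfolding F_def by blast
  moreover have "integral\<^sup>L lborel (\<lambda>x. f x * (c * wave (x * y)) + f' x * wave (x * y)) =
      integral\<^sup>L lborel (\<lambda>x. f x * (c * wave (x * y))) + fourier f' y"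
    unfolding fourier_lborel[OF assms(2)]
    by (intro Bochner_Integration.integral_add decays_integrable(1)[OF d] decays_integrable(1)[OF decays_wave[OF assms(2)]])
  moreover have "integral\<^sup>L lborel (\<lambda>x. f x * (c * wave (x * y))) = c * fourier f y"
    unfolding fourier_lborel[OF assms(3)] integral_mult_right_zero[symmetric] by (simp add: mult_ac)
  ultimately show ?thesis unfolding c_def by (simp add: add_eq_0_iff)
qed

text \<open>The mean value inequality twice, first for exp(i t) - 1. The quadratic form suits
  \<open>has_vector_derivative_0_quadratic\<close>.\<close>

lemma norm_exp_imaginary_Taylor: "norm (exp (\<i> * of_real t) - 1 - \<i> * of_real t) \<le> t\<^sup>2" for t :: real
proof -
  have d1: "((\<lambda>t. exp (\<i> * of_real t) - 1) has_vector_derivative \<i> * exp (\<i> * of_real t)) (at t)" for t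
  proof -
    have "((\<lambda>z. exp (\<i> * z) - 1) has_field_derivative \<i> * exp (\<i> * of_real t)) (at (of_real t))"
      by (auto intro!: derivative_eq_intros)
    from field_vector_diff_chain_at[OF has_vector_derivative_complex_of_real this]
    show ?thesis by (simp add: o_def)
  qed
  have d2: "((\<lambda>t. exp (\<i> * of_real t) - 1 - \<i> * of_real t) has_vector_derivative \<i> * (exp (\<i> * of_real t) - 1)) (at t)" for t
    using has_vector_derivative_diff[OF d1 has_vector_derivative_mult_right[OF has_vector_derivative_complex_of_real, of \<i> t]]
    by (simp add: algebra_simps)
  have b1: "norm (exp (\<i> * of_real t) - 1) \<le> \<bar>t\<bar>" for t
    using norm_diff_le_deriv[of 0 t "\<lambda>t. exp (\<i> * of_real t) - 1" "\<lambda>t. \<i> * exp (\<i> * of_real t)" 1] d1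
    by (simp add: norm_mult)
  have "norm ((exp (\<i> * of_real t) - 1 - \<i> * of_real t) - (exp (\<i> * of_real 0) - 1 - \<i> * of_real 0)) \<le> \<bar>t\<bar> * \<bar>t - 0\<bar>"
    by (rule norm_diff_le_deriv[OF d2]) (use b1 abs_le_in_closed_segment_0 order_trans in \<open>fastforce simp: norm_mult\<close>)
  then show ?thesis by (simp add: power2_eq_square)
qed

text \<open>Two extra powers of decay allow a second order Taylor estimate under the integral sign.\<close>

lemma fourier_has_deriv:
  assumes "decays C f" "decays D (\<lambda>x. of_real x * f x)" "decays E (\<lambda>x. (of_real x)\<^sup>2 * f x)"
  shows "(fourier f has_vector_derivative fourier (\<lambda>x. - 2 * of_real pi * \<i> * (of_real x * f x)) y) (at y)"
proof -
  define f1 where "f1 = (\<lambda>x. (- 2 * of_real pi * \<i>) * (of_real x * f x))"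
  have f1: "decays (norm (- 2 * of_real pi * \<i>) * D) f1"
    unfolding f1_def by (rule decays_cmult[OF assms(2)])
  define I :: real where "I = (\<integral>x. 1 / (1 + x\<^sup>2) \<partial>lborel)"
  have main: "norm (fourier f (y + h) - fourier f y - of_real h * fourier f1 y) \<le> ((2 * pi)\<^sup>2 * E * I) * h\<^sup>2" for h
  proof -
    define g where "g x = f x * wave (x * (y + h)) + ((-1) * (f x * wave (x * y)) + (- of_real h) * (f1 x * wave (x * y)))" for x
    note ds = decays_wave[OF assms(1), of "y + h"] decays_cmult[OF decays_wave[OF assms(1), of y], of "-1"]
      decays_cmult[OF decays_wave[OF f1, of y], of "- of_real h"]
    have cont: "continuous_on UNIV g"
      using decays_add[OF ds(1) decays_add[OF ds(2,3)]] unfolding decays_def g_def by blast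
    have eq: "integral\<^sup>L lborel g = fourier f (y + h) - fourier f y - of_real h * fourier f1 y"
      unfolding g_def fourier_lborel[OF assms(1)] fourier_lborel[OF f1]
      using ds[THEN decays_integrable(1)] by simp
    have "norm (g x) \<le> (2 * pi)\<^sup>2 * E * h\<^sup>2 / (1 + x\<^sup>2)" for x
    proof -
      define t where "t = - 2 * pi * (x * h)"
      have "wave (x * (y + h)) = wave (x * y) * exp (\<i> * of_real t)"
        unfolding wave_def t_def exp_add[symmetric] by (simp add: algebra_simps)
      then have "g x = f x * wave (x * y) * (exp (\<i> * of_real t) - 1 - \<i> * of_real t)"
        unfolding g_def f1_def t_def by (simp add: algebra_simps)
      then have "norm (g x) \<le> norm (f x) * t\<^sup>2"
        using norm_exp_imaginary_Taylor[of t] by (simp add: norm_mult mult_left_mono)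
      also have "\<dots> = (2 * pi)\<^sup>2 * h\<^sup>2 * norm ((of_real x)\<^sup>2 * f x)"
        unfolding t_def by (simp add: power_mult_distrib norm_mult norm_power mult_ac)
      also have "\<dots> \<le> (2 * pi)\<^sup>2 * h\<^sup>2 * (E / (1 + x\<^sup>2))"
        using assms(3) unfolding decays_def by (intro mult_left_mono) auto
      finally show ?thesis by (simp add: mult_ac)
    qed
    with cont have "decays ((2 * pi)\<^sup>2 * E * h\<^sup>2) g" unfolding decays_def by blast
    from decays_integrable(4)[OF this] show ?thesis unfolding eq I_def by (simp add: mult_ac)
  qed
  have "((\<lambda>h. fourier f (y + h) - fourier f y - of_real h * fourier f1 y) has_vector_derivative 0) (at 0)"
    by (rule has_vector_derivative_0_quadratic[of 1, OF _ main]) simp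
  from has_vector_derivative_add[OF this has_vector_derivative_add[OF has_vector_derivative_const[of "fourier f y"]
        has_vector_derivative_mult_left[OF has_vector_derivative_complex_of_real, of "fourier f1 y"]]]
  have "((\<lambda>h. fourier f (y + h)) has_vector_derivative fourier f1 y) (at 0)" by simp
  then have "((\<lambda>h. fourier f (y + h)) has_vector_derivative fourier f1 y) (at (y - y))" by simp
  moreover have "((\<lambda>t. t - y) has_vector_derivative 1) (at y)"
    by (auto intro!: derivative_eq_intros simp flip: has_real_derivative_iff_has_vector_derivative)
  ultimately have "(fourier f has_vector_derivative fourier f1 y) (at y)"
    using vector_diff_chain_at[of "\<lambda>t. t - y" 1 y "\<lambda>h. fourier f (y + h)" "fourier f1 y"] by (simp add: o_def)
  then show ?thesis unfolding f1_def by (simp add: mult.assoc)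
qed

text \<open>Fubini for f(x) g(y) \<open>wave (x * y)\<close>, which is absolutely integrable because
  the wave has modulus 1.\<close>

lemma fourier_multiplication_formula:
  assumes "decays C f" "decays D g"
  shows "integral\<^sup>L lborel (\<lambda>y. fourier f y * g y) = integral\<^sup>L lborel (\<lambda>x. f x * fourier g x)"
proof -
  have cf: "continuous_on UNIV f" and cg: "continuous_on UNIV g" using assms unfolding decays_def by auto
  have [measurable]: "f \<in> borel_measurable borel" "g \<in> borel_measurable borel"
    using cf cg by (auto intro: borel_measurable_continuous_onI)
  have [measurable]: "(\<lambda>(x, y). wave (x * y)) \<in> borel_measurable (borel \<Otimes>\<^sub>M borel)"
    unfolding wave_def split_beta by measurable
  define H where "H = (\<lambda>(x, y). f x * (g y * wave (x * y)))"
  have "integrable (lborel \<Otimes>\<^sub>M lborel) H"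
  proof (rule lborel_pair.Fubini_integrable)
    show "H \<in> borel_measurable (lborel \<Otimes>\<^sub>M lborel)" unfolding H_def split_beta by measurable
    have "(\<integral>y. norm (H (x, y)) \<partial>lborel) = norm (f x) * (\<integral>y. norm (g y) \<partial>lborel)" for x
      unfolding H_def by (simp add: norm_mult)
    then show "integrable lborel (\<lambda>x. \<integral>y. norm (H (x, y)) \<partial>lborel)"
      using decays_integrable(1)[OF assms(1)] by simp
    have "integrable lborel (\<lambda>y. H (x, y))" for x
      unfolding H_def using decays_integrable(1)[OF decays_wave[OF assms(2)], of x]
      by (simp add: mult.commute[of x])
    then show "AE x in lborel. integrable lborel (\<lambda>y. H (x, y))" by simp
  qed
  then have "(\<integral>y. (\<integral>x. f x * (g y * wave (x * y)) \<partial>lborel) \<partial>lborel) = (\<integral>x. (\<integral>y. f x * (g y * wave (x * y)) \<partial>lborel) \<partial>lborel)"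
    unfolding H_def by (rule lborel_pair.Fubini_integral)
  moreover have "(\<integral>x. f x * (g y * wave (x * y)) \<partial>lborel) = fourier f y * g y" for y
    unfolding fourier_lborel[OF assms(1)] integral_mult_left_zero[symmetric] by (simp add: mult_ac)
  moreover have "(\<integral>y. f x * (g y * wave (x * y)) \<partial>lborel) = f x * fourier g x" for x
    unfolding fourier_lborel[OF assms(2)] integral_mult_right_zero[symmetric] by (simp add: mult_ac)
  ultimately show ?thesis by (simp only:)
qed

section \<open>Invariance of the Schwartz space under the Fourier transform\<close>

section \<open>The Fourier transform of Schwartz functions\<close>

lemma nderiv_times_x:
  assumes "smooth_on UNIV f"
  shows "nderiv (Suc i) (\<lambda>x. of_real x * f x) x = of_real x * nderiv (Suc i) f x + of_nat (Suc i) * nderiv i f x"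
proof -
  have "nderiv 1 (\<lambda>x. of_real x * f x) y = euler f y + f y" for y
    using nderiv_1_eq[OF has_vector_derivative_mult[OF has_vector_derivative_complex_of_real
          smooth_on_has_deriv[OF assms UNIV_I]]] by (simp add: euler_def)
  then have "nderiv (Suc i) (\<lambda>x. of_real x * f x) x = nderiv i (\<lambda>x. euler f x + f x) x"
    unfolding nderiv_Suc_right by (intro nderiv_cong[OF open_UNIV]) auto
  also have "\<dots> = of_real x * nderiv (Suc i) f x + of_nat i * nderiv i f x + nderiv i f x"
    using nderiv_plus[OF open_UNIV smooth_on_euler[OF open_UNIV assms] assms UNIV_I]
      nderiv_euler[OF open_UNIV assms UNIV_I] by simp
  finally show ?thesis by (simp add: algebra_simps)
qed

lemma schwartz_nderiv: "schwartz f \<Longrightarrow> schwartz (nderiv n f)"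
  unfolding schwartz_def by (auto intro: smooth_on_nderiv simp: nderiv_add[symmetric])

lemma schwartz_times_x:
  assumes "schwartz f"
  shows "schwartz (\<lambda>x. of_real x * f x)"
  unfolding schwartz_iff
proof (intro conjI allI)
  have sm: "smooth_on UNIV f" using assms by (rule schwartz_smooth)
  then show "smooth_on UNIV (\<lambda>x. of_real x * f x)" by (intro smooth_on_mult smooth_on_of_real open_UNIV)
  fix N
  obtain B where B: "schwartz_bound (Suc N) B f" using assms schwartz_iff by blast
  have b: "\<bar>x\<bar> ^ j * norm (nderiv i f x) \<le> B" if "i \<le> Suc N" "j \<le> Suc N" for x i j
    using B that unfolding schwartz_bound_def by blast
  have B0: "B \<ge> 0" using b[of 0 0 0] order_trans[OF norm_ge_zero, of "f 0" B] by simp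
  have "schwartz_bound N ((1 + real N) * B) (\<lambda>x. of_real x * f x)"
    unfolding schwartz_bound_def
  proof (intro allI impI)
    fix x :: real and i j assume ij: "i \<le> N" "j \<le> N"
    show "\<bar>x\<bar> ^ j * norm (nderiv i (\<lambda>x. of_real x * f x) x) \<le> (1 + real N) * B"
    proof (cases i)
      case 0
      have "\<bar>x\<bar> ^ j * norm (nderiv i (\<lambda>x. of_real x * f x) x) \<le> B"
        using b[of 0 "Suc j" x] ij 0 by (simp add: norm_mult mult_ac)
      also have "\<dots> \<le> (1 + real N) * B" using B0 by (simp add: algebra_simps)
      finally show ?thesis .
    next
      case (Suc l)
      have "\<bar>x\<bar> ^ j * norm (nderiv i (\<lambda>x. of_real x * f x) x) \<le>
          \<bar>x\<bar> ^ j * (\<bar>x\<bar> * norm (nderiv i f x) + real i * norm (nderiv l f x))"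
        unfolding Suc nderiv_times_x[OF sm] by (intro mult_left_mono norm_triangle_le) (simp_all add: norm_mult del: of_nat_Suc)
      also have "\<dots> = \<bar>x\<bar> ^ Suc j * norm (nderiv i f x) + real i * (\<bar>x\<bar> ^ j * norm (nderiv l f x))"
        by (simp add: algebra_simps)
      also have "\<dots> \<le> B + real N * B"
        using ij Suc B0 by (intro add_mono mult_mono b) auto
      finally show ?thesis by (simp add: algebra_simps)
    qed
  qed
  then show "\<exists>B. schwartz_bound N B (\<lambda>x. of_real x * f x)" ..
qed

lemma schwartz_decays:
  assumes "schwartz f"
  obtains C where "decays C f"
proof -
  obtain B where B: "schwartz_bound 2 B f" using assms schwartz_iff by blast
  have "norm (f x) \<le> 2 * B / (1 + x\<^sup>2)" for x
  proof -
    have "norm (f x) \<le> B" "\<bar>x\<bar>\<^sup>2 * norm (f x) \<le> B"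
      using B[unfolded schwartz_bound_def, rule_format, of 0 0 x] B[unfolded schwartz_bound_def, rule_format, of 0 2 x] by auto
    then have "(1 + x\<^sup>2) * norm (f x) \<le> 2 * B" by (simp add: algebra_simps)
    moreover have "1 + x\<^sup>2 > 0" by (simp add: add_pos_nonneg)
    ultimately show ?thesis by (simp add: pos_le_divide_eq mult.commute)
  qed
  then show ?thesis using that[of "2 * B"] smooth_on_continuous_on[OF schwartz_smooth[OF assms], of 0]
    unfolding decays_def by simp
qed

lemma fourier_schwartz_has_deriv:
  assumes "schwartz f"
  shows "(fourier f has_vector_derivative fourier (\<lambda>x. - 2 * of_real pi * \<i> * (of_real x * f x)) y) (at y)"
proof -
  note s = assms schwartz_times_x[OF assms] schwartz_times_x[OF schwartz_times_x[OF assms]]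
  obtain C D E where "decays C f" "decays D (\<lambda>x. of_real x * f x)" "decays E (\<lambda>x. of_real x * (of_real x * f x))"
    using s schwartz_decays by metis
  then show ?thesis by (intro fourier_has_deriv[of C f D E]) (simp_all add: power2_eq_square mult.assoc)
qed

lemma fourier_schwartz_nderiv:
  assumes "schwartz f"
  shows "fourier (nderiv n f) y = (2 * of_real pi * \<i> * of_real y) ^ n * fourier f y"
proof (induction n)
  case (Suc n)
  obtain C where "decays C (nderiv n f)" using schwartz_nderiv[OF assms] schwartz_decays by metis
  moreover obtain D where "decays D (nderiv (Suc n) f)" using schwartz_nderiv[OF assms] schwartz_decays by metis
  ultimately have "fourier (nderiv (Suc n) f) y = 2 * of_real pi * \<i> * of_real y * fourier (nderiv n f) y"
    using fourier_deriv[of "nderiv n f" "nderiv (Suc n) f"] smooth_on_has_nderiv[OF schwartz_smooth[OF assms]] by blast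
  then show ?case using Suc by (simp add: mult_ac)
qed simp

lemma smooth_on_fourier_schwartz:
  assumes "schwartz f"
  shows "smooth_on UNIV (fourier f)"
  unfolding smooth_on_iff_C_on
proof
  fix n show "C_on n UNIV (fourier f)"
    using assms
  proof (induction n arbitrary: f)
    case (Suc n)
    have "schwartz (\<lambda>x. - 2 * of_real pi * \<i> * (of_real x * f x))"
      by (intro schwartz_cmult schwartz_times_x Suc.prems)
    from C_on_SucI[OF open_UNIV fourier_schwartz_has_deriv[OF Suc.prems] Suc.IH[OF this]] show ?case .
  qed simp
qed

text \<open>Decay of order j comes from the transform of the j-th derivative, differentiation from
  multiplying f by - 2 \<pi> i x.\<close>

lemma fourier_schwartz_bound:
  assumes "schwartz f"
  shows "\<exists>B. \<forall>y. \<bar>y\<bar> ^ j * norm (nderiv i (fourier f) y) \<le> B"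
  using assms
proof (induction i arbitrary: f)
  case 0
  obtain C where "decays C (nderiv j f)" using schwartz_nderiv[OF 0] schwartz_decays by metis
  from norm_fourier_le[OF this]
  have *: "(2 * pi * \<bar>y\<bar>) ^ j * norm (fourier f y) \<le> C * (\<integral>x. 1 / (1 + x\<^sup>2) \<partial>lborel)" for y
    unfolding fourier_schwartz_nderiv[OF 0] by (simp add: norm_mult norm_power)
  have "\<bar>y\<bar> ^ j * norm (fourier f y) \<le> C * (\<integral>x. 1 / (1 + x\<^sup>2) \<partial>lborel)" for y
  proof -
    have "1 * \<bar>y\<bar> \<le> (2 * pi) * \<bar>y\<bar>" using pi_ge_two by (intro mult_right_mono) auto
    then have "\<bar>y\<bar> ^ j * norm (fourier f y) \<le> (2 * pi * \<bar>y\<bar>) ^ j * norm (fourier f y)"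
      by (intro mult_right_mono power_mono) auto
    with * show ?thesis using order_trans by blast
  qed
  then show ?case by auto
next
  case (Suc i)
  have s: "schwartz (\<lambda>x. - 2 * of_real pi * \<i> * (of_real x * f x))"
    by (intro schwartz_cmult schwartz_times_x Suc.prems)
  have "nderiv 1 (fourier f) = fourier (\<lambda>x. - 2 * of_real pi * \<i> * (of_real x * f x))"
    using nderiv_1_eq[OF fourier_schwartz_has_deriv[OF Suc.prems]] by blast
  then show ?case using Suc.IH[OF s] by (simp only: nderiv_Suc_right)
qed

lemma schwartz_fourier:
  assumes "schwartz f"
  shows "schwartz (fourier f)"
  unfolding schwartz_def
proof (intro conjI allI)
  show "smooth_on UNIV (fourier f)" using assms by (rule smooth_on_fourier_schwartz)
  fix j k
  obtain B where "\<forall>y. \<bar>y\<bar> ^ j * norm (nderiv k (fourier f) y) \<le> B" using fourier_schwartz_bound[OF assms] by blast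
  then show "bounded (range (\<lambda>x. of_real (x ^ j) * nderiv k (fourier f) x))"
    unfolding bounded_iff by (auto simp: norm_mult norm_power power_abs)
qed

section \<open>Transforms of functions of polynomial growth, as functions off the origin\<close>

section \<open>Fourier transforms of symbols\<close>

text \<open>Each derivative gains one power of decay. Although F may grow, its n-th derivative is
  integrable once n \<ge> p + 2, which makes the transform a function away from 0.\<close>

definition symbol :: "nat \<Rightarrow> (real \<Rightarrow> complex) \<Rightarrow> bool" where
  "symbol p F \<longleftrightarrow> smooth_on UNIV F \<and>
     (\<forall>n. \<exists>C. \<forall>x. (1 + \<bar>x\<bar>) ^ n * norm (nderiv n F x) \<le> C * (1 + \<bar>x\<bar>) ^ p)"

text \<open>The Fourier transform of a symbol away from \<open>0\<close>; the sequence is eventually constant.\<close>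

definition symbol_fourier :: "(real \<Rightarrow> complex) \<Rightarrow> real \<Rightarrow> complex" where
  "symbol_fourier F y = lim (\<lambda>n. fourier (nderiv n F) y * inverse (2 * of_real pi * \<i> * of_real y) ^ n)"

lemma symbol_smooth: "symbol p F \<Longrightarrow> smooth_on UNIV F"
  by (simp add: symbol_def)

text \<open>The threshold is the growth p, plus 2 for 1 / (1 + x^2), plus d for the factor
  x^d.\<close>

lemma symbol_decays:
  assumes "symbol p F" "n \<ge> p + 2 + d"
  obtains C where "decays C (\<lambda>x. of_real x ^ d * nderiv n F x)"
proof -
  obtain C where C: "\<And>x. (1 + \<bar>x\<bar>) ^ n * norm (nderiv n F x) \<le> C * (1 + \<bar>x\<bar>) ^ p"
    using assms(1) unfolding symbol_def by blast
  have "norm (of_real x ^ d * nderiv n F x) \<le> C / (1 + x\<^sup>2)" for x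
  proof -
    have "(1 + \<bar>x\<bar>) ^ p * ((1 + x\<^sup>2) * norm (of_real x ^ d * nderiv n F x)) \<le>
        (1 + \<bar>x\<bar>) ^ p * ((1 + \<bar>x\<bar>) ^ 2 * ((1 + \<bar>x\<bar>) ^ d * norm (nderiv n F x)))"
    proof (intro mult_left_mono mult_mono)
      show "1 + x\<^sup>2 \<le> (1 + \<bar>x\<bar>)\<^sup>2" by (simp add: power2_sum)
      have "\<bar>x\<bar> ^ d \<le> (1 + \<bar>x\<bar>) ^ d" by (intro power_mono) auto
      then show "norm (of_real x ^ d * nderiv n F x) \<le> (1 + \<bar>x\<bar>) ^ d * norm (nderiv n F x)"
        by (simp add: norm_mult norm_power mult_right_mono)
    qed auto
    also have "\<dots> = (1 + \<bar>x\<bar>) ^ (p + 2 + d) * norm (nderiv n F x)" by (simp add: power_add power2_eq_square mult_ac)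
    also have "\<dots> \<le> (1 + \<bar>x\<bar>) ^ n * norm (nderiv n F x)"
      using assms(2) by (intro mult_right_mono power_increasing) auto
    also have "\<dots> \<le> (1 + \<bar>x\<bar>) ^ p * C" using C[of x] by (simp add: mult.commute)
    finally have "(1 + x\<^sup>2) * norm (of_real x ^ d * nderiv n F x) \<le> C"
      by (rule mult_left_le_imp_le) simp
    moreover have "1 + x\<^sup>2 > 0" by (simp add: add_pos_nonneg)
    ultimately show ?thesis by (simp add: pos_le_divide_eq mult.commute)
  qed
  moreover have "continuous_on UNIV (\<lambda>x. of_real x ^ d * nderiv n F x)"
    using smooth_on_continuous_on[OF symbol_smooth[OF assms(1)], of n] by (intro continuous_intros) auto
  ultimately show ?thesis using that[of C] unfolding decays_def by blast
qed

lemma symbol_decays_0: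
  assumes "symbol p F" "n \<ge> p + 2"
  obtains C where "decays C (nderiv n F)"
  using symbol_decays[of p F 0 n] assms by auto

text \<open>One integration by parts produces exactly the factor 2 \<pi> i y that the additional
  inverse removes. Above the threshold the sequence defining \<open>symbol_fourier\<close> is
  therefore constant.\<close>

lemma symbol_fourier_Suc:
  assumes "symbol p F" "n \<ge> p + 2" "y \<noteq> 0"
  shows "fourier (nderiv (Suc n) F) y * inverse (2 * of_real pi * \<i> * of_real y) ^ Suc n =
    fourier (nderiv n F) y * inverse (2 * of_real pi * \<i> * of_real y) ^ n"
proof -
  obtain C where C: "decays C (nderiv n F)" using symbol_decays_0[OF assms(1,2)] .
  obtain D where D: "decays D (nderiv (Suc n) F)" using symbol_decays_0[OF assms(1), of "Suc n"] assms(2) by auto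
  have "fourier (nderiv (Suc n) F) y = 2 * of_real pi * \<i> * of_real y * fourier (nderiv n F) y"
    by (rule fourier_deriv[OF smooth_on_has_nderiv[OF symbol_smooth[OF assms(1)] UNIV_I] D C])
  moreover define c where "c = 2 * of_real pi * \<i> * complex_of_real y"
  moreover have "c \<noteq> 0" using assms(3) by (simp add: c_def)
  ultimately show ?thesis unfolding c_def[symmetric] by simp
qed

lemma symbol_fourier_eq:
  assumes "symbol p F" "n \<ge> p + 2" "y \<noteq> 0"
  shows "symbol_fourier F y = fourier (nderiv n F) y * inverse (2 * of_real pi * \<i> * of_real y) ^ n"
proof -
  let ?c = "\<lambda>n. fourier (nderiv n F) y * inverse (2 * of_real pi * \<i> * of_real y) ^ n"
  have "?c (n + k) = ?c n" for k
  proof (induction k)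
    case (Suc k)
    then show ?case using symbol_fourier_Suc[OF assms(1) _ assms(3), of "n + k"] assms(2)
      by (simp only: add_Suc_right)
  qed simp
  then have "(\<lambda>k. ?c (k + n)) = (\<lambda>k. ?c n)" by (simp add: add.commute)
  then have "(\<lambda>k. ?c (k + n)) \<longlonglongrightarrow> ?c n" by (simp only: tendsto_const)
  then have "?c \<longlonglongrightarrow> ?c n" by (rule LIMSEQ_offset)
  then show ?thesis unfolding symbol_fourier_def by (rule limI)
qed

text \<open>The factor x in \<theta> costs one power and the derivative regains it, so the order p
  is unchanged. Scalar multiples and F + \<theta> F are both special cases.\<close>

lemma symbol_euler:
  assumes "symbol p F"
  shows "symbol p (\<lambda>x. c * F x + d * euler F x)"
  unfolding symbol_def
proof (intro conjI allI)
  have sm: "smooth_on UNIV F" using assms by (rule symbol_smooth)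
  note sme = smooth_on_euler[OF open_UNIV sm]
  show "smooth_on UNIV (\<lambda>x. c * F x + d * euler F x)" by (intro smooth_on_add smooth_on_cmult sm sme open_UNIV)
  fix n
  obtain C where C: "\<And>x. (1 + \<bar>x\<bar>) ^ n * norm (nderiv n F x) \<le> C * (1 + \<bar>x\<bar>) ^ p"
    using assms unfolding symbol_def by blast
  obtain D where D: "\<And>x. (1 + \<bar>x\<bar>) ^ Suc n * norm (nderiv (Suc n) F x) \<le> D * (1 + \<bar>x\<bar>) ^ p"
    using assms unfolding symbol_def by blast
  have "(1 + \<bar>x\<bar>) ^ n * norm (nderiv n (\<lambda>x. c * F x + d * euler F x) x) \<le>
      (norm c * C + norm d * (D + real n * C)) * (1 + \<bar>x\<bar>) ^ p" for x
  proof -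
    have "nderiv n (\<lambda>x. c * F x + d * euler F x) x =
        c * nderiv n F x + d * (of_real x * nderiv (Suc n) F x + of_nat n * nderiv n F x)"
      using nderiv_plus[OF open_UNIV smooth_on_cmult[OF open_UNIV sm] smooth_on_cmult[OF open_UNIV sme] UNIV_I]
        nderiv_cmult[OF open_UNIV sm UNIV_I] nderiv_cmult[OF open_UNIV sme UNIV_I]
        nderiv_euler[OF open_UNIV sm UNIV_I] by simp
    also have "norm \<dots> \<le> norm c * norm (nderiv n F x) +
        norm d * (\<bar>x\<bar> * norm (nderiv (Suc n) F x) + real n * norm (nderiv n F x))"
      by (intro norm_triangle_le add_mono order_refl) (auto simp: norm_mult intro!: mult_left_mono norm_triangle_le)
    finally have "(1 + \<bar>x\<bar>) ^ n * norm (nderiv n (\<lambda>x. c * F x + d * euler F x) x) \<le> (1 + \<bar>x\<bar>) ^ n * \<dots>"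
      by (intro mult_left_mono) auto
    also have "\<dots> = norm c * ((1 + \<bar>x\<bar>) ^ n * norm (nderiv n F x)) +
        norm d * (\<bar>x\<bar> * ((1 + \<bar>x\<bar>) ^ n * norm (nderiv (Suc n) F x)) + real n * ((1 + \<bar>x\<bar>) ^ n * norm (nderiv n F x)))"
      by (simp add: algebra_simps)
    also have "\<dots> \<le> norm c * (C * (1 + \<bar>x\<bar>) ^ p) + norm d * (D * (1 + \<bar>x\<bar>) ^ p + real n * (C * (1 + \<bar>x\<bar>) ^ p))"
    proof (intro add_mono mult_left_mono C)
      have "\<bar>x\<bar> * ((1 + \<bar>x\<bar>) ^ n * norm (nderiv (Suc n) F x)) \<le> (1 + \<bar>x\<bar>) * ((1 + \<bar>x\<bar>) ^ n * norm (nderiv (Suc n) F x))"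
        by (intro mult_right_mono) auto
      also have "\<dots> \<le> D * (1 + \<bar>x\<bar>) ^ p" using D[of x] by (simp add: mult_ac)
      finally show "\<bar>x\<bar> * ((1 + \<bar>x\<bar>) ^ n * norm (nderiv (Suc n) F x)) \<le> D * (1 + \<bar>x\<bar>) ^ p" .
    qed auto
    finally show ?thesis by (simp add: algebra_simps)
  qed
  then show "\<exists>C. \<forall>x. (1 + \<bar>x\<bar>) ^ n * norm (nderiv n (\<lambda>x. c * F x + d * euler F x) x) \<le> C * (1 + \<bar>x\<bar>) ^ p" by blast
qed

lemma symbol_plus_euler: "symbol p F \<Longrightarrow> symbol p (\<lambda>x. F x + euler F x)"
  using symbol_euler[of p F 1 1] by simp

lemma symbol_mono:
  assumes "symbol p F" "p \<le> q"
  shows "symbol q F"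
  unfolding symbol_def
proof (intro conjI allI)
  show "smooth_on UNIV F" using assms(1) by (rule symbol_smooth)
  fix n
  obtain C where C: "\<And>x. (1 + \<bar>x\<bar>) ^ n * norm (nderiv n F x) \<le> C * (1 + \<bar>x\<bar>) ^ p"
    using assms unfolding symbol_def by blast
  have "C * (1 + \<bar>x\<bar>) ^ p \<le> \<bar>C\<bar> * (1 + \<bar>x\<bar>) ^ q" for x
    using assms(2) by (intro mult_mono power_increasing) auto
  then show "\<exists>C. \<forall>x. (1 + \<bar>x\<bar>) ^ n * norm (nderiv n F x) \<le> C * (1 + \<bar>x\<bar>) ^ q"
    using C order_trans by blast
qed

lemma symbol_fourier_add:
  assumes "symbol p F" "symbol q G" "y \<noteq> 0"
  shows "symbol_fourier (\<lambda>x. F x + G x) y = symbol_fourier F y + symbol_fourier G y"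
proof -
  have FG: "symbol (max p q) F" "symbol (max p q) G" using assms symbol_mono by auto
  have *: "fourier (nderiv n (\<lambda>x. F x + G x)) y = fourier (nderiv n F) y + fourier (nderiv n G) y"
    if "n \<ge> max p q + 2" for n
  proof -
    obtain C where "decays C (nderiv n F)" using symbol_decays_0[OF FG(1) \<open>n \<ge> _\<close>] .
    moreover obtain D where "decays D (nderiv n G)" using symbol_decays_0[OF FG(2) \<open>n \<ge> _\<close>] .
    moreover have "nderiv n (\<lambda>x. F x + G x) = (\<lambda>x. nderiv n F x + nderiv n G x)"
      using nderiv_plus[OF open_UNIV symbol_smooth[OF FG(1)] symbol_smooth[OF FG(2)] UNIV_I] by blast
    ultimately show ?thesis using fourier_add by simp
  qed
  let ?k = "inverse (2 * of_real pi * \<i> * complex_of_real y)"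
  have "eventually (\<lambda>n. fourier (nderiv n (\<lambda>x. F x + G x)) y * ?k ^ n = symbol_fourier F y + symbol_fourier G y) sequentially"
    unfolding eventually_sequentially
  proof (intro exI[of _ "max p q + 2"] allI impI)
    fix n assume n: "max p q + 2 \<le> n"
    show "fourier (nderiv n (\<lambda>x. F x + G x)) y * ?k ^ n = symbol_fourier F y + symbol_fourier G y"
      unfolding *[OF n] symbol_fourier_eq[OF FG(1) n assms(3)] symbol_fourier_eq[OF FG(2) n assms(3)]
      by (simp add: distrib_right)
  qed
  then show ?thesis unfolding symbol_fourier_def[of "\<lambda>x. F x + G x"]
    by (intro limI tendsto_eventually)
qed

lemma symbol_fourier_cmult:
  assumes "symbol p F" "y \<noteq> 0"
  shows "symbol_fourier (\<lambda>x. c * F x) y = c * symbol_fourier F y"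
proof -
  have "symbol p (\<lambda>x. c * F x)" using symbol_euler[OF assms(1), of c 0] by simp
  from symbol_fourier_eq[OF this order_refl assms(2)]
  have "symbol_fourier (\<lambda>x. c * F x) y = fourier (nderiv (p + 2) (\<lambda>x. c * F x)) y * inverse (2 * of_real pi * \<i> * of_real y) ^ (p + 2)" .
  also have "nderiv (p + 2) (\<lambda>x. c * F x) = (\<lambda>x. c * nderiv (p + 2) F x)"
    using nderiv_cmult[OF open_UNIV symbol_smooth[OF assms(1)] UNIV_I] by blast
  finally show ?thesis unfolding fourier_cmult symbol_fourier_eq[OF assms(1) order_refl assms(2)] by simp
qed

lemma inverse_power_has_deriv:
  assumes "y \<noteq> 0" "c \<noteq> 0"
  shows "((\<lambda>y. inverse (c * complex_of_real y) ^ n) has_vector_derivative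
    - (of_nat n / of_real y) * inverse (c * of_real y) ^ n) (at y)"
proof -
  have "((\<lambda>z. inverse (c * z)) has_field_derivative - (inverse (c * of_real y) * c * inverse (c * of_real y))) (at (of_real y))"
    using assms by (auto intro!: derivative_eq_intros)
  from DERIV_power[OF this, of n]
  have "((\<lambda>z. inverse (c * z) ^ n) has_field_derivative - (of_nat n / of_real y) * inverse (c * of_real y) ^ n) (at (of_real y))"
    by (rule DERIV_cong) (use assms in \<open>cases n; simp add: field_simps\<close>)
  from field_vector_diff_chain_at[OF has_vector_derivative_complex_of_real this]
  show ?thesis by (simp add: o_def)
qed

text \<open>For integrable F this is the rule that \<theta> of the transform is minus the transform
  of (x F)' = F + \<theta> F. Here it is verified on the n-th derivative, where the integrals
  converge.\<close>

lemma symbol_fourier_has_deriv: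
  assumes F: "symbol p F" and y: "y \<noteq> 0"
  shows "(symbol_fourier F has_vector_derivative - symbol_fourier (\<lambda>x. F x + euler F x) y / of_real y) (at y)"
proof -
  \<comment> \<open>\<open>fourier_has_deriv\<close> asks for decay of G, x G and x^2 G, that is d =
    2 in \<open>symbol_decays\<close>.\<close>
  define n where "n = p + 4"
  define k where "k y = inverse (2 * of_real pi * \<i> * complex_of_real y)" for y
  define G where "G = nderiv n F"
  define G' where "G' = nderiv (Suc n) F"
  have sm: "smooth_on UNIV F" using F by (rule symbol_smooth)
  obtain C0 where C0: "decays C0 G" using symbol_decays[OF F, of 0 n] unfolding n_def G_def by auto
  obtain C1 where C1: "decays C1 (\<lambda>x. of_real x * G x)" using symbol_decays[OF F, of 1 n] unfolding n_def G_def by auto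
  obtain C2 where C2: "decays C2 (\<lambda>x. (of_real x)\<^sup>2 * G x)" using symbol_decays[OF F, of 2 n] unfolding n_def G_def by auto
  obtain C3 where C3: "decays C3 (\<lambda>x. of_real x * G' x)" using symbol_decays[OF F, of 1 "Suc n"] unfolding n_def G'_def by auto
  have d: "(fourier G has_vector_derivative - 2 * of_real pi * \<i> * fourier (\<lambda>x. of_real x * G x) y) (at y)"
    using fourier_has_deriv[OF C0 C1 C2, of y] unfolding fourier_cmult .
  \<comment> \<open>G + x G' is the derivative of x G; this eliminates the transform of x G in
    favour of terms that occur for F + \<theta> F.\<close>
  have "fourier (\<lambda>x. G x + of_real x * G' x) y = 2 * of_real pi * \<i> * of_real y * fourier (\<lambda>x. of_real x * G x) y"
  proof (rule fourier_deriv[OF _ decays_add[OF C0 C3] C1])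
    show "((\<lambda>x. of_real x * G x) has_vector_derivative G x + of_real x * G' x) (at x)" for x
      using has_vector_derivative_mult[OF has_vector_derivative_complex_of_real smooth_on_has_nderiv[OF sm UNIV_I, of n x]]
      unfolding G_def G'_def by (simp add: add.commute)
  qed
  then have eq: "2 * of_real pi * \<i> * of_real y * fourier (\<lambda>x. of_real x * G x) y = fourier G y + fourier (\<lambda>x. of_real x * G' x) y"
    unfolding fourier_add[OF C0 C3] by simp
  \<comment> \<open>The commutator contributes n G, which matches the derivative of the factor
    y^(-n).\<close>
  have "nderiv n (\<lambda>x. F x + euler F x) x = (of_nat n + 1) * G x + of_real x * G' x" for x
    using nderiv_plus[OF open_UNIV sm smooth_on_euler[OF open_UNIV sm] UNIV_I] nderiv_euler[OF open_UNIV sm UNIV_I]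
    unfolding G_def G'_def by (simp add: algebra_simps)
  then have "nderiv n (\<lambda>x. F x + euler F x) = (\<lambda>x. (of_nat n + 1) * G x + of_real x * G' x)" by blast
  then have "fourier (nderiv n (\<lambda>x. F x + euler F x)) y = (of_nat n + 1) * fourier G y + fourier (\<lambda>x. of_real x * G' x) y"
    using fourier_add[OF decays_cmult[OF C0] C3] fourier_cmult by metis
  then have e1: "symbol_fourier (\<lambda>x. F x + euler F x) y =
      ((of_nat n + 1) * fourier G y + fourier (\<lambda>x. of_real x * G' x) y) * k y ^ n"
    using symbol_fourier_eq[OF symbol_plus_euler[OF F] _ y, of n] unfolding n_def k_def by simp
  have "((\<lambda>y. fourier G y * k y ^ n) has_vector_derivative
      fourier G y * (- (of_nat n / of_real y) * k y ^ n) +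
      (- 2 * of_real pi * \<i> * fourier (\<lambda>x. of_real x * G x) y) * k y ^ n) (at y)"
    unfolding k_def by (intro has_vector_derivative_mult d inverse_power_has_deriv y) simp
  also have "fourier G y * (- (of_nat n / of_real y) * k y ^ n) +
      (- 2 * of_real pi * \<i> * fourier (\<lambda>x. of_real x * G x) y) * k y ^ n =
      - (of_nat n * fourier G y + 2 * of_real pi * \<i> * of_real y * fourier (\<lambda>x. of_real x * G x) y) * k y ^ n / of_real y"
    using y by (simp add: field_simps)
  also have "\<dots> = - symbol_fourier (\<lambda>x. F x + euler F x) y / of_real y"
    unfolding eq e1 by (simp add: algebra_simps)
  finally have "((\<lambda>y. fourier G y * k y ^ n) has_vector_derivative - symbol_fourier (\<lambda>x. F x + euler F x) y / of_real y) (at y)" .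
  then show ?thesis
    by (rule has_vector_derivative_open_congI[OF open_punctured, rotated 2])
       (use y symbol_fourier_eq[OF F, of n] in \<open>auto simp: n_def k_def G_def\<close>)
qed

lemma smooth_on_inverse_x: "smooth_on (- {0}) (\<lambda>x. 1 / of_real x)"
  by (intro smooth_on_divide smooth_on_const smooth_on_of_real open_punctured) auto

text \<open>The derivative is - 1 / y times the transform of another symbol, so differentiability
  propagates to all orders.\<close>

lemma smooth_on_symbol_fourier:
  assumes "symbol p F"
  shows "smooth_on (- {0}) (symbol_fourier F)"
  unfolding smooth_on_iff_C_on
proof
  fix n show "C_on n (- {0}) (symbol_fourier F)"
    using assms
  proof (induction n arbitrary: F)
    case (Suc n)
    have "C_on n (- {0}) (\<lambda>y. (1 / of_real y) * ((-1) * symbol_fourier (\<lambda>x. F x + euler F x) y))"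
      using smooth_on_inverse_x
      by (intro C_on_mult C_on_const open_punctured Suc.IH symbol_plus_euler Suc.prems) (simp add: smooth_on_iff_C_on)
    then have "C_on n (- {0}) (\<lambda>y. - symbol_fourier (\<lambda>x. F x + euler F x) y / of_real y)" by simp
    from C_on_SucI[OF open_punctured symbol_fourier_has_deriv[OF Suc.prems] this] show ?case by simp
  qed simp
qed

lemma euler_symbol_fourier:
  assumes "symbol p F" "y \<noteq> 0"
  shows "euler (symbol_fourier F) y = - symbol_fourier (\<lambda>x. F x + euler F x) y"
  using euler_eqI[OF symbol_fourier_has_deriv[OF assms]] assms(2) by simp

lemma schwartz_symbol:
  assumes "schwartz F"
  shows "symbol 0 F"
  unfolding symbol_def
proof (intro conjI allI)
  show "smooth_on UNIV F" using assms by (rule schwartz_smooth)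
  fix n
  obtain B where B: "schwartz_bound n B F" using assms schwartz_iff by blast
  have b: "norm (nderiv n F x) \<le> B" "\<bar>x\<bar> ^ n * norm (nderiv n F x) \<le> B" for x
    using B[unfolded schwartz_bound_def, rule_format, of n 0 x] B[unfolded schwartz_bound_def, rule_format, of n n x] by auto
  have "(1 + \<bar>x\<bar>) ^ n * norm (nderiv n F x) \<le> (2 ^ n * B) * (1 + \<bar>x\<bar>) ^ 0" for x
  proof (cases "\<bar>x\<bar> \<le> 1")
    case True
    then have "(1 + \<bar>x\<bar>) ^ n \<le> 2 ^ n" by (intro power_mono) auto
    then have "(1 + \<bar>x\<bar>) ^ n * norm (nderiv n F x) \<le> 2 ^ n * B" using b(1) by (intro mult_mono) auto
    then show ?thesis by simp
  next
    case False
    then have "(1 + \<bar>x\<bar>) ^ n \<le> (2 * \<bar>x\<bar>) ^ n" by (intro power_mono) auto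
    then have "(1 + \<bar>x\<bar>) ^ n * norm (nderiv n F x) \<le> (2 * \<bar>x\<bar>) ^ n * norm (nderiv n F x)" by (intro mult_right_mono) auto
    also have "\<dots> \<le> 2 ^ n * B" using b(2)[of x] by (simp add: power_mult_distrib mult.assoc)
    finally show ?thesis by simp
  qed
  then show "\<exists>C. \<forall>x. (1 + \<bar>x\<bar>) ^ n * norm (nderiv n F x) \<le> C * (1 + \<bar>x\<bar>) ^ 0" by blast
qed

lemma symbol_fourier_schwartz:
  assumes "schwartz F" "y \<noteq> 0"
  shows "symbol_fourier F y = fourier F y"
  using symbol_fourier_eq[OF schwartz_symbol[OF assms(1)] order_refl assms(2)] assms(2)
  unfolding fourier_schwartz_nderiv[OF assms(1)] by (simp add: power_mult_distrib field_simps)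

lemma symbol_times_schwartz_decays:
  assumes "symbol p F" "schwartz h"
  obtains C where "decays C (\<lambda>x. nderiv j F x * h x)"
proof -
  obtain C where C: "\<And>x. (1 + \<bar>x\<bar>) ^ j * norm (nderiv j F x) \<le> C * (1 + \<bar>x\<bar>) ^ p"
    using assms(1) unfolding symbol_def by blast
  have C': "norm (nderiv j F x) \<le> C * (1 + \<bar>x\<bar>) ^ p" for x
  proof -
    have "1 * norm (nderiv j F x) \<le> (1 + \<bar>x\<bar>) ^ j * norm (nderiv j F x)"
      by (intro mult_right_mono one_le_power) auto
    then show ?thesis using C[of x] by simp
  qed
  obtain B where B: "schwartz_bound (p + 2) B h" using assms(2) schwartz_iff by blast
  have b: "\<bar>x\<bar> ^ l * norm (h x) \<le> B" if "l \<le> p + 2" for l x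
    using B[unfolded schwartz_bound_def, rule_format, of 0 l x] that by simp
  have C0: "C \<ge> 0" using C'[of 0] order_trans[OF norm_ge_zero, of "nderiv j F 0" C] by simp
  have "norm (nderiv j F x * h x) \<le> (C * (2 ^ (p + 2) * B)) / (1 + x\<^sup>2)" for x
  proof -
    have "(1 + \<bar>x\<bar>) ^ (p + 2) * norm (h x) \<le> 2 ^ (p + 2) * B"
    proof (cases "\<bar>x\<bar> \<le> 1")
      case True
      then have "(1 + \<bar>x\<bar>) ^ (p + 2) \<le> 2 ^ (p + 2)" by (intro power_mono) auto
      then show ?thesis using b[of 0 x] by (intro mult_mono) auto
    next
      case False
      then have "(1 + \<bar>x\<bar>) ^ (p + 2) \<le> (2 * \<bar>x\<bar>) ^ (p + 2)" by (intro power_mono) auto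
      then have "(1 + \<bar>x\<bar>) ^ (p + 2) * norm (h x) \<le> (2 * \<bar>x\<bar>) ^ (p + 2) * norm (h x)" by (intro mult_right_mono) auto
      also have "\<dots> = 2 ^ (p + 2) * (\<bar>x\<bar> ^ (p + 2) * norm (h x))" by (simp only: power_mult_distrib mult.assoc)
      also have "\<dots> \<le> 2 ^ (p + 2) * B" by (intro mult_left_mono b) auto
      finally show ?thesis .
    qed
    moreover have "(1 + x\<^sup>2) * ((1 + \<bar>x\<bar>) ^ p * norm (h x)) \<le> (1 + \<bar>x\<bar>)\<^sup>2 * ((1 + \<bar>x\<bar>) ^ p * norm (h x))"
      by (intro mult_right_mono) (auto simp: power2_sum)
    ultimately have *: "(1 + x\<^sup>2) * ((1 + \<bar>x\<bar>) ^ p * norm (h x)) \<le> 2 ^ (p + 2) * B"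
      by (simp add: power_add power2_eq_square mult_ac)
    have "(1 + x\<^sup>2) * norm (nderiv j F x * h x) \<le> (1 + x\<^sup>2) * (C * (1 + \<bar>x\<bar>) ^ p * norm (h x))"
      unfolding norm_mult by (intro mult_left_mono mult_right_mono C') auto
    also have "\<dots> = C * ((1 + x\<^sup>2) * ((1 + \<bar>x\<bar>) ^ p * norm (h x)))" by (simp add: mult_ac)
    also have "\<dots> \<le> C * (2 ^ (p + 2) * B)" by (intro mult_left_mono * C0)
    finally have "(1 + x\<^sup>2) * norm (nderiv j F x * h x) \<le> C * (2 ^ (p + 2) * B)" .
    moreover have "1 + x\<^sup>2 > 0" by (simp add: add_pos_nonneg)
    ultimately show ?thesis by (simp add: pos_le_divide_eq mult.commute)
  qed
  moreover have "continuous_on UNIV (\<lambda>x. nderiv j F x * h x)"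
    using smooth_on_continuous_on[OF symbol_smooth[OF assms(1)], of j]
      smooth_on_continuous_on[OF schwartz_smooth[OF assms(2)], of 0] by (intro continuous_intros) auto
  ultimately show ?thesis using that unfolding decays_def by blast
qed

lemma integral_symbol_by_parts:
  assumes "symbol p F" "schwartz h"
  shows "integral\<^sup>L lborel (\<lambda>x. nderiv n F x * h x) = (-1) ^ n * integral\<^sup>L lborel (\<lambda>x. F x * nderiv n h x)"
  using assms(2)
proof (induction n arbitrary: h)
  case (Suc n)
  have h': "schwartz (nderiv 1 h)" using Suc.prems by (rule schwartz_nderiv)
  obtain C1 where C1: "decays C1 (\<lambda>x. nderiv n F x * nderiv 1 h x)"
    using symbol_times_schwartz_decays[OF assms(1) h'] .
  obtain C2 where C2: "decays C2 (\<lambda>x. nderiv (Suc n) F x * h x)"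
    using symbol_times_schwartz_decays[OF assms(1) Suc.prems] .
  obtain C3 where C3: "decays C3 (\<lambda>x. nderiv n F x * h x)"
    using symbol_times_schwartz_decays[OF assms(1) Suc.prems] .
  have "((\<lambda>x. nderiv n F x * h x) has_vector_derivative nderiv n F x * nderiv 1 h x + nderiv (Suc n) F x * h x) (at x)" for x
    by (intro has_vector_derivative_mult smooth_on_has_nderiv[OF symbol_smooth[OF assms(1)] UNIV_I]
        smooth_on_has_deriv[OF schwartz_smooth[OF Suc.prems] UNIV_I])
  from integral_deriv_eq_0[OF this decays_add[OF C1 C2] C3]
  have "integral\<^sup>L lborel (\<lambda>x. nderiv n F x * nderiv 1 h x) + integral\<^sup>L lborel (\<lambda>x. nderiv (Suc n) F x * h x) = 0"
    using decays_integrable(1)[OF C1] decays_integrable(1)[OF C2] by simp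
  then have "integral\<^sup>L lborel (\<lambda>x. nderiv (Suc n) F x * h x) = - integral\<^sup>L lborel (\<lambda>x. nderiv n F x * nderiv 1 h x)"
    by (simp add: add_eq_0_iff)
  also have "\<dots> = - ((-1) ^ n * integral\<^sup>L lborel (\<lambda>x. F x * nderiv (Suc n) h x))"
    unfolding Suc.IH[OF h'] nderiv_Suc_right ..
  finally show ?case by simp
qed simp

lemma nderiv_fourier_schwartz:
  assumes "schwartz f"
  shows "nderiv n (fourier f) = fourier (\<lambda>x. (- 2 * of_real pi * \<i> * of_real x) ^ n * f x)"
  using assms
proof (induction n arbitrary: f)
  case (Suc n)
  have s: "schwartz (\<lambda>x. - 2 * of_real pi * \<i> * (of_real x * f x))"
    by (intro schwartz_cmult schwartz_times_x Suc.prems)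
  have "nderiv 1 (fourier f) = fourier (\<lambda>x. - 2 * of_real pi * \<i> * (of_real x * f x))"
    using nderiv_1_eq[OF fourier_schwartz_has_deriv[OF Suc.prems]] by blast
  then have "nderiv (Suc n) (fourier f) = nderiv n (fourier (\<lambda>x. - 2 * of_real pi * \<i> * (of_real x * f x)))"
    by (simp only: nderiv_Suc_right)
  also have "\<dots> = fourier (\<lambda>x. (- 2 * of_real pi * \<i> * of_real x) ^ n * (- 2 * of_real pi * \<i> * (of_real x * f x)))"
    by (rule Suc.IH[OF s])
  finally show ?case by (simp add: mult_ac)
qed simp

text \<open>The factor (2 \<pi> i y)^(-n) passes to \<phi>, whose support avoids 0. After the
  multiplication formula, n integrations by parts differentiate the transform of
  \<open>\<psi>\<close>, which restores (2 \<pi> i y)^n up to a sign that cancels.\<close>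

lemma symbol_fourier_pairing:
  assumes F: "symbol p F" and \<phi>: "\<phi> \<in> test_functions (- {0})"
  shows "fun_dist (- {0}) (symbol_fourier F) \<phi> = dist_fourier (fun_dist UNIV F) \<phi>"
proof -
  \<comment> \<open>p + 2 would give integrability. Two more orders make the transform
    differentiable, hence continuous, so that \<open>lebesgue\<close> may be replaced by
    \<open>lborel\<close>.\<close>
  define n where "n = p + 4"
  define k where "k y = 2 * of_real pi * \<i> * complex_of_real y" for y
  define \<psi> where "\<psi> y = inverse (k y) ^ n * \<phi> y" for y
  have "smooth_on (- {0}) k" unfolding k_def by (intro smooth_on_cmult smooth_on_of_real open_punctured)
  then have "smooth_on (- {0}) (\<lambda>y. inverse (k y) ^ n)"
    by (intro smooth_on_power smooth_on_inverse open_punctured) (auto simp: k_def)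
  from test_functions_mult[OF \<phi> open_punctured this]
  have \<psi>: "\<psi> \<in> test_functions (- {0})" unfolding \<psi>_def .
  have s\<psi>: "schwartz \<psi>" using \<psi> by (rule test_functions_schwartz)
  obtain C where C: "decays C (nderiv n F)" using symbol_decays_0[OF F, of n] unfolding n_def by auto
  obtain C1 where C1: "decays C1 (\<lambda>x. of_real x * nderiv n F x)" using symbol_decays[OF F, of 1 n] unfolding n_def by auto
  obtain C2 where C2: "decays C2 (\<lambda>x. (of_real x)\<^sup>2 * nderiv n F x)" using symbol_decays[OF F, of 2 n] unfolding n_def by auto
  obtain D where D: "decays D \<psi>" using schwartz_decays[OF s\<psi>] .
  have \<phi>0: "\<phi> 0 = 0" using test_functions_eq_0[OF \<phi>] by simp
  have "fun_dist (- {0}) (symbol_fourier F) \<phi> = integral\<^sup>L lebesgue (\<lambda>y. indicator (- {0}) y *\<^sub>R (symbol_fourier F y * \<phi> y))"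
    unfolding fun_dist_def by (subst integral_restrict_space) auto
  also have "(\<lambda>y. indicator (- {0}) y *\<^sub>R (symbol_fourier F y * \<phi> y)) = (\<lambda>y. fourier (nderiv n F) y * \<psi> y)"
    using \<phi>0 symbol_fourier_eq[OF F, of n] by (auto simp: fun_eq_iff indicator_def \<psi>_def k_def n_def)
  also have "integral\<^sup>L lebesgue \<dots> = integral\<^sup>L lborel \<dots>"
  proof -
    have "continuous_on UNIV (fourier (nderiv n F))"
      using fourier_has_deriv[OF C C1 C2, THEN has_vector_derivative_continuous]
      by (simp add: continuous_on_eq_continuous_at)
    then have "continuous_on UNIV (\<lambda>y. fourier (nderiv n F) y * \<psi> y)"
      using D unfolding decays_def by (intro continuous_intros) auto
    then show ?thesis by (intro integral_completion) (simp add: borel_measurable_continuous_onI)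
  qed
  also have "\<dots> = integral\<^sup>L lborel (\<lambda>x. nderiv n F x * fourier \<psi> x)"
    by (rule fourier_multiplication_formula[OF C D])
  also have "\<dots> = (-1) ^ n * integral\<^sup>L lborel (\<lambda>x. F x * nderiv n (fourier \<psi>) x)"
    by (rule integral_symbol_by_parts[OF F schwartz_fourier[OF s\<psi>]])
  also have "nderiv n (fourier \<psi>) = (\<lambda>x. (-1) ^ n * fourier \<phi> x)"
  proof -
    have "(- 2 * of_real pi * \<i> * complex_of_real x) ^ n * \<psi> x = (-1) ^ n * \<phi> x" for x
    proof (cases "x = 0")
      case False
      have "(- 2 * of_real pi * \<i> * complex_of_real x) ^ n = (-1) ^ n * k x ^ n"
        unfolding k_def power_mult_distrib[symmetric] by simp
      moreover have "k x ^ n * inverse (k x) ^ n = 1"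
      proof -
        have "k x \<noteq> 0" using False by (simp add: k_def)
        then show ?thesis by (simp flip: power_mult_distrib)
      qed
      moreover have "(-1) ^ n * k x ^ n * (inverse (k x) ^ n * \<phi> x) = (-1) ^ n * (k x ^ n * inverse (k x) ^ n) * \<phi> x"
        by (simp only: mult_ac)
      ultimately show ?thesis unfolding \<psi>_def by simp
    qed (simp add: \<psi>_def \<phi>0)
    then show ?thesis unfolding nderiv_fourier_schwartz[OF s\<psi>] by (simp add: fourier_cmult fun_eq_iff)
  qed
  also have "(-1) ^ n * integral\<^sup>L lborel (\<lambda>x. F x * ((-1) ^ n * fourier \<phi> x)) = integral\<^sup>L lborel (\<lambda>x. F x * fourier \<phi> x)"
  proof -
    have "(\<lambda>x. F x * ((-1) ^ n * fourier \<phi> x)) = (\<lambda>x. (-1) ^ n * (F x * fourier \<phi> x))" by (simp add: mult_ac)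
    moreover have "(-1) ^ n * ((-1) ^ n * c) = c" for c :: complex
      by (simp flip: power_mult_distrib mult.assoc)
    ultimately show ?thesis by (simp only: integral_mult_right_zero)
  qed
  also have "\<dots> = integral\<^sup>L lebesgue (\<lambda>x. F x * fourier \<phi> x)"
  proof -
    obtain E where "decays E (\<lambda>x. nderiv 0 F x * fourier \<phi> x)"
      using symbol_times_schwartz_decays[OF F schwartz_fourier[OF test_functions_schwartz[OF \<phi>]]] .
    from decays_integrable(3)[OF this] show ?thesis by simp
  qed
  finally show ?thesis unfolding dist_fourier_def fun_dist_def by (simp add: lebesgue_on_UNIV_eq)
qed

section \<open>Inversion, power twist and Fourier transform: continuity of T on singular
  functions\<close>

section \<open>The operator on singular functions\<close>

lemma sgn_abs_powr_eq:
  "x \<noteq> 0 \<Longrightarrow> sgn_abs_powr \<beta> \<eta> x = (if \<eta> = 0 then 1 else of_real (sgn x)) * exp (\<beta> * of_real (ln \<bar>x\<bar>))"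
  by (simp add: sgn_abs_powr_def powr_def Ln_of_real)

lemma norm_sgn_abs_powr: "x \<noteq> 0 \<Longrightarrow> norm (sgn_abs_powr \<beta> \<eta> x) = \<bar>x\<bar> powr Re \<beta>"
  by (simp add: sgn_abs_powr_eq norm_mult norm_sgn powr_def)

lemma ln_abs_has_deriv: "x \<noteq> 0 \<Longrightarrow> ((\<lambda>x. ln \<bar>x\<bar>) has_real_derivative 1 / x) (at x)"
proof (cases "x > 0")
  case True
  have "((\<lambda>x. ln x) has_real_derivative 1 / x) (at x)" using True by (auto intro!: derivative_eq_intros)
  then show ?thesis by (rule has_field_derivative_transform_within_open[of _ _ _ "{0<..}"]) (use True in auto)
next
  case False
  assume "x \<noteq> 0"
  with False have x: "x < 0" by simp
  then have "((\<lambda>x. ln (- x)) has_real_derivative 1 / x) (at x)" by (auto intro!: derivative_eq_intros)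
  then show ?thesis by (rule has_field_derivative_transform_within_open[of _ _ _ "{..<0}"]) (use x in auto)
qed

lemma sgn_abs_powr_has_deriv:
  assumes "x \<noteq> 0"
  shows "(sgn_abs_powr \<beta> \<eta> has_vector_derivative \<beta> / of_real x * sgn_abs_powr \<beta> \<eta> x) (at x)"
proof -
  define c :: complex where "c = (if \<eta> = 0 then 1 else of_real (sgn x))"
  have "((\<lambda>x. complex_of_real (ln \<bar>x\<bar>)) has_vector_derivative of_real (1 / x)) (at x)"
    using ln_abs_has_deriv[OF assms] by (intro has_vector_derivative_of_real)
      (simp add: has_real_derivative_iff_has_vector_derivative)
  moreover have "((\<lambda>z. c * exp (\<beta> * z)) has_field_derivative c * (\<beta> * exp (\<beta> * of_real (ln \<bar>x\<bar>)))) (at (of_real (ln \<bar>x\<bar>)))"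
    by (auto intro!: derivative_eq_intros)
  ultimately have "((\<lambda>x. c * exp (\<beta> * of_real (ln \<bar>x\<bar>))) has_vector_derivative
      of_real (1 / x) * (c * (\<beta> * exp (\<beta> * of_real (ln \<bar>x\<bar>))))) (at x)"
    using field_vector_diff_chain_at by (fastforce simp: o_def)
  then have *: "((\<lambda>x. c * exp (\<beta> * of_real (ln \<bar>x\<bar>))) has_vector_derivative \<beta> / of_real x * sgn_abs_powr \<beta> \<eta> x) (at x)"
    using assms by (simp add: sgn_abs_powr_eq c_def mult_ac)
  show ?thesis
  proof (rule has_vector_derivative_open_congI[OF _ _ _ *])
    \<comment> \<open>This set is the open half line containing x, on which the sign is
      constant.\<close>
    show "open {y. y * x > 0}" by (intro open_Collect_less continuous_intros)
    show "x \<in> {y. y * x > 0}" using assms by (cases x "0::real" rule: linorder_cases) (auto simp: zero_less_mult_iff)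
    fix y assume "y \<in> {y. y * x > 0}"
    then have "y \<noteq> 0" "sgn y = sgn x" by (auto simp: zero_less_mult_iff)
    then show "sgn_abs_powr \<beta> \<eta> y = c * exp (\<beta> * of_real (ln \<bar>y\<bar>))" by (simp add: sgn_abs_powr_eq c_def)
  qed
qed

lemma smooth_on_sgn_abs_powr: "smooth_on (- {0}) (sgn_abs_powr \<beta> \<eta>)"
proof (rule smooth_on_linear_ode[OF open_punctured])
  show "smooth_on (- {0}) (\<lambda>x. \<beta> / of_real x)"
    using smooth_on_cmult[OF open_punctured smooth_on_inverse_x, of \<beta>] by simp
qed (use sgn_abs_powr_has_deriv in auto)

text \<open>The function whose Fourier transform defines \<open>T_op\<close>. On test functions it
  is also the transpose of the inversion and multiplication in \<open>T_star\<close>; this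
  coincidence is the source of the adjointness.\<close>

definition inv_twist :: "complex \<Rightarrow> bit \<Rightarrow> (real \<Rightarrow> complex) \<Rightarrow> real \<Rightarrow> complex" where
  "inv_twist \<alpha> \<eta> f x = (if x = 0 then 0 else f (1 / x) * sgn_abs_powr (- \<alpha> - 1) \<eta> x)"

text \<open>The conjugate of \<theta> under \<open>inv_twist\<close>: inversion reverses the sign of
  \<theta>, and the power contributes - \<alpha> - 1.\<close>

definition inv_euler :: "complex \<Rightarrow> (real \<Rightarrow> complex) \<Rightarrow> real \<Rightarrow> complex" where
  "inv_euler \<alpha> f = (\<lambda>x. (-1) * euler f x + (- (\<alpha> + 1)) * f x)"

lemma smooth_on_comp_inverse:
  assumes "smooth_on (- {0}) f"
  shows "smooth_on (- {0}) (\<lambda>x. f (1 / x))"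
proof (rule smooth_on_compose[OF open_punctured open_punctured assms])
  show "((\<lambda>x. 1 / x) has_real_derivative - (1 / x\<^sup>2)) (at x)" if "x \<in> - {0}" for x
    using that by (auto intro!: derivative_eq_intros simp: power2_eq_square)
  have "smooth_on (- {0}) (\<lambda>x. (-1) * (1 / of_real x * (1 / of_real x)))"
    by (intro smooth_on_cmult smooth_on_mult smooth_on_inverse_x open_punctured)
  then show "smooth_on (- {0}) (\<lambda>x. of_real (- (1 / x\<^sup>2)))" by (simp add: power2_eq_square)
qed auto

lemma smooth_on_inv_twist:
  assumes "smooth_on (- {0}) f"
  shows "smooth_on (- {0}) (inv_twist \<alpha> \<eta> f)"
proof -
  have "smooth_on (- {0}) (\<lambda>x. f (1 / x) * sgn_abs_powr (- \<alpha> - 1) \<eta> x)"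
    by (intro smooth_on_mult smooth_on_comp_inverse smooth_on_sgn_abs_powr assms open_punctured)
  then show ?thesis using smooth_on_cong[OF open_punctured, of "inv_twist \<alpha> \<eta> f"] by (simp add: inv_twist_def)
qed

lemma smooth_on_inv_euler: "smooth_on (- {0}) f \<Longrightarrow> smooth_on (- {0}) (inv_euler \<alpha> f)"
  unfolding inv_euler_def by (intro smooth_on_add smooth_on_cmult smooth_on_euler open_punctured)

lemma euler_inv_twist:
  assumes "smooth_on (- {0}) f"
  shows "euler (inv_twist \<alpha> \<eta> f) = inv_twist \<alpha> \<eta> (inv_euler \<alpha> f)"
proof
  fix x
  show "euler (inv_twist \<alpha> \<eta> f) x = inv_twist \<alpha> \<eta> (inv_euler \<alpha> f) x"
  proof (cases "x = 0")
    case True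
    then show ?thesis by (simp add: euler_def inv_twist_def)
  next
    case False
    have "((\<lambda>x. 1 / x) has_vector_derivative - (1 / x\<^sup>2)) (at x)"
      using False by (auto intro!: derivative_eq_intros simp: power2_eq_square
          simp flip: has_real_derivative_iff_has_vector_derivative)
    moreover have "(f has_vector_derivative nderiv 1 f (1 / x)) (at (1 / x))"
      using smooth_on_has_deriv[OF assms] False by auto
    ultimately have "((\<lambda>x. f (1 / x)) has_vector_derivative (- (1 / x\<^sup>2)) *\<^sub>R nderiv 1 f (1 / x)) (at x)"
      using vector_diff_chain_at[of "\<lambda>x. 1 / x" "- (1 / x\<^sup>2)" x f "nderiv 1 f (1 / x)"] by (simp only: o_def)
    from has_vector_derivative_mult[OF this sgn_abs_powr_has_deriv[OF False, of "- \<alpha> - 1" \<eta>]]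
    have "(inv_twist \<alpha> \<eta> f has_vector_derivative
        f (1 / x) * ((- \<alpha> - 1) / of_real x * sgn_abs_powr (- \<alpha> - 1) \<eta> x) +
        (- (1 / x\<^sup>2)) *\<^sub>R nderiv 1 f (1 / x) * sgn_abs_powr (- \<alpha> - 1) \<eta> x) (at x)"
      by (rule has_vector_derivative_open_congI[OF open_punctured, rotated 2]) (use False in \<open>auto simp: inv_twist_def\<close>)
    moreover have "of_real x * (v * ((- \<alpha> - 1) / of_real x * s) + (- (1 / x\<^sup>2)) *\<^sub>R d * s) =
        ((-1) * (of_real (1 / x) * d) + (- (\<alpha> + 1)) * v) * s" for v s d :: complex
      using False by (simp add: scaleR_conv_of_real power2_eq_square field_simps)
    ultimately show ?thesis
      using False euler_eqI by (simp only: inv_twist_def inv_euler_def euler_def[of f] if_False)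
  qed
qed

lemma euler_pow_inv_twist:
  assumes "smooth_on (- {0}) f"
  shows "(euler ^^ i) (inv_twist \<alpha> \<eta> f) = inv_twist \<alpha> \<eta> ((inv_euler \<alpha> ^^ i) f)"
proof -
  have "(euler ^^ i) (inv_twist \<alpha> \<eta> f) = inv_twist \<alpha> \<eta> ((inv_euler \<alpha> ^^ i) f) \<and> smooth_on (- {0}) ((inv_euler \<alpha> ^^ i) f)"
    by (induction i) (auto simp: assms euler_inv_twist smooth_on_inv_euler)
  then show ?thesis ..
qed

text \<open>Treats \<open>inv_euler\<close> (b = -1) and \<open>shift_euler\<close> (b = 1)
  together. Each application of E costs a factor 1 + |c|; k counts the Euler derivatives still to be
  taken afterwards.\<close>

lemma norm_affine_euler_pow_le:
  assumes z: "z \<noteq> 0" and E: "\<And>f. E f = (\<lambda>x. b * euler f x + c * f x)" and b: "norm b = 1"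
  shows "smooth_on (- {0}) f \<Longrightarrow> (\<And>l. l \<le> i + k \<Longrightarrow> norm ((euler ^^ l) f z) \<le> A) \<Longrightarrow> l \<le> k \<Longrightarrow>
    norm ((euler ^^ l) ((E ^^ i) f) z) \<le> (1 + norm c) ^ i * A"
proof (induction i arbitrary: f A)
  case (Suc i)
  have sm: "smooth_on (- {0}) (\<lambda>x. b * euler f x)" "smooth_on (- {0}) (\<lambda>x. c * f x)"
    by (intro smooth_on_cmult smooth_on_euler open_punctured Suc.prems)+
  have "norm ((euler ^^ l) (E f) z) \<le> (1 + norm c) * A" if "l \<le> i + k" for l
  proof -
    have "(euler ^^ l) (E f) z = b * (euler ^^ Suc l) f z + c * (euler ^^ l) f z"
      unfolding E euler_pow_Suc_right using z
        euler_pow_add[OF open_punctured sm, of z l]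
        euler_pow_cmult[OF open_punctured smooth_on_euler[OF open_punctured Suc.prems(1)], of z l b]
        euler_pow_cmult[OF open_punctured Suc.prems(1), of z l c] by simp
    also have "norm \<dots> \<le> A + norm c * A"
      using Suc.prems(2)[of "Suc l"] Suc.prems(2)[of l] that b
      by (intro norm_triangle_le add_mono) (auto simp: norm_mult mult_left_mono simp del: funpow.simps)
    finally show ?thesis by (simp add: algebra_simps)
  qed
  moreover have "smooth_on (- {0}) (E f)" unfolding E by (intro smooth_on_add sm open_punctured)
  ultimately have "norm ((euler ^^ l) ((E ^^ i) (E f)) z) \<le> (1 + norm c) ^ i * ((1 + norm c) * A)"
    using Suc.IH[of "E f"] Suc.prems(3) by blast
  then show ?case by (simp add: funpow_swap1 mult_ac)
qed simp

text \<open>At 1 / x decay becomes flatness: the weight j = N yields |x|^(a + N) near 0, while j = 0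
  yields growth |x|^a at infinity. The integer q absorbs the power |x|^(- Re \<alpha> - 1) on either
  side.\<close>

lemma inv_twist_euler_bound:
  assumes f: "smooth_on (- {0}) f" "sing_bound a N B f" and q: "real q \<ge> \<bar>Re \<alpha> + 1\<bar>" "q \<le> N"
    and i: "i \<le> N" and x: "x \<noteq> 0"
  shows "\<bar>x\<bar> \<le> 1 \<Longrightarrow> norm ((euler ^^ i) (inv_twist \<alpha> \<eta> f) x) \<le> (2 + norm \<alpha>) ^ N * B * \<bar>x\<bar> ^ (a + N - q)"
    and "\<bar>x\<bar> \<ge> 1 \<Longrightarrow> norm ((euler ^^ i) (inv_twist \<alpha> \<eta> f) x) \<le> (2 + norm \<alpha>) ^ N * B * \<bar>x\<bar> ^ (a + q)"
proof -
  define K where "K = (2 + norm \<alpha>) ^ N"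
  have B0: "B \<ge> 0" using f(2) by (rule sing_bound_nonneg)
  have main: "norm ((euler ^^ i) (inv_twist \<alpha> \<eta> f) x) \<le> K * (B * \<bar>x\<bar> ^ (a + j)) * \<bar>x\<bar> powr (- Re \<alpha> - 1)"
    if j: "j \<le> N" for j
  proof -
    have z: "1 / x \<noteq> 0" using x by simp
    have "norm ((euler ^^ 0) ((inv_euler \<alpha> ^^ i) f) (1 / x)) \<le> (1 + norm (- (\<alpha> + 1))) ^ i * (B * \<bar>x\<bar> ^ (a + j))"
    proof (rule norm_affine_euler_pow_le[where k = 0, OF z _ _ f(1)])
      show "inv_euler \<alpha> f = (\<lambda>x. (-1) * euler f x + (- (\<alpha> + 1)) * f x)" for f by (simp add: inv_euler_def)
      fix l assume "l \<le> i + 0"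
      then show "norm ((euler ^^ l) f (1 / x)) \<le> B * \<bar>x\<bar> ^ (a + j)"
        using sing_boundD[OF f(2) z, of l j] i j x by (simp add: power_divide field_simps)
    qed auto
    also have "\<dots> \<le> K * (B * \<bar>x\<bar> ^ (a + j))"
    proof (intro mult_right_mono)
      have "norm (- (\<alpha> + 1)) \<le> norm \<alpha> + 1" using norm_triangle_ineq[of \<alpha> 1] by (simp only: norm_minus_cancel norm_one)
      then have "(1 + norm (- (\<alpha> + 1))) ^ i \<le> (2 + norm \<alpha>) ^ i" by (intro power_mono) auto
      also have "\<dots> \<le> K" unfolding K_def using i by (intro power_increasing) auto
      finally show "(1 + norm (- (\<alpha> + 1))) ^ i \<le> K" .
    qed (use B0 in auto)
    finally have "norm ((inv_euler \<alpha> ^^ i) f (1 / x)) \<le> K * (B * \<bar>x\<bar> ^ (a + j))" by simp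
    then have "norm ((inv_euler \<alpha> ^^ i) f (1 / x)) * \<bar>x\<bar> powr (- Re \<alpha> - 1) \<le>
        K * (B * \<bar>x\<bar> ^ (a + j)) * \<bar>x\<bar> powr (- Re \<alpha> - 1)" by (intro mult_right_mono) auto
    then show ?thesis
      unfolding euler_pow_inv_twist[OF f(1)] inv_twist_def using x by (simp add: norm_mult norm_sgn_abs_powr)
  qed
  have K0: "K \<ge> 0" unfolding K_def by simp
  show "norm ((euler ^^ i) (inv_twist \<alpha> \<eta> f) x) \<le> (2 + norm \<alpha>) ^ N * B * \<bar>x\<bar> ^ (a + N - q)" if x1: "\<bar>x\<bar> \<le> 1"
  proof -
    have "\<bar>x\<bar> powr (- Re \<alpha> - 1) \<le> \<bar>x\<bar> powr (- real q)" using q x x1 by (intro powr_mono') auto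
    also have "\<dots> = 1 / \<bar>x\<bar> ^ q" using x by (simp add: powr_minus powr_realpow divide_inverse)
    finally have p: "\<bar>x\<bar> powr (- Re \<alpha> - 1) \<le> 1 / \<bar>x\<bar> ^ q" .
    have "norm ((euler ^^ i) (inv_twist \<alpha> \<eta> f) x) \<le> K * (B * \<bar>x\<bar> ^ (a + N)) * (1 / \<bar>x\<bar> ^ q)"
      by (rule order_trans[OF main[OF order_refl] mult_left_mono[OF p]]) (use K0 B0 in simp)
    also have "\<dots> = K * B * (\<bar>x\<bar> ^ (a + N) / \<bar>x\<bar> ^ q)" by simp
    also have "\<bar>x\<bar> ^ (a + N) / \<bar>x\<bar> ^ q = \<bar>x\<bar> ^ (a + N - q)" using x q by (simp add: power_diff)
    finally show ?thesis unfolding K_def .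
  qed
  show "norm ((euler ^^ i) (inv_twist \<alpha> \<eta> f) x) \<le> (2 + norm \<alpha>) ^ N * B * \<bar>x\<bar> ^ (a + q)" if x1: "\<bar>x\<bar> \<ge> 1"
  proof -
    have "\<bar>x\<bar> powr (- Re \<alpha> - 1) \<le> \<bar>x\<bar> powr (real q)" using q x x1 by (intro powr_mono) auto
    also have "\<dots> = \<bar>x\<bar> ^ q" using x by (simp add: powr_realpow)
    finally have p: "\<bar>x\<bar> powr (- Re \<alpha> - 1) \<le> \<bar>x\<bar> ^ q" .
    have "norm ((euler ^^ i) (inv_twist \<alpha> \<eta> f) x) \<le> K * (B * \<bar>x\<bar> ^ (a + 0)) * \<bar>x\<bar> ^ q"
      by (rule order_trans[OF main[of 0] mult_left_mono[OF p]]) (use K0 B0 in auto)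
    then show ?thesis unfolding K_def by (simp add: power_add mult_ac)
  qed
qed

text \<open>Of the a + N - q powers available near 0, n pay for the passage from Euler to ordinary
  derivatives, and two remain for the flatness criterion. This is the origin of q + n + 2 \<le>
  N.\<close>

lemma inv_twist_nderiv_bound:
  assumes f: "smooth_on (- {0}) f" "sing_bound a N B f" and q: "real q \<ge> \<bar>Re \<alpha> + 1\<bar>" "q + n + 2 \<le> N" and x: "x \<noteq> 0"
  shows "\<bar>x\<bar> \<le> 1 \<Longrightarrow> norm (nderiv n (inv_twist \<alpha> \<eta> f) x) \<le> fact n * ((2 + norm \<alpha>) ^ N * B) * x\<^sup>2"
    and "\<bar>x\<bar> \<ge> 1 \<Longrightarrow> \<bar>x\<bar> ^ n * norm (nderiv n (inv_twist \<alpha> \<eta> f) x) \<le> fact n * ((2 + norm \<alpha>) ^ N * B) * \<bar>x\<bar> ^ (a + q)"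
proof -
  have B0: "(2 + norm \<alpha>) ^ N * B \<ge> 0" using sing_bound_nonneg[OF f(2)] by simp
  have N: "q \<le> N" "n \<le> N" using q by auto
  have nd: "\<bar>x\<bar> ^ n * norm (nderiv n (inv_twist \<alpha> \<eta> f) x) \<le> fact n * A"
    if "\<And>i. i \<le> n \<Longrightarrow> norm ((euler ^^ i) (inv_twist \<alpha> \<eta> f) x) \<le> A" for A
    using norm_nderiv_le_euler[OF open_punctured _ smooth_on_inv_twist[OF f(1)]] x that by auto
  show "norm (nderiv n (inv_twist \<alpha> \<eta> f) x) \<le> fact n * ((2 + norm \<alpha>) ^ N * B) * x\<^sup>2" if x1: "\<bar>x\<bar> \<le> 1"
  proof -
    have "\<bar>x\<bar> ^ n * norm (nderiv n (inv_twist \<alpha> \<eta> f) x) \<le> fact n * ((2 + norm \<alpha>) ^ N * B * \<bar>x\<bar> ^ (a + N - q))"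
      by (rule nd) (use inv_twist_euler_bound(1)[OF f q(1) N(1) _ x x1] N in auto)
    also have "\<dots> \<le> fact n * ((2 + norm \<alpha>) ^ N * B * \<bar>x\<bar> ^ (n + 2))"
      using q x1 B0 by (intro mult_left_mono power_decreasing) auto
    also have "\<dots> = \<bar>x\<bar> ^ n * (fact n * ((2 + norm \<alpha>) ^ N * B) * x\<^sup>2)" by (simp add: power_add power2_eq_square)
    finally show ?thesis by (rule mult_left_le_imp_le) (use x in simp)
  qed
  show "\<bar>x\<bar> ^ n * norm (nderiv n (inv_twist \<alpha> \<eta> f) x) \<le> fact n * ((2 + norm \<alpha>) ^ N * B) * \<bar>x\<bar> ^ (a + q)" if x1: "\<bar>x\<bar> \<ge> 1"
    using nd[of "(2 + norm \<alpha>) ^ N * B * \<bar>x\<bar> ^ (a + q)"] inv_twist_euler_bound(2)[OF f q(1) N(1) _ x x1] N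
    by (auto simp: mult.assoc)
qed

lemma smooth_on_UNIV_inv_twist:
  assumes "f \<in> sing_class a"
  shows "smooth_on UNIV (inv_twist \<alpha> \<eta> f)" "nderiv n (inv_twist \<alpha> \<eta> f) 0 = 0"
proof -
  obtain q :: nat where q: "real q \<ge> \<bar>Re \<alpha> + 1\<bar>" using real_arch_simple by blast
  have flat: "\<exists>C. \<exists>\<delta>>0. \<forall>x. x \<noteq> 0 \<longrightarrow> \<bar>x\<bar> < \<delta> \<longrightarrow> norm (nderiv i (inv_twist \<alpha> \<eta> f) x) \<le> C * x\<^sup>2" for i
  proof -
    obtain B where B: "sing_bound a (q + i + 2) B f" using assms by (rule sing_classE)
    show ?thesis
      by (intro exI[of _ "fact i * ((2 + norm \<alpha>) ^ (q + i + 2) * B)"] exI[of _ 1] conjI allI impI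
          inv_twist_nderiv_bound(1)[OF sing_classD[OF assms] B q]) auto
  qed
  then show sm: "smooth_on UNIV (inv_twist \<alpha> \<eta> f)"
    by (intro smooth_on_flat_extension smooth_on_inv_twist[OF sing_classD[OF assms]]) (auto simp: inv_twist_def)
  obtain C \<delta> where \<delta>: "\<delta> > 0" "\<And>x. x \<noteq> 0 \<Longrightarrow> \<bar>x\<bar> < \<delta> \<Longrightarrow> norm (nderiv n (inv_twist \<alpha> \<eta> f) x) \<le> C * x\<^sup>2"
    using flat[of n] by blast
  have "(nderiv n (inv_twist \<alpha> \<eta> f) \<longlongrightarrow> 0) (at 0)"
  proof (rule Lim_null_comparison)
    show "eventually (\<lambda>x. norm (nderiv n (inv_twist \<alpha> \<eta> f) x) \<le> C * x\<^sup>2) (at 0)"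
      unfolding eventually_at using \<delta> by (intro exI[of _ \<delta>]) auto
    have "((\<lambda>x::real. C * x\<^sup>2) \<longlongrightarrow> C * 0\<^sup>2) (at 0)" by (intro tendsto_intros)
    then show "((\<lambda>x::real. C * x\<^sup>2) \<longlongrightarrow> 0) (at 0)" by simp
  qed
  moreover have "(nderiv n (inv_twist \<alpha> \<eta> f) \<longlongrightarrow> nderiv n (inv_twist \<alpha> \<eta> f) 0) (at 0)"
    using smooth_on_isCont[OF sm, of 0 n] by (simp add: isCont_def)
  ultimately show "nderiv n (inv_twist \<alpha> \<eta> f) 0 = 0" using tendsto_unique[OF at_neq_bot] by blast
qed

text \<open>The growth a + q stems from the singularity of f at 0. Near the origin the function is
  flat, and boundedness of its derivatives is enough there.\<close>

lemma symbol_inv_twist: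
  assumes "f \<in> sing_class a" and q: "real q \<ge> \<bar>Re \<alpha> + 1\<bar>"
  shows "symbol (a + q) (inv_twist \<alpha> \<eta> f)"
  unfolding symbol_def
proof (intro conjI allI)
  show "smooth_on UNIV (inv_twist \<alpha> \<eta> f)" using smooth_on_UNIV_inv_twist[OF assms(1)] by blast
  fix n
  obtain B where B: "sing_bound a (q + n + 2) B f" using assms(1) by (rule sing_classE)
  define M where "M = fact n * ((2 + norm \<alpha>) ^ (q + n + 2) * B)"
  have M0: "M \<ge> 0" unfolding M_def using sing_bound_nonneg[OF B] by simp
  note b = inv_twist_nderiv_bound[OF sing_classD[OF assms(1)] B q order_refl, of _ \<eta>, folded M_def]
  have "(1 + \<bar>x\<bar>) ^ n * norm (nderiv n (inv_twist \<alpha> \<eta> f) x) \<le> (2 ^ n * M) * (1 + \<bar>x\<bar>) ^ (a + q)" for x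
  proof (cases "\<bar>x\<bar> \<le> 1")
    case True
    have "norm (nderiv n (inv_twist \<alpha> \<eta> f) x) \<le> M"
    proof (cases "x = 0")
      case False
      have "M * x\<^sup>2 \<le> M * 1" using True M0 by (intro mult_left_mono) (auto simp: abs_square_le_1)
      then show ?thesis using b(1)[OF False True] by simp
    qed (use smooth_on_UNIV_inv_twist(2)[OF assms(1)] M0 in simp)
    moreover have "(1 + \<bar>x\<bar>) ^ n \<le> 2 ^ n" using True by (intro power_mono) auto
    ultimately have "(1 + \<bar>x\<bar>) ^ n * norm (nderiv n (inv_twist \<alpha> \<eta> f) x) \<le> 2 ^ n * M" by (intro mult_mono) auto
    also have "\<dots> \<le> (2 ^ n * M) * (1 + \<bar>x\<bar>) ^ (a + q)"
      using M0 mult_left_mono[of 1 "(1 + \<bar>x\<bar>) ^ (a + q)" "2 ^ n * M"] by (simp add: one_le_power)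
    finally show ?thesis .
  next
    case False
    then have x: "x \<noteq> 0" "\<bar>x\<bar> \<ge> 1" by auto
    then have "(1 + \<bar>x\<bar>) ^ n \<le> (2 * \<bar>x\<bar>) ^ n" by (intro power_mono) auto
    then have "(1 + \<bar>x\<bar>) ^ n * norm (nderiv n (inv_twist \<alpha> \<eta> f) x) \<le> (2 * \<bar>x\<bar>) ^ n * norm (nderiv n (inv_twist \<alpha> \<eta> f) x)"
      by (intro mult_right_mono) auto
    also have "\<dots> = 2 ^ n * (\<bar>x\<bar> ^ n * norm (nderiv n (inv_twist \<alpha> \<eta> f) x))" by (simp add: power_mult_distrib mult.assoc)
    also have "\<dots> \<le> 2 ^ n * (M * \<bar>x\<bar> ^ (a + q))" using b(2)[OF x] by (intro mult_left_mono) auto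
    also have "\<dots> \<le> 2 ^ n * (M * (1 + \<bar>x\<bar>) ^ (a + q))" using M0 by (intro mult_left_mono power_mono) auto
    finally show ?thesis by (simp add: mult.assoc)
  qed
  then show "\<exists>C. \<forall>x. (1 + \<bar>x\<bar>) ^ n * norm (nderiv n (inv_twist \<alpha> \<eta> f) x) \<le> C * (1 + \<bar>x\<bar>) ^ (a + q)" by blast
qed

text \<open>The constant is linear in the norm B of f. The symbol property alone would not give
  continuity of the operator.\<close>

lemma inv_twist_decays:
  assumes "f \<in> sing_class a" and q: "real q \<ge> \<bar>Re \<alpha> + 1\<bar>"
    and n: "n \<ge> a + q + 2" and B: "sing_bound a N B f" "q + n + 2 \<le> N"
  shows "decays (2 * (fact n * ((2 + norm \<alpha>) ^ N * B))) (nderiv n (inv_twist \<alpha> \<eta> f))"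
  unfolding decays_def
proof (intro conjI allI)
  show "continuous_on UNIV (nderiv n (inv_twist \<alpha> \<eta> f))"
    using smooth_on_continuous_on smooth_on_UNIV_inv_twist(1)[OF assms(1)] by blast
  fix x :: real
  define M where "M = fact n * ((2 + norm \<alpha>) ^ N * B)"
  have M0: "M \<ge> 0" unfolding M_def using sing_bound_nonneg[OF B(1)] by simp
  note b = inv_twist_nderiv_bound[OF sing_classD[OF assms(1)] B(1) q B(2), of _ \<eta>, folded M_def]
  have pos: "1 + x\<^sup>2 > 0" by (simp add: add_pos_nonneg)
  have "(1 + x\<^sup>2) * norm (nderiv n (inv_twist \<alpha> \<eta> f) x) \<le> 2 * M"
  proof (cases "\<bar>x\<bar> \<le> 1")
    case True
    then have x2: "x\<^sup>2 \<le> 1" by (simp add: abs_square_le_1)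
    have "norm (nderiv n (inv_twist \<alpha> \<eta> f) x) \<le> M"
    proof (cases "x = 0")
      case False
      have "M * x\<^sup>2 \<le> M * 1" using x2 M0 by (intro mult_left_mono) auto
      then show ?thesis using b(1)[OF False True] by simp
    qed (use smooth_on_UNIV_inv_twist(2)[OF assms(1)] M0 in simp)
    then show ?thesis using x2 by (intro mult_mono) auto
  next
    case False
    then have x: "x \<noteq> 0" "\<bar>x\<bar> \<ge> 1" by auto
    have "\<bar>x\<bar> ^ (a + q) * (\<bar>x\<bar>\<^sup>2 * norm (nderiv n (inv_twist \<alpha> \<eta> f) x)) = \<bar>x\<bar> ^ (a + q + 2) * norm (nderiv n (inv_twist \<alpha> \<eta> f) x)"
      by (simp only: power_add mult.assoc)
    also have "\<dots> \<le> \<bar>x\<bar> ^ n * norm (nderiv n (inv_twist \<alpha> \<eta> f) x)"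
      using x n by (intro mult_right_mono power_increasing) auto
    also have "\<dots> \<le> \<bar>x\<bar> ^ (a + q) * M" using b(2)[OF x] by (simp add: mult.commute)
    finally have x2: "\<bar>x\<bar>\<^sup>2 * norm (nderiv n (inv_twist \<alpha> \<eta> f) x) \<le> M"
      by (rule mult_left_le_imp_le) (use x in simp)
    have "1 * norm (nderiv n (inv_twist \<alpha> \<eta> f) x) \<le> \<bar>x\<bar>\<^sup>2 * norm (nderiv n (inv_twist \<alpha> \<eta> f) x)"
      using x by (intro mult_right_mono one_le_power) auto
    with x2 show ?thesis by (simp add: algebra_simps)
  qed
  then show "norm (nderiv n (inv_twist \<alpha> \<eta> f) x) \<le> 2 * (fact n * ((2 + norm \<alpha>) ^ N * B)) / (1 + x\<^sup>2)"
    unfolding M_def[symmetric] using pos by (simp add: pos_le_divide_eq mult.commute)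
qed

text \<open>An explicit representative of \<open>T_op\<close>, which is fixed by \<open>SOME\<close>
  only; the two agree off 0.\<close>

definition T_fun :: "complex \<Rightarrow> bit \<Rightarrow> (real \<Rightarrow> complex) \<Rightarrow> real \<Rightarrow> complex" where
  "T_fun \<alpha> \<eta> f = symbol_fourier (inv_twist \<alpha> \<eta> f)"

lemma smooth_on_T_fun: "f \<in> sing_space \<Longrightarrow> smooth_on (- {0}) (T_fun \<alpha> \<eta> f)"
  unfolding T_fun_def sing_space_def
  using smooth_on_symbol_fourier[OF symbol_inv_twist] real_arch_simple by blast

lemma sing_space_symbolE:
  assumes "f \<in> sing_space"
  obtains p where "symbol p (inv_twist \<alpha> \<eta> f)"
proof -
  obtain q :: nat where "real q \<ge> \<bar>Re \<alpha> + 1\<bar>" using real_arch_simple by blast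
  then show ?thesis using that assms symbol_inv_twist unfolding sing_space_def by blast
qed

lemma T_fun_add:
  assumes "f \<in> sing_space" "g \<in> sing_space" "y \<noteq> 0"
  shows "T_fun \<alpha> \<eta> (\<lambda>x. f x + g x) y = T_fun \<alpha> \<eta> f y + T_fun \<alpha> \<eta> g y"
proof -
  obtain p where p: "symbol p (inv_twist \<alpha> \<eta> f)" using sing_space_symbolE[OF assms(1)] .
  obtain q where q: "symbol q (inv_twist \<alpha> \<eta> g)" using sing_space_symbolE[OF assms(2)] .
  have "inv_twist \<alpha> \<eta> (\<lambda>x. f x + g x) = (\<lambda>x. inv_twist \<alpha> \<eta> f x + inv_twist \<alpha> \<eta> g x)"
    by (simp add: inv_twist_def fun_eq_iff distrib_right)
  then show ?thesis unfolding T_fun_def using symbol_fourier_add[OF p q assms(3)] by simp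
qed

lemma T_fun_cmult:
  assumes "f \<in> sing_space" "y \<noteq> 0"
  shows "T_fun \<alpha> \<eta> (\<lambda>x. c * f x) y = c * T_fun \<alpha> \<eta> f y"
proof -
  obtain p where p: "symbol p (inv_twist \<alpha> \<eta> f)" using sing_space_symbolE[OF assms(1)] .
  have "inv_twist \<alpha> \<eta> (\<lambda>x. c * f x) = (\<lambda>x. c * inv_twist \<alpha> \<eta> f x)"
    by (simp add: inv_twist_def fun_eq_iff)
  then show ?thesis unfolding T_fun_def using symbol_fourier_cmult[OF p assms(2)] by simp
qed

definition shift_euler :: "complex \<Rightarrow> (real \<Rightarrow> complex) \<Rightarrow> real \<Rightarrow> complex" where
  "shift_euler \<alpha> f = (\<lambda>x. euler f x + \<alpha> * f x)"

lemma sing_class_shift_euler: "f \<in> sing_class a \<Longrightarrow> (shift_euler \<alpha> ^^ i) f \<in> sing_class a"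
  by (induction i) (auto simp: shift_euler_def[of \<alpha> "_ _ _"] intro!: sing_class_add sing_class_cmult sing_class_euler)

text \<open>\<theta> acts on transforms as - (1 + \<theta>) under the integral, and 1 - (\<theta> +
  \<alpha> + 1) = - (\<theta> + \<alpha>) after conjugation by \<open>inv_twist\<close>; the two
  signs cancel.\<close>

lemma euler_T_fun:
  assumes f: "f \<in> sing_class a" and y: "y \<noteq> 0"
  shows "euler (T_fun \<alpha> \<eta> f) y = T_fun \<alpha> \<eta> (shift_euler \<alpha> f) y"
proof -
  obtain q :: nat where q: "real q \<ge> \<bar>Re \<alpha> + 1\<bar>" using real_arch_simple by blast
  have s: "shift_euler \<alpha> f \<in> sing_class a" using sing_class_shift_euler[OF f, where \<alpha> = \<alpha> and i = 1] by simp
  have "euler (T_fun \<alpha> \<eta> f) y = - symbol_fourier (\<lambda>x. inv_twist \<alpha> \<eta> f x + euler (inv_twist \<alpha> \<eta> f) x) y"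
    unfolding T_fun_def by (rule euler_symbol_fourier[OF symbol_inv_twist[OF f q] y])
  also have "(\<lambda>x. inv_twist \<alpha> \<eta> f x + euler (inv_twist \<alpha> \<eta> f) x) = (\<lambda>x. (-1) * inv_twist \<alpha> \<eta> (shift_euler \<alpha> f) x)"
    unfolding euler_inv_twist[OF sing_classD[OF f]]
    by (auto simp: inv_twist_def inv_euler_def shift_euler_def fun_eq_iff algebra_simps)
  also have "- symbol_fourier \<dots> y = T_fun \<alpha> \<eta> (shift_euler \<alpha> f) y"
    unfolding symbol_fourier_cmult[OF symbol_inv_twist[OF s q] y] T_fun_def by simp
  finally show ?thesis .
qed

lemma euler_pow_T_fun:
  assumes f: "f \<in> sing_class a" and y: "y \<noteq> 0"
  shows "(euler ^^ i) (T_fun \<alpha> \<eta> f) y = T_fun \<alpha> \<eta> ((shift_euler \<alpha> ^^ i) f) y"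
  using y
proof (induction i arbitrary: y)
  case (Suc i)
  have "euler ((euler ^^ i) (T_fun \<alpha> \<eta> f)) y = euler (T_fun \<alpha> \<eta> ((shift_euler \<alpha> ^^ i) f)) y"
    by (rule euler_cong[OF open_punctured]) (use Suc in auto)
  also have "\<dots> = T_fun \<alpha> \<eta> (shift_euler \<alpha> ((shift_euler \<alpha> ^^ i) f)) y"
    by (rule euler_T_fun[OF sing_class_shift_euler[OF f] Suc.prems])
  finally show ?case by simp
qed simp

lemma sing_bound_shift_euler:
  assumes "f \<in> sing_class a" "sing_bound a (N + i) B f"
  shows "sing_bound a N ((1 + norm \<alpha>) ^ i * B) ((shift_euler \<alpha> ^^ i) f)"
  unfolding sing_bound_def
proof (intro allI impI)
  fix x :: real and l j assume *: "x \<noteq> 0" "l \<le> N" "j \<le> N"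
  have "norm ((euler ^^ l) ((shift_euler \<alpha> ^^ i) f) x) \<le> (1 + norm \<alpha>) ^ i * (B / \<bar>x\<bar> ^ (a + j))"
  proof (rule norm_affine_euler_pow_le[where k = N, OF *(1) _ _ sing_classD[OF assms(1)] _ *(2)])
    show "shift_euler \<alpha> f = (\<lambda>x. 1 * euler f x + \<alpha> * f x)" for f by (simp add: shift_euler_def)
    fix l assume "l \<le> i + N"
    then show "norm ((euler ^^ l) f x) \<le> B / \<bar>x\<bar> ^ (a + j)"
      using sing_boundD[OF assms(2) *(1), of l j] * by (simp add: field_simps)
  qed simp
  then show "\<bar>x\<bar> ^ (a + j) * norm ((euler ^^ l) ((shift_euler \<alpha> ^^ i) f) x) \<le> (1 + norm \<alpha>) ^ i * B"
    using * by (simp add: field_simps)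
qed

text \<open>|y|^n cancels against (2 \<pi> |y|)^(-n), and the remaining (2 \<pi>)^(-n) is at most
  1.\<close>

lemma norm_T_fun_le:
  assumes "f \<in> sing_class a" and q: "real q \<ge> \<bar>Re \<alpha> + 1\<bar>"
    and n: "n \<ge> a + q + 2" and B: "sing_bound a N B f" "q + n + 2 \<le> N" and y: "y \<noteq> 0"
  shows "\<bar>y\<bar> ^ n * norm (T_fun \<alpha> \<eta> f y) \<le> 2 * (fact n * ((2 + norm \<alpha>) ^ N * B)) * (\<integral>x. 1 / (1 + x\<^sup>2) \<partial>lborel)"
proof -
  have *: "T_fun \<alpha> \<eta> f y = fourier (nderiv n (inv_twist \<alpha> \<eta> f)) y * inverse (2 * of_real pi * \<i> * of_real y) ^ n"
    unfolding T_fun_def by (rule symbol_fourier_eq[OF symbol_inv_twist[OF assms(1) q] n y])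
  have "\<bar>y\<bar> ^ n * norm (T_fun \<alpha> \<eta> f y) =
      (\<bar>y\<bar> * inverse (2 * pi * \<bar>y\<bar>)) ^ n * norm (fourier (nderiv n (inv_twist \<alpha> \<eta> f)) y)"
    unfolding * power_mult_distrib[of "\<bar>y\<bar>"] by (simp add: norm_mult norm_power norm_inverse)
  also have "\<dots> = inverse (2 * pi) ^ n * norm (fourier (nderiv n (inv_twist \<alpha> \<eta> f)) y)"
  proof -
    have "\<bar>y\<bar> * inverse (2 * pi * \<bar>y\<bar>) = inverse (2 * pi)" using y by (simp add: field_simps)
    then show ?thesis by (simp only:)
  qed
  also have "\<dots> \<le> 1 * norm (fourier (nderiv n (inv_twist \<alpha> \<eta> f)) y)"
  proof (intro mult_right_mono power_le_one)
    show "inverse (2 * pi) \<le> 1" using pi_ge_two by (simp add: field_simps)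
  qed auto
  also have "\<dots> \<le> 2 * (fact n * ((2 + norm \<alpha>) ^ N * B)) * (\<integral>x. 1 / (1 + x\<^sup>2) \<partial>lborel)"
    using norm_fourier_le[OF inv_twist_decays[OF assms(1) q n B]] by simp
  finally show ?thesis .
qed

text \<open>Each weight has its own n = a + q + 2 + j: the least admissible n limits the singularity
  at 0, larger ones give decay at infinity.\<close>

lemma T_fun_sing_bound:
  assumes q: "real q \<ge> \<bar>Re \<alpha> + 1\<bar>"
  shows "\<exists>N. \<exists>C\<ge>0. \<forall>f\<in>sing_class a. \<forall>B. sing_bound a N B f \<longrightarrow> sing_bound (a + q + 2) M (C * B) (T_fun \<alpha> \<eta> f)"
proof -
  \<comment> \<open>This is q + n + 2 for the largest n, which is a + q + 2 + M. The bound on f is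
    taken with N + M because up to M powers of \<open>shift_euler\<close> are applied first.\<close>
  define N where "N = q + (a + q + 2 + M) + 2"
  define I :: real where "I = (\<integral>x. 1 / (1 + x\<^sup>2) \<partial>lborel)"
  have I0: "I \<ge> 0" unfolding I_def by (intro integral_nonneg_AE) auto
  define C where "C = 2 * (fact (a + q + 2 + M) * ((2 + norm \<alpha>) ^ N * (1 + norm \<alpha>) ^ M)) * I"
  have "sing_bound (a + q + 2) M (C * B) (T_fun \<alpha> \<eta> f)" if f: "f \<in> sing_class a" "sing_bound a (N + M) B f" for f B
    unfolding sing_bound_def
  proof (intro allI impI)
    fix y :: real and i j assume *: "y \<noteq> 0" "i \<le> M" "j \<le> M"
    have B0: "B \<ge> 0" using f(2) by (rule sing_bound_nonneg)
    have "sing_bound a (N + i) B f" using f(2) by (rule sing_bound_mono) (use * in auto)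
    note b = sing_bound_shift_euler[OF f(1) this]
    have "\<bar>y\<bar> ^ (a + q + 2 + j) * norm ((euler ^^ i) (T_fun \<alpha> \<eta> f) y) \<le>
        2 * (fact (a + q + 2 + j) * ((2 + norm \<alpha>) ^ N * ((1 + norm \<alpha>) ^ i * B))) * I"
      unfolding euler_pow_T_fun[OF f(1) *(1)] I_def
      by (rule norm_T_fun_le[OF sing_class_shift_euler[OF f(1)] q _ b]) (use * in \<open>auto simp: N_def\<close>)
    also have "\<dots> \<le> 2 * (fact (a + q + 2 + M) * ((2 + norm \<alpha>) ^ N * ((1 + norm \<alpha>) ^ M * B))) * I"
      using * B0 I0 by (intro mult_mono fact_mono power_increasing order_refl mult_nonneg_nonneg) auto
    finally show "\<bar>y\<bar> ^ (a + q + 2 + j) * norm ((euler ^^ i) (T_fun \<alpha> \<eta> f) y) \<le> C * B"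
      unfolding C_def by (simp add: mult_ac)
  qed
  moreover have "C \<ge> 0" unfolding C_def using I0 by simp
  ultimately show ?thesis by blast
qed

lemma T_fun_sing_class:
  assumes "f \<in> sing_class a" and q: "real q \<ge> \<bar>Re \<alpha> + 1\<bar>"
  shows "T_fun \<alpha> \<eta> f \<in> sing_class (a + q + 2)"
  unfolding sing_class_def mem_Collect_eq
proof (intro conjI allI)
  show "smooth_on (- {0}) (T_fun \<alpha> \<eta> f)" using smooth_on_T_fun assms(1) unfolding sing_space_def by blast
  fix M
  obtain N C where "\<forall>f\<in>sing_class a. \<forall>B. sing_bound a N B f \<longrightarrow> sing_bound (a + q + 2) M (C * B) (T_fun \<alpha> \<eta> f)"
    using T_fun_sing_bound[OF q] by meson
  moreover obtain B where "sing_bound a N B f" using assms(1) by (rule sing_classE)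
  ultimately show "\<exists>B. sing_bound (a + q + 2) M B (T_fun \<alpha> \<eta> f)" using assms(1) by blast
qed

lemma T_fun_sing_space:
  assumes "f \<in> sing_space"
  shows "T_fun \<alpha> \<eta> f \<in> sing_space"
proof -
  obtain a where a: "f \<in> sing_class a" using assms unfolding sing_space_def by blast
  obtain q :: nat where q: "real q \<ge> \<bar>Re \<alpha> + 1\<bar>" using real_arch_simple by blast
  from T_fun_sing_class[OF a q] show ?thesis unfolding sing_space_def by blast
qed

lemma sing_functional_T_fun:
  assumes L: "sing_functional L"
  shows "sing_functional (\<lambda>f. L (T_fun \<alpha> \<eta> f))"
  unfolding sing_functional_def linear_functional_on_def
proof (intro conjI ballI allI)
  fix f g assume fg: "f \<in> sing_space" "g \<in> sing_space"
  have "L (T_fun \<alpha> \<eta> (\<lambda>x. f x + g x)) = L (\<lambda>y. T_fun \<alpha> \<eta> f y + T_fun \<alpha> \<eta> g y)"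
    by (rule sing_functional_cong[OF L T_fun_sing_space[OF sing_space_add[OF fg]]]) (rule T_fun_add[OF fg])
  then show "L (T_fun \<alpha> \<eta> (\<lambda>x. f x + g x)) = L (T_fun \<alpha> \<eta> f) + L (T_fun \<alpha> \<eta> g)"
    using sing_functional_add[OF L T_fun_sing_space[OF fg(1)] T_fun_sing_space[OF fg(2)]] by simp
next
  fix c f assume f: "f \<in> sing_space"
  have "L (T_fun \<alpha> \<eta> (\<lambda>x. c * f x)) = L (\<lambda>y. c * T_fun \<alpha> \<eta> f y)"
    by (rule sing_functional_cong[OF L T_fun_sing_space[OF sing_space_cmult[OF f]]]) (rule T_fun_cmult[OF f])
  then show "L (T_fun \<alpha> \<eta> (\<lambda>x. c * f x)) = c * L (T_fun \<alpha> \<eta> f)"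
    using sing_functional_cmult[OF L T_fun_sing_space[OF f]] by simp
next
  fix a
  obtain q :: nat where q: "real q \<ge> \<bar>Re \<alpha> + 1\<bar>" using real_arch_simple by blast
  obtain M D where D: "D \<ge> 0" "\<And>f B. f \<in> sing_class (a + q + 2) \<Longrightarrow> sing_bound (a + q + 2) M B f \<Longrightarrow> norm (L f) \<le> D * B"
    using sing_functionalE[OF L] by metis
  obtain N C where C: "\<forall>f\<in>sing_class a. \<forall>B. sing_bound a N B f \<longrightarrow> sing_bound (a + q + 2) M (C * B) (T_fun \<alpha> \<eta> f)"
    using T_fun_sing_bound[OF q] by meson
  have "norm (L (T_fun \<alpha> \<eta> f)) \<le> (D * C) * B" if "f \<in> sing_class a" "sing_bound a N B f" for f B
    using D(2)[OF T_fun_sing_class[OF that(1) q], of "C * B"] C that by (simp add: mult.assoc)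
  then show "\<exists>N C. \<forall>f\<in>sing_class a. \<forall>B. sing_bound a N B f \<longrightarrow> norm (L (T_fun \<alpha> \<eta> f)) \<le> C * B" by blast
qed

section \<open>Multiplicative convolutions and their interchange with a functional\<close>

section \<open>Superpositions of dilated functions\<close>

lemma euler_pow_dilate:
  assumes "smooth_on (- {0}) f" "t \<noteq> 0" "x \<noteq> 0"
  shows "(euler ^^ i) (\<lambda>x. f (x / t)) x = (euler ^^ i) f (x / t)"
  using euler_pow_scale[OF open_punctured open_punctured assms(1), of "1 / t" x i] assms(2,3) by simp

lemma smooth_on_dilate:
  assumes "smooth_on (- {0}) f" "t \<noteq> 0"
  shows "smooth_on (- {0}) (\<lambda>x. f (x / t))"
  by (rule smooth_on_compose[OF open_punctured open_punctured assms(1), where g' = "\<lambda>x. 1 / t"])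
     (use assms(2) in \<open>auto intro!: derivative_eq_intros smooth_on_const\<close>)

text \<open>The weight |x|^(a + j) scales by t^(a + j), at most t^a for t \<le> 1. This power of t
  is what later permits division of a density by t^a.\<close>

lemma sing_bound_dilate:
  assumes "smooth_on (- {0}) f" "0 < t" "t \<le> 1" "sing_bound a M B f"
  shows "sing_bound a M (t ^ a * B) (\<lambda>x. f (x / t))"
  unfolding sing_bound_def
proof (intro allI impI)
  fix x :: real and i j assume *: "x \<noteq> 0" "i \<le> M" "j \<le> M"
  have B0: "B \<ge> 0" using assms(4) by (rule sing_bound_nonneg)
  have "\<bar>x\<bar> ^ (a + j) * norm ((euler ^^ i) f (x / t)) = t ^ (a + j) * (\<bar>x / t\<bar> ^ (a + j) * norm ((euler ^^ i) f (x / t)))"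
    using assms(2) by (simp add: power_divide)
  also have "\<dots> \<le> t ^ (a + j) * B"
    using assms(2) * by (intro mult_left_mono sing_boundD[OF assms(4)]) auto
  also have "\<dots> \<le> t ^ a * B" using assms(2,3) B0 by (intro mult_right_mono power_decreasing) auto
  finally show "\<bar>x\<bar> ^ (a + j) * norm ((euler ^^ i) (\<lambda>x. f (x / t)) x) \<le> t ^ a * B"
    using euler_pow_dilate[OF assms(1) _ *(1)] assms(2) by simp
qed

lemma sing_class_dilate:
  assumes "f \<in> sing_class a" "0 < t" "t \<le> 1"
  shows "(\<lambda>x. f (x / t)) \<in> sing_class a"
  unfolding sing_class_def mem_Collect_eq
proof (intro conjI allI)
  show "smooth_on (- {0}) (\<lambda>x. f (x / t))" using smooth_on_dilate[OF sing_classD[OF assms(1)]] assms(2) by simp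
  fix M
  obtain B where "sing_bound a M B f" using assms(1) by (rule sing_classE)
  from sing_bound_dilate[OF sing_classD[OF assms(1)] assms(2,3) this]
  show "\<exists>B. sing_bound a M B (\<lambda>x. f (x / t))" by blast
qed

text \<open>The t-derivative of f(x / t) is - (\<theta> f)(x / t) / t. One factor of t^(a + j)
  compensates 1 / t, which is the reason for a \<ge> 1.\<close>

lemma sing_bound_dilate_diff:
  assumes f: "smooth_on (- {0}) f" "sing_bound a (Suc M) B f" and a: "a \<ge> 1"
    and t: "t \<in> {0<..1}" "s \<in> {0<..1}"
  shows "sing_bound a M (B * \<bar>t - s\<bar>) (\<lambda>x. f (x / t) - f (x / s))"
  unfolding sing_bound_def
proof (intro allI impI)
  fix x :: real and i j assume *: "x \<noteq> 0" "i \<le> M" "j \<le> M"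
  have B0: "B \<ge> 0" using f(2) by (rule sing_bound_nonneg)
  define F where "F = (euler ^^ i) f"
  have F: "smooth_on (- {0}) F" unfolding F_def by (rule smooth_on_euler_pow[OF open_punctured f(1)])
  have seg: "u \<in> {0<..1}" if "u \<in> closed_segment s t" for u
    using that t by (auto simp: closed_segment_eq_real_ivl split: if_splits)
  have "norm (F (x / t) - F (x / s)) \<le> B / \<bar>x\<bar> ^ (a + j) * \<bar>t - s\<bar>"
  proof (rule norm_diff_le_deriv[where f = "\<lambda>t. F (x / t)" and f' = "\<lambda>u. - (euler F (x / u) / of_real u)"])
    fix u assume "u \<in> closed_segment s t"
    then have u: "0 < u" "u \<le> 1" using seg by auto
    have "((\<lambda>u. x / u) has_vector_derivative - (x / u\<^sup>2)) (at u)"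
      using u by (auto intro!: derivative_eq_intros simp: power2_eq_square
          simp flip: has_real_derivative_iff_has_vector_derivative)
    moreover have "(F has_vector_derivative nderiv 1 F (x / u)) (at (x / u))"
      using smooth_on_has_deriv[OF F] * u by auto
    ultimately have "((\<lambda>u. F (x / u)) has_vector_derivative (- (x / u\<^sup>2)) *\<^sub>R nderiv 1 F (x / u)) (at u)"
      using vector_diff_chain_at[of "\<lambda>u. x / u" "- (x / u\<^sup>2)" u F "nderiv 1 F (x / u)"] by (simp only: o_def)
    also have "(- (x / u\<^sup>2)) *\<^sub>R nderiv 1 F (x / u) = - (euler F (x / u) / of_real u)"
      by (simp add: euler_def scaleR_conv_of_real power2_eq_square)
    finally show "((\<lambda>u. F (x / u)) has_vector_derivative - (euler F (x / u) / of_real u)) (at u)" .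
    have "\<bar>x / u\<bar> ^ (a + j) * norm (euler F (x / u)) \<le> B"
      using sing_boundD[OF f(2), of "x / u" "Suc i" j] * u by (simp add: F_def)
    then have "norm (euler F (x / u)) \<le> B * u ^ (a + j) / \<bar>x\<bar> ^ (a + j)"
      using * u by (simp add: power_divide field_simps)
    also have "\<dots> \<le> B * u ^ 1 / \<bar>x\<bar> ^ (a + j)"
      using u B0 a by (intro divide_right_mono mult_left_mono power_decreasing) auto
    finally show "norm (- (euler F (x / u) / of_real u)) \<le> B / \<bar>x\<bar> ^ (a + j)"
      using u by (simp add: norm_divide divide_le_eq mult.commute)
  qed
  then have 1: "\<bar>x\<bar> ^ (a + j) * norm (F (x / t) - F (x / s)) \<le> B * \<bar>t - s\<bar>"
    using * by (simp add: field_simps)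
  have 2: "(euler ^^ i) (\<lambda>x. f (x / t) - f (x / s)) x = F (x / t) - F (x / s)"
  proof -
    have "(euler ^^ i) (\<lambda>x. f (x / t) + (-1) * f (x / s)) x = (euler ^^ i) (\<lambda>x. f (x / t)) x + (-1) * (euler ^^ i) (\<lambda>x. f (x / s)) x"
      using t * f(1) euler_pow_cmult[OF open_punctured smooth_on_dilate[OF f(1), of s], of x i "-1"]
      by (subst euler_pow_add[OF open_punctured smooth_on_dilate[OF f(1)] smooth_on_cmult[OF open_punctured smooth_on_dilate[OF f(1)]]]) auto
    then show ?thesis using euler_pow_dilate[OF f(1) _ *(1)] t unfolding F_def by simp
  qed
  show "\<bar>x\<bar> ^ (a + j) * norm ((euler ^^ i) (\<lambda>x. f (x / t) - f (x / s)) x) \<le> B * \<bar>t - s\<bar>"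
    unfolding 2 by (rule 1)
qed

text \<open>A multiplicative convolution in which the density 1 / t of the invariant measure is left
  to w.\<close>

definition superpos :: "(real \<Rightarrow> complex) \<Rightarrow> (real \<Rightarrow> complex) \<Rightarrow> real \<Rightarrow> real \<Rightarrow> real \<Rightarrow> complex" where
  "superpos w f r s x = integral {r..s} (\<lambda>t. w t * f (x / t))"

lemma continuous_on_dilate_integrand:
  assumes "smooth_on (- {0}) f" "0 < r" "continuous_on {r..s} w" "x \<noteq> 0"
  shows "continuous_on {r..s} (\<lambda>t. w t * f (x / t))"
proof (intro continuous_on_mult assms(3))
  have 1: "continuous_on {r..s} (\<lambda>t. x / t)" using assms(2) by (intro continuous_intros) auto
  have 2: "continuous_on (- {0}) f" using smooth_on_continuous_on[OF assms(1), of 0] by simp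
  have "(\<lambda>t. x / t) ` {r..s} \<subseteq> - {0}" using assms(2,4) by auto
  from continuous_on_compose2[OF 2 1 this] show "continuous_on {r..s} (\<lambda>t. f (x / t))" .
qed

lemma superpos_has_deriv:
  assumes f: "smooth_on (- {0}) f" and r: "0 < r" and w: "continuous_on {r..s} w" and x: "x \<noteq> 0"
  shows "(superpos w f r s has_vector_derivative superpos (\<lambda>t. w t / of_real t) (nderiv 1 f) r s x) (at x)"
proof -
  \<comment> \<open>Leibniz's rule asks for a convex set, so the half line containing x replaces the
    punctured line.\<close>
  define U where "U = (if x > 0 then {0::real<..} else {..<0})"
  have U: "open U" "convex U" "x \<in> U" "U \<subseteq> - {0}" using x by (auto simp: U_def)
  have cf: "continuous_on (- {0}) (nderiv 1 f)" using smooth_on_continuous_on[OF f] .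
  have "((\<lambda>x. integral (cbox r s) (\<lambda>t. w t * f (x / t))) has_vector_derivative
      integral (cbox r s) (\<lambda>t. w t * (nderiv 1 f (x / t) / of_real t))) (at x within U)"
  proof (rule leibniz_rule_vector_derivative[OF _ _ _ U(3,2)])
    fix y t assume y: "y \<in> U" and t: "t \<in> cbox r s"
    then have yt: "y / t \<in> - {0}" "t > 0" using U(4) r by auto
    have "((\<lambda>y. y / t) has_vector_derivative 1 / t) (at y)"
      using yt by (auto intro!: derivative_eq_intros simp flip: has_real_derivative_iff_has_vector_derivative)
    from vector_diff_chain_at[OF this smooth_on_has_deriv[OF f yt(1)]]
    have "((\<lambda>y. f (y / t)) has_vector_derivative nderiv 1 f (y / t) / of_real t) (at y)"
      by (simp add: o_def scaleR_conv_of_real)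
    from has_vector_derivative_mult_right[OF this]
    show "((\<lambda>y. w t * f (y / t)) has_vector_derivative w t * (nderiv 1 f (y / t) / of_real t)) (at y within U)"
      by (rule has_vector_derivative_at_within)
  next
    fix y assume "y \<in> U"
    then have "y \<noteq> 0" using U(4) by auto
    from continuous_on_dilate_integrand[OF f r w this]
    show "(\<lambda>t. w t * f (y / t)) integrable_on cbox r s" by (simp add: integrable_continuous_real)
  next
    have "continuous_on (U \<times> cbox r s) (\<lambda>p. w (snd p) * (nderiv 1 f (fst p / snd p) / of_real (snd p)))"
    proof (intro continuous_on_mult continuous_on_divide continuous_on_of_real)
      show "continuous_on (U \<times> cbox r s) (\<lambda>p. w (snd p))"
        by (rule continuous_on_compose2[OF w]) (auto intro: continuous_intros)
      have "continuous_on (U \<times> cbox r s) (\<lambda>p. fst p / snd p)" using r by (intro continuous_intros) auto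
      then show "continuous_on (U \<times> cbox r s) (\<lambda>p. nderiv 1 f (fst p / snd p))"
        by (rule continuous_on_compose2[OF cf]) (use U(4) r in auto)
    qed (use r in \<open>auto intro: continuous_intros\<close>)
    then show "continuous_on (U \<times> cbox r s) (\<lambda>(y, t). w t * (nderiv 1 f (y / t) / of_real t))"
      by (simp add: case_prod_beta)
  qed
  then have "(superpos w f r s has_vector_derivative integral {r..s} (\<lambda>t. w t * (nderiv 1 f (x / t) / of_real t))) (at x within U)"
    unfolding superpos_def by simp
  then show ?thesis using at_within_open[OF U(3,1)] by (simp add: superpos_def)
qed

lemma smooth_on_superpos:
  assumes "smooth_on (- {0}) f" "0 < r" "continuous_on {r..s} w"
  shows "smooth_on (- {0}) (superpos w f r s)"
  unfolding smooth_on_iff_C_on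
proof
  fix n show "C_on n (- {0}) (superpos w f r s)"
    using assms(1,3)
  proof (induction n arbitrary: f w)
    case (Suc n)
    have "continuous_on {r..s} (\<lambda>t. w t / of_real t)"
      using Suc.prems(2) assms(2) by (intro continuous_intros) auto
    from Suc.IH[OF smooth_on_nderiv[OF Suc.prems(1)] this, of 1]
    show ?case
      by (rule C_on_SucI[OF open_punctured, rotated]) (use superpos_has_deriv[OF Suc.prems(1) assms(2) Suc.prems(2)] in auto)
  qed simp
qed

lemma euler_superpos:
  assumes "smooth_on (- {0}) f" "0 < r" "continuous_on {r..s} w" "x \<noteq> 0"
  shows "euler (superpos w f r s) x = superpos w (euler f) r s x"
proof -
  have "of_real x * superpos (\<lambda>t. w t / of_real t) (nderiv 1 f) r s x = superpos w (euler f) r s x"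
    unfolding superpos_def integral_mult_right[symmetric] euler_def by (simp add: mult_ac)
  then show ?thesis using euler_eqI[OF superpos_has_deriv[OF assms]] by simp
qed

lemma euler_pow_superpos:
  assumes "smooth_on (- {0}) f" "0 < r" "continuous_on {r..s} w" "x \<noteq> 0"
  shows "(euler ^^ i) (superpos w f r s) x = superpos w ((euler ^^ i) f) r s x"
  using assms(4)
proof (induction i arbitrary: x)
  case (Suc i)
  have "euler ((euler ^^ i) (superpos w f r s)) x = euler (superpos w ((euler ^^ i) f) r s) x"
    by (rule euler_cong[OF open_punctured]) (use Suc in auto)
  also have "\<dots> = superpos w (euler ((euler ^^ i) f)) r s x"
    by (rule euler_superpos[OF smooth_on_euler_pow[OF open_punctured assms(1)] assms(2,3) Suc.prems])
  finally show ?case by simp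
qed simp

lemma superpos_sing_class:
  assumes f: "f \<in> sing_class a" and r: "0 < r" "s \<le> 1" and w: "continuous_on {r..s} w"
  shows "superpos w f r s \<in> sing_class a"
  unfolding sing_class_def mem_Collect_eq
proof (intro conjI allI)
  have sm: "smooth_on (- {0}) f" using f by (rule sing_classD)
  show "smooth_on (- {0}) (superpos w f r s)" by (rule smooth_on_superpos[OF sm r(1) w])
  fix M
  obtain B where B: "sing_bound a M B f" "B \<ge> 0" using f by (rule sing_classE)
  obtain W where W: "W \<ge> 0" "\<And>t. t \<in> {r..s} \<Longrightarrow> norm (w t) \<le> W" using compact_bounded_norm[OF compact_Icc w] by blast
  show "\<exists>B. sing_bound a M B (superpos w f r s)"
  proof (intro exI)
    show "sing_bound a M (W * B * \<bar>s - r\<bar>) (superpos w f r s)"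
      unfolding sing_bound_def
    proof (intro allI impI)
      fix x :: real and i j assume *: "x \<noteq> 0" "i \<le> M" "j \<le> M"
      show "\<bar>x\<bar> ^ (a + j) * norm ((euler ^^ i) (superpos w f r s) x) \<le> W * B * \<bar>s - r\<bar>"
      proof (cases "r \<le> s")
        case True
        have "norm (integral (cbox r s) (\<lambda>t. w t * (euler ^^ i) f (x / t))) \<le>
            (W * (B / \<bar>x\<bar> ^ (a + j))) * Henstock_Kurzweil_Integration.content (cbox r s)"
        proof (rule integrable_bound)
          show "(\<lambda>t. w t * (euler ^^ i) f (x / t)) integrable_on cbox r s"
            using continuous_on_dilate_integrand[OF smooth_on_euler_pow[OF open_punctured sm] r(1) w *(1)]
            by (simp add: integrable_continuous_real)
          fix t assume t: "t \<in> cbox r s"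
          then have t01: "0 < t" "t \<le> 1" using r by auto
          have "\<bar>x / t\<bar> ^ (a + j) * norm ((euler ^^ i) f (x / t)) \<le> B"
            using sing_boundD[OF B(1), of "x / t" i j] * t01 by simp
          then have "norm ((euler ^^ i) f (x / t)) \<le> B * t ^ (a + j) / \<bar>x\<bar> ^ (a + j)"
            using * t01 by (simp add: power_divide field_simps)
          also have "\<dots> \<le> B * 1 / \<bar>x\<bar> ^ (a + j)"
            using B(2) t01 by (intro divide_right_mono mult_left_mono power_le_one) auto
          finally show "norm (w t * (euler ^^ i) f (x / t)) \<le> W * (B / \<bar>x\<bar> ^ (a + j))"
            unfolding norm_mult using W t by (intro mult_mono) auto
        qed (use W B in simp)
        then show ?thesis unfolding euler_pow_superpos[OF sm r(1) w *(1)] superpos_def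
          using True * by (simp add: field_simps)
      next
        case False
        then show ?thesis unfolding euler_pow_superpos[OF sm r(1) w *(1)] superpos_def
          using W(1) B(2) by simp
      qed
    qed
  qed
qed

lemma superpos_combine:
  assumes "smooth_on (- {0}) f" "0 < r" "continuous_on {r..s} w" "r \<le> u" "u \<le> s" "x \<noteq> 0"
  shows "superpos w f r s x = superpos w f r u x + superpos w f u s x"
  unfolding superpos_def
  using continuous_on_dilate_integrand[OF assms(1,2,3,6)] assms(4,5)
  by (intro Henstock_Kurzweil_Integration.integral_combine[symmetric] integrable_continuous_real)

text \<open>Compares the integral over an interval with its integrand frozen at u: e1 accounts for
  the variation of w, e2 for that of the dilate.\<close>

lemma superpos_error_bound:
  assumes f: "f \<in> sing_class a" "a \<ge> 1" "sing_bound a M B f" "sing_bound a (Suc M) B f" and r: "0 < r" "r \<le> s" "s \<le> 1"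
    and w: "continuous_on {r..s} w" and u: "u \<in> {r..s}"
    and e: "\<And>t. t \<in> {r..s} \<Longrightarrow> norm (w t - w u) \<le> e1" "\<And>t. t \<in> {r..s} \<Longrightarrow> \<bar>t - u\<bar> \<le> e2"
  shows "sing_bound a M ((s - r) * (e1 * B + norm (w u) * (B * e2))) (\<lambda>x. superpos w f r s x - of_real (s - r) * w u * f (x / u))"
  unfolding sing_bound_def
proof (intro allI impI)
  fix x :: real and i j assume *: "x \<noteq> 0" "i \<le> M" "j \<le> M"
  have sm: "smooth_on (- {0}) f" using f(1) by (rule sing_classD)
  have B0: "B \<ge> 0" using f(3) by (rule sing_bound_nonneg)
  have u01: "u \<in> {0<..1}" using u r by auto
  define F where "F = (euler ^^ i) f"
  have F: "smooth_on (- {0}) F" unfolding F_def by (rule smooth_on_euler_pow[OF open_punctured sm])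
  have int: "(\<lambda>t. w t * F (x / t)) integrable_on cbox r s"
    using continuous_on_dilate_integrand[OF F r(1) w *(1)] by (simp add: integrable_continuous_real)
  have "(euler ^^ i) (\<lambda>x. superpos w f r s x + (- (of_real (s - r) * w u)) * f (x / u)) x =
      superpos w F r s x + (- (of_real (s - r) * w u)) * F (x / u)"
    using u01 * euler_pow_cmult[OF open_punctured smooth_on_dilate[OF sm, of u], of x i "- (of_real (s - r) * w u)"]
      euler_pow_superpos[OF sm r(1) w *(1), of i] euler_pow_dilate[OF sm, of u x i]
    by (subst euler_pow_add[OF open_punctured smooth_on_superpos[OF sm r(1) w] smooth_on_cmult[OF open_punctured smooth_on_dilate[OF sm]]])
       (auto simp: F_def)
  also have "\<dots> = integral (cbox r s) (\<lambda>t. w t * F (x / t)) - integral (cbox r s) (\<lambda>t. w u * F (x / u))"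
    using r by (simp add: superpos_def scaleR_conv_of_real)
  also have "\<dots> = integral (cbox r s) (\<lambda>t. w t * F (x / t) - w u * F (x / u))"
    by (rule Henstock_Kurzweil_Integration.integral_diff[symmetric, OF int integrable_const])
  finally have eq: "(euler ^^ i) (\<lambda>x. superpos w f r s x - of_real (s - r) * w u * f (x / u)) x =
      integral (cbox r s) (\<lambda>t. w t * F (x / t) - w u * F (x / u))" by simp
  have "norm (integral (cbox r s) (\<lambda>t. w t * F (x / t) - w u * F (x / u))) \<le>
      ((e1 * B + norm (w u) * (B * e2)) / \<bar>x\<bar> ^ (a + j)) * Henstock_Kurzweil_Integration.content (cbox r s)"
  proof (rule integrable_bound)
    have "e1 \<ge> 0" "e2 \<ge> 0" using e(1)[OF u] e(2)[OF u] by auto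
    then show "0 \<le> (e1 * B + norm (w u) * (B * e2)) / \<bar>x\<bar> ^ (a + j)" using B0 by simp
    show "(\<lambda>t. w t * F (x / t) - w u * F (x / u)) integrable_on cbox r s"
      by (intro integrable_diff int integrable_const)
    fix t assume "t \<in> cbox r s"
    then have t: "t \<in> {r..s}" by simp
    then have t01: "t \<in> {0<..1}" using r by auto
    have "sing_bound a M (t ^ a * B) (\<lambda>x. f (x / t))" using sing_bound_dilate[OF sm _ _ f(3)] t01 by auto
    then have "\<bar>x\<bar> ^ (a + j) * norm (F (x / t)) \<le> t ^ a * B"
      using sing_boundD[of a M _ "\<lambda>x. f (x / t)" x i j] * euler_pow_dilate[OF sm, of t x i] t01 by (auto simp: F_def)
    also have "\<dots> \<le> 1 * B" using t01 B0 by (intro mult_right_mono power_le_one) auto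
    finally have b1: "norm (F (x / t)) \<le> B / \<bar>x\<bar> ^ (a + j)" using * by (simp add: field_simps)
    have "(euler ^^ i) (\<lambda>x. f (x / t) + (-1) * f (x / u)) x = F (x / t) + (-1) * F (x / u)"
      using t01 u01 * euler_pow_cmult[OF open_punctured smooth_on_dilate[OF sm, of u], of x i "-1"]
        euler_pow_dilate[OF sm, of u x i] euler_pow_dilate[OF sm, of t x i]
      by (subst euler_pow_add[OF open_punctured smooth_on_dilate[OF sm] smooth_on_cmult[OF open_punctured smooth_on_dilate[OF sm]]])
         (auto simp: F_def)
    then have "\<bar>x\<bar> ^ (a + j) * norm (F (x / t) - F (x / u)) \<le> B * \<bar>t - u\<bar>"
      using sing_boundD[OF sing_bound_dilate_diff[OF sm f(4,2) t01 u01] *] by simp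
    also have "\<dots> \<le> B * e2" using e(2)[OF t] B0 by (intro mult_left_mono)
    finally have b2: "norm (F (x / t) - F (x / u)) \<le> B * e2 / \<bar>x\<bar> ^ (a + j)" using * by (simp add: field_simps)
    have "w t * F (x / t) - w u * F (x / u) = (w t - w u) * F (x / t) + w u * (F (x / t) - F (x / u))"
      by (simp add: algebra_simps)
    also have "norm \<dots> \<le> e1 * (B / \<bar>x\<bar> ^ (a + j)) + norm (w u) * (B * e2 / \<bar>x\<bar> ^ (a + j))"
    proof (intro norm_triangle_le add_mono)
      show "norm ((w t - w u) * F (x / t)) \<le> e1 * (B / \<bar>x\<bar> ^ (a + j))"
        unfolding norm_mult by (rule mult_mono[OF e(1)[OF t] b1 \<open>e1 \<ge> 0\<close>]) simp
      show "norm (w u * (F (x / t) - F (x / u))) \<le> norm (w u) * (B * e2 / \<bar>x\<bar> ^ (a + j))"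
        unfolding norm_mult by (rule mult_left_mono[OF b2]) simp
    qed
    finally show "norm (w t * F (x / t) - w u * F (x / u)) \<le> (e1 * B + norm (w u) * (B * e2)) / \<bar>x\<bar> ^ (a + j)"
      by (simp add: add_divide_distrib)
  qed
  then show "\<bar>x\<bar> ^ (a + j) * norm ((euler ^^ i) (\<lambda>x. superpos w f r s x - of_real (s - r) * w u * f (x / u)) x) \<le>
      (s - r) * (e1 * B + norm (w u) * (B * e2))"
    unfolding eq using * r by (simp add: field_simps)
qed

text \<open>A functional is interchanged with the integral by showing that both sides have the same
  derivative with respect to the upper end point.\<close>

lemma sing_functional_superpos:
  assumes L: "sing_functional L" and f: "f \<in> sing_class a" "a \<ge> 1" and r: "0 < r" "r \<le> 1"
    and w: "continuous_on {r..1} w"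
  shows "((\<lambda>t. w t * L (\<lambda>x. f (x / t))) has_integral L (superpos w f r 1)) {r..1}"
proof -
  obtain M C where C: "C \<ge> 0" "\<And>f B. f \<in> sing_class a \<Longrightarrow> sing_bound a M B f \<Longrightarrow> norm (L f) \<le> C * B"
    using sing_functionalE[OF L] by metis
  obtain B where B: "sing_bound a (Suc M) B f" "B \<ge> 0" using f(1) by (rule sing_classE)
  have B': "sing_bound a M B f" using B(1) by (rule sing_bound_mono) auto
  have sm: "smooth_on (- {0}) f" using f(1) by (rule sing_classD)
  have sp: "superpos w f u v \<in> sing_class a" "superpos w f u v \<in> sing_space" if "u \<ge> r" "v \<le> 1" for u v
    using superpos_sing_class[OF f(1), of u v w] that r continuous_on_subset[OF w, of "{u..v}"] unfolding sing_space_def by auto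
  have dl: "(\<lambda>x. c * f (x / u)) \<in> sing_class a" "(\<lambda>x. c * f (x / u)) \<in> sing_space" "(\<lambda>x. f (x / u)) \<in> sing_space"
    if "u \<in> {r..1}" for u c
  proof -
    have "(\<lambda>x. f (x / u)) \<in> sing_class a" using sing_class_dilate[OF f(1), of u] that r by auto
    then show "(\<lambda>x. c * f (x / u)) \<in> sing_class a" "(\<lambda>x. c * f (x / u)) \<in> sing_space" "(\<lambda>x. f (x / u)) \<in> sing_space"
      using sing_class_cmult unfolding sing_space_def by blast+
  qed
  define G where "G s = L (superpos w f r s)" for s
  have incr: "G v - G u = L (superpos w f u v)" if "r \<le> u" "u \<le> v" "v \<le> 1" for u v
  proof -
    have "G v = L (\<lambda>x. superpos w f r u x + superpos w f u v x)"
      unfolding G_def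
      by (rule sing_functional_cong[OF L sp(2)])
         (use that r superpos_combine[OF sm r(1)] continuous_on_subset[OF w, of "{r..v}"] in auto)
    then show ?thesis using sing_functional_add[OF L sp(2) sp(2), of r u u v] that unfolding G_def by simp
  qed
  have est: "norm (L (superpos w f p q) - of_real (q - p) * (w u * L (\<lambda>x. f (x / u)))) \<le> C * ((q - p) * (e1 * B + norm (w u) * (B * e2)))"
    if pq: "r \<le> p" "p \<le> q" "q \<le> 1" "u \<in> {p..q}"
      and e: "\<And>t. t \<in> {p..q} \<Longrightarrow> norm (w t - w u) \<le> e1" "\<And>t. t \<in> {p..q} \<Longrightarrow> \<bar>t - u\<bar> \<le> e2" for p q u e1 e2
  proof -
    have u: "u \<in> {r..1}" using pq by auto
    have wpq: "continuous_on {p..q} w" using pq by (intro continuous_on_subset[OF w]) auto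
    have "sing_bound a M ((q - p) * (e1 * B + norm (w u) * (B * e2))) (\<lambda>x. superpos w f p q x - of_real (q - p) * w u * f (x / u))"
      by (rule superpos_error_bound[OF f B' B(1) _ pq(2,3) wpq pq(4) e]) (use pq r in auto)
    from C(2)[OF sing_class_diff[OF sp(1) dl(1)[OF u]] this] pq
    show ?thesis
      using sing_functional_diff[OF L sp(2) dl(2)[OF u], of p q "of_real (q - p) * w u"]
        sing_functional_cmult[OF L dl(3)[OF u], of "of_real (q - p) * w u"] by (simp add: mult.assoc)
  qed
  have "(G has_vector_derivative w u * L (\<lambda>x. f (x / u))) (at u within {r..1})" if u: "u \<in> {r..1}" for u
    unfolding has_vector_derivative_def has_derivative_within_alt
  proof (intro conjI allI impI bounded_linear_scaleR_left)
    fix e :: real assume e: "e > 0"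
    \<comment> \<open>The factor of e' (q - p) in \<open>est\<close>, enlarged by 1 to be
      positive.\<close>
    define K where "K = C * (B + norm (w u) * B) + 1"
    have K: "K > 0" unfolding K_def using C(1) B(2) by (intro add_nonneg_pos mult_nonneg_nonneg add_nonneg_nonneg) auto
    define e' where "e' = e / K"
    have e': "e' > 0" unfolding e'_def using e K by simp
    obtain d where d: "d > 0" "\<And>t. t \<in> {r..1} \<Longrightarrow> \<bar>t - u\<bar> < d \<Longrightarrow> norm (w t - w u) < e'"
      using w u e' unfolding continuous_on_iff dist_norm by (metis real_norm_def)
    \<comment> \<open>Stated for an interval containing u, so that it serves left and right
      difference quotients alike.\<close>
    have small: "norm (L (superpos w f p q) - of_real (q - p) * (w u * L (\<lambda>x. f (x / u)))) \<le> e * (q - p)"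
      if pq: "r \<le> p" "p \<le> q" "q \<le> 1" "u \<in> {p..q}" "q - p < min d e'" for p q
    proof -
      have "norm (L (superpos w f p q) - of_real (q - p) * (w u * L (\<lambda>x. f (x / u)))) \<le> C * ((q - p) * (e' * B + norm (w u) * (B * e')))"
      proof (rule est[OF pq(1-4)])
        fix t assume t: "t \<in> {p..q}"
        then have "\<bar>t - u\<bar> \<le> q - p" using pq by auto
        then show "norm (w t - w u) \<le> e'" "\<bar>t - u\<bar> \<le> e'" using d(2)[of t] t pq by auto
      qed
      also have "\<dots> = (C * (B + norm (w u) * B)) * e' * (q - p)" by (simp add: algebra_simps)
      also have "\<dots> \<le> K * e' * (q - p)" using e' pq unfolding K_def by (intro mult_right_mono) auto
      also have "\<dots> = e * (q - p)" unfolding e'_def using K by simp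
      finally show ?thesis .
    qed
    show "\<exists>d>0. \<forall>y\<in>{r..1}. norm (y - u) < d \<longrightarrow> norm (G y - G u - (y - u) *\<^sub>R (w u * L (\<lambda>x. f (x / u)))) \<le> e * norm (y - u)"
    proof (intro exI[of _ "min d e'"] conjI ballI impI)
      show "min d e' > 0" using d e' by simp
      fix y assume y: "y \<in> {r..1}" "norm (y - u) < min d e'"
      show "norm (G y - G u - (y - u) *\<^sub>R (w u * L (\<lambda>x. f (x / u)))) \<le> e * norm (y - u)"
      proof (cases "u \<le> y")
        case True
        then show ?thesis using small[of u y] incr[of u y] y u by (simp add: scaleR_conv_of_real)
      next
        case False
        have "norm (G y - G u - (y - u) *\<^sub>R (w u * L (\<lambda>x. f (x / u)))) =
            norm (L (superpos w f y u) - of_real (u - y) * (w u * L (\<lambda>x. f (x / u))))"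
          using incr[of y u] False y u by (subst norm_minus_cancel[symmetric]) (simp add: scaleR_conv_of_real algebra_simps)
        then show ?thesis using small[of y u] False y u by simp
      qed
    qed
  qed
  from fundamental_theorem_of_calculus[OF r(2) this]
  have "((\<lambda>t. w t * L (\<lambda>x. f (x / t))) has_integral G 1 - G r) {r..1}" by simp
  moreover have "G r = 0"
  proof -
    have "superpos w f r r = (\<lambda>x. 0)" by (simp add: superpos_def fun_eq_iff)
    moreover have "L (\<lambda>x. 0) = 0" using sing_functional_cmult[OF L dl(3)[of r], of 0] r by simp
    ultimately show ?thesis unfolding G_def by simp
  qed
  ultimately show ?thesis unfolding G_def by simp
qed

section \<open>Smoothed fundamental solutions of powers of \<theta>\<close>

section \<open>Truncated power kernels in logarithmic coordinates\<close>

definition ramp :: "nat \<Rightarrow> real \<Rightarrow> complex" where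
  "ramp q v = of_real (v ^ q / fact q)"

text \<open>For c > 0, a smooth substitute for the truncated power v^q / q! on v > 0, whose (q +
  1)-st derivative is a point mass; it vanishes for v < 1 / c.\<close>

definition cut_ramp :: "nat \<Rightarrow> real \<Rightarrow> real \<Rightarrow> complex" where
  "cut_ramp q c v = (if v > 0 then (1 - chi (c * v)) * ramp q v else 0)"

text \<open>In the coordinate v = - ln z, dilations become translations and \<theta> becomes - d/dv;
  the interval 0 < z < 1 corresponds to v > 0.\<close>

definition log_lift :: "(real \<Rightarrow> complex) \<Rightarrow> real \<Rightarrow> complex" where
  "log_lift W z = (if z > 0 then W (- ln z) else 0)"

lemma ramp_has_deriv: "(ramp (Suc q) has_vector_derivative ramp q v) (at v)"
proof -
  have "((\<lambda>v. v ^ Suc q / fact (Suc q)) has_real_derivative real (Suc q) * v ^ q / fact (Suc q)) (at v)"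
    by (rule DERIV_cdivide) (use DERIV_pow[of "Suc q" v] in simp)
  also have "real (Suc q) * v ^ q / fact (Suc q) = v ^ q / fact q" unfolding fact_Suc by (simp del: of_nat_Suc)
  finally show ?thesis unfolding ramp_def
    by (intro has_vector_derivative_of_real) (simp add: has_real_derivative_iff_has_vector_derivative)
qed

lemma nderiv_ramp: "nderiv i (ramp q) = (if i \<le> q then ramp (q - i) else (\<lambda>v. 0))"
proof (induction i)
  case (Suc i)
  show ?case
  proof (cases "Suc i \<le> q")
    case True
    then have "q - i = Suc (q - Suc i)" by simp
    then show ?thesis using Suc True nderiv_Suc_eq[of i "ramp q"] ramp_has_deriv by fastforce
  next
    case False
    show ?thesis
    proof (cases "i = q")
      case True
      moreover have "ramp 0 = (\<lambda>v. 1)" by (simp add: ramp_def fun_eq_iff)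
      ultimately have "nderiv i (ramp q) = (\<lambda>v. 1)" using Suc by simp
      then show ?thesis using True by (simp add: nderiv_Suc)
    next
      case False
      with \<open>\<not> Suc i \<le> q\<close> Suc show ?thesis by (simp add: nderiv_Suc)
    qed
  qed
qed simp

lemma smooth_on_ramp: "smooth_on UNIV (ramp q)"
proof -
  have "smooth_on UNIV (\<lambda>v. (1 / fact q) * of_real v ^ q)"
    by (intro smooth_on_cmult smooth_on_of_real_power open_UNIV)
  moreover have "(\<lambda>v. (1 / fact q) * of_real v ^ q) = ramp q" by (simp add: ramp_def fun_eq_iff)
  ultimately show ?thesis by simp
qed

lemma exp_minus_ramp_le: "v \<ge> 0 \<Longrightarrow> exp (- v) * norm (ramp q v) \<le> 1"
  using power_div_fact_le_exp[of v q] by (simp add: ramp_def exp_minus field_simps norm_divide norm_power)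

lemma nderiv_scale:
  assumes "smooth_on UNIV f"
  shows "nderiv i (\<lambda>x. f (c * x)) x = of_real c ^ i * nderiv i f (c * x)"
proof (induction i arbitrary: x)
  case (Suc i)
  have "((\<lambda>x. c * x) has_vector_derivative c) (at x)"
    by (auto intro!: derivative_eq_intros simp flip: has_real_derivative_iff_has_vector_derivative)
  from vector_diff_chain_at[OF this smooth_on_has_nderiv[OF assms UNIV_I]]
  have "((\<lambda>x. nderiv i f (c * x)) has_vector_derivative of_real c * nderiv (Suc i) f (c * x)) (at x)"
    by (simp add: o_def scaleR_conv_of_real)
  from has_vector_derivative_mult_right[OF this, of "of_real c ^ i"]
  have "(nderiv i (\<lambda>x. f (c * x)) has_vector_derivative of_real c ^ i * (of_real c * nderiv (Suc i) f (c * x))) (at x)"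
    by (rule has_vector_derivative_open_congI[OF open_UNIV UNIV_I Suc])
  from nderiv_Suc_eq[OF this] show ?case by (simp add: mult_ac)
qed simp

lemma open_less_real: "open {v::real. v < b}" "open {v::real. v > b}"
  by (auto simp: open_Collect_less continuous_intros)

lemma smooth_on_cut_ramp:
  assumes "c > 0"
  shows "smooth_on UNIV (cut_ramp q c)"
proof -
  have 1: "cut_ramp q c v = 0" if "v < 1 / c" for v
    using that assms by (simp add: cut_ramp_def) (metis abs_of_pos chi_eq_1 less_eq_real_def mult_pos_pos diff_self mult.commute mult_zero_left pos_less_divide_eq)
  have "smooth_on {v. v < 1 / c} (cut_ramp q c)"
    using smooth_on_cong[OF open_less_real(1), of "1 / c" "cut_ramp q c" "\<lambda>v. 0"] 1 open_less_real(1) by auto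
  moreover have "smooth_on {v. v > 0} (\<lambda>v. (1 - chi (c * v)) * ramp q v)"
    by (intro smooth_on_mult smooth_on_diff smooth_on_const open_less_real)
       (auto intro: smooth_on_subset[OF smooth_on_chi_scale] smooth_on_subset[OF smooth_on_ramp])
  then have "smooth_on {v. v > 0} (cut_ramp q c)"
    using smooth_on_cong[OF open_less_real(2), of 0 "cut_ramp q c" "\<lambda>v. (1 - chi (c * v)) * ramp q v"] by (simp add: cut_ramp_def)
  ultimately have "smooth_on ({v. v < 1 / c} \<union> {v. v > 0}) (cut_ramp q c)" by (rule smooth_on_Un)
  moreover have "{v. v < 1 / c} \<union> {v. v > 0} = UNIV"
  proof -
    have "v < 1 / c \<or> v > 0" for v
    proof (cases "v > 0")
      case False
      moreover have "1 / c > 0" using assms by simp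
      ultimately show ?thesis by linarith
    qed simp
    then show ?thesis by auto
  qed
  ultimately show ?thesis by simp
qed

lemma nderiv_cut_ramp_nonpos:
  assumes "c > 0" "v \<le> 0"
  shows "nderiv i (cut_ramp q c) v = 0"
proof (rule nderiv_eq_0_outside[OF open_less_real(1)[of "1 / c"]])
  fix y assume y: "y \<in> {v. v < 1 / c}"
  show "cut_ramp q c y = 0"
  proof (cases "y > 0")
    case True
    then have "\<bar>c * y\<bar> \<le> 1" using y assms(1) by (simp add: field_simps)
    then show ?thesis by (simp add: cut_ramp_def chi_eq_1)
  qed (simp add: cut_ramp_def)
next
  have "1 / c > 0" using assms(1) by simp
  with assms(2) have "v < 1 / c" by linarith
  then show "v \<in> {v. v < 1 / c}" by blast
qed

text \<open>Homogeneity: the error is - c^(-q) g(c v), where g is \<open>chi\<close> times the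
  power, so i derivatives give c^(i - q).\<close>

lemma cut_ramp_approx:
  "\<exists>G\<ge>0. \<forall>c v. c > 0 \<longrightarrow> v > 0 \<longrightarrow> norm (nderiv i (cut_ramp q c) v - nderiv i (ramp q) v) \<le> G * c ^ i / c ^ q"
proof -
  define g where "g v = chi v * ramp q v" for v
  have g: "smooth_on UNIV g" unfolding g_def by (intro smooth_on_mult smooth_on_chi smooth_on_ramp open_UNIV)
  obtain G where G: "G \<ge> 0" "\<And>v. norm (nderiv i g v) \<le> G"
    using compact_support_nderiv_bound[OF g, of "{-2..2}" i] chi_eq_0 by (fastforce simp: g_def)
  have "norm (nderiv i (cut_ramp q c) v - nderiv i (ramp q) v) \<le> G * c ^ i / c ^ q" if c: "c > 0" and v: "v > 0" for c v
  proof -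
    have gs: "smooth_on UNIV (\<lambda>v. g (c * v))" by (rule smooth_on_scale[OF g])
    have "nderiv i (cut_ramp q c) v = nderiv i (\<lambda>v. ramp q v + (- (1 / of_real c ^ q)) * g (c * v)) v"
    proof (rule nderiv_cong[OF open_less_real(2)[of 0]])
      fix y :: real assume "y \<in> {v. v > 0}"
      then show "cut_ramp q c y = ramp q y + (- (1 / of_real c ^ q)) * g (c * y)"
        using c by (simp add: cut_ramp_def g_def ramp_def algebra_simps power_mult_distrib diff_divide_distrib)
    qed (use v in simp)
    also have "\<dots> = nderiv i (ramp q) v + (- (1 / of_real c ^ q)) * (of_real c ^ i * nderiv i g (c * v))"
      unfolding nderiv_plus[OF open_UNIV smooth_on_ramp smooth_on_cmult[OF open_UNIV gs] UNIV_I]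
        nderiv_cmult[OF open_UNIV gs UNIV_I] nderiv_scale[OF g] ..
    finally have "norm (nderiv i (cut_ramp q c) v - nderiv i (ramp q) v) = 1 / c ^ q * (c ^ i * norm (nderiv i g (c * v)))"
      using c by (simp add: norm_mult norm_divide norm_power)
    also have "\<dots> \<le> 1 / c ^ q * (c ^ i * G)" using c by (intro mult_left_mono G) auto
    finally show ?thesis by (simp add: mult_ac)
  qed
  then show ?thesis using G(1) by blast
qed

lemma smooth_on_log_lift:
  assumes "smooth_on UNIV W"
  shows "smooth_on (- {0}) (log_lift W)"
proof -
  have "smooth_on {0<..} (\<lambda>z. W (- ln z))"
  proof (rule smooth_on_compose[OF _ open_UNIV assms, where g' = "\<lambda>z. - (1 / z)"])
    show "((\<lambda>z. - ln z) has_real_derivative - (1 / z)) (at z)" if "z \<in> {0<..}" for z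
      using that by (auto intro!: derivative_eq_intros)
    have "smooth_on {0<..} (\<lambda>z. - (1 / complex_of_real z))"
      using smooth_on_minus[OF open_punctured smooth_on_inverse_x] by (rule smooth_on_subset) auto
    then show "smooth_on {0<..} (\<lambda>z. complex_of_real (- (1 / z)))" by simp
  qed auto
  then have "smooth_on {0<..} (log_lift W)"
    using smooth_on_cong[of "{0<..}" "log_lift W" "\<lambda>z. W (- ln z)"] by (simp add: log_lift_def)
  moreover have "smooth_on {..<0} (log_lift W)"
    using smooth_on_cong[of "{..<0}" "log_lift W" "\<lambda>z. 0"] by (auto simp: log_lift_def)
  ultimately have "smooth_on ({0<..} \<union> {..<0}) (log_lift W)" by (rule smooth_on_Un)
  moreover have "{0<..} \<union> {..<0} = - {0::real}" by auto
  ultimately show ?thesis by simp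
qed

lemma euler_log_lift:
  assumes "smooth_on UNIV W" "z \<noteq> 0"
  shows "euler (log_lift W) z = (-1) * log_lift (nderiv 1 W) z"
proof (cases "z > 0")
  case True
  have "((\<lambda>z. - ln z) has_vector_derivative - (1 / z)) (at z)"
    using True by (auto intro!: derivative_eq_intros simp flip: has_real_derivative_iff_has_vector_derivative)
  from vector_diff_chain_at[OF this smooth_on_has_deriv[OF assms(1) UNIV_I]]
  have *: "((\<lambda>z. W (- ln z)) has_vector_derivative (- (1 / z)) *\<^sub>R nderiv 1 W (- ln z)) (at z)"
    by (simp only: o_def)
  have "(log_lift W has_vector_derivative (- (1 / z)) *\<^sub>R nderiv 1 W (- ln z)) (at z)"
    by (rule has_vector_derivative_open_congI[OF open_less_real(2)[of 0] _ _ *]) (use True in \<open>auto simp: log_lift_def\<close>)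
  from euler_eqI[OF this] show ?thesis using True by (simp add: log_lift_def scaleR_conv_of_real)
next
  case False
  have "((\<lambda>z. 0) has_vector_derivative 0) (at z)" by simp
  then have "(log_lift W has_vector_derivative 0) (at z)"
    by (rule has_vector_derivative_open_congI[OF open_less_real(1)[of 0], rotated 2])
       (use False assms(2) in \<open>auto simp: log_lift_def\<close>)
  from euler_eqI[OF this] show ?thesis using False by (simp add: log_lift_def)
qed

lemma euler_pow_log_lift:
  assumes "smooth_on UNIV W" "z \<noteq> 0"
  shows "(euler ^^ i) (log_lift W) z = (-1) ^ i * log_lift (nderiv i W) z"
  using assms(1)
proof (induction i arbitrary: W)
  case (Suc i)
  have W': "smooth_on UNIV (nderiv 1 W)" using Suc.prems by (rule smooth_on_nderiv)
  have "(euler ^^ Suc i) (log_lift W) z = (euler ^^ i) (\<lambda>z. (-1) * log_lift (nderiv 1 W) z) z"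
    unfolding euler_pow_Suc_right
    by (rule euler_pow_cong[OF open_punctured]) (use euler_log_lift[OF Suc.prems] assms(2) in auto)
  also have "\<dots> = (-1) * ((-1) ^ i * log_lift (nderiv (Suc i) W) z)"
    using euler_pow_cmult[OF open_punctured smooth_on_log_lift[OF W'], of z i "-1"] Suc.IH[OF W'] assms(2)
    by (simp only: nderiv_Suc_right) simp
  finally show ?case by simp
qed simp

text \<open>Powers of the logarithm are beaten by one factor z = exp(- v), so order 1 suffices near
  0; vanishing for z \<ge> 1 makes decay automatic.\<close>

lemma log_kernel_sing_class:
  assumes "c > 0"
  shows "log_lift (cut_ramp q c) \<in> sing_class 1"
  unfolding sing_class_def mem_Collect_eq
proof (intro conjI allI)
  note sm = smooth_on_cut_ramp[OF assms]
  show "smooth_on (- {0}) (log_lift (cut_ramp q c))" by (rule smooth_on_log_lift[OF sm])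
  fix N
  \<comment> \<open>Pairs (x, j) serve as the index of \<open>ex_uniform_bound\<close>, which makes
    the bound uniform in j as well.\<close>
  have "\<exists>D\<ge>0. \<forall>p. fst p \<noteq> (0::real) \<longrightarrow> \<bar>fst p\<bar> ^ (1 + snd p) * norm ((euler ^^ i) (log_lift (cut_ramp q c)) (fst p)) \<le> D" for i
  proof -
    obtain G where G: "G \<ge> 0" "\<And>v. v > 0 \<Longrightarrow> norm (nderiv i (cut_ramp q c) v - nderiv i (ramp q) v) \<le> G * c ^ i / c ^ q"
      using cut_ramp_approx[of i q] assms by meson
    have D0: "1 + G * c ^ i / c ^ q \<ge> 0" using G(1) assms by (intro add_nonneg_nonneg divide_nonneg_nonneg mult_nonneg_nonneg) auto
    have "\<bar>z\<bar> ^ (1 + j) * norm ((euler ^^ i) (log_lift (cut_ramp q c)) z) \<le> 1 + G * c ^ i / c ^ q" if z: "z \<noteq> 0" for z :: real and j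
    proof (cases "0 < z \<and> z < 1")
      case True
      define v where "v = - ln z"
      have v: "v > 0" "exp (- v) = z" using True by (auto simp: v_def)
      have r: "z * norm (nderiv i (ramp q) v) \<le> 1"
        using exp_minus_ramp_le[of v "q - i"] v by (auto simp: nderiv_ramp)
      have "norm (nderiv i (cut_ramp q c) v) \<le> norm (nderiv i (ramp q) v) + norm (nderiv i (cut_ramp q c) v - nderiv i (ramp q) v)"
        by (rule norm_triangle_sub)
      then have "norm (nderiv i (cut_ramp q c) v) \<le> norm (nderiv i (ramp q) v) + G * c ^ i / c ^ q"
        using G(2)[OF v(1)] by simp
      then have "z * norm (nderiv i (cut_ramp q c) v) \<le> z * (norm (nderiv i (ramp q) v) + G * c ^ i / c ^ q)"
        using True by (intro mult_left_mono) auto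
      also have "\<dots> \<le> 1 + 1 * (G * c ^ i / c ^ q)"
        unfolding distrib_left using r True G(1) assms by (intro add_mono mult_right_mono) auto
      finally have b: "z * norm (nderiv i (cut_ramp q c) v) \<le> 1 + G * c ^ i / c ^ q" by simp
      have "\<bar>z\<bar> ^ (1 + j) * norm ((euler ^^ i) (log_lift (cut_ramp q c)) z) = z ^ j * (z * norm (nderiv i (cut_ramp q c) v))"
        unfolding euler_pow_log_lift[OF sm z] using True by (simp add: log_lift_def v_def norm_mult norm_power)
      also have "\<dots> \<le> 1 * (z * norm (nderiv i (cut_ramp q c) v))"
        using True by (intro mult_right_mono power_le_one) auto
      finally show ?thesis using b by simp
    next
      case False
      then have "log_lift (nderiv i (cut_ramp q c)) z = 0"
        using nderiv_cut_ramp_nonpos[OF assms, of "- ln z" i q] by (auto simp: log_lift_def)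
      then show ?thesis unfolding euler_pow_log_lift[OF sm z] using D0 by simp
    qed
    then show ?thesis using D0 by (intro exI[of _ "1 + G * c ^ i / c ^ q"]) auto
  qed
  then obtain D where "\<forall>i\<le>N. \<forall>p. fst p \<noteq> (0::real) \<longrightarrow> \<bar>fst p\<bar> ^ (1 + snd p) * norm ((euler ^^ i) (log_lift (cut_ramp q c)) (fst p)) \<le> D"
    using ex_uniform_bound[of N "\<lambda>p. fst p \<noteq> (0::real)" "\<lambda>i p. \<bar>fst p\<bar> ^ (1 + snd p) * norm ((euler ^^ i) (log_lift (cut_ramp q c)) (fst p))"] by blast
  then have "sing_bound 1 N D (log_lift (cut_ramp q c))" unfolding sing_bound_def by auto
  then show "\<exists>B. sing_bound 1 N B (log_lift (cut_ramp q c))" ..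
qed

lemma log_kernel_eq_0:
  assumes "c > 0" "z \<noteq> 0" "z < 0 \<or> z \<ge> 1"
  shows "(euler ^^ i) (log_lift (cut_ramp q c)) z = 0"
proof -
  have "log_lift (nderiv i (cut_ramp q c)) z = 0"
    using nderiv_cut_ramp_nonpos[OF assms(1), of "- ln z" i q] assms(3) by (auto simp: log_lift_def)
  then show ?thesis unfolding euler_pow_log_lift[OF smooth_on_cut_ramp[OF assms(1)] assms(2)] by simp
qed

text \<open>For i < q the error c^(i - q) is at most 1 / c. The order i = q is excluded because
  there the truncated power has a jump at z = 1.\<close>

lemma log_kernel_approx:
  "\<exists>G\<ge>0. \<forall>i c z. i < q \<longrightarrow> c \<ge> 1 \<longrightarrow> 0 < z \<longrightarrow> z \<le> 1 \<longrightarrow>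
     norm ((euler ^^ i) (log_lift (cut_ramp q c)) z - (-1) ^ i * ramp (q - i) (- ln z)) \<le> G / c"
proof -
  have "\<exists>G\<ge>0. \<forall>p. fst p \<ge> 1 \<and> 0 < snd p \<and> snd p \<le> 1 \<longrightarrow> fst p *
     norm ((euler ^^ i) (log_lift (cut_ramp q (fst p))) (snd p) - (-1) ^ i * ramp (q - i) (- ln (snd p))) \<le> G" if i: "i < q" for i
  proof -
    obtain G where G: "G \<ge> 0" "\<And>c v. c > 0 \<Longrightarrow> v > 0 \<Longrightarrow> norm (nderiv i (cut_ramp q c) v - nderiv i (ramp q) v) \<le> G * c ^ i / c ^ q"
      using cut_ramp_approx[of i q] by meson
    have "c * norm ((euler ^^ i) (log_lift (cut_ramp q c)) z - (-1) ^ i * ramp (q - i) (- ln z)) \<le> G"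
      if c: "c \<ge> 1" and z: "0 < z" "z \<le> 1" for c z
    proof (cases "z = 1")
      case True
      moreover have "q - i > 0" using i by simp
      then have "ramp (q - i) 0 = 0" by (simp add: ramp_def)
      ultimately show ?thesis using log_kernel_eq_0[of c z i q] c G(1) by simp
    next
      case False
      define v where "v = - ln z"
      have v: "v > 0" using z False by (simp add: v_def)
      have "(euler ^^ i) (log_lift (cut_ramp q c)) z - (-1) ^ i * ramp (q - i) (- ln z) =
          (-1) ^ i * (nderiv i (cut_ramp q c) v - nderiv i (ramp q) v)"
        using euler_pow_log_lift[OF smooth_on_cut_ramp, of c z i q] c z i
        by (simp add: log_lift_def v_def nderiv_ramp algebra_simps)
      then have "c * norm ((euler ^^ i) (log_lift (cut_ramp q c)) z - (-1) ^ i * ramp (q - i) (- ln z)) =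
          c * norm (nderiv i (cut_ramp q c) v - nderiv i (ramp q) v)"
        by (simp add: norm_mult norm_power)
      also have "\<dots> \<le> c * (G * c ^ i / c ^ q)" using G(2)[of c v] v c by (intro mult_left_mono) auto
      also have "\<dots> = G * (c ^ Suc i / c ^ q)" by simp
      also have "\<dots> \<le> G * 1"
      proof (intro mult_left_mono G(1))
        have "c ^ Suc i \<le> c ^ q" using c i by (intro power_increasing) auto
        then show "c ^ Suc i / c ^ q \<le> 1" using c by simp
      qed
      finally show ?thesis by simp
    qed
    then show ?thesis using G(1) by (intro exI[of _ G]) auto
  qed
  \<comment> \<open>\<open>ex_uniform_bound\<close> runs over i \<le> q, so the excluded index
    receives the value 0.\<close>
  then have "\<exists>G\<ge>0. \<forall>p. fst p \<ge> 1 \<and> 0 < snd p \<and> snd p \<le> 1 \<longrightarrow> (if i < q then fst p *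
     norm ((euler ^^ i) (log_lift (cut_ramp q (fst p))) (snd p) - (-1) ^ i * ramp (q - i) (- ln (snd p))) else 0) \<le> G" for i
    by (cases "i < q") auto
  then obtain G where G: "G \<ge> 0" "\<forall>i\<le>q. \<forall>p. fst p \<ge> 1 \<and> 0 < snd p \<and> snd p \<le> 1 \<longrightarrow> (if i < q then fst p *
     norm ((euler ^^ i) (log_lift (cut_ramp q (fst p))) (snd p) - (-1) ^ i * ramp (q - i) (- ln (snd p))) else 0) \<le> G"
    using ex_uniform_bound[of q "\<lambda>p. fst p \<ge> 1 \<and> 0 < snd p \<and> snd p \<le> 1" "\<lambda>i p. if i < q then fst p *
     norm ((euler ^^ i) (log_lift (cut_ramp q (fst p))) (snd p) - (-1) ^ i * ramp (q - i) (- ln (snd p))) else 0"] by blast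
  show ?thesis
  proof (intro exI[of _ G] conjI allI impI G(1))
    fix i :: nat and c z :: real assume *: "i < q" "c \<ge> 1" "0 < z" "z \<le> 1"
    then have "c * norm ((euler ^^ i) (log_lift (cut_ramp q c)) z - (-1) ^ i * ramp (q - i) (- ln z)) \<le> G"
      using G(2)[rule_format, of i "(c, z)"] by simp
    then show "norm ((euler ^^ i) (log_lift (cut_ramp q c)) z - (-1) ^ i * ramp (q - i) (- ln z)) \<le> G / c"
      using *(2) by (simp add: field_simps)
  qed
qed

text \<open>Taylor's formula with integral remainder in the variable - ln t, expanded at t = 1,
  where all terms but the remainder vanish.\<close>

lemma log_Taylor:
  assumes \<psi>: "smooth_on UNIV \<psi>" and x: "0 < x" "x \<le> 1" and z: "\<And>l. (euler ^^ l) \<psi> 1 = 0"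
  shows "((\<lambda>t. (-1) ^ Suc M * (ramp M (ln (t / x)) * (euler ^^ Suc M) \<psi> t / of_real t)) has_integral \<psi> x) {x..1}"
proof -
  \<comment> \<open>A primitive whose derivative telescopes to the last term. At t = x only l = 0
    survives, because the other terms contain powers of ln 1.\<close>
  define \<Psi> where "\<Psi> M t = (\<Sum>l\<le>M. (-1) ^ l * (ramp l (ln (t / x)) * (euler ^^ l) \<psi> t))" for M t
  have sm: "smooth_on UNIV ((euler ^^ l) \<psi>)" for l by (rule smooth_on_euler_pow[OF open_UNIV \<psi>])
  have ed: "((euler ^^ l) \<psi> has_vector_derivative (euler ^^ Suc l) \<psi> t / of_real t) (at t)" if "t > 0" for l t
    using euler_has_deriv[OF sm, of t l] that by simp
  have D: "(\<Psi> M has_vector_derivative (-1) ^ M * (ramp M (ln (t / x)) * (euler ^^ Suc M) \<psi> t / of_real t)) (at t)"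
    if t: "t > 0" for t
  proof (induction M)
    case 0
    show ?case using ed[OF t, of 0] by (simp add: \<Psi>_def ramp_def)
  next
    case (Suc M)
    have "((\<lambda>t. ln (t / x)) has_vector_derivative 1 / t) (at t)"
      using t x by (auto intro!: derivative_eq_intros simp flip: has_real_derivative_iff_has_vector_derivative)
    from vector_diff_chain_at[OF this ramp_has_deriv]
    have "((\<lambda>t. ramp (Suc M) (ln (t / x))) has_vector_derivative ramp M (ln (t / x)) / of_real t) (at t)"
      by (simp add: o_def scaleR_conv_of_real)
    from has_vector_derivative_add[OF Suc has_vector_derivative_mult_right[OF has_vector_derivative_mult[OF this ed[OF t]], of "(-1) ^ Suc M" "Suc M"]]
    have "((\<lambda>t. \<Psi> M t + (-1) ^ Suc M * (ramp (Suc M) (ln (t / x)) * (euler ^^ Suc M) \<psi> t)) has_vector_derivative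
      (-1) ^ Suc M * (ramp (Suc M) (ln (t / x)) * (euler ^^ Suc (Suc M)) \<psi> t / of_real t)) (at t)"
      by (rule has_vector_derivative_eq_rhs) (simp add: algebra_simps del: funpow.simps)
    then show ?case by (simp add: \<Psi>_def[abs_def] del: funpow.simps)
  qed
  have "((\<lambda>t. (-1) ^ M * (ramp M (ln (t / x)) * (euler ^^ Suc M) \<psi> t / of_real t)) has_integral \<Psi> M 1 - \<Psi> M x) {x..1}"
    by (rule fundamental_theorem_of_calculus[OF x(2)]) (use D x in \<open>auto intro: has_vector_derivative_at_within\<close>)
  moreover have "\<Psi> M 1 = 0" unfolding \<Psi>_def by (simp add: z)
  moreover have "\<Psi> M x = \<psi> x"
  proof -
    have "\<Psi> M x = (\<Sum>l\<le>M. if l = 0 then \<psi> x else 0)"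
      unfolding \<Psi>_def using x by (intro sum.cong) (auto simp: ramp_def)
    then show ?thesis by simp
  qed
  ultimately have "((\<lambda>t. (-1) ^ M * (ramp M (ln (t / x)) * (euler ^^ Suc M) \<psi> t / of_real t)) has_integral - \<psi> x) {x..1}"
    by simp
  from has_integral_neg[OF this] show ?thesis by (simp del: funpow.simps)
qed

lemma test_functions_euler_pow:
  assumes "\<phi> \<in> test_functions U"
  shows "(euler ^^ n) \<phi> \<in> test_functions U"
proof -
  obtain K where K: "smooth_on UNIV \<phi>" "compact K" "K \<subseteq> U" "\<And>x. x \<notin> K \<Longrightarrow> \<phi> x = 0"
    using test_functionsE[OF assms] by blast
  have "open (- K)" using K(2) by (simp add: compact_imp_closed open_Compl)
  then have "(euler ^^ n) \<phi> x = 0" if "x \<notin> K" for x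
    using euler_pow_eq_0_outside[of "- K" \<phi> x n] K(4) that by simp
  then show ?thesis using test_functionsI[OF smooth_on_euler_pow[OF open_UNIV K(1)] K(2,3)] by blast
qed

section \<open>Densities: every continuous functional vanishes to infinite order\<close>

section \<open>Representation of functionals near the singularity\<close>

lemma inverse_Suc_bound_imp_0:
  fixes c :: complex
  assumes "\<And>n. norm c \<le> K / real (Suc n)"
  shows "c = 0"
proof -
  have "(\<lambda>n. K * (1 / real (Suc n))) \<longlonglongrightarrow> 0"
    using tendsto_mult_left[OF LIMSEQ_Suc[OF lim_1_over_n], of K] by simp
  then have "norm c \<le> 0" by (rule LIMSEQ_le_const) (use assms in auto)
  then show ?thesis by simp
qed

text \<open>Cutting a test function in two at 0 destroys its smoothness there but keeps it in
  \<open>sing_space\<close>, so the half lines can be treated separately.\<close>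

definition restrict_pos :: "(real \<Rightarrow> complex) \<Rightarrow> real \<Rightarrow> complex" where
  "restrict_pos f x = (if x > 0 then f x else 0)"

lemma euler_pow_restrict_pos:
  assumes "x \<noteq> 0"
  shows "(euler ^^ i) (restrict_pos f) x = restrict_pos ((euler ^^ i) f) x"
proof (cases "x > 0")
  case True
  then show ?thesis
    using euler_pow_cong[OF open_less_real(2)[of 0], of "restrict_pos f" f x i] by (simp add: restrict_pos_def)
next
  case False
  with assms have "x < 0" by simp
  then show ?thesis
    using euler_pow_eq_0_outside[OF open_less_real(1)[of 0], of "restrict_pos f" x i] by (simp add: restrict_pos_def)
qed

lemma smooth_on_restrict_pos:
  assumes "smooth_on UNIV f"
  shows "smooth_on (- {0}) (restrict_pos f)"
proof -
  have "smooth_on {x. x > 0} (restrict_pos f)"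
    using smooth_on_cong[OF open_less_real(2), of 0 "restrict_pos f" f] smooth_on_subset[OF assms] by (simp add: restrict_pos_def)
  moreover have "smooth_on {x. x < 0} (restrict_pos f)"
    using smooth_on_cong[OF open_less_real(1), of 0 "restrict_pos f" "\<lambda>x. 0"] open_less_real(1) by (auto simp: restrict_pos_def)
  ultimately have "smooth_on ({x. x > 0} \<union> {x. x < 0}) (restrict_pos f)" by (rule smooth_on_Un)
  moreover have "{x. x > 0} \<union> {x. x < 0} = - {0::real}" by auto
  ultimately show ?thesis by simp
qed

lemma restrict_pos_sing_class:
  assumes "smooth_on UNIV f" "f \<in> sing_class a"
  shows "restrict_pos f \<in> sing_class a"
  unfolding sing_class_def mem_Collect_eq
proof (intro conjI allI)
  show "smooth_on (- {0}) (restrict_pos f)" by (rule smooth_on_restrict_pos[OF assms(1)])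
  fix N
  obtain B where B: "sing_bound a N B f" "B \<ge> 0" using assms(2) by (rule sing_classE)
  have "sing_bound a N B (restrict_pos f)"
    unfolding sing_bound_def
  proof (intro allI impI)
    fix x :: real and i j assume *: "x \<noteq> 0" "i \<le> N" "j \<le> N"
    show "\<bar>x\<bar> ^ (a + j) * norm ((euler ^^ i) (restrict_pos f) x) \<le> B"
      unfolding euler_pow_restrict_pos[OF *(1)] using sing_boundD[OF B(1) *] B(2)
      by (cases "x > 0") (simp_all add: restrict_pos_def)
  qed
  then show "\<exists>B. sing_bound a N B (restrict_pos f)" ..
qed

text \<open>The kernels \<open>K c\<close> are smooth approximations, as \<open>c\<close> tends to infinity, of the fundamental
  solution of the \<open>(q + 1)\<close>-st power of the Euler operator.\<close>

context
  fixes q :: nat and K :: "real \<Rightarrow> real \<Rightarrow> complex"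
  defines "K \<equiv> \<lambda>c. log_lift (cut_ramp q c)"
begin

lemma kernel_smooth: "c > 0 \<Longrightarrow> smooth_on (- {0}) (K c)"
  unfolding K_def by (intro smooth_on_log_lift smooth_on_cut_ramp)

lemma kernel_sing_class: "c > 0 \<Longrightarrow> a \<ge> 1 \<Longrightarrow> K c \<in> sing_class a"
  unfolding K_def using sing_class_mono[OF log_kernel_sing_class] by blast

lemma kernel_zero: "c > 0 \<Longrightarrow> z \<noteq> 0 \<Longrightarrow> z < 0 \<or> z \<ge> 1 \<Longrightarrow> (euler ^^ i) (K c) z = 0"
  unfolding K_def by (rule log_kernel_eq_0)

text \<open>On (0, 1] both kernels are close to the same truncated power, elsewhere they vanish. As
  |x| \<le> 1 there, the bound holds for every a.\<close>

lemma kernel_diff_bound: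
  assumes "q = Suc m"
  shows "\<exists>G\<ge>0. \<forall>a c d. c \<ge> 1 \<longrightarrow> d \<ge> 1 \<longrightarrow> sing_bound a m (G / c + G / d) (\<lambda>x. K c x - K d x)"
proof -
  obtain G where G: "G \<ge> 0" "\<And>i c z. i < q \<Longrightarrow> c \<ge> 1 \<Longrightarrow> 0 < z \<Longrightarrow> z \<le> 1 \<Longrightarrow>
     norm ((euler ^^ i) (K c) z - (-1) ^ i * ramp (q - i) (- ln z)) \<le> G / c"
    using log_kernel_approx[of q] unfolding K_def by meson
  have "sing_bound a m (G / c + G / d) (\<lambda>x. K c x - K d x)" if cd: "c \<ge> 1" "d \<ge> 1" for a c d
    unfolding sing_bound_def
  proof (intro allI impI)
    fix x :: real and i j assume *: "x \<noteq> 0" "i \<le> m" "j \<le> m"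
    have cd0: "c > 0" "d > 0" using cd by auto
    have "(euler ^^ i) (\<lambda>x. K c x + (-1) * K d x) x = (euler ^^ i) (K c) x + (-1) * (euler ^^ i) (K d) x"
      using * euler_pow_cmult[OF open_punctured kernel_smooth[OF cd0(2)], of x i "-1"]
      by (subst euler_pow_add[OF open_punctured kernel_smooth[OF cd0(1)] smooth_on_cmult[OF open_punctured kernel_smooth[OF cd0(2)]]]) auto
    then have eq: "(euler ^^ i) (\<lambda>x. K c x - K d x) x = (euler ^^ i) (K c) x - (euler ^^ i) (K d) x" by simp
    have GG: "G / c + G / d \<ge> 0" using G(1) cd0 by simp
    show "\<bar>x\<bar> ^ (a + j) * norm ((euler ^^ i) (\<lambda>x. K c x - K d x) x) \<le> G / c + G / d"
    proof (cases "0 < x \<and> x \<le> 1")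
      case True
      define \<kappa> where "\<kappa> = (-1) ^ i * ramp (q - i) (- ln x)"
      have "norm ((euler ^^ i) (K c) x - (euler ^^ i) (K d) x) = norm (((euler ^^ i) (K c) x - \<kappa>) - ((euler ^^ i) (K d) x - \<kappa>))"
        by simp
      also have "\<dots> \<le> G / c + G / d"
        unfolding \<kappa>_def using True * assms cd by (intro norm_triangle_le_diff add_mono G(2)) auto
      finally have "norm ((euler ^^ i) (\<lambda>x. K c x - K d x) x) \<le> G / c + G / d" unfolding eq .
      moreover have "\<bar>x\<bar> ^ (a + j) \<le> 1" using True by (intro power_le_one) auto
      ultimately show ?thesis using mult_mono[of "\<bar>x\<bar> ^ (a + j)" 1] by fastforce
    next
      case False
      then have "(euler ^^ i) (\<lambda>x. K c x - K d x) x = 0"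
        unfolding eq using kernel_zero[OF cd0(1) *(1)] kernel_zero[OF cd0(2) *(1)] * by auto
      then show ?thesis using GG by simp
    qed
  qed
  then show ?thesis using G(1) by blast
qed

text \<open>\<open>log_Taylor\<close> exhibits \<phi> as an exact superposition of truncated powers.
  Two errors arise: G / c from smoothing the kernel, and the omitted t < 1 / c, where the kernel may
  be as large as 1 / x; the weight with a \<ge> 1 absorbs the latter.\<close>

lemma kernel_approximates:
  assumes \<phi>: "\<phi> \<in> test_functions {-1<..<1}" and q: "q = Suc m" and a: "a \<ge> 1"
    and A: "\<And>t. t \<in> {0<..1} \<Longrightarrow> norm ((euler ^^ Suc q) \<phi> t / of_real t) \<le> A"
  shows "\<exists>D\<ge>0. \<forall>n. sing_bound a m (D / real (Suc n))
    (\<lambda>x. superpos (\<lambda>t. (-1) ^ Suc q * ((euler ^^ Suc q) \<phi> t / of_real t)) (K (real (Suc n))) (1 / real (Suc n)) 1 x - restrict_pos \<phi> x)"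
proof -
  define w where "w t = (-1) ^ Suc q * ((euler ^^ Suc q) \<phi> t / of_real t)" for t
  have sm: "smooth_on UNIV \<phi>" using \<phi> by (rule test_functions_smooth)
  have cw: "continuous_on {r..1} w" if "r > 0" for r
    unfolding w_def using that smooth_on_continuous_on[OF smooth_on_euler_pow[OF open_UNIV sm, of "Suc q"], of 0]
    by (intro continuous_intros) (auto simp del: funpow.simps intro: continuous_on_subset)
  have wA: "norm (w t) \<le> A" if "t \<in> {0<..1}" for t unfolding w_def using A[OF that] by (simp add: norm_mult norm_power norm_divide del: funpow.simps)
  have A0: "A \<ge> 0" using order_trans[OF norm_ge_zero wA[of 1]] by simp
  obtain G where G: "G \<ge> 0" "\<And>i c z. i < q \<Longrightarrow> c \<ge> 1 \<Longrightarrow> 0 < z \<Longrightarrow> z \<le> 1 \<Longrightarrow>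
     norm ((euler ^^ i) (K c) z - (-1) ^ i * ramp (q - i) (- ln z)) \<le> G / c"
    using log_kernel_approx[of q] unfolding K_def by meson
  define D where "D = A * G + A"
  have D0: "D \<ge> 0" unfolding D_def using A0 G(1) by simp
  have "sing_bound a m (D / real (Suc n)) (\<lambda>x. superpos w (K (real (Suc n))) (1 / real (Suc n)) 1 x - restrict_pos \<phi> x)" for n
    unfolding sing_bound_def
  proof (intro allI impI)
    fix x :: real and i j assume *: "x \<noteq> 0" "i \<le> m" "j \<le> m"
    define c where "c = real (Suc n)"
    have c: "c \<ge> 1" "c > 0" unfolding c_def by auto
    define r where "r = 1 / c"
    have r: "0 < r" "r \<le> 1" unfolding r_def using c by auto
    have iq: "i < q" using * q by simp
    define F where "F = (euler ^^ i) (K c)"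
    have F: "smooth_on (- {0}) F" unfolding F_def by (rule smooth_on_euler_pow[OF open_punctured kernel_smooth[OF c(2)]])
    have "(euler ^^ i) (\<lambda>x. superpos w (K c) r 1 x + (-1) * restrict_pos \<phi> x) x = superpos w F r 1 x + (-1) * restrict_pos ((euler ^^ i) \<phi>) x"
      unfolding F_def
      using * euler_pow_cmult[OF open_punctured smooth_on_restrict_pos[OF sm], of x i "-1"]
        euler_pow_superpos[OF kernel_smooth[OF c(2)] r(1) cw[OF r(1)] *(1), of i] euler_pow_restrict_pos[OF *(1), of i \<phi>]
      by (subst euler_pow_add[OF open_punctured smooth_on_superpos[OF kernel_smooth[OF c(2)] r(1) cw[OF r(1)]]
            smooth_on_cmult[OF open_punctured smooth_on_restrict_pos[OF sm]]]) auto
    then have eq: "(euler ^^ i) (\<lambda>x. superpos w (K c) r 1 x - restrict_pos \<phi> x) x = superpos w F r 1 x - restrict_pos ((euler ^^ i) \<phi>) x"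
      by simp
    have "\<bar>x\<bar> ^ (a + j) * norm (superpos w F r 1 x - restrict_pos ((euler ^^ i) \<phi>) x) \<le> D / c"
    proof (cases "0 < x \<and> x < 1")
      case False
      have "F (x / t) = 0" if "t \<in> {r..1}" for t
      proof -
        have t: "t > 0" "t \<le> 1" using that r by auto
        have "x / t < 0 \<or> x / t \<ge> 1"
        proof (cases "x < 0")
          case True
          then show ?thesis using t by (simp add: divide_neg_pos)
        next
          case False
          with \<open>\<not> (0 < x \<and> x < 1)\<close> * have "x \<ge> 1" by auto
          then show ?thesis using t by simp
        qed
        then show ?thesis unfolding F_def using kernel_zero[OF c(2), of "x / t" i] t * by simp
      qed
      then have "superpos w F r 1 x = integral {r..1} (\<lambda>t. 0)"
        unfolding superpos_def by (intro Henstock_Kurzweil_Integration.integral_cong) simp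
      moreover have "restrict_pos ((euler ^^ i) \<phi>) x = 0"
        using test_functions_eq_0[OF test_functions_euler_pow[OF \<phi>], of x i] False by (auto simp: restrict_pos_def)
      ultimately show ?thesis using D0 c by simp
    next
      case True
      then have x: "0 < x" "x < 1" by auto
      define \<kappa> where "\<kappa> t = (-1) ^ i * ramp (q - i) (- ln (x / t))" for t
      \<comment> \<open>The kernels vanish for t < x, and t < r is cut off. Both integrals therefore
        live on [y, 1], except for a piece [x, y] of length at most 1 / c.\<close>
      define y where "y = max x r"
      have y: "x \<le> y" "r \<le> y" "y \<le> 1" "0 < y" unfolding y_def using x r by auto
      have "((\<lambda>t. w t * \<kappa> t) has_integral (euler ^^ i) \<phi> x) {x..1}"
      proof -
        have "((\<lambda>t. (-1) ^ Suc (q - i) * (ramp (q - i) (ln (t / x)) * (euler ^^ Suc (q - i)) ((euler ^^ i) \<phi>) t / of_real t))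
            has_integral (euler ^^ i) \<phi> x) {x..1}"
        proof (rule log_Taylor[OF smooth_on_euler_pow[OF open_UNIV sm]])
          fix l
          show "(euler ^^ l) ((euler ^^ i) \<phi>) 1 = 0"
            using test_functions_eq_0[OF test_functions_euler_pow[OF test_functions_euler_pow[OF \<phi>]]] by simp
        qed (use x in auto)
        moreover have "(-1) ^ Suc (q - i) * (ramp (q - i) (ln (t / x)) * (euler ^^ Suc (q - i)) ((euler ^^ i) \<phi>) t / of_real t) = w t * \<kappa> t"
          if "t \<in> {x..1}" for t
        proof -
          have "Suc (q - i) + i = Suc q" using iq by simp
          then have "(euler ^^ Suc (q - i)) ((euler ^^ i) \<phi>) t = (euler ^^ Suc q) \<phi> t"
            by (metis comp_apply funpow_add)
          moreover have "ln (t / x) = - ln (x / t)" using that x by (simp add: ln_div)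
          moreover have "(-1) ^ Suc (q - i) = (-1) ^ Suc q * ((-1) ^ i :: complex)"
          proof -
            have "(-1::complex) ^ Suc q * (-1) ^ i = (-1) ^ Suc (q - i) * ((-1) ^ i * (-1) ^ i)"
              using \<open>Suc (q - i) + i = Suc q\<close> by (metis mult.assoc power_add)
            then show ?thesis by (simp flip: power_mult_distrib)
          qed
          ultimately show ?thesis unfolding w_def \<kappa>_def by (simp del: funpow.simps power_Suc)
        qed
        ultimately show ?thesis by (rule has_integral_eq[rotated]) blast
      qed
      then have wk: "(\<lambda>t. w t * \<kappa> t) integrable_on {x..1}" "integral {x..1} (\<lambda>t. w t * \<kappa> t) = (euler ^^ i) \<phi> x"
        by (auto simp: has_integral_integrable integral_unique)
      have wk1: "(\<lambda>t. w t * \<kappa> t) integrable_on {x..y}" "(\<lambda>t. w t * \<kappa> t) integrable_on {y..1}"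
        using wk(1) y by (auto elim!: integrable_on_subinterval)
      have wF: "(\<lambda>t. w t * F (x / t)) integrable_on {r..1}"
        using continuous_on_dilate_integrand[OF F r(1) cw[OF r(1)] *(1)] by (rule integrable_continuous_real)
      have wF1: "(\<lambda>t. w t * F (x / t)) integrable_on {r..y}" "(\<lambda>t. w t * F (x / t)) integrable_on {y..1}"
        using wF y by (auto elim!: integrable_on_subinterval)
      have "integral {r..y} (\<lambda>t. w t * F (x / t)) = integral {r..y} (\<lambda>t. 0)"
      proof (cases "x \<le> r")
        case True
        then have "y = r" by (simp add: y_def)
        then show ?thesis by simp
      next
        case False
        then have "y = x" by (simp add: y_def)
        show ?thesis
        proof (rule Henstock_Kurzweil_Integration.integral_cong)
          fix t assume "t \<in> {r..y}"
          then have "x / t \<ge> 1" "t > 0" using r \<open>y = x\<close> by auto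
          then show "w t * F (x / t) = 0" unfolding F_def using kernel_zero[OF c(2), of "x / t" i] * by simp
        qed
      qed
      then have s1: "superpos w F r 1 x = integral {y..1} (\<lambda>t. w t * F (x / t))"
        unfolding superpos_def using Henstock_Kurzweil_Integration.integral_combine[OF y(2,3) wF] by simp
      have s2: "restrict_pos ((euler ^^ i) \<phi>) x = integral {x..y} (\<lambda>t. w t * \<kappa> t) + integral {y..1} (\<lambda>t. w t * \<kappa> t)"
        unfolding restrict_pos_def using x wk(2) Henstock_Kurzweil_Integration.integral_combine[OF y(1,3) wk(1)] by simp
      have s3: "superpos w F r 1 x - restrict_pos ((euler ^^ i) \<phi>) x =
          integral {y..1} (\<lambda>t. w t * F (x / t) - w t * \<kappa> t) - integral {x..y} (\<lambda>t. w t * \<kappa> t)"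
        unfolding s1 s2 Henstock_Kurzweil_Integration.integral_diff[OF wF1(2) wk1(2)] by simp
      have "norm (integral (cbox y 1) (\<lambda>t. w t * F (x / t) - w t * \<kappa> t)) \<le> A * (G / c) * Henstock_Kurzweil_Integration.content (cbox y 1)"
      proof (rule integrable_bound)
        show "(\<lambda>t. w t * F (x / t) - w t * \<kappa> t) integrable_on cbox y 1" using integrable_diff[OF wF1(2) wk1(2)] by simp
        show "0 \<le> A * (G / c)" using A0 G(1) c by simp
        fix t assume "t \<in> cbox y 1"
        then have t: "t > 0" "t \<le> 1" "x \<le> t" using y by auto
        have "norm (F (x / t) - \<kappa> t) \<le> G / c"
          unfolding F_def \<kappa>_def using t x by (intro G(2)[OF iq c(1)]) auto
        then have "norm (w t) * norm (F (x / t) - \<kappa> t) \<le> A * (G / c)"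
          using wA[of t] t A0 by (intro mult_mono) auto
        then show "norm (w t * F (x / t) - w t * \<kappa> t) \<le> A * (G / c)"
          by (simp add: norm_mult flip: right_diff_distrib)
      qed
      also have "\<dots> \<le> A * (G / c) * 1" using y A0 G(1) c by (intro mult_left_mono) auto
      finally have b1: "norm (integral {y..1} (\<lambda>t. w t * F (x / t) - w t * \<kappa> t)) \<le> A * G / c" by simp
      have "norm (integral (cbox x y) (\<lambda>t. w t * \<kappa> t)) \<le> A * (1 / x) * Henstock_Kurzweil_Integration.content (cbox x y)"
      proof (rule integrable_bound)
        show "(\<lambda>t. w t * \<kappa> t) integrable_on cbox x y" using wk1(1) by simp
        show "0 \<le> A * (1 / x)" using A0 x by simp
        fix t assume "t \<in> cbox x y"
        then have t: "t > 0" "t \<le> 1" "x \<le> t" using y x by auto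
        define v where "v = - ln (x / t)"
        have v: "v \<ge> 0" "exp (- v) = x / t" unfolding v_def using t x by (auto simp: ln_le_zero_iff)
        have "x * norm (ramp (q - i) v) \<le> x / t * norm (ramp (q - i) v)"
          using t x by (intro mult_right_mono) (auto simp: field_simps)
        also have "\<dots> \<le> 1" using exp_minus_ramp_le[OF v(1), of "q - i"] v(2) by simp
        finally have "norm (\<kappa> t) \<le> 1 / x"
          using x by (simp add: \<kappa>_def v_def norm_mult norm_power field_simps)
        then show "norm (w t * \<kappa> t) \<le> A * (1 / x)"
          unfolding norm_mult using wA[of t] t A0 by (intro mult_mono) auto
      qed
      also have "\<dots> \<le> A * (1 / x) * (1 / c)"
      proof (intro mult_left_mono)
        have "y - x \<le> 1 / c" unfolding y_def r_def using x c by (auto simp: max_def)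
        then show "Henstock_Kurzweil_Integration.content (cbox x y) \<le> 1 / c" using y by simp
      qed (use A0 x in simp)
      finally have b2: "norm (integral {x..y} (\<lambda>t. w t * \<kappa> t)) \<le> A / (x * c)" by simp
      have "\<bar>x\<bar> ^ (a + j) * norm (superpos w F r 1 x - restrict_pos ((euler ^^ i) \<phi>) x) \<le> x ^ (a + j) * (A * G / c + A / (x * c))"
        unfolding s3 using x by (intro mult_mono norm_triangle_le_diff add_mono b1 b2) auto
      also have "\<dots> = x ^ (a + j) * (A * G / c) + (x ^ (a + j) / x) * (A / c)" using x by (simp add: field_simps)
      also have "\<dots> \<le> 1 * (A * G / c) + 1 * (A / c)"
      proof (intro add_mono mult_right_mono)
        show "x ^ (a + j) \<le> 1" using x by (intro power_le_one) auto
        have "x ^ (a + j) \<le> x ^ 1" using x a by (intro power_decreasing) auto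
        then show "x ^ (a + j) / x \<le> 1" using x by simp
      qed (use A0 G(1) c in auto)
      also have "\<dots> = D / c" unfolding D_def by (simp add: add_divide_distrib)
      finally show ?thesis .
    qed
    then show "\<bar>x\<bar> ^ (a + j) * norm ((euler ^^ i) (\<lambda>x. superpos w (K (real (Suc n))) (1 / real (Suc n)) 1 x - restrict_pos \<phi> x) x) \<le> D / real (Suc n)"
      using eq unfolding c_def r_def by simp
  qed
  then show ?thesis using D0 unfolding w_def by blast
qed

end

text \<open>Applying L to the superposition gives the density L(K(x / t)) in t. It converges as the
  kernels sharpen, because the bound on L involves at most m = q - 1 Euler derivatives, and the
  dilation bound makes it O(t^a).\<close>

lemma half_line_representation:
  assumes L: "sing_functional L"
  shows "\<exists>N h B. h \<in> borel_measurable borel \<and> (\<forall>t. norm (h t) \<le> B) \<and>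
    (\<forall>\<phi>\<in>test_functions {-1<..<1}. L (restrict_pos \<phi>) = (\<integral>t. h t * (of_real t ^ k * (euler ^^ N) \<phi> t) \<partial>lborel))"
proof -
  \<comment> \<open>One more than k: the measure dt / t consumes one power of t, and t^k must
    remain.\<close>
  define a where "a = Suc k"
  have a: "a \<ge> 1" unfolding a_def by simp
  obtain m C where C: "C \<ge> 0" "\<And>f B. f \<in> sing_class a \<Longrightarrow> sing_bound a m B f \<Longrightarrow> norm (L f) \<le> C * B"
    using sing_functionalE[OF L] by metis
  \<comment> \<open>One above the order of continuity of L, so that kernel differences are small in
    all m Euler derivatives that L can see.\<close>
  define q where "q = Suc m"
  define N where "N = Suc q"
  define K where "K n = log_lift (cut_ramp q (real (Suc n)))" for n
  have Ks: "K n \<in> sing_class a" "smooth_on (- {0}) (K n)" for n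
    unfolding K_def using kernel_sing_class[of "real (Suc n)" a q] kernel_smooth[of "real (Suc n)" q] a by auto
  obtain G where G: "G \<ge> 0" "\<And>n l. sing_bound a m (G / real (Suc n) + G / real (Suc l)) (\<lambda>x. K n x - K l x)"
    using kernel_diff_bound[OF q_def] unfolding K_def by (metis le_add1 of_nat_1 of_nat_le_iff plus_1_eq_Suc)
  define H where "H n t = L (\<lambda>x. K n (x / t))" for n t
  have dil: "(\<lambda>x. K n (x / t)) \<in> sing_class a" "(\<lambda>x. K n (x / t)) \<in> sing_space" if "t \<in> {0<..1}" for n t
    using sing_class_dilate[OF Ks(1), of t n] that unfolding sing_space_def by auto
  have HH: "norm (H n t - H l t) \<le> C * (t ^ a * (G / real (Suc n) + G / real (Suc l)))" if t: "t \<in> {0<..1}" for n l t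
  proof -
    have "sing_bound a m (t ^ a * (G / real (Suc n) + G / real (Suc l))) (\<lambda>x. K n (x / t) - K l (x / t))"
      using sing_bound_dilate[OF smooth_on_diff[OF open_punctured Ks(2) Ks(2)] _ _ G(2)] t by auto
    from C(2)[OF sing_class_diff[OF dil(1)[OF t] dil(1)[OF t]] this]
    show ?thesis unfolding H_def using sing_functional_diff[OF L dil(2)[OF t] dil(2)[OF t]] by simp
  qed
  define Hinf where "Hinf t = lim (\<lambda>n. H n t)" for t
  have Hlim: "(\<lambda>n. H n t) \<longlonglongrightarrow> Hinf t" if t: "t \<in> {0<..1}" for t
  proof -
    have "norm (H n t - H l t) \<le> (C * t ^ a * G) * (1 / real (Suc n) + 1 / real (Suc l))" for n l
      using HH[OF t, of n l] by (simp add: algebra_simps)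
    then have "convergent (\<lambda>n. H n t)" by (rule convergent_inverse_Suc)
    then show ?thesis unfolding Hinf_def by (simp add: convergent_LIMSEQ_iff)
  qed
  have HHinf: "norm (H n t - Hinf t) \<le> C * G * t ^ a / real (Suc n)" if t: "t \<in> {0<..1}" for n t
  proof -
    have 1: "(\<lambda>l. C * (t ^ a * (G / real (Suc n) + G * (1 / real (Suc l))))) \<longlonglongrightarrow> C * (t ^ a * (G / real (Suc n) + G * 0))"
      by (intro tendsto_intros LIMSEQ_Suc[OF lim_1_over_n])
    have 2: "(\<lambda>l. norm (H n t - H l t)) \<longlonglongrightarrow> norm (H n t - Hinf t)"
      by (intro tendsto_intros Hlim t)
    have "norm (H n t - Hinf t) \<le> C * (t ^ a * (G / real (Suc n) + G * 0))"
      by (rule LIMSEQ_le[OF 2 1]) (use HH[OF t, of n] in auto)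
    then show ?thesis by (simp add: mult_ac)
  qed
  have contH: "continuous_on {0<..1} (H n)" for n
  proof -
    obtain B where B: "sing_bound a (Suc m) B (K n)" "B \<ge> 0" using Ks(1) by (rule sing_classE)
    have lip: "norm (H n t - H n s) \<le> C * B * \<bar>t - s\<bar>" if "t \<in> {0<..1}" "s \<in> {0<..1}" for t s
    proof -
      from C(2)[OF sing_class_diff[OF dil(1)[OF that(1)] dil(1)[OF that(2)]] sing_bound_dilate_diff[OF Ks(2) B(1) a that]]
      show ?thesis unfolding H_def using sing_functional_diff[OF L dil(2)[OF that(1)] dil(2)[OF that(2)]] by (simp add: mult.assoc)
    qed
    show ?thesis
    proof (rule lipschitz_on_continuous_on)
      show "(C * B)-lipschitz_on {0<..1} (H n)"
        unfolding lipschitz_on_def dist_norm using lip C(1) B(2) by simp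
    qed
  qed
  have "uniform_limit {0<..1} H Hinf sequentially"
    unfolding uniform_limit_sequentially_iff dist_norm
  proof (intro allI impI)
    fix e :: real assume e: "e > 0"
    obtain n0 where n0: "C * G / real (Suc n0) < e"
    proof -
      have P: "C * G + 1 > 0" using C(1) G(1) by (simp add: add_nonneg_pos)
      obtain n0 where "inverse (real (Suc n0)) < e / (C * G + 1)"
        using reals_Archimedean[of "e / (C * G + 1)"] e P by auto
      have "(C * G + 1) / real (Suc n0) = (C * G + 1) * inverse (real (Suc n0))" by (simp only: divide_inverse)
      also have "\<dots> < (C * G + 1) * (e / (C * G + 1))"
        using \<open>inverse (real (Suc n0)) < e / (C * G + 1)\<close> P by (rule mult_strict_left_mono)
      also have "\<dots> = e" using P by simp
      finally have "(C * G + 1) / real (Suc n0) < e" .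
      moreover have "C * G / real (Suc n0) \<le> (C * G + 1) / real (Suc n0)" by (intro divide_right_mono) auto
      ultimately have "C * G / real (Suc n0) < e" by (rule order.strict_trans1[rotated])
      then show ?thesis by (rule that)
    qed
    have "norm (H n t - Hinf t) < e" if "n \<ge> n0" "t \<in> {0<..1}" for n t
    proof -
      have "norm (H n t - Hinf t) \<le> C * G * t ^ a / real (Suc n)" by (rule HHinf[OF that(2)])
      also have "\<dots> \<le> C * G * 1 / real (Suc n0)"
        using that C(1) G(1) by (intro frac_le mult_left_mono power_le_one) auto
      finally show ?thesis using n0 by simp
    qed
    then show "\<exists>N. \<forall>n\<ge>N. \<forall>x\<in>{0<..1}. norm (H n x - Hinf x) < e" by blast
  qed
  then have contHinf: "continuous_on {0<..1} Hinf"
    by (rule uniform_limit_theorem[rotated]) (use contH in auto)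
  obtain B0 where B0: "sing_bound a m B0 (K 0)" "B0 \<ge> 0" using Ks(1) by (rule sing_classE)
  have Hbound: "norm (Hinf t) \<le> (C * (B0 + G)) * t ^ a" if t: "t \<in> {0<..1}" for t
  proof -
    have "norm (H 0 t) \<le> C * (t ^ a * B0)"
      unfolding H_def using C(2)[OF dil(1)[OF t] sing_bound_dilate[OF Ks(2) _ _ B0(1)]] t by simp
    moreover have "norm (Hinf t) \<le> norm (H 0 t) + norm (H 0 t - Hinf t)" by (metis norm_minus_commute norm_triangle_sub)
    ultimately have "norm (Hinf t) \<le> C * (t ^ a * B0) + C * G * t ^ a" using HHinf[OF t, of 0] by simp
    then show ?thesis by (simp add: algebra_simps)
  qed
  \<comment> \<open>Division by t^a leaves a bounded function; the sign is that of
    \<open>log_Taylor\<close>.\<close>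
  define h where "h t = indicator {0<..1} t *\<^sub>R ((-1) ^ N * Hinf t / of_real t ^ a)" for t :: real
  have h0: "h t = 0" if "t \<notin> {0<..1}" for t unfolding h_def using that by simp
  have h_meas: "h \<in> borel_measurable borel"
    unfolding h_def by (rule borel_measurable_continuous_on_indicator) (auto intro!: continuous_intros contHinf)
  define B where "B = C * (B0 + G)"
  have B: "B \<ge> 0" unfolding B_def using C(1) B0(2) G(1) by simp
  have h_bound: "norm (h t) \<le> B" for t
  proof (cases "t \<in> {0<..1}")
    case True
    then have "norm (h t) = norm (Hinf t) / t ^ a" by (simp add: h_def norm_mult norm_divide norm_power)
    also have "\<dots> \<le> B" using Hbound[OF True] True unfolding B_def by (simp add: divide_le_eq)
    finally show ?thesis .
  qed (use h0 B in simp)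
  have rep: "L (restrict_pos \<phi>) = (\<integral>t. h t * (of_real t ^ k * (euler ^^ N) \<phi> t) \<partial>lborel)"
    if \<phi>: "\<phi> \<in> test_functions {-1<..<1}" for \<phi>
  proof -
    have sm: "smooth_on UNIV \<phi>" using \<phi> by (rule test_functions_smooth)
    define \<psi> where "\<psi> = (euler ^^ N) \<phi>"
    have \<psi>: "\<psi> \<in> test_functions {-1<..<1}" unfolding \<psi>_def by (rule test_functions_euler_pow[OF \<phi>])
    have \<psi>sm: "smooth_on UNIV \<psi>" using \<psi> by (rule test_functions_smooth)
    \<comment> \<open>Every Euler derivative contains a factor t, so w = \<psi> / t stays bounded
      down to 0.\<close>
    have "fun_vanishes 0 1 \<psi>" unfolding \<psi>_def N_def by (simp add: fun_vanishes_def euler_def)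
    from fun_vanishes_bound[OF _ \<psi>sm this, of 1]
    obtain A where A: "A \<ge> 0" "\<And>t. \<bar>t\<bar> \<le> 1 \<Longrightarrow> norm (\<psi> t) \<le> A * \<bar>t\<bar>" by auto
    define w where "w t = (-1) ^ N * (\<psi> t / of_real t)" for t
    have wA: "norm (w t) \<le> A" if "t \<in> {0<..1}" for t
      using A(2)[of t] that unfolding w_def by (simp add: norm_mult norm_power norm_divide divide_le_eq)
    have cw: "continuous_on {r..1} w" if "r > 0" for r
      unfolding w_def using that smooth_on_continuous_on[OF \<psi>sm, of 0]
      by (intro continuous_intros) (auto intro: continuous_on_subset)
    have "norm ((euler ^^ Suc q) \<phi> t / of_real t) \<le> A" if "t \<in> {0<..1}" for t
      using wA[OF that] unfolding w_def \<psi>_def N_def by (simp add: norm_mult norm_power norm_divide del: funpow.simps)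
    from kernel_approximates[OF \<phi> q_def a this]
    obtain D where D: "D \<ge> 0" "\<And>n. sing_bound a m (D / real (Suc n)) (\<lambda>x. superpos w (K n) (1 / real (Suc n)) 1 x - restrict_pos \<phi> x)"
      unfolding w_def \<psi>_def N_def K_def by blast
    define g where "g t = h t * (of_real t ^ k * \<psi> t)" for t
    have g_eq: "g t = w t * Hinf t" if "t \<in> {0<..1}" for t
      using that unfolding g_def h_def w_def a_def by (simp add: field_simps)
    have g_bound: "norm (g t) \<le> B * A" for t
    proof (cases "t \<in> {0<..1}")
      case True
      have "norm (of_real t ^ k * \<psi> t) \<le> 1 * (A * 1)"
        unfolding norm_mult using True A by (intro mult_mono order_trans[OF A(2)] mult_left_mono) (auto simp: norm_power power_le_one)
      then have "norm (h t) * norm (of_real t ^ k * \<psi> t) \<le> B * A" using h_bound[of t] B by (intro mult_mono) auto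
      then show ?thesis unfolding g_def by (simp add: norm_mult)
    qed (use h0 B A in \<open>simp add: g_def\<close>)
    have g_meas[measurable]: "g \<in> borel_measurable borel"
    proof -
      have "continuous_on UNIV (\<lambda>t. of_real t ^ k * \<psi> t)"
        using smooth_on_continuous_on[OF \<psi>sm, of 0] by (intro continuous_intros) auto
      from borel_measurable_times[OF h_meas borel_measurable_continuous_onI[OF this]] show ?thesis unfolding g_def .
    qed
    have g_int: "set_integrable lborel {u..v} g" for u v
      unfolding set_integrable_def
    proof (rule Bochner_Integration.integrable_bound[of _ "\<lambda>t. B * A * indicator {u..v} t"])
      show "integrable lborel (\<lambda>t. B * A * indicator {u..v} t)"
        by (intro integrable_mult_right integrable_real_indicator) (auto simp: emeasure_lborel_Icc_eq)
      show "(\<lambda>t. indicator {u..v} t *\<^sub>R g t) \<in> borel_measurable lborel" by simp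
      show "AE t in lborel. norm (indicator {u..v} t *\<^sub>R g t) \<le> norm (B * A * indicator {u..v} t)"
        using g_bound B A(1) by (intro AE_I2) (simp add: indicator_def)
    qed
    \<comment> \<open>Three errors of order 1 / (n + 1): the kernel approximation,
      \<open>H n\<close> against its limit, and the missing interval [0, r].\<close>
    have main: "norm (L (restrict_pos \<phi>) - integral\<^sup>L lborel g) \<le> (C * D + A * (C * G) + B * A) / real (Suc n)" for n
    proof -
      define r where "r = 1 / real (Suc n)"
      have r: "0 < r" "r \<le> 1" unfolding r_def by auto
      have "norm (L (\<lambda>x. superpos w (K n) r 1 x - restrict_pos \<phi> x)) \<le> C * (D / real (Suc n))"
        unfolding r_def
        by (intro C(2) D(2) sing_class_diff superpos_sing_class[OF Ks(1)] cw
            restrict_pos_sing_class[OF sm] sing_class_mono[OF schwartz_sing_class[OF test_functions_schwartz[OF \<phi>]]]) auto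
      moreover have "superpos w (K n) r 1 \<in> sing_space" "restrict_pos \<phi> \<in> sing_space"
        using superpos_sing_class[OF Ks(1) r(1) order_refl cw[OF r(1)]]
          restrict_pos_sing_class[OF sm schwartz_sing_class[OF test_functions_schwartz[OF \<phi>]]] unfolding sing_space_def by blast+
      ultimately have e1: "norm (L (superpos w (K n) r 1) - L (restrict_pos \<phi>)) \<le> C * (D / real (Suc n))"
        using sing_functional_diff[OF L] by metis
      have i1: "((\<lambda>t. w t * H n t) has_integral L (superpos w (K n) r 1)) {r..1}"
        unfolding H_def by (rule sing_functional_superpos[OF L Ks(1) a r cw[OF r(1)]])
      have i2: "(g has_integral (LINT t:{r..1}|lborel. g t)) {r..1}"
        using set_borel_integral_eq_integral[OF g_int[of r 1]] by (simp add: has_integral_integral)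
      have "norm (L (superpos w (K n) r 1) - (LINT t:{r..1}|lborel. g t)) \<le> A * (C * G / real (Suc n)) * Henstock_Kurzweil_Integration.content (cbox r 1)"
      proof (rule has_integral_bound)
        show "((\<lambda>t. w t * H n t - g t) has_integral (L (superpos w (K n) r 1) - (LINT t:{r..1}|lborel. g t))) (cbox r 1)"
          using has_integral_diff[OF i1 i2] by simp
        show "0 \<le> A * (C * G / real (Suc n))" using A C(1) G(1) by simp
        fix t assume "t \<in> cbox r 1"
        then have t: "t \<in> {0<..1}" using r by auto
        have "norm (H n t - Hinf t) \<le> C * G * t ^ a / real (Suc n)" by (rule HHinf[OF t])
        also have "\<dots> \<le> C * G * 1 / real (Suc n)"
          using t C(1) G(1) by (intro divide_right_mono mult_left_mono power_le_one) auto
        finally have "norm (w t) * norm (H n t - Hinf t) \<le> A * (C * G / real (Suc n))"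
          using wA[OF t] A by (intro mult_mono) auto
        then show "norm (w t * H n t - g t) \<le> A * (C * G / real (Suc n))"
          unfolding g_eq[OF t] by (simp add: norm_mult flip: right_diff_distrib)
      qed
      also have "\<dots> \<le> A * (C * G / real (Suc n)) * 1"
        using r A C(1) G(1) by (intro mult_left_mono) auto
      finally have e2: "norm (L (superpos w (K n) r 1) - (LINT t:{r..1}|lborel. g t)) \<le> A * (C * G) / real (Suc n)" by simp
      have "integral\<^sup>L lborel g = (LINT t:{0..1}|lborel. g t)"
        unfolding set_lebesgue_integral_def
        by (intro Bochner_Integration.integral_cong) (auto simp: g_def h0 indicator_def)
      also have "\<dots> = (LINT t:{0..r}|lborel. g t) + (LINT t:{r..1}|lborel. g t)"
      proof -
        have "integral {0..r} g + integral {r..1} g = integral {0..1} g"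
          by (rule Henstock_Kurzweil_Integration.integral_combine) (use r set_borel_integral_eq_integral(1)[OF g_int[of 0 1]] in auto)
        then show ?thesis using set_borel_integral_eq_integral(2)[OF g_int] by simp
      qed
      finally have e3: "integral\<^sup>L lborel g - (LINT t:{r..1}|lborel. g t) = (LINT t:{0..r}|lborel. g t)" by simp
      have "norm (LINT t:{0..r}|lborel. g t) \<le> B * A * Henstock_Kurzweil_Integration.content (cbox 0 r)"
      proof (rule has_integral_bound)
        show "(g has_integral (LINT t:{0..r}|lborel. g t)) (cbox 0 r)"
          using set_borel_integral_eq_integral[OF g_int[of 0 r]] by (simp add: has_integral_integral)
      qed (use B A g_bound in auto)
      then have e4: "norm (integral\<^sup>L lborel g - (LINT t:{r..1}|lborel. g t)) \<le> B * A / real (Suc n)"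
        unfolding e3 using r unfolding r_def by simp
      have "L (restrict_pos \<phi>) - integral\<^sup>L lborel g =
          - (L (superpos w (K n) r 1) - L (restrict_pos \<phi>)) + (L (superpos w (K n) r 1) - (LINT t:{r..1}|lborel. g t))
          - (integral\<^sup>L lborel g - (LINT t:{r..1}|lborel. g t))" by simp
      also have "norm \<dots> \<le> C * (D / real (Suc n)) + A * (C * G) / real (Suc n) + B * A / real (Suc n)"
        by (intro norm_triangle_le_diff norm_triangle_le add_mono e2 e4) (use e1 in \<open>simp only: norm_minus_cancel\<close>)
      finally show ?thesis by (simp add: add_divide_distrib)
    qed
    have "L (restrict_pos \<phi>) - integral\<^sup>L lborel g = 0" by (rule inverse_Suc_bound_imp_0[OF main])
    then show ?thesis unfolding g_def \<psi>_def by simp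
  qed
  show ?thesis using h_meas h_bound rep by blast
qed

section \<open>The negative half line, and the passage to tangential operators\<close>

lemma euler_pow_reflect:
  assumes "smooth_on (- {0}) f" "x \<noteq> 0"
  shows "(euler ^^ i) (\<lambda>x. f (- x)) x = (euler ^^ i) f (- x)"
  using euler_pow_scale[OF open_punctured open_punctured assms(1), of "-1" x i] assms(2) by simp

lemma smooth_on_reflect:
  assumes "smooth_on (- {0}) f"
  shows "smooth_on (- {0}) (\<lambda>x. f (- x))"
  by (rule smooth_on_compose[OF open_punctured open_punctured assms(1), where g' = "\<lambda>x. - 1"])
     (auto intro!: derivative_eq_intros smooth_on_minus[OF open_punctured smooth_on_const])

lemma sing_bound_reflect:
  assumes "smooth_on (- {0}) f" "sing_bound a N B f"
  shows "sing_bound a N B (\<lambda>x. f (- x))"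
  unfolding sing_bound_def
proof (intro allI impI)
  fix x :: real and i j assume *: "x \<noteq> 0" "i \<le> N" "j \<le> N"
  show "\<bar>x\<bar> ^ (a + j) * norm ((euler ^^ i) (\<lambda>x. f (- x)) x) \<le> B"
    unfolding euler_pow_reflect[OF assms(1) *(1)] using sing_boundD[OF assms(2), of "- x" i j] * by simp
qed

lemma sing_class_reflect: "f \<in> sing_class a \<Longrightarrow> (\<lambda>x. f (- x)) \<in> sing_class a"
  unfolding sing_class_def using smooth_on_reflect sing_bound_reflect by blast

lemma sing_functional_reflect:
  assumes L: "sing_functional L"
  shows "sing_functional (\<lambda>f. L (\<lambda>x. f (- x)))"
  unfolding sing_functional_def linear_functional_on_def
proof (intro conjI ballI allI)
  have sp: "(\<lambda>x. f (- x)) \<in> sing_space" if "f \<in> sing_space" for f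
    using that sing_class_reflect unfolding sing_space_def by blast
  fix f g assume "f \<in> sing_space" "g \<in> sing_space"
  then show "L (\<lambda>x. f (- x) + g (- x)) = L (\<lambda>x. f (- x)) + L (\<lambda>x. g (- x))"
    by (intro sing_functional_add[OF L] sp)
next
  have sp: "(\<lambda>x. f (- x)) \<in> sing_space" if "f \<in> sing_space" for f
    using that sing_class_reflect unfolding sing_space_def by blast
  fix c f assume "f \<in> sing_space"
  then show "L (\<lambda>x. c * f (- x)) = c * L (\<lambda>x. f (- x))"
    by (intro sing_functional_cmult[OF L] sp)
next
  fix a
  obtain N C where C: "C \<ge> 0" "\<And>f B. f \<in> sing_class a \<Longrightarrow> sing_bound a N B f \<Longrightarrow> norm (L f) \<le> C * B"
    using sing_functionalE[OF L] by metis
  then show "\<exists>N C. \<forall>f\<in>sing_class a. \<forall>B. sing_bound a N B f \<longrightarrow> norm (L (\<lambda>x. f (- x))) \<le> C * B"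
    using sing_class_reflect sing_bound_reflect sing_classD by blast
qed

text \<open>A transposed operator has its coefficients under the derivatives, hence the form d^i
  x^(k + i). The recursion is x^(k + i) \<theta> \<phi> = (x^(k + i + 1) \<phi>)' - (k + i + 1) x^(k
  + i) \<phi>.\<close>

lemma power_euler_expansion:
  "\<exists>\<gamma>. \<forall>\<phi> t. smooth_on UNIV \<phi> \<longrightarrow>
     of_real t ^ k * (euler ^^ N) \<phi> t = (\<Sum>i\<le>N. \<gamma> i * nderiv i (\<lambda>x. of_real x ^ (k + i) * \<phi> x) t)"
proof (induction N)
  case 0
  show ?case by (intro exI[of _ "\<lambda>i. 1"]) simp
next
  case (Suc N)
  then obtain \<gamma> where \<gamma>: "\<And>\<phi> t. smooth_on UNIV \<phi> \<Longrightarrow>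
     of_real t ^ k * (euler ^^ N) \<phi> t = (\<Sum>i\<le>N. \<gamma> i * nderiv i (\<lambda>x. of_real x ^ (k + i) * \<phi> x) t)" by blast
  have step: "nderiv i (\<lambda>x. of_real x ^ (k + i) * euler \<phi> x) t =
      nderiv (Suc i) (\<lambda>x. of_real x ^ (k + Suc i) * \<phi> x) t - of_nat (k + Suc i) * nderiv i (\<lambda>x. of_real x ^ (k + i) * \<phi> x) t"
    if \<phi>: "smooth_on UNIV \<phi>" for i \<phi> t
  proof -
    have p: "smooth_on UNIV (\<lambda>x. of_real x ^ n * \<phi> x)" for n
      by (intro smooth_on_mult smooth_on_of_real_power \<phi> open_UNIV)
    have "((\<lambda>x. of_real x ^ (k + Suc i) * \<phi> x) has_vector_derivative
        of_real x ^ (k + Suc i) * nderiv 1 \<phi> x + (of_nat (k + Suc i) * of_real x ^ (k + i)) * \<phi> x) (at x)" for x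
    proof -
      have "((\<lambda>x. of_real x ^ (k + Suc i) :: complex) has_vector_derivative of_nat (k + Suc i) * of_real x ^ (k + i)) (at x)"
        using smooth_on_has_deriv[OF smooth_on_of_real_power[OF open_UNIV] UNIV_I, of "k + Suc i" x]
          nderiv_power[of 1 "k + Suc i" x] by (simp del: of_nat_Suc)
      from has_vector_derivative_mult[OF this smooth_on_has_deriv[OF \<phi> UNIV_I]] show ?thesis .
    qed
    from nderiv_1_eq[OF this]
    have "nderiv 1 (\<lambda>x. of_real x ^ (k + Suc i) * \<phi> x) =
        (\<lambda>x. of_real x ^ (k + i) * euler \<phi> x + of_nat (k + Suc i) * (of_real x ^ (k + i) * \<phi> x))"
      by (simp add: fun_eq_iff euler_def mult_ac)
    then have "nderiv (Suc i) (\<lambda>x. of_real x ^ (k + Suc i) * \<phi> x) t =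
        nderiv i (\<lambda>x. of_real x ^ (k + i) * euler \<phi> x + of_nat (k + Suc i) * (of_real x ^ (k + i) * \<phi> x)) t"
      by (simp only: nderiv_Suc_right)
    also have "\<dots> = nderiv i (\<lambda>x. of_real x ^ (k + i) * euler \<phi> x) t + of_nat (k + Suc i) * nderiv i (\<lambda>x. of_real x ^ (k + i) * \<phi> x) t"
      by (subst nderiv_plus[OF open_UNIV _ smooth_on_cmult[OF open_UNIV p] UNIV_I])
         (auto intro!: smooth_on_mult smooth_on_of_real_power smooth_on_euler[OF open_UNIV \<phi>] simp: nderiv_cmult[OF open_UNIV p])
    finally show ?thesis by simp
  qed
  \<comment> \<open>Index i collects the derivative term coming from i - 1 and the correction coming
    from i itself; the corrections stop at N.\<close>
  define \<gamma>' where "\<gamma>' i = (if i = 0 then 0 else \<gamma> (i - 1)) - (if i \<le> N then of_nat (k + Suc i) * \<gamma> i else 0)" for i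
  have "of_real t ^ k * (euler ^^ Suc N) \<phi> t = (\<Sum>i\<le>Suc N. \<gamma>' i * nderiv i (\<lambda>x. of_real x ^ (k + i) * \<phi> x) t)"
    if \<phi>: "smooth_on UNIV \<phi>" for \<phi> t
  proof -
    define d where "d i = nderiv i (\<lambda>x. of_real x ^ (k + i) * \<phi> x) t" for i
    have "of_real t ^ k * (euler ^^ Suc N) \<phi> t = (\<Sum>i\<le>N. \<gamma> i * (d (Suc i) - of_nat (k + Suc i) * d i))"
      unfolding euler_pow_Suc_right \<gamma>[OF smooth_on_euler[OF open_UNIV \<phi>]] step[OF \<phi>] d_def ..
    also have "\<dots> = (\<Sum>i\<le>N. \<gamma> i * d (Suc i)) - (\<Sum>i\<le>N. of_nat (k + Suc i) * \<gamma> i * d i)"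
      by (simp add: sum_subtractf right_diff_distrib mult_ac del: of_nat_Suc of_nat_add)
    also have "(\<Sum>i\<le>N. \<gamma> i * d (Suc i)) = (\<Sum>i\<le>Suc N. (if i = 0 then 0 else \<gamma> (i - 1)) * d i)"
      by (subst sum.atMost_Suc_shift) simp
    also have "(\<Sum>i\<le>N. of_nat (k + Suc i) * \<gamma> i * d i) = (\<Sum>i\<le>Suc N. (if i \<le> N then of_nat (k + Suc i) * \<gamma> i else 0) * d i)"
      by (simp del: of_nat_Suc of_nat_add)
    finally show ?thesis unfolding \<gamma>'_def d_def by (simp only: left_diff_distrib sum_subtractf)
  qed
  then show ?case by blast
qed

text \<open>i derivatives lower the order by i and x^i restores it. For i > k the truncated
  \<open>k - i\<close> is 0 and x^i alone is enough.\<close>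

lemma tangential_monomial_op:
  assumes U: "open U" "0 \<in> U"
  shows "tangential_op U 0 N (\<lambda>i x. c i * of_real x ^ i)"
  unfolding tangential_op_def
proof (intro conjI allI impI)
  show "smooth_on U (\<lambda>x. c i * of_real x ^ i)" for i
    by (intro smooth_on_cmult smooth_on_of_real_power U)
  fix k g assume g: "smooth_on U g \<and> fun_vanishes 0 k g"
  have one: "fun_vanishes 0 k (\<lambda>x. c i * of_real x ^ i * nderiv i g x) \<and> smooth_on U (\<lambda>x. c i * of_real x ^ i * nderiv i g x)" for i
  proof
    have "fun_vanishes 0 (k - i) (nderiv i g)"
      using g unfolding fun_vanishes_def by (simp add: nderiv_add[symmetric])
    then have "fun_vanishes 0 (i + (k - i)) (\<lambda>x. of_real x ^ i * nderiv i g x)"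
      using g by (intro fun_vanishes_mult[OF U] smooth_on_of_real_power smooth_on_nderiv U fun_vanishes_power) auto
    then have "fun_vanishes 0 k (\<lambda>x. of_real x ^ i * nderiv i g x)" unfolding fun_vanishes_def by auto
    then show "fun_vanishes 0 k (\<lambda>x. c i * of_real x ^ i * nderiv i g x)"
      unfolding mult.assoc using g by (intro fun_vanishes_cmult[OF U] smooth_on_mult smooth_on_of_real_power smooth_on_nderiv U) auto
    show "smooth_on U (\<lambda>x. c i * of_real x ^ i * nderiv i g x)"
      using g by (intro smooth_on_mult smooth_on_cmult smooth_on_of_real_power smooth_on_nderiv U) auto
  qed
  have "fun_vanishes 0 k (\<lambda>x. \<Sum>i\<le>n. c i * of_real x ^ i * nderiv i g x)" for n
  proof (induction n)
    case (Suc n)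
    show ?case unfolding sum.atMost_Suc
      by (intro fun_vanishes_plus[OF U] smooth_on_sum U conjunct1[OF one] conjunct2[OF one] Suc)
  qed (use one[of 0] in simp)
  then show "fun_vanishes 0 k (diff_op N (\<lambda>i x. c i * of_real x ^ i) g)" unfolding diff_op_def .
qed

text \<open>Transposing d^i yields (-1)^i, which the sign in the coefficients cancels. The left side
  has the shape f D h demanded of a vanishing distribution.\<close>

lemma fun_dist_euler_representation:
  assumes U: "open U" and h: "h \<in> borel_measurable borel" "\<And>t. norm (h t) \<le> B"
    and \<gamma>: "\<And>\<phi> t. smooth_on UNIV \<phi> \<Longrightarrow> of_real t ^ k * (euler ^^ N) \<phi> t = (\<Sum>i\<le>N. \<gamma> i * nderiv i (\<lambda>x. of_real x ^ (k + i) * \<phi> x) t)"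
    and \<phi>: "\<phi> \<in> test_functions U"
  shows "dist_mult (\<lambda>x. of_real x ^ k) (dist_diff_op N (\<lambda>i x. (-1) ^ i * \<gamma> i * of_real x ^ i) (fun_dist U h)) \<phi> =
    (\<integral>t. h t * (of_real t ^ k * (euler ^^ N) \<phi> t) \<partial>lborel)"
proof -
  have sm: "smooth_on UNIV \<phi>" using \<phi> by (rule test_functions_smooth)
  have int: "fun_dist U h \<psi> = (\<integral>t. h t * \<psi> t \<partial>lborel)" "integrable lborel (\<lambda>t. h t * \<psi> t)"
    if \<psi>: "\<psi> \<in> test_functions U" for \<psi>
  proof -
    obtain C where C: "decays C \<psi>" using schwartz_decays[OF test_functions_schwartz[OF \<psi>]] .
    have B0: "B \<ge> 0" using order_trans[OF norm_ge_zero h(2)] .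
    have [measurable]: "\<psi> \<in> borel_measurable borel" using C unfolding decays_def by (simp add: borel_measurable_continuous_onI)
    note h(1)[measurable]
    have m: "(\<lambda>t. h t * \<psi> t) \<in> borel_measurable lborel" by simp
    show "integrable lborel (\<lambda>t. h t * \<psi> t)"
    proof (rule Bochner_Integration.integrable_bound)
      show "integrable lborel (\<lambda>t. B * norm (\<psi> t))" using decays_integrable(1)[OF C] by simp
      show "AE t in lborel. norm (h t * \<psi> t) \<le> norm (B * norm (\<psi> t))"
        using h(2) B0 by (intro AE_I2) (simp add: norm_mult mult_right_mono)
    qed (use m in simp)
    have "fun_dist U h \<psi> = integral\<^sup>L lebesgue (\<lambda>t. indicator U t *\<^sub>R (h t * \<psi> t))"
      unfolding fun_dist_def using U by (subst integral_restrict_space) auto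
    also have "(\<lambda>t. indicator U t *\<^sub>R (h t * \<psi> t)) = (\<lambda>t. h t * \<psi> t)"
      using test_functions_eq_0[OF \<psi>] by (auto simp: indicator_def fun_eq_iff)
    also have "integral\<^sup>L lebesgue \<dots> = integral\<^sup>L lborel \<dots>" by (rule integral_completion[OF m])
    finally show "fun_dist U h \<psi> = (\<integral>t. h t * \<psi> t \<partial>lborel)" .
  qed
  have nd: "nderiv i f \<in> test_functions U" if f: "f \<in> test_functions U" for f i
  proof -
    obtain K where K: "smooth_on UNIV f" "compact K" "K \<subseteq> U" "\<And>x. x \<notin> K \<Longrightarrow> f x = 0" using test_functionsE[OF f] by blast
    have "open (- K)" using K(2) by (simp add: compact_imp_closed open_Compl)
    then have "nderiv i f x = 0" if "x \<notin> K" for x using nderiv_eq_0_outside[of "- K" f x i] K(4) that by simp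
    then show ?thesis by (rule test_functionsI[OF smooth_on_nderiv[OF K(1)] K(2,3)])
  qed
  have p: "(\<lambda>x. of_real x ^ n * \<phi> x) \<in> test_functions U" for n
    by (rule test_functions_mult[OF \<phi> U smooth_on_of_real_power[OF U]])
  have "dist_mult (\<lambda>x. of_real x ^ k) (dist_diff_op N (\<lambda>i x. (-1) ^ i * \<gamma> i * of_real x ^ i) (fun_dist U h)) \<phi> =
      (\<Sum>i\<le>N. (-1) ^ i * fun_dist U h (nderiv i (\<lambda>x. ((-1) ^ i * \<gamma> i) * (of_real x ^ (k + i) * \<phi> x))))"
    unfolding dist_mult_def dist_diff_op_def dist_deriv_pow by (simp add: power_add mult_ac)
  also have "\<dots> = (\<Sum>i\<le>N. \<integral>t. \<gamma> i * (h t * nderiv i (\<lambda>x. of_real x ^ (k + i) * \<phi> x) t) \<partial>lborel)"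
  proof (intro sum.cong refl)
    fix i
    have "nderiv i (\<lambda>x. ((-1) ^ i * \<gamma> i) * (of_real x ^ (k + i) * \<phi> x)) = (\<lambda>t. ((-1) ^ i * \<gamma> i) * nderiv i (\<lambda>x. of_real x ^ (k + i) * \<phi> x) t)"
      using nderiv_cmult[OF open_UNIV test_functions_smooth[OF p] UNIV_I] by blast
    then have "fun_dist U h (nderiv i (\<lambda>x. ((-1) ^ i * \<gamma> i) * (of_real x ^ (k + i) * \<phi> x))) =
        (\<integral>t. ((-1) ^ i * \<gamma> i) * (h t * nderiv i (\<lambda>x. of_real x ^ (k + i) * \<phi> x) t) \<partial>lborel)"
      using int(1)[OF test_functions_cmult[OF nd[OF p]], of "(-1) ^ i * \<gamma> i" i "k + i"] by (simp add: mult_ac)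
    then show "(-1) ^ i * fun_dist U h (nderiv i (\<lambda>x. ((-1) ^ i * \<gamma> i) * (of_real x ^ (k + i) * \<phi> x))) =
        (\<integral>t. \<gamma> i * (h t * nderiv i (\<lambda>x. of_real x ^ (k + i) * \<phi> x) t) \<partial>lborel)"
      by (simp add: mult.assoc)
  qed
  also have "\<dots> = (\<integral>t. (\<Sum>i\<le>N. \<gamma> i * (h t * nderiv i (\<lambda>x. of_real x ^ (k + i) * \<phi> x) t)) \<partial>lborel)"
    by (rule Bochner_Integration.integral_sum[symmetric]) (intro integrable_mult_right int(2) nd p)
  also have "(\<lambda>t. \<Sum>i\<le>N. \<gamma> i * (h t * nderiv i (\<lambda>x. of_real x ^ (k + i) * \<phi> x) t)) = (\<lambda>t. h t * (of_real t ^ k * (euler ^^ N) \<phi> t))"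
    unfolding \<gamma>[OF sm] by (simp add: sum_distrib_left mult_ac)
  finally show ?thesis .
qed

lemma bounded_measurable_Linf_loc:
  assumes "open U" "h \<in> borel_measurable borel" "\<And>t. norm (h t) \<le> B"
  shows "Linf_loc U h"
  unfolding Linf_loc_def
proof (intro conjI allI impI)
  have "h \<in> borel_measurable lebesgue" using assms(2) by (simp add: measurable_completion)
  then show "h \<in> borel_measurable (lebesgue_on U)" by (rule measurable_restrict_space1)
  show "\<exists>C. AE x in lebesgue_on K. norm (h x) \<le> C" for K
    using assms(3) by (intro exI[of _ B] AE_I2)
qed

text \<open>Two terms f D h suffice, one per half line; the negative one is the positive one for the
  reflected functional.\<close>

lemma sing_functional_dist_vanishes:
  assumes L: "sing_functional L"
  shows "dist_vanishes_inf 0 L"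
  unfolding dist_vanishes_inf_def
proof
  fix k
  define U where "U = {-1<..<1::real}"
  have U: "open U" "0 \<in> U" unfolding U_def by auto
  obtain N1 h1 B1 where 1: "h1 \<in> borel_measurable borel" "\<And>t. norm (h1 t) \<le> B1"
    "\<And>\<phi>. \<phi> \<in> test_functions U \<Longrightarrow> L (restrict_pos \<phi>) = (\<integral>t. h1 t * (of_real t ^ k * (euler ^^ N1) \<phi> t) \<partial>lborel)"
    using half_line_representation[OF L, of k] unfolding U_def by blast
  obtain N2 h2 B2 where 2: "h2 \<in> borel_measurable borel" "\<And>t. norm (h2 t) \<le> B2"
    "\<And>\<phi>. \<phi> \<in> test_functions U \<Longrightarrow> L (\<lambda>x. restrict_pos \<phi> (- x)) = (\<integral>t. h2 t * (of_real t ^ k * (euler ^^ N2) \<phi> t) \<partial>lborel)"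
    using half_line_representation[OF sing_functional_reflect[OF L], of k] unfolding U_def by blast
  \<comment> \<open>Substituting - t turns t^k into (-1)^k t^k, while \<theta> commutes with the
    reflection.\<close>
  define h3 where "h3 t = (-1) ^ k * h2 (- t)" for t
  have h2m[measurable]: "h2 \<in> borel_measurable borel" by (rule 2(1))
  have 3: "h3 \<in> borel_measurable borel" "\<And>t. norm (h3 t) \<le> B2"
    unfolding h3_def using 2(2) by (auto simp: norm_mult norm_power)
  have reflect: "(\<lambda>x. \<phi> (- x)) \<in> test_functions U" if \<phi>: "\<phi> \<in> test_functions U" for \<phi>
  proof -
    obtain K where K: "smooth_on UNIV \<phi>" "compact K" "K \<subseteq> U" "\<And>x. x \<notin> K \<Longrightarrow> \<phi> x = 0" using test_functionsE[OF \<phi>] by blast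
    have "smooth_on UNIV (\<lambda>x. \<phi> (- 1 * x))" by (rule smooth_on_scale[OF K(1)])
    then have "smooth_on UNIV (\<lambda>x. \<phi> (- x))" by simp
    then show ?thesis
    proof (rule test_functionsI[of _ "uminus ` K"])
      show "compact (uminus ` K)" using K(2) by (rule compact_negations)
      show "uminus ` K \<subseteq> U" using K(3) unfolding U_def by fastforce
      show "\<phi> (- x) = 0" if "x \<notin> uminus ` K" for x
        using K(4)[of "- x"] that by (metis image_eqI minus_minus)
    qed
  qed
  have neg: "L (\<lambda>x. restrict_pos (\<lambda>x. \<phi> (- x)) (- x)) = (\<integral>t. h3 t * (of_real t ^ k * (euler ^^ N2) \<phi> t) \<partial>lborel)"
    if \<phi>: "\<phi> \<in> test_functions U" for \<phi>
  proof -
    have "(euler ^^ N2) (\<lambda>x. \<phi> (- x)) t = (euler ^^ N2) \<phi> (- t)" for t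
      using euler_pow_scale[OF open_UNIV open_UNIV test_functions_smooth[OF \<phi>], of "-1" t N2] by simp
    then have "L (\<lambda>x. restrict_pos (\<lambda>x. \<phi> (- x)) (- x)) = (\<integral>t. h2 t * (of_real t ^ k * (euler ^^ N2) \<phi> (- t)) \<partial>lborel)"
      using 2(3)[OF reflect[OF \<phi>]] by simp
    also have "\<dots> = (\<integral>t. h2 (- t) * (of_real (- t) ^ k * (euler ^^ N2) \<phi> t) \<partial>lborel)"
      using lborel_integral_real_affine[of "-1" "\<lambda>t. h2 t * (of_real t ^ k * (euler ^^ N2) \<phi> (- t))" 0] by simp
    also have "(\<lambda>t. h2 (- t) * (of_real (- t) ^ k * (euler ^^ N2) \<phi> t)) = (\<lambda>t. h3 t * (of_real t ^ k * (euler ^^ N2) \<phi> t))"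
      unfolding h3_def by (simp add: fun_eq_iff power_minus[of "complex_of_real _"] mult_ac)
    finally show ?thesis .
  qed
  obtain \<gamma>1 where \<gamma>1: "\<And>\<phi> t. smooth_on UNIV \<phi> \<Longrightarrow> of_real t ^ k * (euler ^^ N1) \<phi> t = (\<Sum>i\<le>N1. \<gamma>1 i * nderiv i (\<lambda>x. of_real x ^ (k + i) * \<phi> x) t)"
    using power_euler_expansion by blast
  obtain \<gamma>2 where \<gamma>2: "\<And>\<phi> t. smooth_on UNIV \<phi> \<Longrightarrow> of_real t ^ k * (euler ^^ N2) \<phi> t = (\<Sum>i\<le>N2. \<gamma>2 i * nderiv i (\<lambda>x. of_real x ^ (k + i) * \<phi> x) t)"
    using power_euler_expansion by blast
  define f :: "nat \<Rightarrow> real \<Rightarrow> complex" where "f j x = of_real x ^ k" for j x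
  define m where "m j = (if j = 0 then N1 else N2)" for j :: nat
  define a where "a j i x = (-1) ^ i * (if j = 0 then \<gamma>1 i else \<gamma>2 i) * complex_of_real x ^ i" for j i :: nat and x
  define h where "h j = (if j = 0 then h1 else h3)" for j :: nat
  have P1: "\<forall>j<2. Linf_loc U (h j) \<and> tangential_op U 0 (m j) (a j) \<and> smooth_on U (f j) \<and> fun_vanishes 0 k (f j)"
  proof (intro allI impI conjI)
    fix j :: nat
    show "Linf_loc U (h j)"
      unfolding h_def using bounded_measurable_Linf_loc[OF U(1) 1(1,2)] bounded_measurable_Linf_loc[OF U(1) 3] by simp
    show "tangential_op U 0 (m j) (a j)"
      using tangential_monomial_op[OF U, of "m j" "\<lambda>i. (-1) ^ i * (if j = 0 then \<gamma>1 i else \<gamma>2 i)"] unfolding a_def[abs_def] .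
    show "smooth_on U (f j)" unfolding f_def by (rule smooth_on_of_real_power[OF U(1)])
    show "fun_vanishes 0 k (f j)" unfolding f_def by (rule fun_vanishes_power)
  qed
  have P2: "\<forall>\<phi>\<in>test_functions U. L \<phi> = (\<Sum>j<2. dist_mult (f j) (dist_diff_op (m j) (a j) (fun_dist U (h j))) \<phi>)"
  proof
    fix \<phi> assume \<phi>: "\<phi> \<in> test_functions U"
    have sm: "smooth_on UNIV \<phi>" using \<phi> by (rule test_functions_smooth)
    define g1 where "g1 = restrict_pos \<phi>"
    define g2 where "g2 x = restrict_pos (\<lambda>x. \<phi> (- x)) (- x)" for x
    have "g1 \<in> sing_space" unfolding g1_def sing_space_def
      using restrict_pos_sing_class[OF sm schwartz_sing_class[OF test_functions_schwartz[OF \<phi>]]] by blast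
    moreover have "g2 \<in> sing_space" unfolding g2_def sing_space_def
      using sing_class_reflect[OF restrict_pos_sing_class[OF test_functions_smooth[OF reflect[OF \<phi>]]
          schwartz_sing_class[OF test_functions_schwartz[OF reflect[OF \<phi>]]]]] by blast
    ultimately have "L (\<lambda>x. g1 x + g2 x) = L g1 + L g2" by (rule sing_functional_add[OF L])
    moreover have "L \<phi> = L (\<lambda>x. g1 x + g2 x)"
      by (rule sing_functional_cong[OF L schwartz_sing_space[OF test_functions_schwartz[OF \<phi>]]])
         (auto simp: g1_def g2_def restrict_pos_def)
    moreover have "(\<Sum>j<2. dist_mult (f j) (dist_diff_op (m j) (a j) (fun_dist U (h j))) \<phi>) = L g1 + L g2"
    proof -
      have e1: "dist_mult (f 0) (dist_diff_op (m 0) (a 0) (fun_dist U (h 0))) \<phi> = L g1"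
        using fun_dist_euler_representation[OF U(1) 1(1,2) \<gamma>1 \<phi>] 1(3)[OF \<phi>]
        by (simp add: f_def[abs_def] m_def a_def[abs_def] h_def g1_def)
      have e2: "dist_mult (f 1) (dist_diff_op (m 1) (a 1) (fun_dist U (h 1))) \<phi> = L g2"
        using fun_dist_euler_representation[OF U(1) 3 \<gamma>2 \<phi>] neg[OF \<phi>]
        by (simp add: f_def[abs_def] m_def a_def[abs_def] h_def g2_def[abs_def])
      show ?thesis using e1 e2 by (simp add: numeral_2_eq_2)
    qed
    ultimately show "L \<phi> = (\<Sum>j<2. dist_mult (f j) (dist_diff_op (m j) (a j) (fun_dist U (h j))) \<phi>)" by simp
  qed
  show "dist_vanishes 0 k L"
    unfolding dist_vanishes_def
    by (intro exI[of _ U] conjI U, rule exI[of _ "2::nat"], rule exI[of _ f], rule exI[of _ m],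
        rule exI[of _ a], rule exI[of _ h], rule conjI[OF P1 P2])
qed

section \<open>Uniqueness of extensions, and evaluation of the pairing\<close>

section \<open>Canonical extensions and the pairing\<close>

lemma sing_functional_distribution:
  assumes "sing_functional L"
  shows "distribution_on UNIV L"
  unfolding distribution_on_def
proof (intro conjI allI impI)
  have tL: "tempered L" by (rule sing_functional_tempered[OF assms])
  show "linear_functional_on (test_functions UNIV) L"
    unfolding linear_functional_on_def
    using tempered_add[OF tL] tempered_cmult[OF tL] test_functions_schwartz by blast
  obtain N C where C: "C \<ge> 0" "\<And>\<phi> B. schwartz \<phi> \<Longrightarrow> schwartz_bound N B \<phi> \<Longrightarrow> norm (L \<phi>) \<le> C * B"
    using temperedE[OF tL] by metis
  fix K :: "real set" assume "compact K \<and> K \<subseteq> UNIV"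
  then obtain R where R: "R > 0" "\<And>x. x \<in> K \<Longrightarrow> \<bar>x\<bar> \<le> R"
    using compact_imp_bounded[of K] unfolding bounded_pos by auto
  \<comment> \<open>At least 1, so that \<open>R1 ^ N\<close> bounds |x|^j on the support for every
    j \<le> N.\<close>
  define R1 where "R1 = max 1 R"
  show "\<exists>C N. \<forall>\<phi>\<in>test_functions UNIV. {x. \<phi> x \<noteq> 0} \<subseteq> K \<longrightarrow>
      norm (L \<phi>) \<le> C * (\<Sum>j\<le>N. SUP x. norm (nderiv j \<phi> x))"
  proof (intro exI[of _ "C * R1 ^ N"] exI[of _ N] ballI impI)
    fix \<phi> assume \<phi>: "\<phi> \<in> test_functions UNIV" and supp: "{x. \<phi> x \<noteq> 0} \<subseteq> K"
    define s where "s j = (SUP x. norm (nderiv j \<phi> x))" for j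
    have le: "norm (nderiv j \<phi> x) \<le> s j" for j x
    proof -
      obtain B where "\<forall>x. norm (nderiv j \<phi> x) \<le> B" using test_functions_nderiv_bound[OF \<phi>] by blast
      then have "bdd_above (range (\<lambda>x. norm (nderiv j \<phi> x)))" by (auto intro: bdd_aboveI)
      then show ?thesis unfolding s_def by (intro cSUP_upper) auto
    qed
    have s0: "s j \<ge> 0" for j using order_trans[OF norm_ge_zero le[of j 0]] .
    have S0: "(\<Sum>j\<le>N. s j) \<ge> 0" using s0 by (intro sum_nonneg)
    have "schwartz_bound N (R1 ^ N * (\<Sum>j\<le>N. s j)) \<phi>"
      unfolding schwartz_bound_def
    proof (intro allI impI)
      fix x :: real and i j assume ij: "i \<le> N" "j \<le> N"
      show "\<bar>x\<bar> ^ j * norm (nderiv i \<phi> x) \<le> R1 ^ N * (\<Sum>j\<le>N. s j)"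
      proof (cases "\<bar>x\<bar> \<le> R")
        case True
        have "\<bar>x\<bar> ^ j \<le> R1 ^ j" using True unfolding R1_def by (intro power_mono) auto
        also have "\<dots> \<le> R1 ^ N" using ij unfolding R1_def by (intro power_increasing) auto
        finally have 1: "\<bar>x\<bar> ^ j \<le> R1 ^ N" .
        have "norm (nderiv i \<phi> x) \<le> s i" by (rule le)
        also have "\<dots> \<le> (\<Sum>j\<le>N. s j)" using ij s0 by (intro member_le_sum) auto
        finally show ?thesis using 1 by (intro mult_mono) (auto simp: R1_def)
      next
        case False
        have "open {x::real. \<bar>x\<bar> > R}" by (intro open_Collect_less continuous_intros)
        moreover have "\<phi> y = 0" if "\<bar>y\<bar> > R" for y using supp R(2)[of y] that by auto
        ultimately have "nderiv i \<phi> x = 0" using nderiv_eq_0_outside[of "{x. \<bar>x\<bar> > R}" \<phi> x i] False by auto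
        then show ?thesis using S0 by (simp add: R1_def)
      qed
    qed
    from C(2)[OF test_functions_schwartz[OF \<phi>] this]
    show "norm (L \<phi>) \<le> C * R1 ^ N * (\<Sum>j\<le>N. SUP x. norm (nderiv j \<phi> x))" unfolding s_def by (simp add: mult.assoc)
  qed
qed

lemma sing_functional_is_canonical_extension:
  assumes "sing_functional L" "\<And>\<phi>. \<phi> \<in> test_functions (- {0}) \<Longrightarrow> L \<phi> = S \<phi>"
  shows "is_canonical_extension 0 S L"
  unfolding is_canonical_extension_def
  using sing_functional_distribution sing_functional_dist_vanishes assms by blast

lemma test_functions_chi_flat:
  assumes "\<phi> \<in> test_functions UNIV" "c > 0"
  shows "(\<lambda>x. (1 - chi (c * x)) * \<phi> x) \<in> test_functions (- {0})"
proof -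
  obtain K where K: "smooth_on UNIV \<phi>" "compact K" "K \<subseteq> UNIV" "\<And>x. x \<notin> K \<Longrightarrow> \<phi> x = 0"
    using test_functionsE[OF assms(1)] by blast
  define K' where "K' = K \<inter> {x. \<bar>x\<bar> \<ge> 1 / c}"
  show ?thesis
  proof (rule test_functionsI[of _ K'])
    show "smooth_on UNIV (\<lambda>x. (1 - chi (c * x)) * \<phi> x)"
      by (intro smooth_on_mult smooth_on_diff smooth_on_const smooth_on_chi_scale K(1) open_UNIV)
    have "closed {x::real. \<bar>x\<bar> \<ge> 1 / c}" by (intro closed_Collect_le continuous_intros)
    then show "compact K'" unfolding K'_def by (rule compact_Int_closed[OF K(2)])
    show "K' \<subseteq> - {0}" unfolding K'_def using assms(2) by (auto simp: not_le)
    fix x assume "x \<notin> K'"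
    then show "(1 - chi (c * x)) * \<phi> x = 0"
    proof (cases "x \<in> K")
      case True
      then have "\<bar>x\<bar> < 1 / c" using \<open>x \<notin> K'\<close> unfolding K'_def by auto
      then have "\<bar>c * x\<bar> < 1" using assms(2) by (simp add: abs_mult pos_less_divide_eq mult.commute)
      then have "chi (c * x) = 1" by (intro chi_eq_1) simp
      then show ?thesis by simp
    qed (simp add: K(4))
  qed
qed

text \<open>Already vanishing to order one makes extensions across the origin unique.\<close>

lemma dist_vanishes_tendsto:
  assumes lin: "linear_functional_on (test_functions UNIV) S" and van: "dist_vanishes 0 1 S"
    and \<phi>: "\<phi> \<in> test_functions UNIV"
  shows "(\<lambda>n. S (\<lambda>x. (1 - chi (real (Suc n) * x)) * \<phi> x)) \<longlonglongrightarrow> S \<phi>"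
proof -
  obtain r M C where r: "r > 0" and C: "C \<ge> 0" "\<And>\<phi> B. \<phi> \<in> test_functions {-r<..<r} \<Longrightarrow>
      (\<And>x l. x \<noteq> 0 \<Longrightarrow> l \<le> M \<Longrightarrow> \<bar>x\<bar> ^ 1 * norm ((euler ^^ l) \<phi> x) \<le> B) \<Longrightarrow> norm (S \<phi>) \<le> C * B"
    using dist_vanishes_bound[OF van] by metis
  have add: "S (\<lambda>x. f x + g x) = S f + S g" if "f \<in> test_functions UNIV" "g \<in> test_functions UNIV" for f g
    using lin that unfolding linear_functional_on_def by blast
  have f: "\<phi> \<in> sing_class 0" using \<phi> by (intro schwartz_sing_class test_functions_schwartz)
  have sm: "smooth_on UNIV \<phi>" using \<phi> by (rule test_functions_smooth)
  obtain K where K: "K \<ge> 0" "\<And>f B c. smooth_on (- {0}) f \<Longrightarrow> sing_bound 0 M B f \<Longrightarrow> c > 0 \<Longrightarrow>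
     sing_bound (Suc 0) M (K * B / c) (\<lambda>x. chi (c * x) * f x)"
    using sing_bound_chi_small by meson
  obtain B where B: "sing_bound 0 M B \<phi>" using f by (rule sing_classE)
  obtain n0 where n0: "2 / r < real n0" using reals_Archimedean2 by blast
  define X where "X n = S (\<lambda>x. chi (real (Suc (n + n0)) * x) * \<phi> x)" for n
  have "norm (X n - 0) \<le> C * (K * B) / real (Suc n)" for n
  proof -
    define c where "c = real (Suc (n + n0))"
    have c: "c > 0" "c \<ge> real (Suc n)" unfolding c_def by auto
    have "2 / r < c" using n0 unfolding c_def by simp
    then have "2 / c < r" using r c by (simp add: field_simps)
    then have t: "(\<lambda>x. chi (c * x) * \<phi> x) \<in> test_functions {-r<..<r}" by (rule test_functions_chi[OF sm c(1)])
    have "norm (S (\<lambda>x. chi (c * x) * \<phi> x)) \<le> C * (K * B / c)"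
      by (rule C(2)[OF t]) (use sing_boundD[OF K(2)[OF sing_classD[OF f] B c(1)], of _ _ 0] in auto)
    also have "\<dots> \<le> C * (K * B / real (Suc n))"
      using c C(1) K(1) sing_bound_nonneg[OF B] by (intro mult_left_mono divide_left_mono) auto
    finally show ?thesis unfolding X_def c_def by simp
  qed
  then have "X \<longlonglongrightarrow> 0" by (rule tendsto_inverse_Suc_bound)
  then have 0: "(\<lambda>n. S (\<lambda>x. chi (real (Suc n) * x) * \<phi> x)) \<longlonglongrightarrow> 0"
    unfolding X_def by (rule LIMSEQ_offset[of "\<lambda>n. S (\<lambda>x. chi (real (Suc n) * x) * \<phi> x)" n0])
  have "S (\<lambda>x. (1 - chi (real (Suc n) * x)) * \<phi> x) = S \<phi> - S (\<lambda>x. chi (real (Suc n) * x) * \<phi> x)" for n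
  proof -
    have 1: "(\<lambda>x. chi (real (Suc n) * x) * \<phi> x) \<in> test_functions UNIV"
      by (rule test_functions_mult[OF \<phi> open_UNIV smooth_on_chi_scale])
    have 2: "(\<lambda>x. (1 - chi (real (Suc n) * x)) * \<phi> x) \<in> test_functions UNIV"
      using test_functions_mono[OF test_functions_chi_flat[OF \<phi>, of "real (Suc n)"]] by simp
    have "S (\<lambda>x. chi (real (Suc n) * x) * \<phi> x + (1 - chi (real (Suc n) * x)) * \<phi> x) =
        S (\<lambda>x. chi (real (Suc n) * x) * \<phi> x) + S (\<lambda>x. (1 - chi (real (Suc n) * x)) * \<phi> x)"
      by (rule add[OF 1 2])
    moreover have "(\<lambda>x. chi (real (Suc n) * x) * \<phi> x + (1 - chi (real (Suc n) * x)) * \<phi> x) = \<phi>"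
      by (simp add: fun_eq_iff algebra_simps)
    ultimately show ?thesis by simp
  qed
  then show ?thesis using tendsto_diff[OF tendsto_const[of "S \<phi>"] 0] by simp
qed

text \<open>Both extensions are limits of their values on test functions cut away from 0, where they
  coincide with S.\<close>

lemma canonical_extension_unique:
  assumes "is_canonical_extension 0 S E" "is_canonical_extension 0 S F" "\<phi> \<in> test_functions UNIV"
  shows "E \<phi> = F \<phi>"
proof -
  have 1: "(\<lambda>n. D (\<lambda>x. (1 - chi (real (Suc n) * x)) * \<phi> x)) \<longlonglongrightarrow> D \<phi>"
    "D (\<lambda>x. (1 - chi (real (Suc n) * x)) * \<phi> x) = S (\<lambda>x. (1 - chi (real (Suc n) * x)) * \<phi> x)"
    if "is_canonical_extension 0 S D" for D n
    using that dist_vanishes_tendsto[OF _ _ assms(3), of D] test_functions_chi_flat[OF assms(3), of "real (Suc n)"]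
    unfolding is_canonical_extension_def distribution_on_def dist_vanishes_inf_def by auto
  show ?thesis using 1(1)[OF assms(1)] 1(1)[OF assms(2)] unfolding 1(2)[OF assms(1)] 1(2)[OF assms(2)]
    by (rule LIMSEQ_unique)
qed

text \<open>L witnesses that the \<open>SOME\<close> term is an extension at all, and uniqueness
  identifies the two on test functions.\<close>

lemma canonical_extension_eq:
  assumes L: "sing_functional L" "\<And>\<phi>. \<phi> \<in> test_functions (- {0}) \<Longrightarrow> L \<phi> = S \<phi>" and \<phi>: "\<phi> \<in> test_functions UNIV"
  shows "canonical_extension 0 S \<phi> = L \<phi>"
proof -
  have "is_canonical_extension 0 S L" by (rule sing_functional_is_canonical_extension[OF L])
  then have "is_canonical_extension 0 S (canonical_extension 0 S)"
    unfolding canonical_extension_def by (rule someI[of "is_canonical_extension 0 S"])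
  then show ?thesis using \<open>is_canonical_extension 0 S L\<close> \<phi> by (rule canonical_extension_unique)
qed

lemma ex_test_function_eq_1:
  assumes "compact (K :: real set)"
  shows "\<exists>\<psi>\<in>test_functions UNIV. \<exists>W. open W \<and> K \<subseteq> W \<and> (\<forall>x\<in>W. \<psi> x = 1)"
proof -
  obtain R where R: "R > 0" "\<And>x. x \<in> K \<Longrightarrow> \<bar>x\<bar> \<le> R"
    using compact_imp_bounded[OF assms] unfolding bounded_pos by auto
  define c where "c = 1 / (R + 1)"
  have c: "c > 0" unfolding c_def using R(1) by simp
  show ?thesis
  proof (intro bexI[of _ "\<lambda>x. chi (c * x)"] exI[of _ "{x. \<bar>x\<bar> < R + 1}"] conjI ballI)
    show "open {x::real. \<bar>x\<bar> < R + 1}" by (intro open_Collect_less continuous_intros)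
    show "K \<subseteq> {x. \<bar>x\<bar> < R + 1}" using R(2) by fastforce
    show "chi (c * x) = 1" if "x \<in> {x. \<bar>x\<bar> < R + 1}" for x
      using that R(1) unfolding c_def by (intro chi_eq_1) (auto simp: abs_mult field_simps)
    show "(\<lambda>x. chi (c * x)) \<in> test_functions UNIV"
      using test_functions_mono[OF test_functions_chi[OF smooth_on_const[OF open_UNIV, of 1] c, of "2 / c + 1"]] by simp
  qed
qed

lemma cutoff_exists: "\<exists>\<phi>. cutoff \<phi>"
proof -
  obtain \<psi> W where \<psi>: "\<psi> \<in> test_functions UNIV" "open W" "{0::real} \<subseteq> W" "\<forall>x\<in>W. \<psi> x = 1"
    using ex_test_function_eq_1[of "{0}"] by auto
  then obtain d where "d > 0" "ball 0 d \<subseteq> W" by (metis insert_subset open_contains_ball)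
  then have "\<forall>x. \<bar>x\<bar> < d \<longrightarrow> \<psi> x = 1" using \<psi>(4) by (auto simp: ball_def dist_real_def)
  then show ?thesis unfolding cutoff_def using \<psi>(1) \<open>d > 0\<close> by blast
qed

text \<open>The description leaves the carrier open. Two carriers yield the same number because some
  test function is 1 near both.\<close>

lemma dist_integral_eqI:
  assumes K: "compact K" "\<And>\<phi>. \<phi> \<in> test_functions (- K) \<Longrightarrow> E \<phi> = 0"
    and c: "\<And>\<psi> W. \<psi> \<in> test_functions UNIV \<Longrightarrow> open W \<Longrightarrow> K \<subseteq> W \<Longrightarrow> (\<And>x. x \<in> W \<Longrightarrow> \<psi> x = 1) \<Longrightarrow> E \<psi> = c"
  shows "dist_integral E = c"
  unfolding dist_integral_def
proof (rule the_equality)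
  show "\<exists>K. compact K \<and> (\<forall>\<phi>\<in>test_functions (- K). E \<phi> = 0) \<and>
     (\<forall>\<psi>\<in>test_functions UNIV. (\<exists>W. open W \<and> K \<subseteq> W \<and> (\<forall>x\<in>W. \<psi> x = 1)) \<longrightarrow> E \<psi> = c)"
  proof (intro exI[of _ K] conjI ballI impI)
    fix \<psi> assume \<psi>: "\<psi> \<in> test_functions UNIV" "\<exists>W. open W \<and> K \<subseteq> W \<and> (\<forall>x\<in>W. \<psi> x = 1)"
    then obtain W where "open W" "K \<subseteq> W" "\<forall>x\<in>W. \<psi> x = 1" by blast
    then show "E \<psi> = c" by (intro c[OF \<psi>(1)]) auto
  qed (fact K)+
  fix d assume "\<exists>K. compact K \<and> (\<forall>\<phi>\<in>test_functions (- K). E \<phi> = 0) \<and>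
     (\<forall>\<psi>\<in>test_functions UNIV. (\<exists>W. open W \<and> K \<subseteq> W \<and> (\<forall>x\<in>W. \<psi> x = 1)) \<longrightarrow> E \<psi> = d)"
  then obtain K' where K': "compact K'"
    "\<forall>\<psi>\<in>test_functions UNIV. (\<exists>W. open W \<and> K' \<subseteq> W \<and> (\<forall>x\<in>W. \<psi> x = 1)) \<longrightarrow> E \<psi> = d"
    by (elim exE conjE)
  obtain \<psi> W where \<psi>: "\<psi> \<in> test_functions UNIV" "open W" "K \<union> K' \<subseteq> W" "\<forall>x\<in>W. \<psi> x = 1"
    using ex_test_function_eq_1[OF compact_Un[OF K(1) K'(1)]] by blast
  have "E \<psi> = c" by (rule c[OF \<psi>(1,2)]) (use \<psi>(3,4) in auto)
  moreover have "\<exists>W. open W \<and> K' \<subseteq> W \<and> (\<forall>x\<in>W. \<psi> x = 1)" by (intro exI[of _ W] conjI) (use \<psi>(2-4) in auto)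
  with K'(2) \<psi>(1) have "E \<psi> = d" by simp
  ultimately show "d = c" by simp
qed

lemma test_times_sing_class:
  assumes "\<phi> \<in> test_functions UNIV" "f \<in> sing_class a"
  shows "(\<lambda>x. \<phi> x * f x) \<in> sing_class a"
  using sing_class_mult[OF assms(2) schwartz_sing_class[OF test_functions_schwartz[OF assms(1)]]] by simp

text \<open>The functional taking g to L(\<phi> u g) is continuous, hence the canonical extension of
  \<phi> u \<sigma>, and its integral is L(\<phi> u). The rest (1 - \<phi>) u is a Schwartz
  function, so linearity gives L(u) for every cutoff. Separate u and f allow for different values at
  0.\<close>

lemma sis_pairing_eq:
  assumes L: "sing_functional L" and \<sigma>: "\<And>\<phi>. schwartz \<phi> \<Longrightarrow> \<sigma> \<phi> = L \<phi>"
    and f: "f \<in> sing_space" and u: "smooth_on (- {0}) u" "\<And>x. x \<noteq> 0 \<Longrightarrow> u x = f x"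
  shows "sis_pairing u \<sigma> = L f"
proof -
  obtain a where a: "u \<in> sing_class a" using f sing_class_cong[of u f] u(2) unfolding sing_space_def by blast
  then have us: "u \<in> sing_space" unfolding sing_space_def by blast
  have Lu: "L u = L f" by (rule sing_functional_cong[OF L us u(2)])
  have main: "dist_integral (canonical_extension 0 (dist_mult (\<lambda>x. \<phi> x * u x) \<sigma>)) + \<sigma> (\<lambda>x. (1 - \<phi> x) * u x) = L f"
    if "cutoff \<phi>" for \<phi>
  proof -
    obtain \<delta> where \<phi>: "\<phi> \<in> test_functions UNIV" and \<delta>: "\<delta> > 0" "\<And>x. \<bar>x\<bar> < \<delta> \<Longrightarrow> \<phi> x = 1"
      using \<open>cutoff \<phi>\<close> unfolding cutoff_def by blast
    have pu: "(\<lambda>x. \<phi> x * u x) \<in> sing_class a" by (rule test_times_sing_class[OF \<phi> a])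
    then have pus: "(\<lambda>x. \<phi> x * u x) \<in> sing_space" unfolding sing_space_def by blast
    define M where "M g = L (\<lambda>x. (\<phi> x * u x) * g x)" for g
    have M: "sing_functional M" unfolding M_def by (rule sing_functional_mult[OF L pus])
    have M_eq: "M \<psi> = dist_mult (\<lambda>x. \<phi> x * u x) \<sigma> \<psi>" if \<psi>: "\<psi> \<in> test_functions (- {0})" for \<psi>
    proof -
      have "smooth_on (- {0}) (\<lambda>x. \<phi> x * u x)" using pu by (rule sing_classD)
      from test_functions_mult[OF \<psi> open_punctured this]
      show ?thesis unfolding M_def dist_mult_def using \<sigma> test_functions_schwartz by simp
    qed
    define E where "E = canonical_extension 0 (dist_mult (\<lambda>x. \<phi> x * u x) \<sigma>)"
    have E: "E \<psi> = M \<psi>" if "\<psi> \<in> test_functions UNIV" for \<psi>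
      unfolding E_def by (rule canonical_extension_eq[OF M M_eq that])
    obtain K where K: "smooth_on UNIV \<phi>" "compact K" "K \<subseteq> UNIV" "\<And>x. x \<notin> K \<Longrightarrow> \<phi> x = 0" using test_functionsE[OF \<phi>] by blast
    have zero: "L (\<lambda>x. 0) = 0" using sing_functional_cmult[OF L us, of 0] by simp
    have "dist_integral E = L (\<lambda>x. \<phi> x * u x)"
    proof (rule dist_integral_eqI[OF K(2)])
      fix \<psi> assume \<psi>: "\<psi> \<in> test_functions (- K)"
      have "(\<lambda>x. (\<phi> x * u x) * \<psi> x) = (\<lambda>x. 0)"
        using K(4) test_functions_eq_0[OF \<psi>] by (auto simp: fun_eq_iff)
      then show "E \<psi> = 0" using E[OF test_functions_mono[OF \<psi>]] zero unfolding M_def by simp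
    next
      fix \<psi> W assume \<psi>: "\<psi> \<in> test_functions UNIV" "K \<subseteq> W" "\<And>x. x \<in> W \<Longrightarrow> \<psi> x = 1"
      have "(\<lambda>x. (\<phi> x * u x) * \<psi> x) = (\<lambda>x. \<phi> x * u x)"
        using K(4) \<psi>(2,3) by (auto simp: fun_eq_iff)
      then show "E \<psi> = L (\<lambda>x. \<phi> x * u x)" using E[OF \<psi>(1)] unfolding M_def by simp
    qed
    moreover have "\<sigma> (\<lambda>x. (1 - \<phi> x) * u x) = L u - L (\<lambda>x. \<phi> x * u x)"
    proof -
      have "(\<lambda>x. (1 - \<phi> x) * u x) \<in> sing_class a"
        using sing_class_diff[OF a pu] by (simp add: left_diff_distrib)
      from flat_schwartz[OF \<delta>(1) this] have "schwartz (\<lambda>x. (1 - \<phi> x) * u x)" using \<delta>(2) by simp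
      from \<sigma>[OF this] show ?thesis using sing_functional_diff[OF L us pus] by (simp add: left_diff_distrib)
    qed
    ultimately show ?thesis unfolding E_def using Lu by simp
  qed
  show ?thesis
    unfolding sis_pairing_def
  proof (rule the_equality)
    show "\<forall>\<phi>. cutoff \<phi> \<longrightarrow> L f = dist_integral (canonical_extension 0 (dist_mult (\<lambda>x. \<phi> x * u x) \<sigma>)) + \<sigma> (\<lambda>x. (1 - \<phi> x) * u x)"
      using main by simp
    fix c assume "\<forall>\<phi>. cutoff \<phi> \<longrightarrow> c = dist_integral (canonical_extension 0 (dist_mult (\<lambda>x. \<phi> x * u x) \<sigma>)) + \<sigma> (\<lambda>x. (1 - \<phi> x) * u x)"
    then show "c = L f" using cutoff_exists main by metis
  qed
qed

section \<open>Density of test functions, and uniqueness of smooth densities off 0\<close>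

section \<open>Uniqueness of tempered functionals and of densities\<close>

text \<open>Truncating f by \<open>chi\<close> at radius about n + 1 converges to f in the norm that
  controls the functional, by \<open>sing_bound_chi_large\<close>.\<close>

lemma tempered_unique:
  assumes S: "tempered S" and T: "tempered T" and eq: "\<And>\<phi>. \<phi> \<in> test_functions UNIV \<Longrightarrow> S \<phi> = T \<phi>" and f: "schwartz f"
  shows "S f = T f"
proof -
  have lim: "(\<lambda>n. R (\<lambda>x. chi (1 / real (Suc n) * x) * f x)) \<longlonglongrightarrow> R f" if R: "tempered R" for R
  proof -
    obtain N C where C: "C \<ge> 0" "\<And>\<phi> B. schwartz \<phi> \<Longrightarrow> schwartz_bound N B \<phi> \<Longrightarrow> norm (R \<phi>) \<le> C * B"
      using temperedE[OF R] by metis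
    have f0: "f \<in> sing_class 0" "smooth_on (- {0}) f" using schwartz_sing_class[OF f] sing_classD by auto
    obtain K where K: "K \<ge> 0" "\<And>f B c. smooth_on (- {0}) f \<Longrightarrow> sing_bound 0 (Suc N) B f \<Longrightarrow> c > 0 \<Longrightarrow>
       sing_bound 0 N (K * B * c) (\<lambda>x. (1 - chi (c * x)) * f x)"
      using sing_bound_chi_large by meson
    obtain B where B: "sing_bound 0 (Suc N) B f" using f0(1) by (rule sing_classE)
    have tst: "(\<lambda>x. chi (1 / real (Suc n) * x) * f x) \<in> test_functions UNIV" for n
      using test_functions_mono[OF test_functions_chi[OF schwartz_smooth[OF f], of "1 / real (Suc n)" "2 / (1 / real (Suc n)) + 1"]] by simp
    have "norm (R (\<lambda>x. chi (1 / real (Suc n) * x) * f x) - R f) \<le> C * (fact N * (K * B)) / real (Suc n)" for n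
    proof -
      define c where "c = 1 / real (Suc n)"
      have c: "c > 0" "c \<le> 1" unfolding c_def by auto
      define g where "g x = (1 - chi (c * x)) * f x" for x
      have g: "schwartz g" unfolding g_def by (rule schwartz_one_minus_chi[OF f0(1) c(1)])
      have "sing_bound 0 N (K * B * c) g" unfolding g_def by (rule K(2)[OF f0(2) B c(1)])
      moreover have "g x = 0" if "\<bar>x\<bar> < 1" for x
      proof -
        have "\<bar>c * x\<bar> \<le> 1 * 1" unfolding abs_mult using that c by (intro mult_mono) auto
        then show ?thesis unfolding g_def by (simp add: chi_eq_1)
      qed
      ultimately have "schwartz_bound N (fact N / 1 ^ (0 + N) * (K * B * c)) g"
        using sing_classD[OF schwartz_sing_class[OF g]] by (intro sing_bound_imp_schwartz_bound) auto
      from C(2)[OF g this] have "norm (R g) \<le> C * (fact N * (K * B)) * c" by (simp add: mult_ac)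
      moreover have "R g = R f - R (\<lambda>x. chi (c * x) * f x)"
        using tempered_diff[OF R f test_functions_schwartz[OF tst[of n]]] unfolding g_def c_def by (simp add: left_diff_distrib)
      ultimately show ?thesis unfolding c_def by (simp add: norm_minus_commute)
    qed
    then show ?thesis by (rule tendsto_inverse_Suc_bound)
  qed
  have "S (\<lambda>x. chi (1 / real (Suc n) * x) * f x) = T (\<lambda>x. chi (1 / real (Suc n) * x) * f x)" for n
    using test_functions_mono[OF test_functions_chi[OF schwartz_smooth[OF f], of "1 / real (Suc n)" "2 / (1 / real (Suc n)) + 1"]]
    by (intro eq) simp
  then show ?thesis using lim[OF S] lim[OF T] LIMSEQ_unique by simp
qed

text \<open>Inversion is a homeomorphism of the punctured line, so compact supports avoiding 0 are
  carried to such supports.\<close>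

lemma inv_twist_test_function:
  assumes "\<phi> \<in> test_functions (- {0})"
  shows "inv_twist \<alpha> \<eta> \<phi> \<in> test_functions (- {0})"
proof -
  obtain K where K: "smooth_on UNIV \<phi>" "compact K" "K \<subseteq> - {0}" "\<And>x. x \<notin> K \<Longrightarrow> \<phi> x = 0"
    using test_functionsE[OF assms] by blast
  have c: "\<phi> \<in> sing_class 0" using assms by (intro schwartz_sing_class test_functions_schwartz)
  define K' where "K' = (\<lambda>x. 1 / x) ` K"
  show ?thesis
  proof (rule test_functionsI[of _ K'])
    show "smooth_on UNIV (inv_twist \<alpha> \<eta> \<phi>)" by (rule smooth_on_UNIV_inv_twist(1)[OF c])
    have "continuous_on K (\<lambda>x. 1 / x)" using K(3) by (intro continuous_intros) auto
    then show "compact K'" unfolding K'_def using K(2) by (rule compact_continuous_image)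
    show "K' \<subseteq> - {0}" unfolding K'_def using K(3) by auto
    fix x assume "x \<notin> K'"
    then have "x \<noteq> 0 \<longrightarrow> 1 / x \<notin> K" unfolding K'_def by (auto simp: image_iff)
    then show "inv_twist \<alpha> \<eta> \<phi> x = 0" unfolding inv_twist_def using K(4) by auto
  qed
qed

text \<open>Testing with the conjugate of u - v times a bump at x makes the integral of |u - v|^2
  times the bump vanish, and continuity then forces u = v at x.\<close>

lemma fun_dist_injective:
  assumes u: "smooth_on (- {0}) u" and v: "smooth_on (- {0}) v"
    and eq: "\<And>\<phi>. \<phi> \<in> test_functions (- {0}) \<Longrightarrow> fun_dist (- {0}) u \<phi> = fun_dist (- {0}) v \<phi>"
    and x: "x \<noteq> 0"
  shows "u x = v x"
proof (rule ccontr)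
  assume ne: "u x \<noteq> v x"
  define d where "d y = u y - v y" for y
  have d: "smooth_on (- {0}) d" unfolding d_def by (intro smooth_on_diff u v open_punctured)
  \<comment> \<open>Nonzero exactly for |y - x| < |x| / 2, an interval that avoids 0.\<close>
  define \<beta> where "\<beta> y = exp_bump 0 (x\<^sup>2 / 4 - (y - x)\<^sup>2)" for y
  define K where "K = {x - \<bar>x\<bar> / 2..x + \<bar>x\<bar> / 2}"
  have K0: "K \<subseteq> - {0}" unfolding K_def using x by (auto simp: abs_if split: if_splits)
  have \<beta>_out: "\<beta> y = 0" if "y \<notin> K" for y
  proof -
    have "\<bar>y - x\<bar> \<ge> \<bar>x\<bar> / 2" using that unfolding K_def by auto
    then have "(\<bar>x\<bar> / 2)\<^sup>2 \<le> \<bar>y - x\<bar>\<^sup>2" by (intro power_mono) auto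
    then show ?thesis by (simp add: \<beta>_def exp_bump_def power_divide)
  qed
  have "smooth_on UNIV \<beta>"
    unfolding \<beta>_def
  proof (rule smooth_on_compose[OF open_UNIV open_UNIV smooth_on_exp_bump, where g' = "\<lambda>y. - (2 * (y - x))"])
    show "smooth_on UNIV (\<lambda>y. complex_of_real (- (2 * (y - x))))"
      using smooth_on_minus[OF open_UNIV smooth_on_cmult[OF open_UNIV smooth_on_diff[OF open_UNIV smooth_on_of_real[OF open_UNIV] smooth_on_const[OF open_UNIV]]], of 2 "of_real x"]
      by simp
  qed (auto intro!: derivative_eq_intros)
  then have \<beta>: "\<beta> \<in> test_functions (- {0})"
    by (rule test_functionsI[OF _ _ K0]) (auto simp: K_def intro: \<beta>_out[unfolded K_def])
  have cnj_smooth: "smooth_on (- {0}) (\<lambda>y. cnj (d y))"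
    unfolding smooth_on_iff_C_on
  proof
    fix n show "C_on n (- {0}) (\<lambda>y. cnj (d y))"
      using d
    proof (induction n arbitrary: d)
      case (Suc n)
      have "((\<lambda>y. cnj (d y)) has_vector_derivative cnj (nderiv 1 d y)) (at y)" if "y \<in> - {0}" for y
        using bounded_linear.has_vector_derivative[OF bounded_linear_cnj smooth_on_has_deriv[OF Suc.prems that]] .
      from C_on_SucI[OF open_punctured this Suc.IH[OF smooth_on_nderiv[OF Suc.prems]]] show ?case .
    qed simp
  qed
  define \<phi> where "\<phi> y = cnj (d y) * \<beta> y" for y
  have \<phi>: "\<phi> \<in> test_functions (- {0})" unfolding \<phi>_def by (rule test_functions_mult[OF \<beta> open_punctured cnj_smooth])
  have int: "fun_dist (- {0}) w \<phi> = (\<integral>y. w y * \<phi> y \<partial>lborel)" "integrable lborel (\<lambda>y. w y * \<phi> y)"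
    "continuous_on UNIV (\<lambda>y. w y * \<phi> y)"
    if w: "smooth_on (- {0}) w" for w
  proof -
    have t: "(\<lambda>y. w y * \<phi> y) \<in> test_functions (- {0})" by (rule test_functions_mult[OF \<phi> open_punctured w])
    obtain C where C: "decays C (\<lambda>y. w y * \<phi> y)" using schwartz_decays[OF test_functions_schwartz[OF t]] .
    show "integrable lborel (\<lambda>y. w y * \<phi> y)" by (rule decays_integrable(1)[OF C])
    show "continuous_on UNIV (\<lambda>y. w y * \<phi> y)" using C unfolding decays_def by blast
    have "fun_dist (- {0}) w \<phi> = integral\<^sup>L lebesgue (\<lambda>y. indicator (- {0}) y *\<^sub>R (w y * \<phi> y))"
      unfolding fun_dist_def by (subst integral_restrict_space) auto
    also have "(\<lambda>y. indicator (- {0}) y *\<^sub>R (w y * \<phi> y)) = (\<lambda>y. w y * \<phi> y)"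
      using test_functions_eq_0[OF \<phi>, of 0] by (auto simp: indicator_def fun_eq_iff)
    finally show "fun_dist (- {0}) w \<phi> = (\<integral>y. w y * \<phi> y \<partial>lborel)" using decays_integrable(3)[OF C] by simp
  qed
  define g where "g y = Re (d y * \<phi> y)" for y
  have g_eq: "g y = (norm (d y))\<^sup>2 * Re (\<beta> y)" for y
  proof -
    have "d y * \<phi> y = of_real ((norm (d y))\<^sup>2) * \<beta> y"
      unfolding \<phi>_def mult.assoc[symmetric] complex_norm_square by simp
    then show ?thesis unfolding g_def by simp
  qed
  have Re\<beta>: "Re (\<beta> y) \<ge> 0" for y unfolding \<beta>_def exp_bump_def by auto
  have dint: "(\<integral>y. d y * \<phi> y \<partial>lborel) = 0"
  proof -
    have "(\<integral>y. d y * \<phi> y \<partial>lborel) = (\<integral>y. u y * \<phi> y - v y * \<phi> y \<partial>lborel)"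
      unfolding d_def by (simp add: left_diff_distrib)
    also have "\<dots> = (\<integral>y. u y * \<phi> y \<partial>lborel) - (\<integral>y. v y * \<phi> y \<partial>lborel)"
      by (rule Bochner_Integration.integral_diff[OF int(2)[OF u] int(2)[OF v]])
    also have "\<dots> = 0" using eq[OF \<phi>] int(1)[OF u] int(1)[OF v] by simp
    finally show ?thesis .
  qed
  have "(\<integral>y. g y \<partial>lborel) = 0" unfolding g_def using dint integral_Re[OF int(2)[OF d]] by simp
  moreover have gi: "integrable lborel g" unfolding g_def using int(2)[OF d] by (rule integrable_Re)
  moreover have g0: "g y \<ge> 0" for y unfolding g_eq using Re\<beta> by simp
  ultimately have "AE y in lborel. g y = 0" using integral_nonneg_eq_0_iff_AE[OF gi] by simp
  \<comment> \<open>The zero set of the continuous function \<open>g\<close> is closed and of full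
    measure, hence the whole line.\<close>
  then have "AE y in lebesgue. y \<in> UNIV \<longrightarrow> y \<in> {y. g y = 0}" using AE_completion by fastforce
  moreover have "continuous_on UNIV g" unfolding g_def by (rule continuous_on_Re[OF int(3)[OF d]])
  then have "closed {y. g y = 0}" by (intro closed_Collect_eq continuous_intros)
  ultimately have "g x = 0" using mem_closed_if_AE_lebesgue_open[OF open_UNIV, of "{y. g y = 0}" x] by simp
  moreover have "g x > 0" unfolding g_eq \<beta>_def exp_bump_def d_def using ne x by (simp add: zero_less_power)
  ultimately show False by simp
qed

section \<open>Powers, logarithms and rapid decay: \<open>S_sis\<close> lies in
  \<open>sing_space\<close>\<close>

section \<open>Simple singularities are moderate\<close>

text \<open>The local counterpart of \<open>sing_class\<close>: one order a for all Euler
  derivatives, while the bound may depend on i. It is stable under sums and products, with orders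
  adding under the latter.\<close>

definition moderate_near_0 :: "nat \<Rightarrow> real \<Rightarrow> (real \<Rightarrow> complex) \<Rightarrow> bool" where
  "moderate_near_0 a \<delta> f \<longleftrightarrow> smooth_on {x. 0 < \<bar>x\<bar> \<and> \<bar>x\<bar> < \<delta>} f \<and>
     (\<forall>i. \<exists>B\<ge>0. \<forall>x. 0 < \<bar>x\<bar> \<and> \<bar>x\<bar> < \<delta> \<longrightarrow> \<bar>x\<bar> ^ a * norm ((euler ^^ i) f x) \<le> B)"

lemma open_punctured_interval [simp]: "open {x::real. 0 < \<bar>x\<bar> \<and> \<bar>x\<bar> < \<delta>}"
  by (intro open_Collect_conj open_Collect_less continuous_intros)

lemma moderate_near_0_mono:
  assumes "moderate_near_0 a \<delta> f" "a \<le> b" "\<epsilon> \<le> \<delta>" "\<epsilon> \<le> 1"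
  shows "moderate_near_0 b \<epsilon> f"
  unfolding moderate_near_0_def
proof (intro conjI allI)
  show "smooth_on {x. 0 < \<bar>x\<bar> \<and> \<bar>x\<bar> < \<epsilon>} f"
    using assms unfolding moderate_near_0_def by (auto elim: smooth_on_subset)
  fix i
  obtain B where B: "B \<ge> 0" "\<And>x. 0 < \<bar>x\<bar> \<and> \<bar>x\<bar> < \<delta> \<Longrightarrow> \<bar>x\<bar> ^ a * norm ((euler ^^ i) f x) \<le> B"
    using assms(1) unfolding moderate_near_0_def by meson
  have "\<bar>x\<bar> ^ b * norm ((euler ^^ i) f x) \<le> B" if "0 < \<bar>x\<bar> \<and> \<bar>x\<bar> < \<epsilon>" for x
  proof -
    have "\<bar>x\<bar> ^ b * norm ((euler ^^ i) f x) \<le> \<bar>x\<bar> ^ a * norm ((euler ^^ i) f x)"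
      using that assms by (intro mult_right_mono power_decreasing) auto
    also have "\<dots> \<le> B" using B(2) that assms by auto
    finally show ?thesis .
  qed
  then show "\<exists>B\<ge>0. \<forall>x. 0 < \<bar>x\<bar> \<and> \<bar>x\<bar> < \<epsilon> \<longrightarrow> \<bar>x\<bar> ^ b * norm ((euler ^^ i) f x) \<le> B" using B(1) by blast
qed

lemma moderate_near_0_cong:
  assumes "\<And>x. 0 < \<bar>x\<bar> \<and> \<bar>x\<bar> < \<delta> \<Longrightarrow> f x = g x"
  shows "moderate_near_0 a \<delta> f \<longleftrightarrow> moderate_near_0 a \<delta> g"
proof -
  have "(euler ^^ i) f x = (euler ^^ i) g x" if "0 < \<bar>x\<bar> \<and> \<bar>x\<bar> < \<delta>" for i x
    by (rule euler_pow_cong[OF open_punctured_interval[of \<delta>]]) (use assms that in auto)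
  then show ?thesis unfolding moderate_near_0_def
    using smooth_on_cong[OF open_punctured_interval[of \<delta>], of f g] assms by simp
qed

lemma moderate_near_0_add:
  assumes "moderate_near_0 a \<delta> f" "moderate_near_0 a \<delta> g"
  shows "moderate_near_0 a \<delta> (\<lambda>x. f x + g x)"
  unfolding moderate_near_0_def
proof (intro conjI allI)
  have sm: "smooth_on {x. 0 < \<bar>x\<bar> \<and> \<bar>x\<bar> < \<delta>} f" "smooth_on {x. 0 < \<bar>x\<bar> \<and> \<bar>x\<bar> < \<delta>} g"
    using assms unfolding moderate_near_0_def by auto
  then show "smooth_on {x. 0 < \<bar>x\<bar> \<and> \<bar>x\<bar> < \<delta>} (\<lambda>x. f x + g x)" by (intro smooth_on_add open_punctured_interval)
  fix i
  obtain A where A: "A \<ge> 0" "\<And>x. 0 < \<bar>x\<bar> \<and> \<bar>x\<bar> < \<delta> \<Longrightarrow> \<bar>x\<bar> ^ a * norm ((euler ^^ i) f x) \<le> A"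
    using assms(1) unfolding moderate_near_0_def by meson
  obtain B where B: "B \<ge> 0" "\<And>x. 0 < \<bar>x\<bar> \<and> \<bar>x\<bar> < \<delta> \<Longrightarrow> \<bar>x\<bar> ^ a * norm ((euler ^^ i) g x) \<le> B"
    using assms(2) unfolding moderate_near_0_def by meson
  have "\<bar>x\<bar> ^ a * norm ((euler ^^ i) (\<lambda>x. f x + g x) x) \<le> A + B" if x: "0 < \<bar>x\<bar> \<and> \<bar>x\<bar> < \<delta>" for x
  proof -
    have "(euler ^^ i) (\<lambda>x. f x + g x) x = (euler ^^ i) f x + (euler ^^ i) g x"
      by (rule euler_pow_add[OF open_punctured_interval sm]) (use x in simp)
    then have "\<bar>x\<bar> ^ a * norm ((euler ^^ i) (\<lambda>x. f x + g x) x) \<le> \<bar>x\<bar> ^ a * (norm ((euler ^^ i) f x) + norm ((euler ^^ i) g x))"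
      by (simp add: mult_left_mono norm_triangle_ineq)
    also have "\<dots> \<le> A + B" unfolding distrib_left by (intro add_mono A(2) B(2) x)
    finally show ?thesis .
  qed
  moreover have "A + B \<ge> 0" using A(1) B(1) by simp
  ultimately show "\<exists>B\<ge>0. \<forall>x. 0 < \<bar>x\<bar> \<and> \<bar>x\<bar> < \<delta> \<longrightarrow> \<bar>x\<bar> ^ a * norm ((euler ^^ i) (\<lambda>x. f x + g x) x) \<le> B" by blast
qed

lemma moderate_near_0_mult:
  assumes "moderate_near_0 a \<delta> f" "moderate_near_0 b \<delta> g"
  shows "moderate_near_0 (a + b) \<delta> (\<lambda>x. f x * g x)"
  unfolding moderate_near_0_def
proof (intro conjI allI)
  let ?U = "{x. 0 < \<bar>x\<bar> \<and> \<bar>x\<bar> < \<delta>}"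
  have sm: "smooth_on ?U f" "smooth_on ?U g" using assms unfolding moderate_near_0_def by auto
  then show "smooth_on ?U (\<lambda>x. f x * g x)" by (intro smooth_on_mult open_punctured_interval)
  fix n
  obtain A where A: "A \<ge> 0" "\<And>i x. i \<le> n \<Longrightarrow> 0 < \<bar>x\<bar> \<and> \<bar>x\<bar> < \<delta> \<Longrightarrow> \<bar>x\<bar> ^ a * norm ((euler ^^ i) f x) \<le> A"
    using ex_uniform_bound[of n "\<lambda>x. 0 < \<bar>x\<bar> \<and> \<bar>x\<bar> < \<delta>" "\<lambda>i x. \<bar>x\<bar> ^ a * norm ((euler ^^ i) f x)"] assms(1)
    unfolding moderate_near_0_def by meson
  obtain B where B: "B \<ge> 0" "\<And>i x. i \<le> n \<Longrightarrow> 0 < \<bar>x\<bar> \<and> \<bar>x\<bar> < \<delta> \<Longrightarrow> \<bar>x\<bar> ^ b * norm ((euler ^^ i) g x) \<le> B"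
    using ex_uniform_bound[of n "\<lambda>x. 0 < \<bar>x\<bar> \<and> \<bar>x\<bar> < \<delta>" "\<lambda>i x. \<bar>x\<bar> ^ b * norm ((euler ^^ i) g x)"] assms(2)
    unfolding moderate_near_0_def by meson
  have "\<bar>x\<bar> ^ (a + b) * norm ((euler ^^ n) (\<lambda>x. f x * g x) x) \<le> 2 ^ n * (A * B)" if x: "0 < \<bar>x\<bar> \<and> \<bar>x\<bar> < \<delta>" for x
  proof -
    have "norm ((euler ^^ n) (\<lambda>x. f x * g x) x) \<le> 2 ^ n * (A / \<bar>x\<bar> ^ a * (B / \<bar>x\<bar> ^ b))"
    proof (rule norm_euler_pow_mult_le[OF open_punctured_interval[of \<delta>] _ sm])
      fix i assume "i \<le> n"
      then show "norm ((euler ^^ i) f x) \<le> A / \<bar>x\<bar> ^ a" "norm ((euler ^^ i) g x) \<le> B / \<bar>x\<bar> ^ b"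
        using A(2)[of i x] B(2)[of i x] x by (simp_all add: field_simps)
    qed (use x in simp)
    then show ?thesis using x by (simp add: power_add field_simps)
  qed
  moreover have "2 ^ n * (A * B) \<ge> 0" using A(1) B(1) by simp
  ultimately show "\<exists>B\<ge>0. \<forall>x. 0 < \<bar>x\<bar> \<and> \<bar>x\<bar> < \<delta> \<longrightarrow> \<bar>x\<bar> ^ (a + b) * norm ((euler ^^ n) (\<lambda>x. f x * g x) x) \<le> B" by blast
qed

text \<open>\<delta> < d leaves a compact interval inside the domain, on which the Euler derivatives
  are continuous up to 0.\<close>

lemma moderate_near_0_smooth:
  assumes "smooth_on {-d<..<d} f" "\<delta> < d" "\<delta> \<le> 1"
  shows "moderate_near_0 a \<delta> f"
proof -
  have "moderate_near_0 0 \<delta> f"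
    unfolding moderate_near_0_def
  proof (intro conjI allI)
    show "smooth_on {x. 0 < \<bar>x\<bar> \<and> \<bar>x\<bar> < \<delta>} f" by (rule smooth_on_subset[OF assms(1)]) (use assms(2) in auto)
    fix i
    have "continuous_on {-\<delta>..\<delta>} ((euler ^^ i) f)"
      using smooth_on_continuous_on[OF smooth_on_euler_pow[OF _ assms(1), of i], of 0] assms(2)
      by (auto elim: continuous_on_subset)
    then obtain B where B: "B \<ge> 0" "\<And>x. x \<in> {-\<delta>..\<delta>} \<Longrightarrow> norm ((euler ^^ i) f x) \<le> B"
      using compact_bounded_norm[OF compact_Icc] by blast
    have "\<bar>x\<bar> ^ 0 * norm ((euler ^^ i) f x) \<le> B" if "0 < \<bar>x\<bar> \<and> \<bar>x\<bar> < \<delta>" for x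
      using B(2)[of x] that by (simp add: abs_le_iff abs_less_iff)
    then show "\<exists>B\<ge>0. \<forall>x. 0 < \<bar>x\<bar> \<and> \<bar>x\<bar> < \<delta> \<longrightarrow> \<bar>x\<bar> ^ 0 * norm ((euler ^^ i) f x) \<le> B"
      using B(1) by blast
  qed
  then show ?thesis by (rule moderate_near_0_mono) (use assms(3) in auto)
qed

text \<open>\<theta> acts on the power as multiplication by \<alpha>, so all Euler derivatives share
  one order.\<close>

lemma moderate_near_0_sgn_abs_powr:
  assumes "real a \<ge> - Re \<alpha>" "\<delta> \<le> 1"
  shows "moderate_near_0 a \<delta> (sgn_abs_powr \<alpha> \<eta>)"
  unfolding moderate_near_0_def
proof (intro conjI allI)
  show "smooth_on {x. 0 < \<bar>x\<bar> \<and> \<bar>x\<bar> < \<delta>} (sgn_abs_powr \<alpha> \<eta>)"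
    by (rule smooth_on_subset[OF smooth_on_sgn_abs_powr]) auto
  fix i
  have e: "(euler ^^ i) (sgn_abs_powr \<alpha> \<eta>) x = \<alpha> ^ i * sgn_abs_powr \<alpha> \<eta> x" if "x \<noteq> 0" for x
    using that
  proof (induction i arbitrary: x)
    case (Suc i)
    have "euler ((euler ^^ i) (sgn_abs_powr \<alpha> \<eta>)) x = euler (\<lambda>x. \<alpha> ^ i * sgn_abs_powr \<alpha> \<eta> x) x"
      by (rule euler_cong[OF open_punctured]) (use Suc in auto)
    also have "\<dots> = \<alpha> ^ i * euler (sgn_abs_powr \<alpha> \<eta>) x"
      by (rule euler_cmult[OF open_punctured smooth_on_sgn_abs_powr]) (use Suc.prems in auto)
    also have "euler (sgn_abs_powr \<alpha> \<eta>) x = \<alpha> * sgn_abs_powr \<alpha> \<eta> x"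
      using euler_eqI[OF sgn_abs_powr_has_deriv[OF Suc.prems]] Suc.prems by simp
    finally show ?case by simp
  qed simp
  have "\<bar>x\<bar> ^ a * norm ((euler ^^ i) (sgn_abs_powr \<alpha> \<eta>) x) \<le> norm \<alpha> ^ i" if x: "0 < \<bar>x\<bar> \<and> \<bar>x\<bar> < \<delta>" for x
  proof -
    have "\<bar>x\<bar> ^ a * \<bar>x\<bar> powr Re \<alpha> = \<bar>x\<bar> powr (real a + Re \<alpha>)"
      using x by (simp add: powr_add powr_realpow)
    also have "\<dots> \<le> \<bar>x\<bar> powr 0" using x assms by (intro powr_mono') auto
    finally have "\<bar>x\<bar> ^ a * \<bar>x\<bar> powr Re \<alpha> \<le> 1" using x by simp
    then have "norm \<alpha> ^ i * (\<bar>x\<bar> ^ a * \<bar>x\<bar> powr Re \<alpha>) \<le> norm \<alpha> ^ i * 1" by (intro mult_left_mono) auto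
    then show ?thesis using e[of x] x by (simp add: norm_mult norm_power norm_sgn_abs_powr mult_ac)
  qed
  then show "\<exists>B\<ge>0. \<forall>x. 0 < \<bar>x\<bar> \<and> \<bar>x\<bar> < \<delta> \<longrightarrow> \<bar>x\<bar> ^ a * norm ((euler ^^ i) (sgn_abs_powr \<alpha> \<eta>) x) \<le> B"
    by (intro exI[of _ "norm \<alpha> ^ i"]) auto
qed

text \<open>\<theta> maps ln |x| to 1 and then to 0, so only the logarithm itself uses the weight,
  through |x| |ln |x|| \<le> 1.\<close>

lemma moderate_near_0_ln:
  assumes "\<delta> \<le> 1"
  shows "moderate_near_0 1 \<delta> (\<lambda>x. of_real (ln \<bar>x\<bar>))"
  unfolding moderate_near_0_def
proof (intro conjI allI)
  have d: "((\<lambda>x. complex_of_real (ln \<bar>x\<bar>)) has_vector_derivative 1 / of_real x) (at x)" if "x \<noteq> 0" for x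
    using has_vector_derivative_of_real[OF ln_abs_has_deriv[OF that, folded has_real_derivative_iff_has_vector_derivative], where 'a = complex] by simp
  have "smooth_on (- {0}) (\<lambda>x. complex_of_real (ln \<bar>x\<bar>))"
    by (rule smooth_onI_deriv[OF open_punctured _ smooth_on_inverse_x]) (use d in auto)
  then show "smooth_on {x. 0 < \<bar>x\<bar> \<and> \<bar>x\<bar> < \<delta>} (\<lambda>x. complex_of_real (ln \<bar>x\<bar>))" by (rule smooth_on_subset) auto
  fix i
  have b: "\<bar>x\<bar> * \<bar>ln \<bar>x\<bar>\<bar> \<le> 1" if "0 < \<bar>x\<bar> \<and> \<bar>x\<bar> < \<delta>" for x :: real
  proof -
    have "\<bar>ln \<bar>x\<bar>\<bar> = - ln \<bar>x\<bar>" using that assms by (auto simp: abs_if ln_less_zero)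
    moreover have "exp (- (- ln \<bar>x\<bar>)) * norm (ramp 1 (- ln \<bar>x\<bar>)) \<le> 1"
      by (rule exp_minus_ramp_le) (use that assms in simp)
    ultimately show ?thesis using that by (simp add: ramp_def)
  qed
  have e1: "euler (\<lambda>x. complex_of_real (ln \<bar>x\<bar>)) x = 1" if "x \<noteq> 0" for x
    using euler_eqI[OF d[OF that]] that by simp
  have e: "(euler ^^ Suc n) (\<lambda>x. complex_of_real (ln \<bar>x\<bar>)) x = (if n = 0 then 1 else 0)" if "x \<noteq> 0" for n x
  proof -
    have "(euler ^^ Suc n) (\<lambda>x. complex_of_real (ln \<bar>x\<bar>)) x = (euler ^^ n) (\<lambda>x. 1) x"
      unfolding euler_pow_Suc_right by (rule euler_pow_cong[OF open_punctured]) (use e1 that in auto)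
    moreover have "euler (\<lambda>x. 1) = (\<lambda>x. 0)" using nderiv_const_Suc[of 0 1] by (simp add: euler_def fun_eq_iff)
    ultimately show ?thesis by (cases n) (simp_all add: funpow_swap1)
  qed
  have "\<bar>x\<bar> ^ 1 * norm ((euler ^^ i) (\<lambda>x. complex_of_real (ln \<bar>x\<bar>)) x) \<le> 1" if x: "0 < \<bar>x\<bar> \<and> \<bar>x\<bar> < \<delta>" for x
  proof (cases i)
    case 0
    then show ?thesis using b[OF x] by simp
  next
    case (Suc n)
    then show ?thesis using e[of x n] x assms by (simp del: funpow.simps)
  qed
  then show "\<exists>B\<ge>0. \<forall>x. 0 < \<bar>x\<bar> \<and> \<bar>x\<bar> < \<delta> \<longrightarrow> \<bar>x\<bar> ^ 1 * norm ((euler ^^ i) (\<lambda>x. complex_of_real (ln \<bar>x\<bar>)) x) \<le> B"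
    by (intro exI[of _ 1]) auto
qed

lemma moderate_near_0_const: "\<delta> \<le> 1 \<Longrightarrow> moderate_near_0 a \<delta> (\<lambda>x. c)"
  by (rule moderate_near_0_smooth[of "\<delta> + 1"]) auto

lemma moderate_near_0_power:
  assumes "moderate_near_0 a \<delta> f" "\<delta> \<le> 1"
  shows "moderate_near_0 (n * a) \<delta> (\<lambda>x. f x ^ n)"
proof (induction n)
  case 0
  then show ?case using moderate_near_0_const[OF assms(2)] by simp
next
  case (Suc n)
  then show ?case using moderate_near_0_mult[OF assms(1) Suc] by simp
qed

lemma moderate_near_0_sum:
  assumes "\<And>j. j \<in> J \<Longrightarrow> moderate_near_0 a \<delta> (f j)" "\<delta> \<le> 1"
  shows "moderate_near_0 a \<delta> (\<lambda>x. \<Sum>j\<in>J. f j x)"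
  using assms(1)
  by (induction J rule: infinite_finite_induct)
     (simp_all add: moderate_near_0_const[OF assms(2)] moderate_near_0_add)

text \<open>The order is a for the power and one more for each logarithm, of which there are at most
  n.\<close>

lemma singularity_of_type_moderate:
  assumes "singularity_of_type \<alpha> \<eta> f"
  shows "\<exists>a \<delta>. \<delta> > 0 \<and> \<delta> \<le> 1 \<and> moderate_near_0 a \<delta> f"
proof -
  obtain d n g where d: "d > 0" and g: "\<And>j. j \<le> n \<Longrightarrow> smooth_on {-d<..<d} (g j)"
    and f: "\<And>x. 0 < \<bar>x\<bar> \<and> \<bar>x\<bar> < d \<Longrightarrow> f x = (\<Sum>j\<le>(n::nat). sgn_abs_powr \<alpha> \<eta> x * of_real (ln \<bar>x\<bar>) ^ j * g j x)"
    using assms unfolding singularity_of_type_def by metis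
  obtain a :: nat where a: "real a \<ge> - Re \<alpha>" using real_arch_simple by blast
  define \<delta> where "\<delta> = min (d / 2) 1"
  have \<delta>: "\<delta> > 0" "\<delta> \<le> 1" "\<delta> < d" unfolding \<delta>_def using d by auto
  have "moderate_near_0 (a + n + 0) \<delta> (\<lambda>x. sgn_abs_powr \<alpha> \<eta> x * of_real (ln \<bar>x\<bar>) ^ j * g j x)" if "j \<le> n" for j
  proof -
    have "moderate_near_0 n \<delta> (\<lambda>x. of_real (ln \<bar>x\<bar>) ^ j)"
      using moderate_near_0_mono[OF moderate_near_0_power[OF moderate_near_0_ln[OF \<delta>(2)] \<delta>(2), of j], of n \<delta>] that \<delta>(2) by simp
    then show ?thesis
      by (intro moderate_near_0_mult moderate_near_0_sgn_abs_powr a \<delta> moderate_near_0_smooth[OF g[OF that] \<delta>(3)])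
  qed
  then have "moderate_near_0 (a + n + 0) \<delta> (\<lambda>x. \<Sum>j\<le>n. sgn_abs_powr \<alpha> \<eta> x * of_real (ln \<bar>x\<bar>) ^ j * g j x)"
    using \<delta>(2) by (intro moderate_near_0_sum) auto
  then have "moderate_near_0 (a + n + 0) \<delta> f"
    using moderate_near_0_cong[of \<delta> f "\<lambda>x. \<Sum>j\<le>n. sgn_abs_powr \<alpha> \<eta> x * of_real (ln \<bar>x\<bar>) ^ j * g j x"] f \<delta>(3) by auto
  then show ?thesis using \<delta> by blast
qed

lemma simple_singularity_moderate:
  assumes "simple_singularity f"
  shows "\<exists>a \<delta>. \<delta> > 0 \<and> \<delta> \<le> 1 \<and> moderate_near_0 a \<delta> f"
proof -
  obtain d N \<alpha> \<eta> g where d: "d > 0" and g: "\<And>j. j < (N::nat) \<Longrightarrow> singularity_of_type (\<alpha> j) (\<eta> j) (g j)"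
    and f: "\<And>x. 0 < \<bar>x\<bar> \<and> \<bar>x\<bar> < d \<Longrightarrow> f x = (\<Sum>j<N. g j x)"
    using assms unfolding simple_singularity_def by metis
  have "\<forall>j. \<exists>a \<delta>. j < N \<longrightarrow> \<delta> > 0 \<and> \<delta> \<le> 1 \<and> moderate_near_0 a \<delta> (g j)"
    using singularity_of_type_moderate[OF g] by blast
  then obtain a \<delta> where ad: "\<And>j. j < N \<Longrightarrow> \<delta> j > 0 \<and> \<delta> j \<le> 1 \<and> moderate_near_0 (a j) (\<delta> j) (g j)" by metis
  define A where "A = (\<Sum>j<N. a j)"
  define e where "e = Min (insert (min d 1) (\<delta> ` {..<N}))"
  have e: "e > 0" "e \<le> 1" "e \<le> d" unfolding e_def using d ad by (auto simp: Min_le_iff)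
  have "moderate_near_0 A e (g j)" if "j < N" for j
  proof (rule moderate_near_0_mono)
    show "moderate_near_0 (a j) (\<delta> j) (g j)" using ad[OF that] by blast
    show "a j \<le> A" unfolding A_def using that by (intro member_le_sum) auto
    show "e \<le> \<delta> j" unfolding e_def using that by (intro Min_le) auto
  qed (rule e)
  then have "moderate_near_0 A e (\<lambda>x. \<Sum>j<N. g j x)" using e(2) by (intro moderate_near_0_sum) auto
  then have "moderate_near_0 A e f" using moderate_near_0_cong[of e f "\<lambda>x. \<Sum>j<N. g j x"] f e(3) by auto
  then show ?thesis using e by blast
qed

text \<open>Below \<delta> the simple singularity is moderate. Beyond \<delta> the rapid decay of
  ordinary derivatives is converted to Euler derivatives, at the cost of further weights
  |x|^l.\<close>

lemma S_sis_sing_space: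
  assumes "f \<in> S_sis"
  shows "f \<in> sing_space"
proof -
  have sm: "smooth_on (- {0}) f" and dec: "\<And>n k. ((\<lambda>x. of_real (x ^ n) * nderiv k f x) \<longlongrightarrow> 0) at_infinity"
    using assms unfolding S_sis_def by auto
  obtain a \<delta> where \<delta>: "\<delta> > 0" "\<delta> \<le> 1" and m: "moderate_near_0 a \<delta> f"
    using simple_singularity_moderate assms unfolding S_sis_def by blast
  have far: "\<exists>D\<ge>0. \<forall>x. \<bar>x\<bar> \<ge> \<delta> \<longrightarrow> \<bar>x\<bar> ^ n * norm (nderiv k f x) \<le> D" for n k
  proof -
    have "eventually (\<lambda>x. norm (of_real (x ^ n) * nderiv k f x) < 1) at_infinity"
      using tendstoD[OF dec[of n k], of 1] by (simp add: dist_norm)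
    then obtain R where R: "\<And>x. \<bar>x\<bar> \<ge> R \<Longrightarrow> \<bar>x\<bar> ^ n * norm (nderiv k f x) < 1"
      unfolding eventually_at_infinity by (auto simp: norm_mult norm_power power_abs)
    \<comment> \<open>Between \<delta> and |R| lies a compact set away from 0, where continuity is
      enough.\<close>
    define K where "K = {-\<bar>R\<bar>..-\<delta>} \<union> {\<delta>..\<bar>R\<bar>}"
    have "compact K" unfolding K_def by (intro compact_Un compact_Icc)
    moreover have "continuous_on K (\<lambda>x. of_real x ^ n * nderiv k f x)"
      using \<delta>(1) unfolding K_def
      by (intro continuous_intros continuous_on_subset[OF smooth_on_continuous_on[OF sm]]) auto
    ultimately obtain D where D: "D \<ge> 0" "\<And>x. x \<in> K \<Longrightarrow> norm (of_real x ^ n * nderiv k f x) \<le> D"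
      using compact_bounded_norm by blast
    have "\<bar>x\<bar> ^ n * norm (nderiv k f x) \<le> max D 1" if "\<bar>x\<bar> \<ge> \<delta>" for x
    proof (cases "\<bar>x\<bar> \<ge> R")
      case True
      then show ?thesis using R[of x] by simp
    next
      case False
      then have "x \<in> K" unfolding K_def using that by (auto simp: abs_if split: if_splits)
      from D(2)[OF this] show ?thesis by (simp add: norm_mult norm_power)
    qed
    then show ?thesis by (intro exI[of _ "max D 1"]) auto
  qed
  have bnd: "\<exists>D\<ge>0. \<forall>x. x \<noteq> 0 \<longrightarrow> \<bar>x\<bar> ^ (a + j) * norm ((euler ^^ i) f x) \<le> D" for i j
  proof -
    obtain D where D: "D \<ge> 0" "\<forall>l\<le>i. \<forall>x. \<bar>x\<bar> \<ge> \<delta> \<longrightarrow> \<bar>x\<bar> ^ (a + j + l) * norm (nderiv l f x) \<le> D"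
      using ex_uniform_bound[of i "\<lambda>x. \<bar>x\<bar> \<ge> \<delta>" "\<lambda>l x. \<bar>x\<bar> ^ (a + j + l) * norm (nderiv l f x)"] far by blast
    obtain B where B: "B \<ge> 0" "\<And>x. 0 < \<bar>x\<bar> \<and> \<bar>x\<bar> < \<delta> \<Longrightarrow> \<bar>x\<bar> ^ a * norm ((euler ^^ i) f x) \<le> B"
      using m unfolding moderate_near_0_def by meson
    have "\<bar>x\<bar> ^ (a + j) * norm ((euler ^^ i) f x) \<le> B + fact i * D" if x: "x \<noteq> 0" for x
    proof (cases "\<bar>x\<bar> < \<delta>")
      case True
      have "\<bar>x\<bar> ^ (a + j) * norm ((euler ^^ i) f x) = \<bar>x\<bar> ^ j * (\<bar>x\<bar> ^ a * norm ((euler ^^ i) f x))"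
        by (simp add: power_add mult_ac)
      also have "\<dots> \<le> 1 * B" using True x \<delta> B by (intro mult_mono power_le_one) auto
      also have "\<dots> \<le> B + fact i * D" using D(1) by simp
      finally show ?thesis .
    next
      case False
      have "norm ((euler ^^ i) f x) \<le> fact i * (D / \<bar>x\<bar> ^ (a + j))"
      proof (rule norm_euler_le_nderiv[OF open_punctured _ sm])
        fix l assume "l \<le> i"
        then have "\<bar>x\<bar> ^ (a + j + l) * norm (nderiv l f x) \<le> D" using D(2) False by auto
        then show "\<bar>x\<bar> ^ l * norm (nderiv l f x) \<le> D / \<bar>x\<bar> ^ (a + j)" using x by (simp add: power_add field_simps)
      qed (use x in simp)
      then have "\<bar>x\<bar> ^ (a + j) * norm ((euler ^^ i) f x) \<le> fact i * D" using x by (simp add: field_simps)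
      then show ?thesis using B(1) by simp
    qed
    moreover have "B + fact i * D \<ge> 0" using B(1) D(1) by simp
    ultimately show ?thesis by blast
  qed
  have "\<exists>B. sing_bound a N B f" for N
  proof -
    \<comment> \<open>Summing over the weights turns one bound per j into a single bound for all j
      \<le> N.\<close>
    have "\<exists>D\<ge>0. \<forall>x. x \<noteq> 0 \<longrightarrow> (\<Sum>j\<le>N. \<bar>x\<bar> ^ (a + j) * norm ((euler ^^ i) f x)) \<le> D" for i
    proof -
      obtain D where D: "\<And>j. D j \<ge> 0" "\<And>j x. x \<noteq> 0 \<Longrightarrow> \<bar>x\<bar> ^ (a + j) * norm ((euler ^^ i) f x) \<le> D j"
        using choice[of "\<lambda>j D. D \<ge> 0 \<and> (\<forall>x. x \<noteq> 0 \<longrightarrow> \<bar>x\<bar> ^ (a + j) * norm ((euler ^^ i) f x) \<le> D)"] bnd[of _ i] by blast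
      then show ?thesis by (intro exI[of _ "\<Sum>j\<le>N. D j"]) (auto intro!: sum_nonneg sum_mono)
    qed
    then obtain D where D: "D \<ge> 0" "\<forall>i\<le>N. \<forall>x. x \<noteq> 0 \<longrightarrow> (\<Sum>j\<le>N. \<bar>x\<bar> ^ (a + j) * norm ((euler ^^ i) f x)) \<le> D"
      using ex_uniform_bound[of N "\<lambda>x. x \<noteq> 0" "\<lambda>i x. \<Sum>j\<le>N. \<bar>x\<bar> ^ (a + j) * norm ((euler ^^ i) f x)"] by blast
    have "sing_bound a N D f"
      unfolding sing_bound_def
    proof (intro allI impI)
      fix x :: real and i j assume *: "x \<noteq> 0" "i \<le> N" "j \<le> N"
      have "\<bar>x\<bar> ^ (a + j) * norm ((euler ^^ i) f x) \<le> (\<Sum>j\<le>N. \<bar>x\<bar> ^ (a + j) * norm ((euler ^^ i) f x))"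
        using *(3) by (intro member_le_sum) auto
      also have "\<dots> \<le> D" using D(2) * by blast
      finally show "\<bar>x\<bar> ^ (a + j) * norm ((euler ^^ i) f x) \<le> D" .
    qed
    then show ?thesis ..
  qed
  then show ?thesis unfolding sing_space_def sing_class_def using sm by blast
qed

section \<open>Identification of \<open>T_op\<close> and \<open>T_star\<close>, and the adjoint
  formula\<close>

section \<open>The adjoint\<close>

text \<open>\<open>T_fun\<close> has the defining property, and smooth densities on the punctured
  line are unique, so whichever function is chosen agrees with it off 0.\<close>

lemma T_op_eq_T_fun:
  assumes "f \<in> sing_space"
  shows "smooth_on (- {0}) (T_op \<alpha> \<eta> f)" "x \<noteq> 0 \<Longrightarrow> T_op \<alpha> \<eta> f x = T_fun \<alpha> \<eta> f x"
proof -
  define P where "P u \<longleftrightarrow> smooth_on (- {0}) u \<and>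
     (\<forall>\<phi>\<in>test_functions (- {0}). fun_dist (- {0}) u \<phi> = dist_fourier (fun_dist UNIV (inv_twist \<alpha> \<eta> f)) \<phi>)" for u
  obtain p where p: "symbol p (inv_twist \<alpha> \<eta> f)" using sing_space_symbolE[OF assms] .
  have PT: "P (T_fun \<alpha> \<eta> f)"
    unfolding P_def using smooth_on_T_fun[OF assms] symbol_fourier_pairing[OF p] by (simp add: T_fun_def)
  have "T_op \<alpha> \<eta> f = (SOME u. P u)" unfolding T_op_def P_def inv_twist_def[abs_def] ..
  then have PO: "P (T_op \<alpha> \<eta> f)" using someI[of P, OF PT] by simp
  then show sm: "smooth_on (- {0}) (T_op \<alpha> \<eta> f)" unfolding P_def by blast
  show "T_op \<alpha> \<eta> f x = T_fun \<alpha> \<eta> f x" if "x \<noteq> 0"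
    by (rule fun_dist_injective[OF sm smooth_on_T_fun[OF assms] _ that]) (use PO PT in \<open>simp add: P_def\<close>)
qed

text \<open>|1 / y|^(\<alpha> - 1) / y^2 = |y|^(- \<alpha> - 1), and the sign is invariant under
  inversion. At y = 0 the division by zero gives 0, the default value in
  \<open>inv_twist\<close>.\<close>

lemma inv_twist_eq_dist_inversion:
  "(\<lambda>y. sgn_abs_powr (\<alpha> - 1) \<eta> (1 / y) * \<phi> (1 / y) / of_real (y\<^sup>2)) = inv_twist \<alpha> \<eta> \<phi>"
proof
  fix y :: real
  show "sgn_abs_powr (\<alpha> - 1) \<eta> (1 / y) * \<phi> (1 / y) / of_real (y\<^sup>2) = inv_twist \<alpha> \<eta> \<phi> y"
  proof (cases "y = 0")
    case False
    define l where "l = complex_of_real (ln \<bar>y\<bar>)"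
    have y2: "complex_of_real (y\<^sup>2) = exp (2 * l)"
    proof -
      have "y\<^sup>2 = exp (2 * ln \<bar>y\<bar>)" using False by (simp add: exp_double)
      then show ?thesis unfolding l_def by (simp flip: exp_of_real)
    qed
    have e: "exp ((\<alpha> - 1) * (- l)) / exp (2 * l) = exp ((- \<alpha> - 1) * l)"
      unfolding exp_diff[symmetric] by (rule arg_cong[where f = exp]) algebra
    have s: "sgn (1 / y) = sgn y" by (simp add: sgn_if)
    have l: "complex_of_real (ln \<bar>1 / y\<bar>) = - l" using False unfolding l_def by (simp add: ln_div)
    define q :: complex where "q = (if \<eta> = 0 then 1 else of_real (sgn y))"
    have "sgn_abs_powr (\<alpha> - 1) \<eta> (1 / y) * \<phi> (1 / y) / of_real (y\<^sup>2) =
        \<phi> (1 / y) * (q * (exp ((\<alpha> - 1) * (- l)) / exp (2 * l)))"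
      using sgn_abs_powr_eq[of "1 / y" "\<alpha> - 1" \<eta>] False unfolding s l y2 q_def by simp
    also have "\<dots> = inv_twist \<alpha> \<eta> \<phi> y"
      using sgn_abs_powr_eq[OF False, of "- \<alpha> - 1" \<eta>] False unfolding e l_def[symmetric] q_def[symmetric] inv_twist_def
      by simp
    finally show ?thesis .
  qed (simp add: inv_twist_def)
qed

text \<open>On test functions away from 0 the defining distribution is \<sigma> applied to the
  transform of \<open>inv_twist\<close>, which is L composed with \<open>T_fun\<close>. Uniqueness
  of canonical extensions, then of tempered functionals, carries this to all Schwartz
  functions.\<close>

lemma T_star_eq:
  assumes L: "sing_functional L" and \<sigma>: "\<And>\<phi>. schwartz \<phi> \<Longrightarrow> \<sigma> \<phi> = L \<phi>" and f: "schwartz f"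
  shows "T_star \<alpha> \<eta> \<sigma> f = L (T_fun \<alpha> \<eta> f)"
proof -
  define M where "M g = L (T_fun \<alpha> \<eta> g)" for g
  have M: "sing_functional M" unfolding M_def by (rule sing_functional_T_fun[OF L])
  define S where "S = dist_mult (sgn_abs_powr (\<alpha> - 1) \<eta>) (dist_inversion (dist_fourier \<sigma>))"
  have "M \<phi> = S \<phi>" if \<phi>: "\<phi> \<in> test_functions (- {0})" for \<phi>
  proof -
    have s: "schwartz (inv_twist \<alpha> \<eta> \<phi>)" by (rule test_functions_schwartz[OF inv_twist_test_function[OF \<phi>]])
    have "S \<phi> = \<sigma> (fourier (inv_twist \<alpha> \<eta> \<phi>))"
      unfolding S_def dist_mult_def dist_inversion_def dist_fourier_def inv_twist_eq_dist_inversion ..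
    also have "\<dots> = L (fourier (inv_twist \<alpha> \<eta> \<phi>))" by (rule \<sigma>[OF schwartz_fourier[OF s]])
    also have "\<dots> = M \<phi>" unfolding M_def T_fun_def
      by (rule sing_functional_cong[OF L schwartz_sing_space[OF schwartz_fourier[OF s]]])
         (use symbol_fourier_schwartz[OF s] in simp)
    finally show ?thesis ..
  qed
  from canonical_extension_eq[OF M this]
  have E: "canonical_extension 0 S \<phi> = M \<phi>" if "\<phi> \<in> test_functions UNIV" for \<phi> using that by blast
  define P where "P T \<longleftrightarrow> tempered T \<and> (\<forall>\<phi>\<in>test_functions UNIV. T \<phi> = canonical_extension 0 S \<phi>)" for T
  have "P M" unfolding P_def using E sing_functional_tempered[OF M] by simp
  moreover have "T_star \<alpha> \<eta> \<sigma> = (SOME T. P T)" unfolding T_star_def as_tempered_def P_def S_def ..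
  ultimately have "P (T_star \<alpha> \<eta> \<sigma>)" using someI[of P M] by simp
  then have "T_star \<alpha> \<eta> \<sigma> f = M f"
    using E by (intro tempered_unique[OF _ sing_functional_tempered[OF M] _ f]) (auto simp: P_def)
  then show ?thesis unfolding M_def .
qed

theorem theorem6p9:
  fixes \<alpha> :: complex and \<eta> :: bit
    and \<sigma> :: functional and f :: "real \<Rightarrow> complex"
  assumes "tempered \<sigma>" and "dist_vanishes_inf 0 \<sigma>" and "f \<in> S_sis"
  shows "sis_pairing (T_op \<alpha> \<eta> f) \<sigma> = sis_pairing f (T_star \<alpha> \<eta> \<sigma>)"
proof -
  define L where "L = sing_extension \<sigma>"
  have L: "sing_functional L" unfolding L_def by (rule sing_extension_sing_functional[OF assms(1,2)])
  have \<sigma>: "\<sigma> \<phi> = L \<phi>" if "schwartz \<phi>" for \<phi>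
    unfolding L_def using sing_extension_schwartz[OF assms(1,2) that] by simp
  have f: "f \<in> sing_space" by (rule S_sis_sing_space[OF assms(3)])
  have "sis_pairing (T_op \<alpha> \<eta> f) \<sigma> = L (T_fun \<alpha> \<eta> f)"
    by (rule sis_pairing_eq[OF L \<sigma> T_fun_sing_space[OF f] T_op_eq_T_fun[OF f]])
  \<comment> \<open>The pairing lemma is now used with L composed with \<open>T_fun\<close> as the
    functional; values of \<open>T_star\<close> on Schwartz functions are all that it asks
    for.\<close>
  moreover have "sis_pairing f (T_star \<alpha> \<eta> \<sigma>) = L (T_fun \<alpha> \<eta> f)"
  proof (rule sis_pairing_eq[OF sing_functional_T_fun[OF L] T_star_eq[OF L \<sigma>] f])
    show "smooth_on (- {0}) f" using f sing_classD unfolding sing_space_def by blast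
  qed auto
  ultimately show ?thesis by simp
qed

end
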